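(* For $\Lambda>0$ let $E_\Lambda$ be the span of all Dirichlet eigenfunctions of $-\Delta$ on the Sierpiński gasket $\mathrm{SG}$ with eigenvalue $\lambda\le\Lambda$, let $d_\Lambda=\dim E_\Lambda$, and let $P_\Lambda$ be the orthogonal projection of $L^2(\mathrm{SG},\mu)$ onto $E_\Lambda$. Let $f>0$ be a continuous function on $\mathrm{SG}$, let $[f]$ be the operator of multiplication by $f$, and let $M_\Lambda$ be the matrix of $P_\Lambda[f]P_\Lambda$ (as an operator on $E_\Lambda$) in an orthonormal basis of $E_\Lambda$ consisting of eigenfunctions. Then $$\lim_{\Lambda\to\infty}\frac{1}{d_\Lambda}\log\det M_\Lambda=\int_{\mathrm{SG}}\log f(x)\,d\mu(x).$$ If in addition $f$ is Hölder continuous of order $\alpha$ in the effective resistance metric $d$ on $\mathrm{SG}$, then, as $\Lambda\to\infty$, $$\frac{1}{d_\Lambda}\log\det M_\Lambda-\int_{\mathrm{SG}}\log f(x)\,d\mu(x)=O(d_\Lambda^{-\tilde\beta}),\qquad \tilde\beta=\left(\frac{\alpha\log(5/3)}{\log3+\alpha\log(5/3)}\right)\left(1-\frac{\log2}{\log3}\right).$$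
   Context: Sierpiński gasket: let $F_1(x)=\frac12x$, $F_2(x)=\frac12x+(\frac12,0)$, $F_3(x)=\frac12x+(\frac14,\frac{\sqrt3}{4})$ on $\mathbb{R}^2$; $\mathrm{SG}$ is the unique nonempty compact set with $\mathrm{SG}=\bigcup_{i=1}^3F_i(\mathrm{SG})$. For a word $\omega=(\omega_1,\dots,\omega_m)$ in $\{1,2,3\}$, $F_\omega=F_{\omega_1}\circ\cdots\circ F_{\omega_m}$, and $F_\omega(\mathrm{SG})$ is called an $m$-cell. $\mu$ is the probability measure on $\mathrm{SG}$ giving each $m$-cell measure $3^{-m}$. $V_0=\{(0,0),(1,0),(\frac12,\frac{\sqrt3}{2})\}$ is the boundary, $V_m=\bigcup_{i=1}^3F_iV_{m-1}$; for distinct $x,y\in V_m$ write $x\sim_m y$ if $x,y$ lie in a common $m$-cell. Resistance metric: the energy is $\mathcal{E}(u,u)=\lim_{m\to\infty}(5/3)^m\sum_{x\sim_m y}(u(x)-u(y))^2$ (sum over edges) for continuous $u$, and for $x\neq y$, $d(x,y)=\left(\min\{\mathcal{E}(u,u):u(x)=0,\ u(y)=1\}\right)^{-1}$, with $d(x,x)=0$. Laplacian: $\Delta_mu(x)=\sum_{y\sim_mx}u(y)-4u(x)$ for $x\in V_m\setminus V_0$, and $\Delta u=\frac32\lim_{m\to\infty}5^m\Delta_mu$ (a continuous $u$ is in the domain with $\Delta u=g$, $g$ continuous, if the convergence to $g$ is uniform on $\bigcup_mV_m\setminus V_0$). A Dirichlet eigenfunction with eigenvalue $\lambda$ is a nonzero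 $u$ in the domain of $\Delta$ with $-\Delta u=\lambda u$ and $u|_{V_0}=0$. The Dirichlet spectrum is discrete, so $E_\Lambda$ is finite-dimensional. *)

theory Defs
  imports
    "HOL-Analysis.Analysis"
    "HOL-Library.Function_Algebras"
    "HOL-Library.Landau_Symbols"
    "Jordan_Normal_Form.Determinant"
begin

section \<open>The Sierpinski gasket\<close>

text \<open>The index \<open>i\<close> of \<open>sg_map i\<close> is only ever used in the range \<open>{1, 2, 3}\<close>.\<close>

definition sg_map :: "nat \<Rightarrow> real \<times> real \<Rightarrow> real \<times> real" where
  "sg_map i x =
     (if i = 1 then (1/2) *\<^sub>R x
      else if i = 2 then (1/2) *\<^sub>R x + (1/2, 0)
      else (1/2) *\<^sub>R x + (1/4, sqrt 3 / 4))"

definition SG :: "(real \<times> real) set" where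
  "SG = (THE K. compact K \<and> K \<noteq> {} \<and> K = (\<Union>i\<in>{1,2,3}. sg_map i ` K))"

primrec sg_word_map :: "nat list \<Rightarrow> real \<times> real \<Rightarrow> real \<times> real" where
  "sg_word_map [] = id"
| "sg_word_map (i # w) = sg_map i \<circ> sg_word_map w"

definition sg_words :: "nat \<Rightarrow> nat list set" where
  "sg_words m = {w. set w \<subseteq> {1,2,3} \<and> length w = m}"

definition sg_cell :: "nat list \<Rightarrow> (real \<times> real) set" where
  "sg_cell w = sg_word_map w ` SG"

text \<open>The normalization \<open>\<mu> SG = 1\<close> is the case \<open>m = 0\<close>.\<close>

definition sg_measure :: "(real \<times> real) measure" where
  "sg_measure =
     (THE M. sets M = sets (restrict_space borel SG) \<and>
             (\<forall>m. \<forall>w\<in>sg_words m. emeasure M (sg_cell w) = ennreal ((1/3) ^ m)))"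

primrec sg_V :: "nat \<Rightarrow> (real \<times> real) set" where
  "sg_V 0 = {(0, 0), (1, 0), (1/2, sqrt 3 / 2)}"
| "sg_V (Suc m) = (\<Union>i\<in>{1,2,3}. sg_map i ` sg_V m)"

definition sg_adj :: "nat \<Rightarrow> real \<times> real \<Rightarrow> real \<times> real \<Rightarrow> bool" where
  "sg_adj m x y \<longleftrightarrow> x \<in> sg_V m \<and> y \<in> sg_V m \<and> x \<noteq> y \<and>
     (\<exists>w\<in>sg_words m. x \<in> sg_cell w \<and> y \<in> sg_cell w)"


section \<open>Functions on the gasket\<close>

text \<open>
  A function on the gasket is represented by its extension by \<open>0\<close> to the plane,
  so that equality of such functions is equality on \<open>SG\<close>.
\<close>

definition sg_C :: "(real \<times> real \<Rightarrow> real) set" where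
  "sg_C = {u. continuous_on SG u \<and> (\<forall>x. x \<notin> SG \<longrightarrow> u x = 0)}"

definition fun_scale :: "real \<Rightarrow> ('a \<Rightarrow> real) \<Rightarrow> 'a \<Rightarrow> real" where
  "fun_scale c u = (\<lambda>x. c * u x)"

interpretation funs: vector_space fun_scale
  by unfold_locales (auto simp: fun_scale_def fun_eq_iff algebra_simps)

definition sg_inner :: "(real \<times> real \<Rightarrow> real) \<Rightarrow> (real \<times> real \<Rightarrow> real) \<Rightarrow> real" where
  "sg_inner u v = (\<integral>x. u x * v x \<partial>sg_measure)"


section \<open>Energy and effective resistance metric\<close>

text \<open>
  Every edge \<open>{x, y}\<close> occurs as two ordered pairs, hence the factor \<open>1/2\<close>.
\<close>

definition sg_graph_energy :: "nat \<Rightarrow> (real \<times> real \<Rightarrow> real) \<Rightarrow> real" where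
  "sg_graph_energy m u =
     (5/3) ^ m * ((1/2) * (\<Sum>(x, y) | sg_adj m x y. (u x - u y)\<^sup>2))"

text \<open>
  The sequence is nondecreasing; the limit is taken in \<open>[0, \<infinity>]\<close>.
\<close>

definition sg_energy :: "(real \<times> real \<Rightarrow> real) \<Rightarrow> ennreal" where
  "sg_energy u = lim (\<lambda>m. ennreal (sg_graph_energy m u))"

definition sg_resistance :: "real \<times> real \<Rightarrow> real \<times> real \<Rightarrow> real" where
  "sg_resistance x y =
     (if x = y then 0
      else inverse (enn2real (LEAST e. \<exists>u\<in>sg_C. u x = 0 \<and> u y = 1 \<and> e = sg_energy u)))"

definition sg_holder :: "real \<Rightarrow> (real \<times> real \<Rightarrow> real) \<Rightarrow> bool" where
  "sg_holder \<alpha> f \<longleftrightarrow>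
     (\<exists>C. \<forall>x\<in>SG. \<forall>y\<in>SG. \<bar>f x - f y\<bar> \<le> C * sg_resistance x y powr \<alpha>)"


section \<open>Laplacian and Dirichlet spectrum\<close>

definition sg_graph_laplacian :: "nat \<Rightarrow> (real \<times> real \<Rightarrow> real) \<Rightarrow> real \<times> real \<Rightarrow> real" where
  "sg_graph_laplacian m u x = (\<Sum>y | sg_adj m x y. u y) - 4 * u x"

text \<open>
  \<open>has_sg_laplacian u g\<close> says that \<open>u\<close> is in the domain of the Laplacian and \<open>\<Delta>u = g\<close>.
  The graph Laplacian of level \<open>m\<close> is only defined on \<open>V\<^sub>m \<setminus> V\<^sub>0\<close>; uniformity of the
  limit means that the bound at level \<open>m\<close> is uniform in the points of this set.
\<close>

definition has_sg_laplacian ::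
    "(real \<times> real \<Rightarrow> real) \<Rightarrow> (real \<times> real \<Rightarrow> real) \<Rightarrow> bool" where
  "has_sg_laplacian u g \<longleftrightarrow> u \<in> sg_C \<and> g \<in> sg_C \<and>
     (\<forall>\<epsilon>>0. \<exists>N. \<forall>m\<ge>N. \<forall>x \<in> sg_V m - sg_V 0.
        \<bar>3/2 * (5 ^ m * sg_graph_laplacian m u x) - g x\<bar> < \<epsilon>)"

definition sg_dirichlet_eigenfunction :: "real \<Rightarrow> (real \<times> real \<Rightarrow> real) \<Rightarrow> bool" where
  "sg_dirichlet_eigenfunction \<mu> u \<longleftrightarrow>
     u \<noteq> 0 \<and> has_sg_laplacian u (\<lambda>x. - \<mu> * u x) \<and> (\<forall>x\<in>sg_V 0. u x = 0)"

definition sg_E :: "real \<Rightarrow> (real \<times> real \<Rightarrow> real) set" where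
  "sg_E \<Lambda> = funs.span {u. \<exists>\<mu>\<le>\<Lambda>. sg_dirichlet_eigenfunction \<mu> u}"

definition sg_d :: "real \<Rightarrow> nat" where
  "sg_d \<Lambda> = funs.dim (sg_E \<Lambda>)"

text \<open>
  The orthogonal projection of \<open>L\<^sup>2\<close> onto \<open>E\<^sub>\<Lambda>\<close>. Elements of \<open>E\<^sub>\<Lambda>\<close> are
  continuous on \<open>SG\<close> and vanish elsewhere, and every cell has positive measure, so there
  is only one such function in each almost-everywhere class.
\<close>

definition sg_P :: "real \<Rightarrow> (real \<times> real \<Rightarrow> real) \<Rightarrow> real \<times> real \<Rightarrow> real" where
  "sg_P \<Lambda> u = (THE v. v \<in> sg_E \<Lambda> \<and> (\<forall>w\<in>sg_E \<Lambda>. sg_inner (u - v) w = 0))"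

definition mult_op :: "('a \<Rightarrow> real) \<Rightarrow> ('a \<Rightarrow> real) \<Rightarrow> 'a \<Rightarrow> real" where
  "mult_op f u = (\<lambda>x. f x * u x)"

definition sg_orthonormal_eigenbasis :: "real \<Rightarrow> (nat \<Rightarrow> real \<times> real \<Rightarrow> real) \<Rightarrow> bool" where
  "sg_orthonormal_eigenbasis \<Lambda> b \<longleftrightarrow>
     (\<forall>i<sg_d \<Lambda>. \<exists>\<mu>. sg_dirichlet_eigenfunction \<mu> (b i)) \<and>
     (\<forall>i<sg_d \<Lambda>. \<forall>j<sg_d \<Lambda>. sg_inner (b i) (b j) = (if i = j then 1 else 0)) \<and>
     funs.span (b ` {..<sg_d \<Lambda>}) = sg_E \<Lambda>"

text \<open>
  In an orthonormal basis, the coefficient of \<open>T (b j)\<close> at \<open>b i\<close> is the inner product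
  of the two.
\<close>

definition sg_M ::
    "(real \<times> real \<Rightarrow> real) \<Rightarrow> real \<Rightarrow> (nat \<Rightarrow> real \<times> real \<Rightarrow> real) \<Rightarrow> real Matrix.mat" where
  "sg_M f \<Lambda> b =
     Matrix.mat (sg_d \<Lambda>) (sg_d \<Lambda>)
       (\<lambda>(i, j). sg_inner ((sg_P \<Lambda> \<circ> mult_op f \<circ> sg_P \<Lambda>) (b j)) (b i))"

end

theory Submission imports Defs "HOL-Probability.Probability"
begin

text \<open>
Writing an eigenfunction on an \<open>m\<close>-cell through its values at the three corners and controlling
the deviation, one sees (spectral decimation) that an eigenfunction with eigenvalue at most
\<open>(3/2) 5^M\<close> restricts on \<open>V_M\<close> to an exact eigenfunction of the graph Laplacian; hence there are at
most of order \<open>2^M\<close> distinct eigenvalues below that bound, while \<open>d_\<Lambda>\<close> is comparable to \<open>3^M\<close>.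
In each eigenspace, the functions vanishing together with their normal derivatives on \<open>V_N\<close>
split into eigenfunctions supported in single \<open>N\<close>-cells and have codimension of order \<open>3^N\<close>.
On a function supported in a cell, \<open>f\<close> is nearly constant. In an orthonormal basis adapted to the
cells, the determinant of the weighted Gram matrix therefore lies between products of extreme
values of \<open>f\<close>, with an error of order \<open>osc_N(log f) + 3^N (2/3)^M\<close> after division by \<open>d_\<Lambda>\<close>.
Fixing \<open>N\<close> gives the limit; \<open>N\<close> proportional to \<open>M\<close> gives the rate.
\<close>

section \<open>Geometry of the gasket\<close>

text \<open>The threshold \<open>3/2 * 5 ^ M\<close> is chosen so that below it all decimation
  parameters from level M on lie in [0,1]. There \<open>dec\<close> is injective and the exceptional
  values 2, 5, 6 do not occur, so no branches have to be recorded: the level-M discrete eigenvalue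
  alone determines the eigenvalue. The Laplacian is only a uniform limit, so decimation is run from
  fine to coarse levels on approximate solutions: one step multiplies the residual by at most 5,
  while the residual at level n is o(5^(-n)), and in the limit the equations are exact. That the
  dimension is at least of order \<open>3 ^ M\<close> comes from one explicit eigenfunction, started
  at the exceptional value 6 and copied into all cells of a level. The determinant is controlled
  through its pivots: each is a Schur complement, bounded above by a diagonal entry and below by the
  least value of the quadratic form on vectors with one entry equal to 1; completing the square
  bounds that value by f on a single cell. The attractor, the measure, the projection and the
  minimum in the metric are given only by descriptions, so their existence is part of the
  proof.\<close>

definition sg_alph :: "nat set" where "sg_alph = {1, 2, 3}"

definition sg_corner :: "nat \<Rightarrow> real \<times> real" where
  "sg_corner i = (if i = 1 then (0, 0) else if i = 2 then (1, 0) else (1/2, sqrt 3 / 2))"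

definition bary :: "nat \<Rightarrow> real \<times> real \<Rightarrow> real" where
  "bary i z = (if i = 1 then 1 - fst z - snd z / sqrt 3
               else if i = 2 then fst z - snd z / sqrt 3 else 2 * snd z / sqrt 3)"

text \<open>The solid triangle on the three corners. Separation of cells is proved for points of
  this convex set, where membership is just three inequalities; \<open>SG\<close> is covered through
  \<open>SG_tri\<close>.\<close>

definition sg_tri :: "(real \<times> real) set" where
  "sg_tri = {z. \<forall>i\<in>sg_alph. 0 \<le> bary i z}"

lemma finite_sg_alph [simp]: "finite sg_alph" and card_sg_alph [simp]: "card sg_alph = 3"
  by (auto simp: sg_alph_def)

lemma sg_alph_mem [simp]: "1 \<in> sg_alph" "Suc 0 \<in> sg_alph" "2 \<in> sg_alph" "3 \<in> sg_alph"
  by (auto simp: sg_alph_def)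

lemma sum_sg_alph:
  fixes f :: "nat \<Rightarrow> real"
  shows "(\<Sum>j\<in>sg_alph. f j) = f 1 + f 2 + f 3"
  by (simp add: sg_alph_def)

lemma sum_sg_alph':
  fixes f :: "nat \<Rightarrow> real"
  assumes "sg_alph = {i, j, l}" "i \<noteq> j" "i \<noteq> l" "j \<noteq> l"
  shows "(\<Sum>j\<in>sg_alph. f j) = f i + f j + f l"
  unfolding assms(1) using assms(2-4) by simp

lemma sg_alph_third:
  assumes "i \<in> sg_alph" "j \<in> sg_alph" "i \<noteq> j"
  obtains l where "l \<in> sg_alph" "l \<noteq> i" "l \<noteq> j" "sg_alph = {i, j, l}"
proof -
  have "\<exists>l\<in>sg_alph. l \<noteq> i \<and> l \<noteq> j \<and> sg_alph = {i, j, l}"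
    using assms by (auto simp: sg_alph_def)
  then show thesis using that by blast
qed

lemma sg_map_eq: "sg_map i x = (1/2) *\<^sub>R (x + sg_corner i)"
  by (cases x) (auto simp: sg_map_def sg_corner_def field_simps)

lemma bary_corner:
  "i \<in> sg_alph \<Longrightarrow> j \<in> sg_alph \<Longrightarrow> bary i (sg_corner j) = (if i = j then 1 else 0)"
  by (auto simp: bary_def sg_corner_def sg_alph_def)

lemma bary_sum: "(\<Sum>i\<in>sg_alph. bary i z) = 1"
  by (simp add: sum_sg_alph bary_def)

lemma bary_map: "bary i (sg_map j x) = (bary i x + bary i (sg_corner j)) / 2"
  by (simp add: bary_def sg_map_eq add_divide_distrib diff_divide_distrib)

lemma bary_eqI:
  assumes "\<And>i. i \<in> sg_alph \<Longrightarrow> bary i x = bary i y"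
  shows "x = y"
proof -
  have "bary 3 x = bary 3 y" "bary 2 x = bary 2 y" using assms by auto
  then show ?thesis by (auto simp: bary_def prod_eq_iff)
qed

lemma sg_corner_eq_iff [simp]:
  assumes "i \<in> sg_alph" "j \<in> sg_alph"
  shows "sg_corner i = sg_corner j \<longleftrightarrow> i = j"
  using bary_corner[OF assms(1), of i] bary_corner[OF assms(1), of j] assms by (auto split: if_splits)

lemma sg_triD: "z \<in> sg_tri \<Longrightarrow> i \<in> sg_alph \<Longrightarrow> 0 \<le> bary i z"
  by (simp add: sg_tri_def)

lemma bary_le_1: "z \<in> sg_tri \<Longrightarrow> i \<in> sg_alph \<Longrightarrow> bary i z \<le> 1"
  using bary_sum[of z] sum_nonneg_leq_bound[of sg_alph "\<lambda>i. bary i z" 1 i]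
  by (auto simp: sg_tri_def)

lemma bary_1_corner:
  assumes "z \<in> sg_tri" "i \<in> sg_alph" "bary i z \<ge> 1"
  shows "z = sg_corner i"
proof (rule bary_eqI)
  fix j assume j: "j \<in> sg_alph"
  have "bary i z = 1" using assms bary_le_1 by fastforce
  show "bary j z = bary j (sg_corner i)"
  proof (cases "j = i")
    case True then show ?thesis using \<open>bary i z = 1\<close> assms by (simp add: bary_corner)
  next
    case False
    have "(\<Sum>i\<in>sg_alph - {i}. bary i z) = 0"
      using bary_sum[of z] \<open>bary i z = 1\<close> assms by (simp add: sum.remove)
    then have "bary j z = 0"
      using False j assms sum_nonneg_eq_0_iff[of "sg_alph - {i}" "\<lambda>i. bary i z"]
      by (auto simp: sg_tri_def)
    then show ?thesis using False j assms by (simp add: bary_corner)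
  qed
qed

lemma sg_corner_tri: "i \<in> sg_alph \<Longrightarrow> sg_corner i \<in> sg_tri"
  by (auto simp: sg_tri_def bary_corner)

lemma sg_map_tri: "i \<in> sg_alph \<Longrightarrow> z \<in> sg_tri \<Longrightarrow> sg_map i z \<in> sg_tri"
  by (auto simp: sg_tri_def bary_map bary_corner)

lemma sg_tri_bounds: assumes "z \<in> sg_tri" shows "0 \<le> fst z" "fst z \<le> 1" "0 \<le> snd z" "snd z \<le> 1"
proof -
  have *: "0 \<le> 1 - fst z - snd z / sqrt 3" "0 \<le> fst z - snd z / sqrt 3" "0 \<le> 2 * snd z / sqrt 3"
    using assms by (auto simp: sg_tri_def sg_alph_def bary_def)
  then have s: "0 \<le> snd z / sqrt 3" by linarith
  have "sqrt 3 \<le> 2" by (rule real_le_lsqrt) auto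
  have "snd z / sqrt 3 \<le> 1/2" using *(1,2) by linarith
  then have "snd z / sqrt 3 * sqrt 3 \<le> 1/2 * sqrt 3" by (rule mult_right_mono) simp
  then have "snd z \<le> 1/2 * sqrt 3" by simp
  then show "snd z \<le> 1" using \<open>sqrt 3 \<le> 2\<close> by simp
  show "0 \<le> snd z" using s by (simp add: zero_le_divide_iff)
  show "0 \<le> fst z" "fst z \<le> 1" using * s by auto
qed

lemma sg_tri_bounded: "bounded sg_tri"
proof (rule bounded_subset[OF bounded_cbox])
  show "sg_tri \<subseteq> cbox (0,0) (1,1)"
    using sg_tri_bounds by (auto simp: cbox_Pair_eq) 
qed

lemma sg_tri_closed: "closed sg_tri"
proof -
  have "sg_tri = (\<Inter>i\<in>sg_alph. {z. 0 \<le> bary i z})" by (auto simp: sg_tri_def)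
  moreover have c: "continuous_on UNIV (bary i)" for i
    unfolding bary_def by (cases "i = 1"; cases "i = 2"; simp; intro continuous_intros; simp)
  have "closed {z. 0 \<le> bary i z}" for i
    by (intro closed_Collect_le continuous_intros c)
  then have "closed (\<Inter>i\<in>sg_alph. {z. 0 \<le> bary i z})" by blast
  ultimately show ?thesis by (simp only:)
qed

lemma dist_sg_map: "dist (sg_map i x) (sg_map i y) = dist x y / 2"
proof -
  have "sg_map i x - sg_map i y = (1/2) *\<^sub>R (x - y)" by (simp add: sg_map_eq algebra_simps)
  then show ?thesis unfolding dist_norm by simp
qed

lemma sg_map_inj: "sg_map i x = sg_map i y \<longleftrightarrow> x = y"
  using dist_sg_map[of i x y] by auto

lemma sg_map_cont: "continuous_on S (sg_map i)"
  unfolding sg_map_eq by (intro continuous_intros)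

lemma sg_map_corner: "sg_map i (sg_corner i) = sg_corner i"
  by (simp add: sg_map_eq flip: scaleR_2)

lemma sg_map_corner_sym: "sg_map i (sg_corner j) = sg_map j (sg_corner i)"
  by (simp add: sg_map_eq add.commute)

lemma sg_V_0_eq: "sg_V 0 = sg_corner ` sg_alph"
  by (auto simp: sg_corner_def sg_alph_def)

lemma sg_V_Suc_eq: "sg_V (Suc m) = (\<Union>i\<in>sg_alph. sg_map i ` sg_V m)"
  by (simp add: sg_alph_def)

declare sg_V.simps [simp del]

lemma sg_V_mono_Suc: "sg_V m \<subseteq> sg_V (Suc m)"
proof (induction m)
  case 0
  show ?case unfolding sg_V_0_eq sg_V_Suc_eq using sg_map_corner by force
next
  case (Suc m)
  then show ?case by (subst (1 2) sg_V_Suc_eq) blast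
qed

lemma sg_V_mono: "m \<le> n \<Longrightarrow> sg_V m \<subseteq> sg_V n"
  using lift_Suc_mono_le[of sg_V] sg_V_mono_Suc by blast

lemma sg_V_tri: "sg_V m \<subseteq> sg_tri"
proof (induction m)
  case 0 then show ?case by (auto simp: sg_V_0_eq sg_corner_tri)
next
  case (Suc m) then show ?case by (auto simp: sg_V_Suc_eq intro!: sg_map_tri)
qed

section \<open>Existence and uniqueness of the attractor\<close>

lemma sg_attractor_le:
  assumes K: "compact K" "K \<noteq> {}" "K = (\<Union>i\<in>sg_alph. sg_map i ` K)"
    and L: "compact L" "L \<noteq> {}" "L = (\<Union>i\<in>sg_alph. sg_map i ` L)"
  shows "K \<subseteq> L"
proof -
  \<comment> \<open>A point of K at maximal distance from L is the image of some y in K. As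
    \<open>sg_map i\<close> halves distances, the maximum is at most half of itself.\<close>
  have "continuous_on K (\<lambda>x. infdist x L)" by (intro continuous_intros)
  then obtain x where x: "x \<in> K" "\<And>y. y \<in> K \<Longrightarrow> infdist y L \<le> infdist x L"
    using continuous_attains_sup[OF K(1,2)] by metis
  from x(1) K(3) obtain i y where iy: "i \<in> sg_alph" "y \<in> K" "x = sg_map i y" by blast
  obtain k where k: "k \<in> L" "infdist y L = dist y k"
    using infdist_attains_inf[OF compact_imp_closed[OF L(1)] L(2)] by metis
  have "sg_map i k \<in> L" using iy k L(3) by blast
  then have "infdist x L \<le> dist x (sg_map i k)" by (rule infdist_le)
  also have "\<dots> = infdist y L / 2" using iy k by (simp add: dist_sg_map)
  also have "\<dots> \<le> infdist x L / 2" using x(2)[OF iy(2)] by simp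
  finally have "infdist x L \<le> 0" by simp
  show ?thesis
  proof
    fix z assume "z \<in> K"
    then have "infdist z L = 0"
      using x(2)[of z] \<open>infdist x L \<le> 0\<close> infdist_nonneg[of z L] by simp
    then show "z \<in> L"
      using in_closed_iff_infdist_zero[OF compact_imp_closed[OF L(1)] L(2)] by blast
  qed
qed

lemma closure_image_compact:
  fixes f :: "'a::heine_borel \<Rightarrow> 'b::heine_borel"
  assumes "bounded S" "continuous_on UNIV f"
  shows "closure (f ` S) = f ` closure S"
proof
  have "compact (f ` closure S)"
    using assms by (intro compact_continuous_image) (auto intro: continuous_on_subset)
  then show "closure (f ` S) \<subseteq> f ` closure S"
    by (intro closure_minimal image_mono closure_subset compact_imp_closed)
  show "f ` closure S \<subseteq> closure (f ` S)"
    by (intro image_closure_subset closed_closure closure_subset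
        continuous_on_subset[OF assms(2)] subset_UNIV)
qed

text \<open>The closure of all vertices is the existence witness: the vertex sets increase, and by
  \<open>sg_V_Suc_eq\<close> the three maps together carry their union onto itself.\<close>

lemma sg_attractor_closure:
  defines "K \<equiv> closure (\<Union>m. sg_V m)"
  shows "compact K" "K \<noteq> {}" "K = (\<Union>i\<in>sg_alph. sg_map i ` K)" "K \<subseteq> sg_tri"
proof -
  have sub: "(\<Union>m. sg_V m) \<subseteq> sg_tri" using sg_V_tri by auto
  then have b: "bounded (\<Union>m. sg_V m)" using sg_tri_bounded bounded_subset by blast
  then show "compact K" by (simp add: K_def compact_closure)
  show "K \<subseteq> sg_tri" unfolding K_def using sub sg_tri_closed by (rule closure_minimal)
  have "sg_corner 1 \<in> sg_V 0" by (simp add: sg_V_0_eq)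
  then show "K \<noteq> {}" unfolding K_def using closure_subset by blast
  have "(\<Union>m. sg_V m) = (\<Union>m. sg_V (Suc m))" using sg_V_mono_Suc by blast
  also have "\<dots> = (\<Union>i\<in>sg_alph. sg_map i ` (\<Union>m. sg_V m))" by (auto simp: sg_V_Suc_eq)
  finally have "K = closure (\<Union>i\<in>sg_alph. sg_map i ` (\<Union>m. sg_V m))" by (simp add: K_def)
  also have "\<dots> = (\<Union>i\<in>sg_alph. closure (sg_map i ` (\<Union>m. sg_V m)))"
    using finite_sg_alph by (induction rule: finite_induct) auto
  also have "\<dots> = (\<Union>i\<in>sg_alph. sg_map i ` K)"
    unfolding K_def using closure_image_compact[OF b sg_map_cont] by simp
  finally show "K = (\<Union>i\<in>sg_alph. sg_map i ` K)" .
qed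

lemma SG_eq_closure: "SG = closure (\<Union>m. sg_V m)"
  unfolding SG_def
proof (rule the_equality)
  show "compact (closure (\<Union>m. sg_V m)) \<and> closure (\<Union>m. sg_V m) \<noteq> {} \<and>
     closure (\<Union>m. sg_V m) = (\<Union>i\<in>{1,2,3}. sg_map i ` closure (\<Union>m. sg_V m))"
    using sg_attractor_closure(1-3) unfolding sg_alph_def by (intro conjI)
next
  fix K assume a: "compact K \<and> K \<noteq> {} \<and> K = (\<Union>i\<in>{1,2,3}. sg_map i ` K)"
  then have K: "compact K" "K \<noteq> {}" by blast+
  have K': "K = (\<Union>i\<in>sg_alph. sg_map i ` K)"
    unfolding sg_alph_def by (rule a[THEN conjunct2, THEN conjunct2])
  show "K = closure (\<Union>m. sg_V m)"
    using sg_attractor_le[OF K K' sg_attractor_closure(1-3)]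
      sg_attractor_le[OF sg_attractor_closure(1-3) K K'] by (rule subset_antisym)
qed

lemma SG_compact: "compact SG" and SG_nonempty: "SG \<noteq> {}"
  and SG_self_similar: "SG = (\<Union>i\<in>sg_alph. sg_map i ` SG)" and SG_tri: "SG \<subseteq> sg_tri"
  using sg_attractor_closure unfolding SG_eq_closure by blast+

lemma sg_V_SG: "sg_V m \<subseteq> SG"
  unfolding SG_eq_closure by (rule order_trans[OF _ closure_subset]) blast

lemma sg_corner_SG: "i \<in> sg_alph \<Longrightarrow> sg_corner i \<in> SG"
  using sg_V_SG[of 0] by (auto simp: sg_V_0_eq)

section \<open>Words, cells and addresses of points\<close>

lemma sg_words_iff: "w \<in> sg_words m \<longleftrightarrow> set w \<subseteq> sg_alph \<and> length w = m"
  by (simp add: sg_words_def sg_alph_def)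

lemma sg_words_eq: "sg_words m = {w. set w \<subseteq> sg_alph \<and> length w = m}"
  by (simp add: sg_words_def sg_alph_def)

lemma finite_sg_words [simp]: "finite (sg_words m)"
  unfolding sg_words_eq by (rule finite_lists_length_eq) simp

lemma card_sg_words: "card (sg_words m) = 3 ^ m"
  unfolding sg_words_eq by (simp add: card_lists_length_eq)

lemma sg_word_map_append: "sg_word_map (u @ v) x = sg_word_map u (sg_word_map v x)"
  by (induction u) auto

lemma sg_word_map_tri: "set w \<subseteq> sg_alph \<Longrightarrow> x \<in> sg_tri \<Longrightarrow> sg_word_map w x \<in> sg_tri"
  by (induction w) (auto intro: sg_map_tri)

lemma sg_word_map_SG: "set w \<subseteq> sg_alph \<Longrightarrow> x \<in> SG \<Longrightarrow> sg_word_map w x \<in> SG"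
proof (induction w)
  case (Cons i w)
  then have "sg_map i (sg_word_map w x) \<in> (\<Union>i\<in>sg_alph. sg_map i ` SG)" by auto
  then show ?case by (subst SG_self_similar) simp
qed simp

lemma dist_sg_word_map: "dist (sg_word_map w x) (sg_word_map w y) = dist x y / 2 ^ length w"
  by (induction w) (auto simp: dist_sg_map)

lemma sg_word_map_inj [simp]: "sg_word_map w x = sg_word_map w y \<longleftrightarrow> x = y"
  using dist_sg_word_map[of w x y] by auto

lemma sg_word_map_cont: "continuous_on S (sg_word_map w)"
  by (induction w arbitrary: S)
    (auto intro: continuous_on_compose sg_map_cont continuous_on_id simp del: o_apply simp: id_def)

lemma sg_word_map_replicate: "sg_word_map (replicate k i) (sg_corner i) = sg_corner i"
  by (induction k) (auto simp: sg_map_corner)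

lemma sg_cell_subset: "w \<in> sg_words m \<Longrightarrow> sg_cell w \<subseteq> SG"
  by (auto simp: sg_cell_def sg_words_iff sg_word_map_SG)

lemma sg_cell_compact: "compact (sg_cell w)"
  unfolding sg_cell_def by (intro compact_continuous_image sg_word_map_cont SG_compact)

lemma SG_cells: "SG = (\<Union>w\<in>sg_words m. sg_cell w)"
proof (induction m)
  case 0
  have "sg_words 0 = {[]}" by (auto simp: sg_words_iff)
  then show ?case by (simp add: sg_cell_def)
next
  case (Suc m)
  show ?case
  proof
    show "SG \<subseteq> (\<Union>w\<in>sg_words (Suc m). sg_cell w)"
    proof
      fix x assume "x \<in> SG"
      then obtain i y where iy: "i \<in> sg_alph" "y \<in> SG" "x = sg_map i y"
        using SG_self_similar by blast
      then obtain w where w: "w \<in> sg_words m" "y \<in> sg_cell w" using Suc by auto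
      then have "i # w \<in> sg_words (Suc m)" "x \<in> sg_cell (i # w)"
        using iy by (auto simp: sg_words_iff sg_cell_def)
      then show "x \<in> (\<Union>w\<in>sg_words (Suc m). sg_cell w)" by blast
    qed
    show "(\<Union>w\<in>sg_words (Suc m). sg_cell w) \<subseteq> SG" using sg_cell_subset by blast
  qed
qed

lemma SG_cellE:
  assumes "x \<in> SG"
  obtains w p where "w \<in> sg_words m" "p \<in> SG" "x = sg_word_map w p"
proof -
  have "x \<in> (\<Union>w\<in>sg_words m. sg_cell w)" using assms SG_cells by blast
  then show thesis using that by (auto simp: sg_cell_def)
qed

lemma sg_V_eq: "sg_V m = {sg_word_map w (sg_corner i) |w i. w \<in> sg_words m \<and> i \<in> sg_alph}"
proof (induction m)
  case 0
  have "sg_words 0 = {[]}" by (auto simp: sg_words_iff)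
  then show ?case by (auto simp: sg_V_0_eq)
next
  case (Suc m)
  show ?case
  proof (intro Set.set_eqI iffI)
    fix x assume "x \<in> sg_V (Suc m)"
    then obtain i w j where "i \<in> sg_alph" "w \<in> sg_words m" "j \<in> sg_alph"
      "x = sg_map i (sg_word_map w (sg_corner j))" unfolding sg_V_Suc_eq Suc by blast
    then have "i # w \<in> sg_words (Suc m)" "x = sg_word_map (i # w) (sg_corner j)"
      by (auto simp: sg_words_iff)
    then show "x \<in> {sg_word_map w (sg_corner i) |w i. w \<in> sg_words (Suc m) \<and> i \<in> sg_alph}"
      using \<open>j \<in> sg_alph\<close> by blast
  next
    fix x assume "x \<in> {sg_word_map w (sg_corner i) |w i. w \<in> sg_words (Suc m) \<and> i \<in> sg_alph}"
    then obtain w j where w: "w \<in> sg_words (Suc m)" "j \<in> sg_alph" "x = sg_word_map w (sg_corner j)"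
      by blast
    then obtain i v where v: "w = i # v" by (auto simp: sg_words_iff length_Suc_conv)
    have "i \<in> sg_alph" "v \<in> sg_words m" using w v by (auto simp: sg_words_iff)
    then show "x \<in> sg_V (Suc m)" unfolding sg_V_Suc_eq Suc using w v by auto
  qed
qed

lemma sg_V_I: "set w \<subseteq> sg_alph \<Longrightarrow> length w = m \<Longrightarrow> i \<in> sg_alph \<Longrightarrow> sg_word_map w (sg_corner i) \<in> sg_V m"
  by (auto simp: sg_V_eq sg_words_iff)

lemma finite_sg_V [simp]: "finite (sg_V m)"
  by (induction m) (auto simp: sg_V_0_eq sg_V_Suc_eq)

lemma card_sg_V: "card (sg_V m) \<le> 3 * 3 ^ m"
proof -
  have "sg_V m = (\<lambda>(w, i). sg_word_map w (sg_corner i)) ` (sg_words m \<times> sg_alph)"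
    by (auto simp: sg_V_eq)
  then have "card (sg_V m) \<le> card (sg_words m \<times> sg_alph)"
    by (simp only: card_image_le finite_cartesian_product finite_sg_words finite_sg_alph)
  then show ?thesis by (simp add: card_cartesian_product card_sg_words)
qed

text \<open>On the triangle \<open>bary b\<close> reaches its maximum 1 only at corner b, and
  \<open>sg_map a\<close> averages it with 1 if a = b and with 0 otherwise. So the outermost letter
  is b, and the rest follows by induction.\<close>

lemma sg_word_map_eq_corner:
  assumes "set v \<subseteq> sg_alph" "p \<in> sg_tri" "b \<in> sg_alph" "sg_word_map v p = sg_corner b"
  shows "v = replicate (length v) b \<and> p = sg_corner b"
  using assms
proof (induction v)
  case (Cons a v)
  let ?q = "sg_word_map v p"
  have q: "?q \<in> sg_tri" using Cons.prems by (auto intro: sg_word_map_tri)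
  have a: "a \<in> sg_alph" using Cons.prems by simp
  have "bary b (sg_map a ?q) = 1" using Cons.prems by (simp add: bary_corner)
  then have *: "bary b ?q + (if b = a then 1 else 0) = 2"
    using a Cons.prems(3) by (simp add: bary_map bary_corner)
  have "bary b ?q \<le> 1" using bary_le_1[OF q Cons.prems(3)] .
  then have "a = b" "bary b ?q \<ge> 1" using * by (auto split: if_splits)
  then have "?q = sg_corner b" using bary_1_corner[OF q Cons.prems(3)] by simp
  then show ?case using Cons \<open>a = b\<close> by auto
qed simp

text \<open>After the common prefix the words branch into letters a and b. Comparing the coordinates
  a and b of the two sides gives \<open>bary a q + 1 = bary a q'\<close> and its mirror image.
  Coordinates lie in [0,1], so q and q' are corners, and \<open>sg_word_map_eq_corner\<close> makes
  the remaining letters constant.\<close>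

lemma sg_cells_meet:
  assumes "w \<in> sg_words m" "w' \<in> sg_words m" "w \<noteq> w'" "p \<in> sg_tri" "p' \<in> sg_tri"
    "sg_word_map w p = sg_word_map w' p'"
  shows "\<exists>s a b k. set s \<subseteq> sg_alph \<and> a \<in> sg_alph \<and> b \<in> sg_alph \<and> a \<noteq> b \<and>
    w = s @ a # replicate k b \<and> w' = s @ b # replicate k a \<and> p = sg_corner b \<and> p' = sg_corner a"
  using assms
proof (induction m arbitrary: w w')
  case 0 then show ?case by (auto simp: sg_words_iff)
next
  case (Suc m)
  obtain a v where w: "w = a # v" "a \<in> sg_alph" "v \<in> sg_words m"
    using Suc.prems(1) by (auto simp: sg_words_iff length_Suc_conv)
  obtain b v' where w': "w' = b # v'" "b \<in> sg_alph" "v' \<in> sg_words m"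
    using Suc.prems(2) by (auto simp: sg_words_iff length_Suc_conv)
  show ?case
  proof (cases "a = b")
    case True
    then have "v \<noteq> v'" "sg_word_map v p = sg_word_map v' p'"
      using Suc.prems w w' by (auto simp: sg_map_inj)
    from Suc.IH[OF w(3) w'(3) this(1) Suc.prems(4,5) this(2)]
    obtain s c d k where "set s \<subseteq> sg_alph" "c \<in> sg_alph" "d \<in> sg_alph" "c \<noteq> d"
      "v = s @ c # replicate k d" "v' = s @ d # replicate k c" "p = sg_corner d" "p' = sg_corner c"
      by blast
    then show ?thesis using w w' True
      by (intro exI[of _ "a # s"] exI[of _ c] exI[of _ d] exI[of _ k]) auto
  next
    case False
    define q q' where "q = sg_word_map v p" and "q' = sg_word_map v' p'"
    have q: "q \<in> sg_tri" "q' \<in> sg_tri" unfolding q_def q'_def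
      using w w' Suc.prems by (auto intro!: sg_word_map_tri simp: sg_words_iff)
    have e: "sg_map a q = sg_map b q'" using Suc.prems w w' by (simp add: q_def q'_def)
    have "bary a (sg_map a q) = bary a (sg_map b q')" "bary b (sg_map a q) = bary b (sg_map b q')"
      using e by simp_all
    then have "bary a q + 1 = bary a q'" "bary b q' + 1 = bary b q"
      using False w w' by (auto simp: bary_map bary_corner)
    then have "q' = sg_corner a" "q = sg_corner b"
      using sg_triD[OF q(1) w(2)] sg_triD[OF q(2) w'(2)] w w' q by (auto intro!: bary_1_corner)
    then have "sg_word_map v' p' = sg_corner a" "sg_word_map v p = sg_corner b"
      by (simp_all add: q_def q'_def)
    moreover have "set v \<subseteq> sg_alph" "set v' \<subseteq> sg_alph" using w w' by (auto simp: sg_words_iff)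
    ultimately have "v = replicate (length v) b \<and> p = sg_corner b"
      "v' = replicate (length v') a \<and> p' = sg_corner a"
      using w(2) w'(2) Suc.prems sg_word_map_eq_corner by blast+
    moreover have "length v = m" "length v' = m" using w w' by (auto simp: sg_words_iff)
    ultimately show ?thesis using w w' False
      by (intro exI[of _ "[]"] exI[of _ a] exI[of _ b] exI[of _ m]) auto
  qed
qed

lemma sg_cell_Int:
  assumes "w \<in> sg_words m" "w' \<in> sg_words m" "w \<noteq> w'" "x \<in> sg_cell w" "x \<in> sg_cell w'"
  shows "x \<in> sg_V m"
proof -
  obtain p p' where "p \<in> SG" "p' \<in> SG" "x = sg_word_map w p" "x = sg_word_map w' p'"
    using assms by (auto simp: sg_cell_def)
  then obtain b where "b \<in> sg_alph" "p = sg_corner b"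
    using sg_cells_meet[OF assms(1-3), of p p'] SG_tri by auto
  then show ?thesis using assms \<open>x = sg_word_map w p\<close> by (auto simp: sg_V_eq)
qed

text \<open>A vertex might owe its level to another cell; it is then a meeting point of two cells,
  hence again a corner of w.\<close>

lemma sg_V_cell:
  assumes "x \<in> sg_V m" "w \<in> sg_words m" "x \<in> sg_cell w"
  obtains i where "i \<in> sg_alph" "x = sg_word_map w (sg_corner i)"
proof -
  obtain v j where v: "v \<in> sg_words m" "j \<in> sg_alph" "x = sg_word_map v (sg_corner j)"
    using assms(1) by (auto simp: sg_V_eq)
  obtain p where p: "p \<in> SG" "x = sg_word_map w p" using assms by (auto simp: sg_cell_def)
  show thesis
  proof (cases "v = w")
    case True then show ?thesis using that v by blast
  next
    case False
    then have "\<exists>b\<in>sg_alph. p = sg_corner b"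
      using sg_cells_meet[OF assms(2) v(1), of p "sg_corner j"] p v SG_tri sg_corner_tri by auto
    then show ?thesis using that p by blast
  qed
qed

subsection \<open>Junction points\<close>

text \<open>The point shared by the children a and b of the cell s, a vertex from level
  \<open>length s + 1\<close> on.\<close>

definition sg_jn :: "nat list \<Rightarrow> nat \<Rightarrow> nat \<Rightarrow> real \<times> real" where
  "sg_jn s a b = sg_word_map (s @ [a]) (sg_corner b)"

definition jn_ok :: "nat list \<Rightarrow> nat \<Rightarrow> nat \<Rightarrow> bool" where
  "jn_ok s a b \<longleftrightarrow> set s \<subseteq> sg_alph \<and> a \<in> sg_alph \<and> b \<in> sg_alph \<and> a \<noteq> b"

lemma sg_jn_sym: "sg_jn s a b = sg_jn s b a"
  by (simp add: sg_jn_def sg_word_map_append sg_map_corner_sym)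

text \<open>Appending the letter b passes to a smaller cell with the same corner b; at finer levels
  a junction is addressed in this form.\<close>

lemma sg_jn_eq: "sg_word_map (s @ a # replicate k b) (sg_corner b) = sg_jn s a b"
  by (simp add: sg_jn_def sg_word_map_append sg_word_map_replicate)

lemma sg_jn_in_V: "jn_ok s a b \<Longrightarrow> length s < m \<Longrightarrow> sg_jn s a b \<in> sg_V m"
  using sg_V_I[of "s @ a # replicate (m - Suc (length s)) b" m b]
  by (auto simp: jn_ok_def sg_jn_eq set_replicate_conv_if split: if_splits)

lemma sg_jn_notin_V0: "jn_ok s a b \<Longrightarrow> sg_jn s a b \<notin> sg_V 0"
proof
  assume j: "jn_ok s a b" and "sg_jn s a b \<in> sg_V 0"
  then obtain c where c: "c \<in> sg_alph" "sg_word_map (s @ [a]) (sg_corner b) = sg_corner c"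
    by (auto simp: sg_V_0_eq sg_jn_def)
  have "s @ [a] = replicate (length (s @ [a])) c \<and> sg_corner b = sg_corner c"
    using j by (intro sg_word_map_eq_corner c) (auto simp: jn_ok_def sg_corner_tri)
  then have "a = c" "b = c" using j c
    by (auto simp: jn_ok_def simp flip: replicate_append_same)
  then show False using j by (simp add: jn_ok_def)
qed

text \<open>Trailing letters i do not move the corner i, so removing them leads either to a boundary
  corner or to the level where the vertex is born.\<close>

lemma word_last_decomp:
  "w = replicate (length w) i \<or> (\<exists>s a k. w = s @ a # replicate k i \<and> a \<noteq> i)"
proof (induction w rule: rev_induct)
  case (snoc x w)
  show ?case
  proof (cases "x = i")
    case False
    have "w @ [x] = w @ x # replicate 0 i" by simp
    then show ?thesis using False by blast
  next
    case True
    from snoc show ?thesis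
    proof
      assume "w = replicate (length w) i"
      then have "w @ [x] = replicate (length (w @ [x])) i"
        using True by (metis length_append_singleton replicate_Suc replicate_append_same)
      then show ?thesis by blast
    next
      assume "\<exists>s a k. w = s @ a # replicate k i \<and> a \<noteq> i"
      then obtain s a k where "w = s @ a # replicate k i" "a \<noteq> i" by blast
      then have "w @ [x] = s @ a # replicate (Suc k) i"
        using True by (simp add: replicate_append_same)
      then show ?thesis using \<open>a \<noteq> i\<close> by blast
    qed
  qed
qed simp

lemma word_last_decomp_unique:
  assumes "s @ a # replicate k b = s' @ a' # replicate k' b" "a \<noteq> b" "a' \<noteq> b"
  shows "s = s' \<and> a = a' \<and> k = k'"
proof -
  have "replicate k b @ a # rev s = replicate k' b @ a' # rev s'"
    using arg_cong[OF assms(1), of rev] by simp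
  then have "k = k' \<and> a # rev s = a' # rev s'"
    using assms(2,3)
  proof (induction k arbitrary: k')
    case 0 then show ?case by (cases k') auto
  next
    case (Suc k) then show ?case by (cases k') auto
  qed
  then show ?thesis by auto
qed

text \<open>Makes the meeting point of two cells of the same level unique: prefix and branching
  letters are determined by the words.\<close>

lemma word_first_diff_unique:
  assumes "s @ a # x = s' @ a' # x'" "s @ b # y = s' @ b' # y'" "a \<noteq> b" "a' \<noteq> b'"
  shows "s = s' \<and> a = a' \<and> b = b'"
  using assms
proof (induction s arbitrary: s')
  case Nil then show ?case by (cases s') auto
next
  case (Cons c s) then show ?case by (cases s') auto
qed

lemma sg_V_junction:
  assumes "x \<in> sg_V m - sg_V 0"
  obtains s a b k where "jn_ok s a b" "m = length s + Suc k" "x = sg_jn s a b"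
proof -
  obtain w i where w: "w \<in> sg_words m" "i \<in> sg_alph" "x = sg_word_map w (sg_corner i)"
    using assms by (auto simp: sg_V_eq[of m])
  have "w \<noteq> replicate (length w) i"
  proof
    assume "w = replicate (length w) i"
    then have "x = sg_corner i" using w sg_word_map_replicate by metis
    then show False using assms w by (auto simp: sg_V_0_eq)
  qed
  then obtain s a k where s: "w = s @ a # replicate k i" "a \<noteq> i" using word_last_decomp by metis
  show thesis
    by (rule that[of s a i k]) (use s w in \<open>auto simp: sg_words_iff jn_ok_def sg_jn_eq\<close>)
qed

subsection \<open>The graph Laplacian\<close>

text \<open>Unnormalized discrete normal derivative at corner i of the cell w: the sum of the
  differences to the other two corners. The sum includes j = i, hence the factor 3 instead of
  2.\<close>

definition nd :: "(real \<times> real \<Rightarrow> real) \<Rightarrow> nat list \<Rightarrow> nat \<Rightarrow> real" where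
  "nd u w i = (\<Sum>j\<in>sg_alph. u (sg_word_map w (sg_corner j))) - 3 * u (sg_word_map w (sg_corner i))"

lemma sg_adj_iff:
  "sg_adj m x y \<longleftrightarrow> (\<exists>w\<in>sg_words m. \<exists>i\<in>sg_alph. \<exists>j\<in>sg_alph. i \<noteq> j \<and>
     x = sg_word_map w (sg_corner i) \<and> y = sg_word_map w (sg_corner j))"
proof
  assume a: "sg_adj m x y"
  then obtain w where w: "w \<in> sg_words m" "x \<in> sg_cell w" "y \<in> sg_cell w" by (auto simp: sg_adj_def)
  obtain i where "i \<in> sg_alph" "x = sg_word_map w (sg_corner i)"
    using sg_V_cell[OF _ w(1,2)] a by (auto simp: sg_adj_def)
  moreover obtain j where "j \<in> sg_alph" "y = sg_word_map w (sg_corner j)"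
    using sg_V_cell[OF _ w(1,3)] a by (auto simp: sg_adj_def)
  ultimately show "\<exists>w\<in>sg_words m. \<exists>i\<in>sg_alph. \<exists>j\<in>sg_alph. i \<noteq> j \<and>
     x = sg_word_map w (sg_corner i) \<and> y = sg_word_map w (sg_corner j)"
    using w a by (auto simp: sg_adj_def)
next
  assume "\<exists>w\<in>sg_words m. \<exists>i\<in>sg_alph. \<exists>j\<in>sg_alph. i \<noteq> j \<and>
     x = sg_word_map w (sg_corner i) \<and> y = sg_word_map w (sg_corner j)"
  then show "sg_adj m x y"
    unfolding sg_adj_def sg_V_eq sg_cell_def using sg_corner_SG by fastforce
qed

text \<open>A second cell through the junction meets the first one at its corner b, so
  \<open>sg_cells_meet\<close> prescribes its word, and uniqueness of the removal of trailing
  letters identifies the parameters.\<close>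

lemma sg_junction_addresses:
  assumes "jn_ok s a b" "m = length s + Suc k" "w \<in> sg_words m" "i \<in> sg_alph"
    "sg_word_map w (sg_corner i) = sg_jn s a b"
  shows "(w = s @ a # replicate k b \<and> i = b) \<or> (w = s @ b # replicate k a \<and> i = a)"
proof -
  let ?w = "s @ a # replicate k b"
  have w1: "?w \<in> sg_words m" and J: "sg_word_map ?w (sg_corner b) = sg_jn s a b"
    using assms by (auto simp: sg_words_iff jn_ok_def sg_jn_eq)
  have b: "b \<in> sg_alph" "a \<noteq> b" using assms(1) by (auto simp: jn_ok_def)
  show ?thesis
  proof (cases "w = ?w")
    case True
    have "sg_word_map ?w (sg_corner i) = sg_word_map ?w (sg_corner b)"
      using J assms(5) True by simp
    then show ?thesis using True assms(4) b by simp
  next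
    case False
    obtain s' a' b' k' where d: "a' \<in> sg_alph" "b' \<in> sg_alph" "a' \<noteq> b'"
      "?w = s' @ a' # replicate k' b'" "w = s' @ b' # replicate k' a'"
      "sg_corner b = sg_corner b'" "sg_corner i = sg_corner a'"
      using sg_cells_meet[OF w1 assms(3) False[symmetric], of "sg_corner b" "sg_corner i"]
        J assms(4,5) b sg_corner_tri by auto
    then have "b' = b" "i = a'" using b assms(4) by auto
    then have "s = s' \<and> a = a' \<and> k = k'" using d b word_last_decomp_unique by metis
    then show ?thesis using d \<open>b' = b\<close> \<open>i = a'\<close> by auto
  qed
qed

text \<open>The four neighbours come in two pairs, one in each of the two cells meeting at the
  junction, and the term \<open>- 4 * u x\<close> is shared equally. The pairs are disjoint, because
  two cells of one level meet in at most one point.\<close>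

lemma sg_graph_laplacian_jn:
  assumes j: "jn_ok s a b" and m: "m = length s + Suc k"
  shows "sg_graph_laplacian m u (sg_jn s a b) =
    nd u (s @ a # replicate k b) b + nd u (s @ b # replicate k a) a"
proof -
  let ?v = "s @ a # replicate k b" and ?w = "s @ b # replicate k a" and ?J = "sg_jn s a b"
  have v: "?v \<in> sg_words m" "?w \<in> sg_words m" and ab: "a \<in> sg_alph" "b \<in> sg_alph" "a \<noteq> b"
    using j m by (auto simp: sg_words_iff jn_ok_def)
  have Jv: "sg_word_map ?v (sg_corner b) = ?J" and Jw: "sg_word_map ?w (sg_corner a) = ?J"
    using sg_jn_eq sg_jn_sym by metis+
  let ?V = "(\<lambda>j. sg_word_map ?v (sg_corner j)) ` (sg_alph - {b})"
  let ?W = "(\<lambda>j. sg_word_map ?w (sg_corner j)) ` (sg_alph - {a})"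
  have "{y. sg_adj m ?J y} = ?V \<union> ?W"
  proof (intro Set.set_eqI iffI)
    fix y assume "y \<in> {y. sg_adj m ?J y}"
    then obtain z i l where z: "z \<in> sg_words m" "i \<in> sg_alph" "l \<in> sg_alph" "i \<noteq> l"
      "?J = sg_word_map z (sg_corner i)" "y = sg_word_map z (sg_corner l)"
      unfolding sg_adj_iff by blast
    show "y \<in> ?V \<union> ?W"
      using sg_junction_addresses[OF j m z(1,2) z(5)[symmetric]]
    proof
      assume "z = ?v \<and> i = b"
      then have "y = sg_word_map ?v (sg_corner l)" "l \<in> sg_alph - {b}" using z(3,4,6) by auto
      then show ?thesis by blast
    next
      assume "z = ?w \<and> i = a"
      then have "y = sg_word_map ?w (sg_corner l)" "l \<in> sg_alph - {a}" using z(3,4,6) by auto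
      then show ?thesis by blast
    qed
  next
    fix y assume "y \<in> ?V \<union> ?W"
    then show "y \<in> {y. sg_adj m ?J y}"
    proof
      assume "y \<in> ?V"
      then obtain l where "l \<in> sg_alph" "b \<noteq> l" "y = sg_word_map ?v (sg_corner l)" by blast
      then have "sg_adj m ?J y" unfolding sg_adj_iff
        using v(1) Jv[symmetric] ab(2) by (intro bexI conjI)
      then show ?thesis by simp
    next
      assume "y \<in> ?W"
      then obtain l where "l \<in> sg_alph" "a \<noteq> l" "y = sg_word_map ?w (sg_corner l)" by blast
      then have "sg_adj m ?J y" unfolding sg_adj_iff
        using v(2) Jw[symmetric] ab(1) by (intro bexI conjI)
      then show ?thesis by simp
    qed
  qed
  moreover have "?V \<inter> ?W = {}"
  proof (rule ccontr)
    assume "?V \<inter> ?W \<noteq> {}"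
    then obtain i l where il: "i \<in> sg_alph" "i \<noteq> b" "l \<in> sg_alph" "l \<noteq> a"
      "sg_word_map ?v (sg_corner i) = sg_word_map ?w (sg_corner l)" by blast
    obtain s' a' b' k' where d: "a' \<in> sg_alph" "b' \<in> sg_alph" "a' \<noteq> b'"
      "?v = s' @ a' # replicate k' b'" "?w = s' @ b' # replicate k' a'"
      "sg_corner i = sg_corner b'"
      using sg_cells_meet[OF v _ sg_corner_tri[OF il(1)] sg_corner_tri[OF il(3)] il(5)] ab(3)
      by blast
    then have "b = b'" using word_first_diff_unique[OF d(4,5)] ab by blast
    then show False using d il by auto
  qed
  ultimately have "(\<Sum>y | sg_adj m ?J y. u y) = sum u ?V + sum u ?W"
    by (simp add: sum.union_disjoint)
  also have "sum u ?V = (\<Sum>j\<in>sg_alph - {b}. u (sg_word_map ?v (sg_corner j)))"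
    by (subst sum.reindex) (auto simp: inj_on_def)
  also have "sum u ?W = (\<Sum>j\<in>sg_alph - {a}. u (sg_word_map ?w (sg_corner j)))"
    by (subst sum.reindex) (auto simp: inj_on_def)
  finally show ?thesis
    using Jv Jw sum.remove[OF finite_sg_alph ab(2), of "\<lambda>j. u (sg_word_map ?v (sg_corner j))"]
      sum.remove[OF finite_sg_alph ab(1), of "\<lambda>j. u (sg_word_map ?w (sg_corner j))"]
    by (simp add: sg_graph_laplacian_def nd_def)
qed

declare split_paired_All [simp del] split_paired_Ex [simp del]

section \<open>Linearity of the Laplacian\<close>

lemma sg_graph_laplacian_add:
  "sg_graph_laplacian m (u + v) x = sg_graph_laplacian m u x + sg_graph_laplacian m v x"
  by (simp add: sg_graph_laplacian_def sum.distrib)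

lemma sg_graph_laplacian_scale:
  "sg_graph_laplacian m (fun_scale c u) x = c * sg_graph_laplacian m u x"
  by (simp add: sg_graph_laplacian_def fun_scale_def sum_distrib_left algebra_simps)

lemma sg_C_add: "u \<in> sg_C \<Longrightarrow> v \<in> sg_C \<Longrightarrow> u + v \<in> sg_C"
  unfolding sg_C_def plus_fun_def by (auto intro: continuous_on_add)

lemma sg_C_scale: "u \<in> sg_C \<Longrightarrow> fun_scale c u \<in> sg_C"
  unfolding sg_C_def fun_scale_def by (auto intro: continuous_on_mult_left)

lemma sg_C_0: "0 \<in> sg_C"
  unfolding sg_C_def zero_fun_def by auto

lemma sg_C_off: "u \<in> sg_C \<Longrightarrow> x \<notin> SG \<Longrightarrow> u x = 0"
  by (simp add: sg_C_def)

lemma has_sg_laplacian_add: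
  assumes "has_sg_laplacian u g" "has_sg_laplacian v h"
  shows "has_sg_laplacian (u + v) (g + h)"
  unfolding has_sg_laplacian_def
proof (intro conjI allI impI)
  fix \<epsilon> :: real assume "\<epsilon> > 0"
  then have "\<epsilon> / 2 > 0" by simp
  obtain N where N: "\<And>m x. m \<ge> N \<Longrightarrow> x \<in> sg_V m - sg_V 0 \<Longrightarrow>
      \<bar>3/2 * (5 ^ m * sg_graph_laplacian m u x) - g x\<bar> < \<epsilon> / 2"
    using assms(1) \<open>\<epsilon> / 2 > 0\<close> unfolding has_sg_laplacian_def by meson
  obtain M where M: "\<And>m x. m \<ge> M \<Longrightarrow> x \<in> sg_V m - sg_V 0 \<Longrightarrow>
      \<bar>3/2 * (5 ^ m * sg_graph_laplacian m v x) - h x\<bar> < \<epsilon> / 2"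
    using assms(2) \<open>\<epsilon> / 2 > 0\<close> unfolding has_sg_laplacian_def by meson
  show "\<exists>N. \<forall>m\<ge>N. \<forall>x\<in>sg_V m - sg_V 0.
      \<bar>3/2 * (5 ^ m * sg_graph_laplacian m (u + v) x) - (g + h) x\<bar> < \<epsilon>"
  proof (intro exI allI impI ballI)
    fix m x assume m: "max N M \<le> m" "x \<in> sg_V m - sg_V 0"
    have "3/2 * (5 ^ m * sg_graph_laplacian m (u + v) x) - (g + h) x =
      (3/2 * (5 ^ m * sg_graph_laplacian m u x) - g x) + (3/2 * (5 ^ m * sg_graph_laplacian m v x) - h x)"
      by (simp add: sg_graph_laplacian_add algebra_simps)
    moreover have "N \<le> m" "M \<le> m" using m(1) by auto
    ultimately show "\<bar>3/2 * (5 ^ m * sg_graph_laplacian m (u + v) x) - (g + h) x\<bar> < \<epsilon>"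
      using N[OF _ m(2)] M[OF _ m(2)] by linarith
  qed
qed (use assms in \<open>auto simp: has_sg_laplacian_def intro: sg_C_add\<close>)

lemma has_sg_laplacian_scale:
  assumes "has_sg_laplacian u g"
  shows "has_sg_laplacian (fun_scale c u) (fun_scale c g)"
  unfolding has_sg_laplacian_def
proof (intro conjI allI impI)
  fix \<epsilon> :: real assume "\<epsilon> > 0"
  then have "\<epsilon> / (\<bar>c\<bar> + 1) > 0" by simp
  then obtain N where N: "\<And>m x. m \<ge> N \<Longrightarrow> x \<in> sg_V m - sg_V 0 \<Longrightarrow>
      \<bar>3/2 * (5 ^ m * sg_graph_laplacian m u x) - g x\<bar> < \<epsilon> / (\<bar>c\<bar> + 1)"
    using assms(1) unfolding has_sg_laplacian_def by meson
  show "\<exists>N. \<forall>m\<ge>N. \<forall>x\<in>sg_V m - sg_V 0.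
      \<bar>3/2 * (5 ^ m * sg_graph_laplacian m (fun_scale c u) x) - fun_scale c g x\<bar> < \<epsilon>"
  proof (intro exI allI impI ballI)
    fix m x assume m: "N \<le> m" "x \<in> sg_V m - sg_V 0"
    let ?r = "3/2 * (5 ^ m * sg_graph_laplacian m u x) - g x"
    have "3/2 * (5 ^ m * sg_graph_laplacian m (fun_scale c u) x) - fun_scale c g x = c * ?r"
      unfolding sg_graph_laplacian_scale by (simp add: fun_scale_def algebra_simps)
    moreover have "\<bar>?r\<bar> * (\<bar>c\<bar> + 1) < \<epsilon>" using N[OF m] by (simp add: field_simps)
    moreover have "\<bar>?r\<bar> * (\<bar>c\<bar> + 1) = \<bar>c\<bar> * \<bar>?r\<bar> + \<bar>?r\<bar>" by (rule distrib_left[of "\<bar>?r\<bar>" "\<bar>c\<bar>" 1, simplified mult_1_right mult.commute[of "\<bar>?r\<bar>" "\<bar>c\<bar>"]])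
    ultimately have "\<bar>c\<bar> * \<bar>?r\<bar> < \<epsilon>" using abs_ge_zero[of ?r] by linarith
    moreover note \<open>_ = c * ?r\<close>
    ultimately show "\<bar>3/2 * (5 ^ m * sg_graph_laplacian m (fun_scale c u) x) - fun_scale c g x\<bar> < \<epsilon>"
      by (simp add: abs_mult)
  qed
qed (use assms in \<open>auto simp: has_sg_laplacian_def intro: sg_C_scale\<close>)

section \<open>Spectral decimation\<close>

text \<open>The spectral decimation polynomial: apart from the exceptional value 6, a level-(m+1)
  eigenfunction with parameter t is a level-m eigenfunction with parameter
  \<open>dec t\<close>.\<close>

definition dec :: "real \<Rightarrow> real" where "dec t = t * (5 - t)"

text \<open>The vertex term \<open>t * u x\<close> is split equally between the two cells meeting at
  a junction, so that the discrete eigenvalue equation there says that two of these half residuals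
  cancel. This makes the equation local to a cell.\<close>

definition hres :: "real \<Rightarrow> (real \<times> real \<Rightarrow> real) \<Rightarrow> nat list \<Rightarrow> nat \<Rightarrow> real" where
  "hres t u w i = nd u w i + t / 2 * u (sg_word_map w (sg_corner i))"

text \<open>By \<open>laplacian_midres\<close> this is the full residual of the eigenvalue equation
  at the midpoint between corners i and j of w.\<close>

definition midres :: "real \<Rightarrow> (real \<times> real \<Rightarrow> real) \<Rightarrow> nat list \<Rightarrow> nat \<Rightarrow> nat \<Rightarrow> real" where
  "midres t u w i j = hres t u (w @ [i]) j + hres t u (w @ [j]) i"

definition deig :: "nat \<Rightarrow> real \<Rightarrow> (real \<times> real \<Rightarrow> real) \<Rightarrow> bool" where
  "deig m t u \<longleftrightarrow> (\<forall>x\<in>sg_V m - sg_V 0. sg_graph_laplacian m u x = - t * u x)"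

lemma sg_word_map_snoc: "sg_word_map (w @ [i]) x = sg_word_map w (sg_map i x)"
  by (simp add: sg_word_map_append)

text \<open>An identity between the six values of u on a once subdivided cell, valid for every u.
  Because the residuals are kept, it serves for exact eigenfunctions, for approximate ones and for
  the construction of new ones.\<close>

lemma hres_step:
  assumes "sg_alph = {i, j, l}" "i \<noteq> j" "i \<noteq> l" "j \<noteq> l"
  shows "(2 - t) * (5 - t) * hres t u (w @ [i]) i = (6 - t) * hres (dec t) u w i
    - ((4 - t) * (midres t u w i j + midres t u w i l) + 2 * midres t u w j l)"
  unfolding hres_def midres_def nd_def dec_def sum_sg_alph'[OF assms] sg_word_map_snoc sg_map_corner
    sg_map_corner_sym[of j i] sg_map_corner_sym[of l i] sg_map_corner_sym[of l j]
  by (simp add: field_simps)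

text \<open>Elimination from the three midpoint equations of the cell. The factor
  \<open>(2 - t) * (5 - t)\<close> is the source of the exceptional values 2 and 5, while 6 comes
  from the factor in \<open>hres_step\<close>.\<close>

lemma mid_value:
  assumes "sg_alph = {i, j, l}" "i \<noteq> j" "i \<noteq> l" "j \<noteq> l"
  shows "(2 - t) * (5 - t) * u (sg_word_map (w @ [i]) (sg_corner j)) =
      (4 - t) * (u (sg_word_map w (sg_corner i)) + u (sg_word_map w (sg_corner j)))
      + 2 * u (sg_word_map w (sg_corner l))
    - ((3 - t) * midres t u w i j + midres t u w i l + midres t u w j l)"
  unfolding hres_def midres_def nd_def dec_def sum_sg_alph'[OF assms] sg_word_map_snoc sg_map_corner
    sg_map_corner_sym[of j i] sg_map_corner_sym[of l i] sg_map_corner_sym[of l j]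
  by (simp add: field_simps)

lemma laplacian_hres:
  assumes "jn_ok s a b" "m = length s + Suc k"
  shows "sg_graph_laplacian m u (sg_jn s a b) + t * u (sg_jn s a b) =
    hres t u (s @ a # replicate k b) b + hres t u (s @ b # replicate k a) a"
  using sg_graph_laplacian_jn[OF assms] sg_jn_eq[of s a k b] sg_jn_eq[of s b k a] sg_jn_sym[of s a b]
  by (simp add: hres_def)

lemma laplacian_midres:
  assumes "jn_ok w i j"
  shows "sg_graph_laplacian (Suc (length w)) u (sg_jn w i j) + t * u (sg_jn w i j) = midres t u w i j"
  using laplacian_hres[OF assms, of "Suc (length w)" 0] by (simp add: midres_def)

text \<open>The six midpoint residuals, three in each cell, contribute at most
  \<open>2 * (10 - 2 * t) * \<epsilon>\<close>, and
  \<open>(2 - t) * (5 - t) + 4 * (5 - t) = (6 - t) * (5 - t)\<close>. So the error grows by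
  \<open>5 - t\<close>, hence at most by 5, which is the renormalization factor of the
  Laplacian.\<close>

lemma laplacian_error_step:
  assumes t: "0 \<le> t" "t < 2"
    and e: "\<And>x. x \<in> sg_V (Suc m) - sg_V 0 \<Longrightarrow> \<bar>sg_graph_laplacian (Suc m) u x + t * u x\<bar> \<le> \<epsilon>"
    and x: "x \<in> sg_V m - sg_V 0"
  shows "\<bar>sg_graph_laplacian m u x + dec t * u x\<bar> \<le> 5 * \<epsilon>"
proof -
  obtain s a b k where j: "jn_ok s a b" "m = length s + Suc k" "x = sg_jn s a b"
    using sg_V_junction[OF x] .
  let ?v = "s @ a # replicate k b" and ?w = "s @ b # replicate k a"
  let ?D = "(2 - t) * (5 - t)"
  have ab: "a \<in> sg_alph" "b \<in> sg_alph" "b \<noteq> a" "set s \<subseteq> sg_alph" using j by (auto simp: jn_ok_def)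
  obtain l where l: "l \<in> sg_alph" "l \<noteq> b" "l \<noteq> a" "sg_alph = {b, a, l}"
    using sg_alph_third[OF ab(2,1,3)] .
  then have l': "sg_alph = {a, b, l}" by auto
  have mid: "\<bar>midres t u w i' j'\<bar> \<le> \<epsilon>"
    if "w \<in> {?v, ?w}" "i' \<in> sg_alph" "j' \<in> sg_alph" "i' \<noteq> j'" for w i' j'
  proof -
    have lw: "length w = m" "set w \<subseteq> sg_alph" using that ab j by auto
    then have ok: "jn_ok w i' j'" using that by (auto simp: jn_ok_def)
    have "sg_jn w i' j' \<in> sg_V (Suc m) - sg_V 0"
      using sg_jn_in_V[OF ok] sg_jn_notin_V0[OF ok] lw by auto
    from e[OF this] show ?thesis using laplacian_midres[OF ok, of u t] lw by simp
  qed
  define R where "R = ((4 - t) * (midres t u ?v b a + midres t u ?v b l) + 2 * midres t u ?v a l)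
    + ((4 - t) * (midres t u ?w a b + midres t u ?w a l) + 2 * midres t u ?w b l)"
  have "(6 - t) * (hres (dec t) u ?v b + hres (dec t) u ?w a)
      = ?D * (hres t u (?v @ [b]) b + hres t u (?w @ [a]) a) + R"
    using hres_step[OF l(4) ab(3) l(2)[symmetric] l(3)[symmetric], of t u ?v]
      hres_step[OF l' ab(3)[symmetric] l(3)[symmetric] l(2)[symmetric], of t u ?w]
    by (simp add: R_def algebra_simps)
  moreover have "hres (dec t) u ?v b + hres (dec t) u ?w a = sg_graph_laplacian m u x + dec t * u x"
    using laplacian_hres[OF j(1,2)] j(3) by simp
  moreover have "hres t u (?v @ [b]) b + hres t u (?w @ [a]) a = sg_graph_laplacian (Suc m) u x + t * u x"
    using laplacian_hres[OF j(1), of "Suc m" "Suc k" u t] j(2,3) by (simp add: replicate_append_same)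
  ultimately have eq: "(6 - t) * (sg_graph_laplacian m u x + dec t * u x) =
      ?D * (sg_graph_laplacian (Suc m) u x + t * u x) + R" by simp
  have q: "\<bar>(4 - t) * (p + q) + 2 * r\<bar> \<le> (10 - 2 * t) * \<epsilon>"
    if "\<bar>p\<bar> \<le> \<epsilon>" "\<bar>q\<bar> \<le> \<epsilon>" "\<bar>r\<bar> \<le> \<epsilon>" for p q r
  proof -
    have "\<bar>(4 - t) * (p + q)\<bar> \<le> (4 - t) * (2 * \<epsilon>)"
      unfolding abs_mult using t that by (intro mult_mono) auto
    moreover have "(4 - t) * (2 * \<epsilon>) + 2 * \<epsilon> = (10 - 2 * t) * \<epsilon>" by (simp add: algebra_simps)
    ultimately show ?thesis using that(3) by linarith
  qed
  have "\<bar>(4 - t) * (midres t u ?v b a + midres t u ?v b l) + 2 * midres t u ?v a l\<bar> \<le> (10 - 2 * t) * \<epsilon>"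
    by (intro q mid) (use ab l in auto)
  moreover have "\<bar>(4 - t) * (midres t u ?w a b + midres t u ?w a l) + 2 * midres t u ?w b l\<bar> \<le> (10 - 2 * t) * \<epsilon>"
    by (intro q mid) (use ab l in auto)
  ultimately have "\<bar>R\<bar> \<le> (10 - 2 * t) * \<epsilon> + (10 - 2 * t) * \<epsilon>"
    unfolding R_def by linarith
  moreover have "\<bar>?D * (sg_graph_laplacian (Suc m) u x + t * u x)\<bar> \<le> ?D * \<epsilon>"
    unfolding abs_mult using t e[of x] x sg_V_mono_Suc by (intro mult_mono) auto
  ultimately have "\<bar>(6 - t) * (sg_graph_laplacian m u x + dec t * u x)\<bar> \<le> ?D * \<epsilon> + 2 * ((10 - 2 * t) * \<epsilon>)"
    unfolding eq by linarith
  also have "\<dots> = (6 - t) * ((5 - t) * \<epsilon>)" by (simp add: algebra_simps)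
  finally have "\<bar>sg_graph_laplacian m u x + dec t * u x\<bar> \<le> (5 - t) * \<epsilon>"
    unfolding abs_mult using t by simp
  moreover have "0 \<le> \<epsilon>" using e[of x] x sg_V_mono_Suc by fastforce
  then have "(5 - t) * \<epsilon> \<le> 5 * \<epsilon>" using t by (intro mult_right_mono) auto
  ultimately show ?thesis by linarith
qed

lemma deigD:
  assumes "deig m t u" "jn_ok s a b" "m = length s + Suc k"
  shows "hres t u (s @ a # replicate k b) b + hres t u (s @ b # replicate k a) a = 0"
proof -
  have "sg_jn s a b \<in> sg_V m - sg_V 0"
    using sg_jn_in_V[OF assms(2)] sg_jn_notin_V0[OF assms(2)] assms(3) by auto
  then show ?thesis using assms(1) laplacian_hres[OF assms(2,3), of u t] by (simp add: deig_def)
qed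

lemma deigI:
  assumes "\<And>s a b k. jn_ok s a b \<Longrightarrow> m = length s + Suc k \<Longrightarrow>
    hres t u (s @ a # replicate k b) b + hres t u (s @ b # replicate k a) a = 0"
  shows "deig m t u"
  unfolding deig_def
proof
  fix x assume "x \<in> sg_V m - sg_V 0"
  then obtain s a b k where j: "jn_ok s a b" "m = length s + Suc k" "x = sg_jn s a b"
    by (rule sg_V_junction)
  then show "sg_graph_laplacian m u x = - t * u x"
    using laplacian_hres[OF j(1,2), of u t] assms[OF j(1,2)] by simp
qed

lemma deig_midres:
  assumes "deig (Suc m) t u" "w \<in> sg_words m" "i \<in> sg_alph" "j \<in> sg_alph" "i \<noteq> j"
  shows "midres t u w i j = 0"
  using deigD[OF assms(1), of w i j 0] assms by (auto simp: midres_def jn_ok_def sg_words_iff)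

lemma hres_step_deig:
  assumes "deig (Suc m) t u" "w \<in> sg_words m" "i \<in> sg_alph"
  shows "(2 - t) * (5 - t) * hres t u (w @ [i]) i = (6 - t) * hres (dec t) u w i"
proof -
  have "\<exists>j\<in>sg_alph. i \<noteq> j" using assms(3) by (auto simp: sg_alph_def)
  then obtain j where j: "j \<in> sg_alph" "i \<noteq> j" by blast
  obtain l where l: "l \<in> sg_alph" "l \<noteq> i" "l \<noteq> j" "sg_alph = {i, j, l}"
    using sg_alph_third[OF assms(3) j] .
  have "midres t u w i j = 0" "midres t u w i l = 0" "midres t u w j l = 0"
    using deig_midres[OF assms(1,2)] j l(1-3) assms(3) by blast+
  then show ?thesis
    using hres_step[OF l(4) j(2) l(2)[symmetric] l(3)[symmetric], of t u w] by simp
qed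

text \<open>Adding \<open>hres_step_deig\<close> for the two cells at a junction, the fine equation
  makes one side zero, and \<open>6 - t\<close> can be cancelled on the other.\<close>

lemma deig_down:
  assumes "deig (Suc m) t u" "t \<noteq> 6"
  shows "deig m (dec t) u"
proof (rule deigI)
  fix s a b k assume j: "jn_ok s a b" "m = length s + Suc k"
  let ?v = "s @ a # replicate k b" and ?w = "s @ b # replicate k a"
  have w: "?v \<in> sg_words m" "?w \<in> sg_words m" "a \<in> sg_alph" "b \<in> sg_alph"
    using j by (auto simp: sg_words_iff jn_ok_def)
  have "(6 - t) * (hres (dec t) u ?v b + hres (dec t) u ?w a) =
      (2 - t) * (5 - t) * (hres t u (?v @ [b]) b + hres t u (?w @ [a]) a)"
    using hres_step_deig[OF assms(1) w(1,4)] hres_step_deig[OF assms(1) w(2,3)]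
    by (simp add: algebra_simps)
  also have "hres t u (?v @ [b]) b + hres t u (?w @ [a]) a = 0"
    using deigD[OF assms(1) j(1), of "Suc k"] j(2) by (simp add: replicate_append_same)
  finally show "hres (dec t) u ?v b + hres (dec t) u ?w a = 0" using assms(2) by simp
qed

lemma sg_V_SucE:
  assumes "x \<in> sg_V (Suc m)"
  obtains "x \<in> sg_V m"
  | w i j where "w \<in> sg_words m" "i \<in> sg_alph" "j \<in> sg_alph" "i \<noteq> j" "x = sg_word_map (w @ [i]) (sg_corner j)"
proof -
  obtain v j where v: "v \<in> sg_words (Suc m)" "j \<in> sg_alph" "x = sg_word_map v (sg_corner j)"
    using assms by (auto simp: sg_V_eq)
  obtain w i where w: "v = w @ [i]" using v(1) by (cases v rule: rev_cases) (auto simp: sg_words_iff)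
  have wi: "w \<in> sg_words m" "i \<in> sg_alph" using v w by (auto simp: sg_words_iff)
  show thesis
  proof (cases "i = j")
    case True
    then have "x = sg_word_map w (sg_corner i)" using v w by (simp add: sg_word_map_snoc sg_map_corner)
    then show ?thesis using that(1) wi by (auto simp: sg_V_eq)
  next
    case False then show ?thesis using that(2) v w wi by auto
  qed
qed

text \<open>With vanishing midpoint residuals, \<open>mid_value\<close> expresses the new values
  through the three old ones, as long as 2 and 5 are excluded.\<close>

lemma deig_zero_up:
  assumes "deig (Suc m) t u" "t \<noteq> 2" "t \<noteq> 5" "\<And>x. x \<in> sg_V m \<Longrightarrow> u x = 0" "x \<in> sg_V (Suc m)"
  shows "u x = 0"
  using assms(5)
proof (cases rule: sg_V_SucE)
  case 1 then show ?thesis using assms by blast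
next
  case (2 w i j)
  obtain l where l: "l \<in> sg_alph" "l \<noteq> i" "l \<noteq> j" "sg_alph = {i, j, l}"
    using sg_alph_third[OF 2(2-4)] .
  have "sg_word_map w (sg_corner k) \<in> sg_V m" if "k \<in> sg_alph" for k
    using that 2(1) by (auto simp: sg_V_eq)
  then have "u (sg_word_map w (sg_corner k)) = 0" if "k \<in> sg_alph" for k
    using that assms(4) by blast
  then have "u (sg_word_map w (sg_corner i)) = 0" "u (sg_word_map w (sg_corner j)) = 0"
    "u (sg_word_map w (sg_corner l)) = 0"
    using 2(2,3) l(1) by blast+
  moreover have "midres t u w i j = 0" "midres t u w i l = 0" "midres t u w j l = 0"
    using deig_midres[OF assms(1) 2(1)] 2(2-4) l(1-3) by blast+
  ultimately have "(2 - t) * (5 - t) * u x = 0"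
    using mid_value[OF l(4) 2(4) l(2)[symmetric] l(3)[symmetric], of t u w] 2(5) by simp
  then show ?thesis using assms(2,3) by simp
qed

section \<open>Counting Dirichlet eigenvalues\<close>

definition dspec :: "nat \<Rightarrow> real set" where
  "dspec m = {t. \<exists>u. (\<exists>x\<in>sg_V m. u x \<noteq> 0) \<and> (\<forall>x\<in>sg_V 0. u x = 0) \<and> deig m t u}"

text \<open>Outside the exceptional values an eigenfunction of level m + 1 does not vanish on
  \<open>sg_V m\<close>, and it satisfies the coarser equation with \<open>dec t\<close>.\<close>

lemma dspec_Suc: "dspec (Suc m) \<subseteq> {2, 5, 6} \<union> dec -` dspec m"
proof
  fix t assume "t \<in> dspec (Suc m)"
  then obtain u where u: "\<exists>x\<in>sg_V (Suc m). u x \<noteq> 0" "\<forall>x\<in>sg_V 0. u x = 0" "deig (Suc m) t u"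
    by (auto simp: dspec_def)
  show "t \<in> {2, 5, 6} \<union> dec -` dspec m"
  proof (cases "t \<in> {2, 5, 6}")
    case False
    then have "\<exists>x\<in>sg_V m. u x \<noteq> 0" using deig_zero_up[OF u(3)] u(1) by auto
    then show ?thesis using deig_down[OF u(3)] u(2) False by (auto simp: dspec_def)
  qed blast
qed

lemma dec_vimage: "finite (dec -` {c}) \<and> card (dec -` {c}) \<le> 2"
proof (cases "dec -` {c} = {}")
  case False
  then obtain t where t: "dec t = c" by auto
  have "dec -` {c} \<subseteq> {t, 5 - t}"
  proof
    fix s assume "s \<in> dec -` {c}"
    then have "(s - t) * (5 - s - t) = 0" using t by (simp add: dec_def algebra_simps)
    then show "s \<in> {t, 5 - t}" by auto
  qed
  moreover have "card {t, 5 - t} \<le> 2" by (simp add: card_insert_if)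
  ultimately show ?thesis
    using card_mono[of "{t, 5 - t}" "dec -` {c}"] finite_subset[of "dec -` {c}" "{t, 5 - t}"] by auto
qed simp

text \<open>Each level at most doubles the number of eigenvalues and adds the three exceptional
  ones. The recursion starts from an empty spectrum, because all vertices of level 0 lie on the
  boundary.\<close>

lemma dspec_card: "finite (dspec m) \<and> card (dspec m) \<le> 3 * (2 ^ m - 1)"
proof (induction m)
  case 0
  have "dspec 0 = {}" by (auto simp: dspec_def)
  then show ?case by simp
next
  case (Suc m)
  have eq: "dec -` dspec m = (\<Union>c\<in>dspec m. dec -` {c})" by auto
  have fin: "finite (dec -` dspec m)" unfolding eq using Suc dec_vimage by auto
  have "card (dec -` dspec m) \<le> (\<Sum>c\<in>dspec m. card (dec -` {c}))"
    unfolding eq using Suc by (intro card_UN_le) auto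
  also have "\<dots> \<le> (\<Sum>c\<in>dspec m. 2)" using dec_vimage by (intro sum_mono) auto
  finally have c: "card (dec -` dspec m) \<le> 2 * (3 * (2 ^ m - 1))" using Suc by simp
  have "card (dspec (Suc m)) \<le> card ({2, 5, 6} \<union> dec -` dspec m)"
    using fin by (intro card_mono dspec_Suc) auto
  also have "\<dots> \<le> card {2, 5, 6::real} + card (dec -` dspec m)" by (rule card_Un_le)
  also have "\<dots> \<le> 3 + 2 * (3 * (2 ^ m - 1))" using c by simp
  also have "\<dots> = 3 * (2 ^ Suc m - 1)"
    using one_le_power[of "2::nat" m] by (simp add: algebra_simps)
  finally show ?case using finite_subset[OF dspec_Suc] fin by auto
qed

subsection \<open>The decimation sequence of an eigenvalue\<close>

text \<open>
  The sequence attached to \<open>z\<close> is \<open>k \<mapsto> \<Phi> (z / 5 ^ k)\<close>, where \<open>\<Phi>\<close> is the entire solution of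
  Poincare's equation \<open>\<Phi> (5 z) = dec (\<Phi> z)\<close> with \<open>\<Phi>' 0 = 1\<close>.
\<close>

definition dec_seq :: "real \<Rightarrow> (nat \<Rightarrow> real) \<Rightarrow> bool" where
  "dec_seq z ls \<longleftrightarrow> (\<forall>k. 0 \<le> ls k \<and> ls k \<le> 1 \<and> ls k = dec (ls (Suc k))) \<and>
     (\<lambda>k. 5 ^ k * ls k) \<longlonglongrightarrow> z"

lemma dec_bounds:
  assumes "0 \<le> t" "t \<le> 1"
  shows "0 \<le> dec t" "dec t \<le> 5 * t"
  using assms by (auto simp: dec_def algebra_simps mult_left_le intro: order_trans[OF mult_left_le])

text \<open>The hypothesis \<open>5 ^ k * y \<le> 1\<close> keeps the orbits inside [0,1], where
  \<open>dec\<close> is increasing and \<open>dec t \<le> 5 * t\<close>.\<close>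

lemma dec_funpow_mono:
  assumes "0 \<le> x" "x \<le> y" "5 ^ k * y \<le> 1"
  shows "0 \<le> (dec ^^ k) x \<and> (dec ^^ k) x \<le> (dec ^^ k) y \<and> (dec ^^ k) y \<le> 5 ^ k * y"
  using assms(3)
proof (induction k)
  case 0 then show ?case using assms by simp
next
  case (Suc k)
  let ?a = "(dec ^^ k) x" and ?b = "(dec ^^ k) y"
  have "0 \<le> 5 ^ k * y" using assms by simp
  then have "5 ^ k * y \<le> 1" using Suc.prems by (simp add: algebra_simps)
  then have IH: "0 \<le> ?a" "?a \<le> ?b" "?b \<le> 5 ^ k * y" "?b \<le> 1" using Suc.IH by auto
  have "dec ?b - dec ?a = (?b - ?a) * (5 - ?a - ?b)" by (simp add: dec_def algebra_simps)
  moreover have "0 \<le> (?b - ?a) * (5 - ?a - ?b)" using IH by (intro mult_nonneg_nonneg) auto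
  moreover have "0 \<le> dec ?a" unfolding dec_def[of ?a] using IH by (intro mult_nonneg_nonneg) auto
  moreover have "dec ?b \<le> 5 * ?b" using IH by (simp add: dec_def algebra_simps)
  ultimately have "dec ?a \<le> dec ?b" "0 \<le> dec ?a" "dec ?b \<le> 5 * (5 ^ k * y)" using IH by linarith+
  then show ?case by simp
qed

text \<open>As \<open>dec t\<close> is \<open>5 * t\<close> minus the square of t, the accumulated
  quadratic loss stays below the square of \<open>5 ^ k * x\<close>. This gives the limit function
  the derivative 1 at 0.\<close>

lemma dec_funpow_lower:
  assumes "0 \<le> x" "5 ^ k * x \<le> 1"
  shows "5 ^ k * x - (5 ^ k * x)\<^sup>2 \<le> (dec ^^ k) x"
  using assms(2)
proof (induction k)
  case (Suc k)
  let ?a = "(dec ^^ k) x" and ?X = "5 ^ k * x"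
  have X: "0 \<le> ?X" "?X \<le> 1" using assms Suc.prems by (simp_all add: algebra_simps)
  then have a: "?X - ?X\<^sup>2 \<le> ?a" "0 \<le> ?a" "?a \<le> ?X"
    using Suc.IH dec_funpow_mono[of x x k] assms by auto
  then have "?a\<^sup>2 \<le> ?X\<^sup>2" by (intro power_mono) auto
  then have "5 * (?X - ?X\<^sup>2) - ?X\<^sup>2 \<le> dec ?a" using a by (simp add: dec_def algebra_simps power2_eq_square)
  moreover have "5 * ?X - (5 * ?X)\<^sup>2 \<le> 5 * (?X - ?X\<^sup>2) - ?X\<^sup>2"
    using zero_le_power2[of ?X] by (simp add: power_mult_distrib del: zero_le_power2)
  ultimately have "5 * ?X - (5 * ?X)\<^sup>2 \<le> dec ?a" by linarith
  then show ?case by (simp add: mult.assoc)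
qed simp

text \<open>The limit of \<open>(dec ^^ k) (s / 5 ^ k)\<close> exists because the sequence
  decreases, and shifting k by one gives Poincare's equation in the limit. The bounds of \<Phi>
  between s minus its square and s give
  \<open>5 ^ k * \<Phi> (z / 5 ^ k) \<longlonglongrightarrow> z\<close>.\<close>

lemma dec_seq_exists:
  assumes z: "0 \<le> z" "z \<le> 1"
  shows "\<exists>ls. dec_seq z ls"
proof -
  define \<Phi> where "\<Phi> s = lim (\<lambda>k. (dec ^^ k) (s / 5 ^ k))" for s
  have bd: "0 \<le> (dec ^^ k) (s / 5 ^ k)" "(dec ^^ k) (s / 5 ^ k) \<le> s" "s - s\<^sup>2 \<le> (dec ^^ k) (s / 5 ^ k)"
    if "0 \<le> s" "s \<le> 1" for s k
    using dec_funpow_mono[of "s / 5 ^ k" "s / 5 ^ k" k] dec_funpow_lower[of "s / 5 ^ k" k] that by auto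
  have conv: "(\<lambda>k. (dec ^^ k) (s / 5 ^ k)) \<longlonglongrightarrow> \<Phi> s" if s: "0 \<le> s" "s \<le> 1" for s
  proof -
    have "decseq (\<lambda>k. (dec ^^ k) (s / 5 ^ k))"
    proof (rule decseq_SucI)
      fix k
      have "0 \<le> s / 5 ^ Suc k" "s / 5 ^ Suc k \<le> 1"
        using s one_le_power[of "5::real" "Suc k"] by (simp_all add: field_simps)
      then have "0 \<le> dec (s / 5 ^ Suc k)" "dec (s / 5 ^ Suc k) \<le> 5 * (s / 5 ^ Suc k)"
        by (rule dec_bounds)+
      then have "dec (s / 5 ^ Suc k) \<le> s / 5 ^ k" "0 \<le> dec (s / 5 ^ Suc k)" by simp_all
      then have "(dec ^^ k) (dec (s / 5 ^ Suc k)) \<le> (dec ^^ k) (s / 5 ^ k)"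
        using dec_funpow_mono[of "dec (s / 5 ^ Suc k)" "s / 5 ^ k" k] s by auto
      then show "(dec ^^ Suc k) (s / 5 ^ Suc k) \<le> (dec ^^ k) (s / 5 ^ k)"
        by (simp add: funpow_swap1)
    qed
    then have "convergent (\<lambda>k. (dec ^^ k) (s / 5 ^ k))"
      using bd[OF s] decseq_convergent[of _ 0] unfolding convergent_def by metis
    then show ?thesis unfolding \<Phi>_def by (simp add: convergent_LIMSEQ_iff)
  qed
  have \<Phi>: "0 \<le> \<Phi> s" "\<Phi> s \<le> s" "s - s\<^sup>2 \<le> \<Phi> s" if "0 \<le> s" "s \<le> 1" for s
    using LIMSEQ_le_const[OF conv[OF that]] LIMSEQ_le_const2[OF conv[OF that]] bd[OF that] by blast+
  have fe: "\<Phi> (5 * s) = dec (\<Phi> s)" if s: "0 \<le> s" "5 * s \<le> 1" for s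
  proof -
    have "(\<lambda>k. (dec ^^ Suc k) (5 * s / 5 ^ Suc k)) \<longlonglongrightarrow> \<Phi> (5 * s)"
      using s by (intro LIMSEQ_Suc conv) auto
    moreover have "(\<lambda>k. dec ((dec ^^ k) (s / 5 ^ k))) \<longlonglongrightarrow> dec (\<Phi> s)"
      unfolding dec_def[of "(dec ^^ _) _"] dec_def[of "\<Phi> _"] using s by (intro tendsto_intros conv) auto
    ultimately show ?thesis using LIMSEQ_unique by simp
  qed
  have zk: "0 \<le> z / 5 ^ k" "z / 5 ^ k \<le> 1" "5 * (z / 5 ^ Suc k) = z / 5 ^ k" for k
    using z one_le_power[of "5::real" k] by (auto simp: field_simps intro: order_trans)
  have lim: "(\<lambda>k. 5 ^ k * \<Phi> (z / 5 ^ k)) \<longlonglongrightarrow> z"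
  proof (rule tendsto_sandwich)
    show "\<forall>\<^sub>F k in sequentially. z - z\<^sup>2 * (1/5) ^ k \<le> 5 ^ k * \<Phi> (z / 5 ^ k)"
    proof (intro always_eventually allI)
      fix k
      have "5 ^ k * (z / 5 ^ k - (z / 5 ^ k)\<^sup>2) \<le> 5 ^ k * \<Phi> (z / 5 ^ k)"
        using \<Phi>(3)[OF zk(1,2)[of k]] by (intro mult_left_mono) auto
      moreover have "5 ^ k * (z / 5 ^ k - (z / 5 ^ k)\<^sup>2) = z - z\<^sup>2 * (1/5) ^ k"
        by (simp add: right_diff_distrib power2_eq_square power_one_over)
      ultimately show "z - z\<^sup>2 * (1/5) ^ k \<le> 5 ^ k * \<Phi> (z / 5 ^ k)" by linarith
    qed
    show "\<forall>\<^sub>F k in sequentially. 5 ^ k * \<Phi> (z / 5 ^ k) \<le> z"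
      using \<Phi>(2)[OF zk(1,2)] by (intro always_eventually allI) (simp add: field_simps)
    have "(\<lambda>k. z - z\<^sup>2 * (1/5) ^ k) \<longlonglongrightarrow> z - z\<^sup>2 * 0"
      by (intro tendsto_intros LIMSEQ_realpow_zero) auto
    then show "(\<lambda>k. z - z\<^sup>2 * (1/5) ^ k) \<longlonglongrightarrow> z" by simp
  qed simp
  have "0 \<le> \<Phi> (z / 5 ^ k) \<and> \<Phi> (z / 5 ^ k) \<le> 1 \<and> \<Phi> (z / 5 ^ k) = dec (\<Phi> (z / 5 ^ Suc k))" for k
  proof -
    have "\<Phi> (5 * (z / 5 ^ Suc k)) = dec (\<Phi> (z / 5 ^ Suc k))"
      by (rule fe) (use zk(3)[of k] zk(1)[of "Suc k"] zk(2)[of k] in auto)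
    then have "\<Phi> (z / 5 ^ k) = dec (\<Phi> (z / 5 ^ Suc k))" using zk(3)[of k] by simp
    then show ?thesis using \<Phi>(1,2)[OF zk(1,2)[of k]] zk(2)[of k] by linarith
  qed
  then show ?thesis using lim
    unfolding dec_seq_def by (intro exI[of _ "\<lambda>k. \<Phi> (z / 5 ^ k)"] conjI) blast+
qed

text \<open>Two numbers in [0,1] add up to at most 2, never to 5, so \<open>dec\<close> is injective
  there and the first term determines all others, hence the limit. Distinct eigenvalues therefore
  have distinct discrete counterparts.\<close>

lemma dec_seq_unique:
  assumes "dec_seq z ls" "dec_seq z' ls'" "ls 0 = ls' 0"
  shows "z = z'"
proof -
  have "ls k = ls' k" for k
  proof (induction k)
    case (Suc k)
    have "ls k = dec (ls (Suc k))" "ls' k = dec (ls' (Suc k))"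
      using assms(1,2) unfolding dec_seq_def by blast+
    then have b: "ls (Suc k) \<le> 1" "ls' (Suc k) \<le> 1" "dec (ls (Suc k)) = dec (ls' (Suc k))"
      using assms(1,2) Suc unfolding dec_seq_def by (blast, blast, argo)
    have "(ls (Suc k) - ls' (Suc k)) * (5 - ls (Suc k) - ls' (Suc k)) =
        dec (ls (Suc k)) - dec (ls' (Suc k))" by (simp add: dec_def algebra_simps)
    then have "(ls (Suc k) - ls' (Suc k)) * (5 - ls (Suc k) - ls' (Suc k)) = 0" using b(3) by linarith
    moreover have "5 - ls (Suc k) - ls' (Suc k) \<noteq> 0" using b(1,2) by linarith
    ultimately show ?case by simp
  qed (use assms in simp)
  then have "ls = ls'" by auto
  then show ?thesis using assms(1,2) LIMSEQ_unique unfolding dec_seq_def by blast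
qed

section \<open>Eigenfunctions of the Laplacian as discrete eigenfunctions\<close>

lemma sg_C_bounded:
  assumes "u \<in> sg_C"
  obtains B where "B > 0" "\<And>x. \<bar>u x\<bar> \<le> B"
proof -
  have "bounded (u ` SG)"
    using assms SG_compact by (auto simp: sg_C_def intro: compact_imp_bounded compact_continuous_image)
  then obtain B where B: "B > 0" "\<And>x. x \<in> SG \<Longrightarrow> \<bar>u x\<bar> \<le> B"
    by (auto simp: bounded_pos)
  have "\<bar>u x\<bar> \<le> B" for x
  proof (cases "x \<in> SG")
    case False
    then have "u x = 0" using assms by (simp add: sg_C_def)
    then show ?thesis using B by simp
  qed (use B in simp)
  then show thesis using that B by blast
qed

lemma sg_C_eq_0:
  assumes "u \<in> sg_C" "\<And>k x. x \<in> sg_V (m + k) \<Longrightarrow> u x = 0"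
  shows "u = 0"
proof -
  have *: "u x = 0" if "x \<in> (\<Union>m. sg_V m)" for x
  proof -
    obtain n where "x \<in> sg_V n" using \<open>x \<in> _\<close> by auto
    then have "x \<in> sg_V (m + n)" using sg_V_mono[of n "m + n"] by auto
    then show ?thesis using assms(2) by blast
  qed
  have "u x = 0" if "x \<in> SG" for x
    by (rule continuous_constant_on_closure[of "\<Union>m. sg_V m" u])
      (use assms(1) * that in \<open>auto simp: sg_C_def simp flip: SG_eq_closure\<close>)
  then show ?thesis using assms(1) by (auto simp: sg_C_def fun_eq_iff)
qed

text \<open>At a very fine level m + n uniform convergence leaves a residual of at most
  \<open>\<epsilon> / 5 ^ (m + n)\<close>. Descending n - k levels multiplies it by at most
  \<open>5 ^ (n - k)\<close>, which leaves \<open>\<epsilon> / 5 ^ (m + k)\<close>; as \<epsilon> is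
  arbitrary, the equation at level m + k is exact.\<close>

lemma laplacian_deig:
  assumes u: "has_sg_laplacian u (\<lambda>x. - \<Lambda> * u x)" and ls: "dec_seq (2/3 * \<Lambda> / 5 ^ m) ls"
  shows "deig (m + k) (ls k) u"
  unfolding deig_def
proof
  fix x assume x: "x \<in> sg_V (m + k) - sg_V 0"
  have uC: "u \<in> sg_C" using u by (simp add: has_sg_laplacian_def)
  obtain B where B: "B > 0" "\<And>x. \<bar>u x\<bar> \<le> B" using sg_C_bounded[OF uC] by blast
  have "\<bar>sg_graph_laplacian (m + k) u x + ls k * u x\<bar> \<le> \<epsilon>" if "\<epsilon> > 0" for \<epsilon>
  proof -
    obtain N where N: "\<And>n x. n \<ge> N \<Longrightarrow> x \<in> sg_V n - sg_V 0 \<Longrightarrow>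
        \<bar>3/2 * (5 ^ n * sg_graph_laplacian n u x) + \<Lambda> * u x\<bar> < \<epsilon> / 2"
    proof -
      have "\<epsilon> / 2 > 0" using \<open>\<epsilon> > 0\<close> by simp
      then obtain N where "\<And>n x. n \<ge> N \<Longrightarrow> x \<in> sg_V n - sg_V 0 \<Longrightarrow>
        \<bar>3/2 * (5 ^ n * sg_graph_laplacian n u x) - - \<Lambda> * u x\<bar> < \<epsilon> / 2"
        using u unfolding has_sg_laplacian_def by blast
      then show ?thesis by (intro that) simp
    qed
    have "(\<lambda>n. 5 ^ n * ls n) \<longlonglongrightarrow> 2/3 * \<Lambda> / 5 ^ m" using ls unfolding dec_seq_def by blast
    then have "(\<lambda>n. 3/2 * 5 ^ m * (5 ^ n * ls n)) \<longlonglongrightarrow> 3/2 * 5 ^ m * (2/3 * \<Lambda> / 5 ^ m)"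
      by (rule tendsto_mult_left)
    then have "(\<lambda>n. 3/2 * 5 ^ m * (5 ^ n * ls n)) \<longlonglongrightarrow> \<Lambda>" by simp
    moreover have "\<epsilon> / (2 * B) > 0" using \<open>\<epsilon> > 0\<close> B by simp
    ultimately obtain M where M: "\<And>n. n \<ge> M \<Longrightarrow> \<bar>3/2 * 5 ^ m * (5 ^ n * ls n) - \<Lambda>\<bar> < \<epsilon> / (2 * B)"
      unfolding LIMSEQ_iff real_norm_def by meson
    define d where "d = N + M"
    define n where "n = k + d"
    \<comment> \<open>One half of \<epsilon> pays for the graph Laplacian, the other for replacing
      \<open>ls n\<close> by its limit; the factor 3/2 on the left is dropped at the end.\<close>
    have small: "\<bar>sg_graph_laplacian (m + n) u y + ls n * u y\<bar> \<le> \<epsilon> / 5 ^ (m + n)"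
      if y: "y \<in> sg_V (m + n) - sg_V 0" for y
    proof -
      have 1: "\<bar>3/2 * (5 ^ (m + n) * sg_graph_laplacian (m + n) u y) + \<Lambda> * u y\<bar> < \<epsilon> / 2"
        by (rule N) (use y in \<open>auto simp: n_def d_def\<close>)
      have "\<bar>(3/2 * 5 ^ m * (5 ^ n * ls n) - \<Lambda>) * u y\<bar> \<le> \<epsilon> / (2 * B) * B"
        unfolding abs_mult using M[of n] B by (intro mult_mono) (auto simp: n_def d_def less_imp_le)
      then have 2: "\<bar>(3/2 * 5 ^ m * (5 ^ n * ls n) - \<Lambda>) * u y\<bar> \<le> \<epsilon> / 2" using B by simp
      have "3/2 * 5 ^ (m + n) * (sg_graph_laplacian (m + n) u y + ls n * u y) =
        (3/2 * (5 ^ (m + n) * sg_graph_laplacian (m + n) u y) + \<Lambda> * u y)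
        + (3/2 * 5 ^ m * (5 ^ n * ls n) - \<Lambda>) * u y" by (simp add: algebra_simps power_add)
      then have "\<bar>3/2 * 5 ^ (m + n) * (sg_graph_laplacian (m + n) u y + ls n * u y)\<bar> \<le> \<epsilon>"
        using 1 2 by linarith
      then have "3/2 * 5 ^ (m + n) * \<bar>sg_graph_laplacian (m + n) u y + ls n * u y\<bar> \<le> \<epsilon>"
        by (simp add: abs_mult)
      moreover have "0 \<le> 5 ^ (m + n) * \<bar>sg_graph_laplacian (m + n) u y + ls n * u y\<bar>" by simp
      ultimately have "5 ^ (m + n) * \<bar>sg_graph_laplacian (m + n) u y + ls n * u y\<bar> \<le> \<epsilon>" by linarith
      then show ?thesis by (simp add: field_simps)
    qed
    have "\<forall>y\<in>sg_V (m + (n - i)) - sg_V 0.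
        \<bar>sg_graph_laplacian (m + (n - i)) u y + ls (n - i) * u y\<bar> \<le> 5 ^ i * (\<epsilon> / 5 ^ (m + n))"
      if "i \<le> n" for i
      using that
    proof (induction i)
      case 0 then show ?case using small by auto
    next
      case (Suc i)
      define q where "q = n - Suc i"
      have q: "n - i = Suc q" using Suc.prems by (simp add: q_def)
      have "0 \<le> ls (Suc q)" "ls (Suc q) \<le> 1" and l: "ls q = dec (ls (Suc q))"
        using ls unfolding dec_seq_def by blast+
      then have l': "0 \<le> ls (Suc q)" "ls (Suc q) < 2" by auto
      have "\<bar>sg_graph_laplacian (m + q) u y + dec (ls (Suc q)) * u y\<bar> \<le> 5 * (5 ^ i * (\<epsilon> / 5 ^ (m + n)))"
        if "y \<in> sg_V (m + q) - sg_V 0" for y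
        by (rule laplacian_error_step[OF l' _ that]) (use Suc q in auto)
      then show ?case using l by (simp add: q_def[symmetric] mult.assoc)
    qed
    from this[of "n - k"] x have "\<bar>sg_graph_laplacian (m + k) u x + ls k * u x\<bar> \<le> 5 ^ (n - k) * (\<epsilon> / 5 ^ (m + n))"
      by (auto simp: n_def)
    also have "5 ^ (n - k) * (\<epsilon> / 5 ^ (m + n)) = \<epsilon> / 5 ^ (m + k)"
      by (simp add: n_def power_add)
    also have "\<dots> \<le> \<epsilon>" using \<open>\<epsilon> > 0\<close> by (simp add: field_simps)
    finally show ?thesis .
  qed
  then have "\<bar>sg_graph_laplacian (m + k) u x + ls k * u x\<bar> \<le> 0" by (rule field_le_epsilon[of _ 0, simplified])
  then show "sg_graph_laplacian (m + k) u x = - ls k * u x" by simp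
qed

text \<open>Maximum principle: if the eigenvalue were negative and u positive somewhere, then at a
  maximum x of u on \<open>sg_V n\<close> the graph Laplacian would be at most 0 and yet, rescaled,
  close to a positive multiple of \<open>u x\<close>. That x changes with n is harmless because the
  convergence is uniform.\<close>

lemma eigenvalue_nonneg:
  assumes "sg_dirichlet_eigenfunction \<Lambda> u"
  shows "0 \<le> \<Lambda>"
proof (rule ccontr)
  assume neg: "\<not> 0 \<le> \<Lambda>"
  have main: False if up: "u p > 0" "p \<in> sg_V j" "has_sg_laplacian u (\<lambda>x. - \<Lambda> * u x)" "\<forall>x\<in>sg_V 0. u x = 0" for u p j
  proof -
    have "- \<Lambda> * u p > 0" using that neg by (simp add: mult_neg_pos)
    then obtain N where N: "\<And>n x. n \<ge> N \<Longrightarrow> x \<in> sg_V n - sg_V 0 \<Longrightarrow>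
        \<bar>3/2 * (5 ^ n * sg_graph_laplacian n u x) - (- \<Lambda> * u x)\<bar> < - \<Lambda> * u p"
      using up(3) unfolding has_sg_laplacian_def by blast
    define n where "n = N + j"
    have pn: "p \<in> sg_V n" using that sg_V_mono[of j n] by (auto simp: n_def)
    define M where "M = Max (u ` sg_V n)"
    have "M \<in> u ` sg_V n" unfolding M_def using pn by (intro Max_in) auto
    then obtain x where x: "x \<in> sg_V n" "M = u x" by auto
    have max: "u y \<le> u x" if "y \<in> sg_V n" for y
      using that x(2) unfolding M_def by (metis Max_ge finite_imageI finite_sg_V image_eqI)
    have x0: "x \<notin> sg_V 0" using max[OF pn] up by force
    obtain s a b k where j: "jn_ok s a b" "n = length s + Suc k" "x = sg_jn s a b"
      using sg_V_junction[of x n] x x0 by blast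
    have "nd u w i \<le> 0" if "w \<in> sg_words n" "sg_word_map w (sg_corner i) = x" for w i
    proof -
      have "(\<Sum>j\<in>sg_alph. u (sg_word_map w (sg_corner j))) \<le> (\<Sum>j\<in>sg_alph. u x)"
        using that by (intro sum_mono max) (auto simp: sg_V_eq)
      then show ?thesis using that by (simp add: nd_def)
    qed
    moreover have "s @ a # replicate k b \<in> sg_words n" "s @ b # replicate k a \<in> sg_words n"
      using j by (auto simp: sg_words_iff jn_ok_def)
    ultimately have "sg_graph_laplacian n u x \<le> 0"
      using sg_graph_laplacian_jn[OF j(1,2), of u] sg_jn_eq[of s a k b] sg_jn_eq[of s b k a]
        sg_jn_sym[of s a b] j(3) by (metis add_nonpos_nonpos)
    then have "3/2 * (5 ^ n * sg_graph_laplacian n u x) \<le> 0" by (simp add: mult_nonneg_nonpos)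
    moreover have "\<bar>3/2 * (5 ^ n * sg_graph_laplacian n u x) - (- \<Lambda> * u x)\<bar> < - \<Lambda> * u p"
      by (rule N) (use x x0 in \<open>auto simp: n_def\<close>)
    moreover have "- \<Lambda> * u p \<le> - \<Lambda> * u x" using max[OF pn] neg by (intro mult_left_mono) auto
    ultimately show False by linarith
  qed
  have u: "has_sg_laplacian u (\<lambda>x. - \<Lambda> * u x)" "\<forall>x\<in>sg_V 0. u x = 0" "u \<noteq> 0"
    using assms by (auto simp: sg_dirichlet_eigenfunction_def)
  obtain k p where p: "p \<in> sg_V k" "u p \<noteq> 0"
    using sg_C_eq_0[of u 0] u by (auto simp: has_sg_laplacian_def)
  have "has_sg_laplacian (\<lambda>x. - u x) (\<lambda>x. - \<Lambda> * - u x)"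
    using has_sg_laplacian_scale[OF u(1), of "-1"] by (simp add: fun_scale_def)
  then show False
    using main[of u p k] main[of "\<lambda>x. - u x" p k] p u by (cases "u p > 0") auto
qed

lemma eigenvalue_dec_seq:
  assumes "sg_dirichlet_eigenfunction \<Lambda> u" "\<Lambda> \<le> 3/2 * 5 ^ m"
  obtains ls where "dec_seq (2/3 * \<Lambda> / 5 ^ m) ls"
proof -
  have "0 \<le> \<Lambda>" using assms(1) by (rule eigenvalue_nonneg)
  then have "0 \<le> 2/3 * \<Lambda> / 5 ^ m" "2/3 * \<Lambda> / 5 ^ m \<le> 1" using assms(2) by (auto simp: field_simps)
  then show thesis using dec_seq_exists that by blast
qed

text \<open>All parameters beyond level m are at most 1, so vanishing on \<open>sg_V m\<close>
  propagates to every finer level, and the vertices are dense.\<close>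

lemma eigenfunction_nonzero_on_V:
  assumes u: "sg_dirichlet_eigenfunction \<Lambda> u" and ls: "dec_seq (2/3 * \<Lambda> / 5 ^ m) ls"
  shows "\<exists>x\<in>sg_V m. u x \<noteq> 0"
proof (rule ccontr)
  assume "\<not> ?thesis"
  then have z: "\<forall>x\<in>sg_V m. u x = 0" by simp
  have "\<forall>x\<in>sg_V (m + k). u x = 0" for k
  proof (induction k)
    case (Suc k)
    have "deig (m + Suc k) (ls (Suc k)) u"
      using u ls by (intro laplacian_deig) (auto simp: sg_dirichlet_eigenfunction_def)
    moreover have "0 \<le> ls (Suc k)" "ls (Suc k) \<le> 1" using ls unfolding dec_seq_def by blast+
    ultimately show ?case using deig_zero_up[of "m + k" "ls (Suc k)" u] Suc by auto
  qed (use z in simp)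
  then have "u = 0"
    using u by (intro sg_C_eq_0) (auto simp: sg_dirichlet_eigenfunction_def has_sg_laplacian_def)
  then show False using u by (simp add: sg_dirichlet_eigenfunction_def)
qed

definition sg_eigenvalues :: "real \<Rightarrow> real set" where
  "sg_eigenvalues \<Lambda> = {t. t \<le> \<Lambda> \<and> (\<exists>u. sg_dirichlet_eigenfunction t u)}"

text \<open>Sending an eigenvalue to its level-m parameter \<open>ls 0\<close> is injective by
  \<open>dec_seq_unique\<close> and lands in the discrete Dirichlet spectrum.\<close>

lemma card_sg_eigenvalues:
  assumes "\<Lambda> \<le> 3/2 * 5 ^ m"
  shows "finite (sg_eigenvalues \<Lambda>)" "card (sg_eigenvalues \<Lambda>) \<le> 3 * 2 ^ m"
proof -
  have "\<exists>ls. dec_seq (2/3 * t / 5 ^ m) ls \<and> ls 0 \<in> dspec m" if t: "t \<in> sg_eigenvalues \<Lambda>" for t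
  proof -
    obtain u where u: "sg_dirichlet_eigenfunction t u" and "t \<le> \<Lambda>"
      using t by (auto simp: sg_eigenvalues_def)
    then have tm: "t \<le> 3/2 * 5 ^ m" using assms by linarith
    obtain ls where ls: "dec_seq (2/3 * t / 5 ^ m) ls" using eigenvalue_dec_seq[OF u tm] .
    have "deig (m + 0) (ls 0) u"
      using u ls by (intro laplacian_deig) (auto simp: sg_dirichlet_eigenfunction_def)
    then have "ls 0 \<in> dspec m"
      using eigenfunction_nonzero_on_V[OF u ls] u
      by (auto simp: dspec_def sg_dirichlet_eigenfunction_def)
    then show ?thesis using ls by blast
  qed
  then obtain F where F: "\<And>t. t \<in> sg_eigenvalues \<Lambda> \<Longrightarrow> dec_seq (2/3 * t / 5 ^ m) (F t) \<and> F t 0 \<in> dspec m"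
    by metis
  have inj: "inj_on (\<lambda>t. F t 0) (sg_eigenvalues \<Lambda>)"
  proof (rule inj_onI)
    fix s t assume "s \<in> sg_eigenvalues \<Lambda>" "t \<in> sg_eigenvalues \<Lambda>" "F s 0 = F t 0"
    then have "2/3 * s / 5 ^ m = 2/3 * t / 5 ^ m" using F dec_seq_unique by metis
    then show "s = t" by simp
  qed
  have img: "(\<lambda>t. F t 0) ` sg_eigenvalues \<Lambda> \<subseteq> dspec m" using F by auto
  show "finite (sg_eigenvalues \<Lambda>)"
    using inj img dspec_card finite_imageD finite_subset by metis
  have "card (sg_eigenvalues \<Lambda>) \<le> card (dspec m)"
    using inj img dspec_card card_inj_on_le by metis
  also have "\<dots> \<le> 3 * (2 ^ m - 1)" using dspec_card by blast
  finally show "card (sg_eigenvalues \<Lambda>) \<le> 3 * 2 ^ m" by simp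
qed

section \<open>Localized eigenfunctions\<close>

definition transplant :: "nat list \<Rightarrow> (real \<times> real \<Rightarrow> real) \<Rightarrow> real \<times> real \<Rightarrow> real" where
  "transplant w v = (\<lambda>x. if x \<in> sg_cell w then v (inv_into UNIV (sg_word_map w) x) else 0)"

definition rstr :: "nat list \<Rightarrow> (real \<times> real \<Rightarrow> real) \<Rightarrow> real \<times> real \<Rightarrow> real" where
  "rstr w u = (\<lambda>x. if x \<in> SG then u (sg_word_map w x) else 0)"

text \<open>What makes copies of v in single cells, extended by zero, eigenfunctions: zero boundary
  values for continuity, zero normal derivatives for the equation at the corners of the cell, and
  the discrete equations inside. Level m + k inside an \<open>N\<close>-cell is level N + m + k of
  \<open>SG\<close>, hence the indexing of \<open>ls\<close>.\<close>

definition localizable :: "nat \<Rightarrow> (nat \<Rightarrow> real) \<Rightarrow> (real \<times> real \<Rightarrow> real) \<Rightarrow> bool" where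
  "localizable m ls v \<longleftrightarrow> v \<in> sg_C \<and> (\<forall>i\<in>sg_alph. v (sg_corner i) = 0) \<and>
     (\<forall>k. \<forall>i\<in>sg_alph. nd v (replicate (m + k) i) i = 0) \<and> (\<forall>k. deig (m + k) (ls k) v)"

lemma sum_fun_apply: "(\<Sum>a\<in>A. f a) x = (\<Sum>a\<in>A. (f a x :: real))"
  by (induction A rule: infinite_finite_induct) simp_all

lemma inv_sg_word_map: "inv_into UNIV (sg_word_map w) (sg_word_map w p) = p"
  by (rule inv_f_f) (simp add: inj_def)

lemma transplant_inside: "p \<in> SG \<Longrightarrow> transplant w v (sg_word_map w p) = v p"
  by (simp add: transplant_def sg_cell_def inv_sg_word_map)

lemma transplant_outside: "x \<notin> sg_cell w \<Longrightarrow> transplant w v x = 0"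
  by (simp add: transplant_def)

lemma transplant_add: "transplant w (u + v) = transplant w u + transplant w v"
  by (simp add: transplant_def fun_eq_iff)

lemma transplant_scale: "transplant w (fun_scale c u) = fun_scale c (transplant w u)"
  by (simp add: transplant_def fun_scale_def fun_eq_iff)

text \<open>If the first N letters of z name a cell other than w, the point can lie in w only at a
  corner of w, where v is zero. So the value depends on the address alone.\<close>

lemma transplant_val:
  assumes v: "\<And>i. i \<in> sg_alph \<Longrightarrow> v (sg_corner i) = 0" and w: "w \<in> sg_words N"
    and z: "set z \<subseteq> sg_alph" "N \<le> length z" and p: "p \<in> SG"
  shows "transplant w v (sg_word_map z p) = (if take N z = w then v (sg_word_map (drop N z) p) else 0)"
proof -
  define q where "q = sg_word_map (drop N z) p"
  have q: "q \<in> SG" unfolding q_def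
    using z set_drop_subset[of N z] by (intro sg_word_map_SG p) auto
  have zq: "sg_word_map z p = sg_word_map (take N z) q"
    unfolding q_def sg_word_map_append[symmetric] by simp
  have tz: "take N z \<in> sg_words N" using z set_take_subset[of N z] by (auto simp: sg_words_iff)
  show ?thesis
  proof (cases "take N z = w")
    case True
    then show ?thesis using transplant_inside[OF q, of w v] zq by (simp add: q_def)
  next
    case False
    have "transplant w v (sg_word_map z p) = 0"
    proof (cases "sg_word_map z p \<in> sg_cell w")
      case True
      then obtain r where r: "r \<in> SG" "sg_word_map z p = sg_word_map w r" by (auto simp: sg_cell_def)
      then have e: "sg_word_map w r = sg_word_map (take N z) q" using zq by simp
      have "r \<in> sg_tri" "q \<in> sg_tri" using r q SG_tri by auto
      then obtain b where "b \<in> sg_alph" "r = sg_corner b"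
        using sg_cells_meet[OF w tz False[symmetric] _ _ e] by blast
      then show ?thesis using transplant_inside[OF r(1), of w v] r(2) v by simp
    qed (simp add: transplant_outside)
    then show ?thesis using False by simp
  qed
qed

text \<open>Pasting over the finitely many closed \<open>N\<close>-cells: on w the function is v
  after a continuous inverse, on the other cells it is zero.\<close>

lemma transplant_sg_C:
  assumes v: "v \<in> sg_C" "\<And>i. i \<in> sg_alph \<Longrightarrow> v (sg_corner i) = 0" and w: "w \<in> sg_words N"
  shows "transplant w v \<in> sg_C"
proof -
  have "continuous_on (sg_cell w') (transplant w v)" if w': "w' \<in> sg_words N" for w'
  proof (cases "w' = w")
    case True
    have "continuous_on (sg_word_map w ` SG) (inv_into UNIV (sg_word_map w))"
      by (rule continuous_on_inv[OF sg_word_map_cont SG_compact]) (simp add: inv_sg_word_map)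
    then have "continuous_on (sg_word_map w ` SG) (\<lambda>x. v (inv_into UNIV (sg_word_map w) x))"
    proof (rule continuous_on_compose2[of SG v, rotated])
      show "continuous_on SG v" using v(1) by (simp add: sg_C_def)
      show "inv_into UNIV (sg_word_map w) ` sg_word_map w ` SG \<subseteq> SG"
        by (simp add: image_image inv_sg_word_map)
    qed
    then show ?thesis unfolding True sg_cell_def
    proof (rule continuous_on_eq)
      fix x assume "x \<in> sg_word_map w ` SG"
      then obtain p where "p \<in> SG" "x = sg_word_map w p" by blast
      then show "v (inv_into UNIV (sg_word_map w) x) = transplant w v x"
        by (simp add: transplant_inside inv_sg_word_map)
    qed
  next
    case False
    have "transplant w v x = 0" if x: "x \<in> sg_cell w'" for x
    proof -
      obtain p where p: "p \<in> SG" "x = sg_word_map w' p" using x unfolding sg_cell_def by blast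
      then show ?thesis using transplant_val[of v w N w' p] v w w' False by (auto simp: sg_words_iff)
    qed
    then show ?thesis by (intro continuous_on_eq[OF continuous_on_const[of _ 0]]) simp
  qed
  then have "continuous_on (\<Union>w'\<in>sg_words N. sg_cell w') (transplant w v)"
    by (intro continuous_on_closed_Union) (auto intro: compact_imp_closed sg_cell_compact)
  then have "continuous_on SG (transplant w v)" using SG_cells[of N] by (simp only:)
  moreover have "transplant w v x = 0" if "x \<notin> SG" for x
    using that sg_cell_subset[OF w] by (intro transplant_outside) auto
  ultimately show ?thesis by (auto simp: sg_C_def)
qed

lemma hres_transplant:
  assumes v: "\<And>i. i \<in> sg_alph \<Longrightarrow> v (sg_corner i) = 0" and w: "w \<in> sg_words N"
    and z: "set z \<subseteq> sg_alph" "N \<le> length z" and i: "i \<in> sg_alph"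
  shows "hres t (transplant w v) z i = (if take N z = w then hres t v (drop N z) i else 0)"
  using transplant_val[of v, OF v w z sg_corner_SG] i by (simp add: hres_def nd_def)

lemma hres_replicate_localizable:
  assumes "localizable m ls v" "i \<in> sg_alph"
  shows "hres t v (replicate (m + k) i) i = 0"
  using assms by (simp add: localizable_def hres_def sg_word_map_replicate)

lemma transplant_deig:
  assumes v: "localizable m ls v" and w: "w \<in> sg_words N"
  shows "deig (N + m + k) (ls k) (transplant w v)"
proof (rule deigI)
  fix s a b j assume j: "jn_ok s a b" "N + m + k = length s + Suc j"
  have v0: "\<And>i. i \<in> sg_alph \<Longrightarrow> v (sg_corner i) = 0" using v by (simp add: localizable_def)
  have ab: "a \<in> sg_alph" "b \<in> sg_alph" "set s \<subseteq> sg_alph" using j by (auto simp: jn_ok_def)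
  let ?x = "s @ a # replicate j b" and ?y = "s @ b # replicate j a"
  have x: "set ?x \<subseteq> sg_alph" "N \<le> length ?x" and y: "set ?y \<subseteq> sg_alph" "N \<le> length ?y"
    using ab j by auto
  note h = hres_transplant[of v, OF v0 w x ab(2), of "ls k"] hres_transplant[of v, OF v0 w y ab(1), of "ls k"]
  show "hres (ls k) (transplant w v) ?x b + hres (ls k) (transplant w v) ?y a = 0"
  proof (cases "N \<le> length s")
    \<comment> \<open>Both addresses of the junction share the first N letters, so the equation is
      one for v itself, or it is trivial.\<close>
    case True
    have "deig (m + k) (ls k) v" using v by (simp add: localizable_def)
    moreover have "jn_ok (drop N s) a b" using j set_drop_subset[of N s] by (auto simp: jn_ok_def)
    moreover have "m + k = length (drop N s) + Suc j" using j True by simp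
    ultimately have "hres (ls k) v (drop N s @ a # replicate j b) b + hres (ls k) v (drop N s @ b # replicate j a) a = 0"
      by (rule deigD)
    moreover have "hres (ls k) (transplant w v) ?x b =
        (if take N s = w then hres (ls k) v (drop N s @ a # replicate j b) b else 0)"
      using h(1) True by simp
    moreover have "hres (ls k) (transplant w v) ?y a =
        (if take N s = w then hres (ls k) v (drop N s @ b # replicate j a) a else 0)"
      using h(2) True by simp
    ultimately show ?thesis by (cases "take N s = w") simp_all
  next
    \<comment> \<open>The junction is a corner of two different \<open>N\<close>-cells. Behind the
      first N letters both addresses are constant words, where the half residual of v vanishes on
      either side.\<close>
    case False
    define d where "d = N - length s - 1"
    have n: "N = length s + Suc d" "j - d = m + k" using j(2) False by (auto simp: d_def)
    have "drop N ?x = replicate (m + k) b" "drop N ?y = replicate (m + k) a"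
      unfolding n(1) by (simp_all add: n(2))
    then have "hres (ls k) (transplant w v) ?x b = 0" "hres (ls k) (transplant w v) ?y a = 0"
      using h hres_replicate_localizable[OF v ab(1)] hres_replicate_localizable[OF v ab(2)] by simp_all
    then show ?thesis by simp
  qed
qed

text \<open>Converse of \<open>laplacian_deig\<close>: the residuals vanish exactly, so the only
  error is that of \<open>3/2 * 5 ^ m * (5 ^ k * ls k)\<close> against its limit, and u is
  bounded.\<close>

lemma deig_laplacian:
  assumes u: "u \<in> sg_C" and d: "\<And>k. deig (m + k) (ls k) u"
    and l: "(\<lambda>k. 5 ^ k * ls k) \<longlonglongrightarrow> 2/3 * \<Lambda> / 5 ^ m"
  shows "has_sg_laplacian u (\<lambda>x. - \<Lambda> * u x)"
  unfolding has_sg_laplacian_def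
proof (intro conjI allI impI)
  show "u \<in> sg_C" by fact
  show "(\<lambda>x. - \<Lambda> * u x) \<in> sg_C" using sg_C_scale[OF u, of "-\<Lambda>"] by (simp add: fun_scale_def)
  fix \<epsilon> :: real assume "\<epsilon> > 0"
  obtain B where B: "B > 0" "\<And>x. \<bar>u x\<bar> \<le> B" using sg_C_bounded[OF u] by blast
  have "(\<lambda>n. 3/2 * 5 ^ m * (5 ^ n * ls n)) \<longlonglongrightarrow> 3/2 * 5 ^ m * (2/3 * \<Lambda> / 5 ^ m)"
    using l by (rule tendsto_mult_left)
  then have "(\<lambda>n. 3/2 * 5 ^ m * (5 ^ n * ls n)) \<longlonglongrightarrow> \<Lambda>" by simp
  moreover have "\<epsilon> / (2 * B) > 0" using \<open>\<epsilon> > 0\<close> B by simp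
  ultimately obtain M where M: "\<And>n. n \<ge> M \<Longrightarrow> \<bar>3/2 * 5 ^ m * (5 ^ n * ls n) - \<Lambda>\<bar> < \<epsilon> / (2 * B)"
    unfolding LIMSEQ_iff real_norm_def by meson
  show "\<exists>N. \<forall>n\<ge>N. \<forall>x\<in>sg_V n - sg_V 0.
      \<bar>3/2 * (5 ^ n * sg_graph_laplacian n u x) - - \<Lambda> * u x\<bar> < \<epsilon>"
  proof (intro exI allI impI ballI)
    fix n x assume n: "m + M \<le> n" "x \<in> sg_V n - sg_V 0"
    define k where "k = n - m"
    have nk: "n = m + k" "M \<le> k" using n by (auto simp: k_def)
    have "sg_graph_laplacian n u x = - ls k * u x" using d[of k] n(2) nk(1) by (simp add: deig_def)
    then have "3/2 * (5 ^ n * sg_graph_laplacian n u x) - - \<Lambda> * u x = - (3/2 * 5 ^ m * (5 ^ k * ls k) - \<Lambda>) * u x"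
      by (simp add: nk(1) power_add algebra_simps)
    also have "\<bar>\<dots>\<bar> \<le> \<epsilon> / (2 * B) * B"
      unfolding abs_mult abs_minus_cancel using M[OF nk(2)] B by (intro mult_mono) (auto intro: less_imp_le)
    also have "\<dots> < \<epsilon>" using B \<open>\<epsilon> > 0\<close> by simp
    finally show "\<bar>3/2 * (5 ^ n * sg_graph_laplacian n u x) - - \<Lambda> * u x\<bar> < \<epsilon>" .
  qed
qed

section \<open>Eigenspaces and their span\<close>

definition sg_eig :: "real \<Rightarrow> (real \<times> real \<Rightarrow> real) set" where
  "sg_eig t = {u. has_sg_laplacian u (\<lambda>x. - t * u x) \<and> (\<forall>x\<in>sg_V 0. u x = 0)}"

lemma sg_eig_iff: "u \<in> sg_eig t \<longleftrightarrow> u = 0 \<or> sg_dirichlet_eigenfunction t u"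
proof -
  have "deig (0 + k) 0 0" for k by (simp add: deig_def sg_graph_laplacian_def)
  moreover have "has_sg_laplacian 0 (\<lambda>x. - t * 0 x)"
    unfolding has_sg_laplacian_def
    using sg_C_0 sg_C_scale[OF sg_C_0, of "-t"]
    by (simp add: sg_graph_laplacian_def fun_scale_def)
  ultimately show ?thesis by (auto simp: sg_eig_def sg_dirichlet_eigenfunction_def)
qed

lemma sg_eig_C: "u \<in> sg_eig t \<Longrightarrow> u \<in> sg_C"
  by (simp add: sg_eig_def has_sg_laplacian_def)

lemma sg_eig_subspace: "funs.subspace (sg_eig t)"
proof (rule funs.subspaceI)
  show "0 \<in> sg_eig t" by (simp add: sg_eig_iff)
next
  fix u v assume "u \<in> sg_eig t" "v \<in> sg_eig t"
  then show "u + v \<in> sg_eig t"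
    using has_sg_laplacian_add[of u "\<lambda>x. - t * u x" v "\<lambda>x. - t * v x"]
    by (simp add: sg_eig_def plus_fun_def algebra_simps)
next
  fix c u assume "u \<in> sg_eig t"
  then show "fun_scale c u \<in> sg_eig t"
    using has_sg_laplacian_scale[of u "\<lambda>x. - t * u x" c]
    by (simp add: sg_eig_def fun_scale_def algebra_simps)
qed

lemma sg_E_eq: "sg_E \<Lambda> = funs.span (\<Union>t\<in>sg_eigenvalues \<Lambda>. sg_eig t)"
proof -
  have "(\<Union>t\<in>sg_eigenvalues \<Lambda>. sg_eig t) - {0} = {u. \<exists>\<mu>\<le>\<Lambda>. sg_dirichlet_eigenfunction \<mu> u}"
    by (auto simp: sg_eig_iff sg_eigenvalues_def sg_dirichlet_eigenfunction_def)
  then show ?thesis unfolding sg_E_def using funs.span_delete_0 by metis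
qed

lemma sg_C_subspace: "funs.subspace sg_C"
  by (rule funs.subspaceI) (auto intro: sg_C_0 sg_C_add sg_C_scale)

lemma sg_E_subset_C: "sg_E \<Lambda> \<subseteq> sg_C"
  unfolding sg_E_eq by (intro funs.span_minimal sg_C_subspace) (auto intro: sg_eig_C)

lemma sg_E_subspace: "funs.subspace (sg_E \<Lambda>)"
  unfolding sg_E_def by simp

lemma transplant_eig:
  assumes v: "localizable m ls v" and w: "w \<in> sg_words N"
    and l: "(\<lambda>k. 5 ^ k * ls k) \<longlonglongrightarrow> 2/3 * t / 5 ^ (N + m)"
  shows "transplant w v \<in> sg_eig t"
proof -
  have v': "v \<in> sg_C" "\<And>i. i \<in> sg_alph \<Longrightarrow> v (sg_corner i) = 0" using v by (auto simp: localizable_def)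
  have "has_sg_laplacian (transplant w v) (\<lambda>x. - t * transplant w v x)"
    by (rule deig_laplacian[OF transplant_sg_C[OF v' w] transplant_deig[OF v w] l])
  moreover have "transplant w v (sg_corner i) = 0" if i: "i \<in> sg_alph" for i
  proof -
    have z: "set (replicate N i) \<subseteq> sg_alph" "N \<le> length (replicate N i)" using i by auto
    have "transplant w v (sg_word_map (replicate N i) (sg_corner i)) = 0"
    proof -
      have "drop N (replicate N i) = []" by simp
      then show ?thesis
        using transplant_val[of v, OF v'(2) w z sg_corner_SG[OF i]] v'(2)[OF i] by (simp only: sg_word_map.simps id_apply if_cancel)
    qed
    then show ?thesis by (simp add: sg_word_map_replicate)
  qed
  ultimately show ?thesis by (auto simp: sg_eig_def sg_V_0_eq)
qed

lemma hres_rstr: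
  assumes "set z \<subseteq> sg_alph" "i \<in> sg_alph"
  shows "hres t (rstr w u) z i = hres t u (w @ z) i"
proof -
  have "sg_word_map z (sg_corner j) \<in> SG" if "j \<in> sg_alph" for j
    by (rule sg_word_map_SG[OF assms(1) sg_corner_SG[OF that]])
  then have "rstr w u (sg_word_map z (sg_corner j)) = u (sg_word_map (w @ z) (sg_corner j))"
    if "j \<in> sg_alph" for j
    using that by (simp add: rstr_def sg_word_map_append)
  then show ?thesis using assms(2) unfolding hres_def nd_def by simp
qed

lemma rstr_sg_C:
  assumes "u \<in> sg_C" "w \<in> sg_words N"
  shows "rstr w u \<in> sg_C"
proof -
  have "continuous_on SG (\<lambda>x. u (sg_word_map w x))"
  proof (rule continuous_on_compose2[of SG u, OF _ sg_word_map_cont])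
    show "continuous_on SG u" using assms(1) by (simp add: sg_C_def)
    show "sg_word_map w ` SG \<subseteq> SG" using assms(2) by (auto simp only: sg_words_iff sg_word_map_SG)
  qed
  then have "continuous_on SG (rstr w u)" by (rule continuous_on_eq) (simp add: rstr_def)
  then show ?thesis by (simp add: sg_C_def rstr_def)
qed

text \<open>The normal derivative is assumed to vanish at level m only. As u is zero at the corner,
  \<open>nd\<close> and \<open>hres\<close> agree there, and \<open>hres_step_deig\<close> carries
  the vanishing to all finer levels, since parameters at most 1 are not exceptional.\<close>

lemma rstr_localizable:
  assumes u: "u \<in> sg_C" "\<And>k. deig (N + m + k) (ls k) u" and w: "w \<in> sg_words N"
    and u0: "\<And>i. i \<in> sg_alph \<Longrightarrow> u (sg_word_map w (sg_corner i)) = 0"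
    and n0: "\<And>i. i \<in> sg_alph \<Longrightarrow> nd u (w @ replicate m i) i = 0"
    and ls: "\<And>k. ls k = dec (ls (Suc k))" "\<And>k. ls k \<le> 1"
  shows "localizable m ls (rstr w u)"
proof -
  have "nd u (w @ replicate (m + k) i) i = 0" if i: "i \<in> sg_alph" for i k
  proof (induction k)
    case 0 then show ?case using n0 i by simp
  next
    case (Suc k)
    let ?z = "w @ replicate (m + k) i" and ?t = "ls (Suc k)"
    have v: "sg_word_map (w @ replicate n i) (sg_corner i) = sg_word_map w (sg_corner i)" for n
      by (simp add: sg_word_map_append sg_word_map_replicate)
    have "?z \<in> sg_words (N + m + k)" using w i by (auto simp: sg_words_iff)
    moreover have "deig (Suc (N + m + k)) ?t u" using u(2)[of "Suc k"] by simp
    ultimately have "(2 - ?t) * (5 - ?t) * hres ?t u (?z @ [i]) i = (6 - ?t) * hres (dec ?t) u ?z i"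
      using hres_step_deig i by blast
    also have "hres (dec ?t) u ?z i = 0"
      using Suc u0[OF i] v[of "m + k"] by (simp add: hres_def)
    finally have "hres ?t u (?z @ [i]) i = 0" using ls(2)[of "Suc k"] by simp
    moreover have "?z @ [i] = w @ replicate (m + Suc k) i" by (simp add: replicate_append_same)
    ultimately show ?case using u0[OF i] v[of "m + Suc k"] by (simp add: hres_def)
  qed
  then have "nd (rstr w u) (replicate (m + k) i) i = 0" if "i \<in> sg_alph" for i k
    using hres_rstr[of "replicate (m + k) i" i 0 w u] that by (simp add: hres_def set_replicate_conv_if)
  moreover have "deig (m + k) (ls k) (rstr w u)" for k
  proof (rule deigI)
    fix s a b j assume j: "jn_ok s a b" "m + k = length s + Suc j"
    have "jn_ok (w @ s) a b" using j w by (auto simp: jn_ok_def sg_words_iff)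
    moreover have "N + m + k = length (w @ s) + Suc j" using j w by (simp add: sg_words_iff)
    ultimately have "hres (ls k) u ((w @ s) @ a # replicate j b) b + hres (ls k) u ((w @ s) @ b # replicate j a) a = 0"
      using deigD[OF u(2)[of k]] by blast
    moreover have "set (s @ a # replicate j b) \<subseteq> sg_alph" "set (s @ b # replicate j a) \<subseteq> sg_alph"
      "a \<in> sg_alph" "b \<in> sg_alph" using j by (auto simp: jn_ok_def)
    ultimately show "hres (ls k) (rstr w u) (s @ a # replicate j b) b + hres (ls k) (rstr w u) (s @ b # replicate j a) a = 0"
      by (simp add: hres_rstr)
  qed
  ultimately show ?thesis
    unfolding localizable_def using rstr_sg_C[OF u(1) w] u0 sg_corner_SG by (simp add: rstr_def)
qed

text \<open>A point of \<open>SG\<close> off \<open>sg_V N\<close> lies in exactly one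
  \<open>N\<close>-cell; at points of \<open>sg_V N\<close> all terms are zero.\<close>

lemma sg_C_cell_decomp:
  assumes u: "u \<in> sg_C" and u0: "\<And>x. x \<in> sg_V N \<Longrightarrow> u x = 0"
  shows "u = (\<Sum>w\<in>sg_words N. transplant w (rstr w u))"
proof
  fix x
  have t: "transplant w (rstr w u) x = (if x \<in> sg_cell w then u x else 0)" for w
  proof (cases "x \<in> sg_cell w")
    case True
    then obtain p where "p \<in> SG" "x = sg_word_map w p" by (auto simp: sg_cell_def)
    then show ?thesis using True transplant_inside[of p w "rstr w u"] by (simp add: rstr_def)
  qed (simp add: transplant_outside)
  have "(\<Sum>w\<in>sg_words N. transplant w (rstr w u) x) = u x"
  proof (cases "x \<in> SG \<and> x \<notin> sg_V N")
    case True
    then obtain w0 where w0: "w0 \<in> sg_words N" "x \<in> sg_cell w0" using SG_cells[of N] by blast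
    have "x \<in> sg_cell w \<longleftrightarrow> w = w0" if "w \<in> sg_words N" for w
      using sg_cell_Int[OF that w0(1), of x] w0(2) True by blast
    then have "(\<Sum>w\<in>sg_words N. transplant w (rstr w u) x) = (\<Sum>w\<in>sg_words N. if w = w0 then u x else 0)"
      by (intro sum.cong) (simp_all add: t)
    then show ?thesis using w0 by simp
  next
    case False
    then have "u x = 0" using u0 sg_C_off[OF u] by blast
    moreover from this have "(\<Sum>w\<in>sg_words N. transplant w (rstr w u) x) = 0"
      by (intro sum.neutral) (simp add: t)
    ultimately show ?thesis by simp
  qed
  then show "u x = (\<Sum>w\<in>sg_words N. transplant w (rstr w u)) x" by (simp add: sum_fun_apply)
qed

subsection \<open>Dimension counts\<close>

definition funs_lin :: "(('a \<Rightarrow> real) \<Rightarrow> real) \<Rightarrow> bool" where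
  "funs_lin l \<longleftrightarrow> (\<forall>u v. l (u + v) = l u + l v) \<and> (\<forall>c u. l (fun_scale c u) = c * l u)"

text \<open>Finitely many linear functionals cut out a subspace of at most that codimension. The
  form with spanning sets allows S to be infinite-dimensional.\<close>

lemma funs_span_kernel:
  assumes "finite L" "\<And>l. l \<in> L \<Longrightarrow> funs_lin l" "funs.subspace S"
  shows "\<exists>B. finite B \<and> card B \<le> card L \<and> B \<subseteq> S \<and> S \<subseteq> funs.span ({u \<in> S. \<forall>l\<in>L. l u = 0} \<union> B)"
  using assms(1,2)
proof (induction L rule: finite_induct)
  case empty
  show ?case by (intro exI[of _ "{}"]) (auto intro: funs.span_base)
next
  case (insert l L)
  then obtain B where B: "finite B" "card B \<le> card L" "B \<subseteq> S"
    "S \<subseteq> funs.span ({u \<in> S. \<forall>l\<in>L. l u = 0} \<union> B)" by auto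
  let ?S0 = "{u \<in> S. \<forall>l\<in>L. l u = 0}" and ?S1 = "{u \<in> S. \<forall>l\<in>insert l L. l u = 0}"
  show ?case
  proof (cases "\<forall>u\<in>?S0. l u = 0")
    case True
    then have "?S1 = ?S0" by auto
    then show ?thesis using B insert.hyps by (intro exI[of _ B]) simp
  next
    case False
    then obtain b where b: "b \<in> ?S0" "l b \<noteq> 0" by blast
    have lin: "funs_lin k" if "k \<in> insert l L" for k using insert.prems that by blast
    have "?S0 \<subseteq> funs.span (?S1 \<union> insert b B)"
    proof
      fix u assume u: "u \<in> ?S0"
      \<comment> \<open>Subtracting this multiple of b puts u into the kernel of l without leaving
        the kernels of the earlier functionals.\<close>
      define c where "c = l u / l b"
      have "u + fun_scale (- c) b \<in> S"
        using u b by (intro funs.subspace_add[OF assms(3)] funs.subspace_scale[OF assms(3)]) auto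
      moreover have "k (u + fun_scale (- c) b) = 0" if "k \<in> insert l L" for k
      proof -
        have "k (u + fun_scale (- c) b) = k u + k (fun_scale (- c) b)" "k (fun_scale (- c) b) = - c * k b"
          using lin[OF that] unfolding funs_lin_def by blast+
        then have e: "k (u + fun_scale (- c) b) = k u - c * k b" by linarith
        show ?thesis
        proof (cases "k = l")
          case True then show ?thesis using e b(2) by (simp only: c_def) simp
        next
          case False
          then have "k u = 0" "k b = 0" using that u b by auto
          then show ?thesis using e by simp
        qed
      qed
      ultimately have "u + fun_scale (- c) b \<in> ?S1" by blast
      then have "u + fun_scale (- c) b + fun_scale c b \<in> funs.span (?S1 \<union> insert b B)"
        by (intro funs.span_add funs.span_scale funs.span_base) auto
      also have "u + fun_scale (- c) b + fun_scale c b = u" by (simp add: fun_eq_iff fun_scale_def)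
      finally show "u \<in> funs.span (?S1 \<union> insert b B)" .
    qed
    moreover have "B \<subseteq> funs.span (?S1 \<union> insert b B)" by (auto intro: funs.span_base)
    ultimately have "funs.span (?S0 \<union> B) \<subseteq> funs.span (?S1 \<union> insert b B)"
      by (intro funs.span_minimal) auto
    then have "S \<subseteq> funs.span (?S1 \<union> insert b B)" using B(4) by blast
    moreover have "card (insert b B) \<le> card (insert l L)"
      using B insert.hyps by (simp add: card_insert_if)
    ultimately show ?thesis using B b by (intro exI[of _ "insert b B"]) auto
  qed
qed

lemma funs_span_UN:
  assumes "finite T" "\<And>t. t \<in> T \<Longrightarrow> funs.subspace (S t)" "u \<in> funs.span (\<Union>t\<in>T. S t)"
  shows "\<exists>f. (\<forall>t\<in>T. f t \<in> S t) \<and> u = (\<Sum>t\<in>T. f t)"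
proof -
  let ?R = "{u. \<exists>f. (\<forall>t\<in>T. f t \<in> S t) \<and> u = (\<Sum>t\<in>T. f t)}"
  have "funs.subspace ?R"
  proof (rule funs.subspaceI)
    show "0 \<in> ?R" using assms(2) by (auto intro!: exI[of _ "\<lambda>_. 0"] funs.subspace_0)
  next
    fix x y assume "x \<in> ?R" "y \<in> ?R"
    then obtain f g where "\<forall>t\<in>T. f t \<in> S t" "x = (\<Sum>t\<in>T. f t)" "\<forall>t\<in>T. g t \<in> S t" "y = (\<Sum>t\<in>T. g t)"
      by blast
    then show "x + y \<in> ?R" using assms(2)
      by (auto intro!: exI[of _ "\<lambda>t. f t + g t"] funs.subspace_add simp: sum.distrib)
  next
    fix c x assume "x \<in> ?R"
    then obtain f where "\<forall>t\<in>T. f t \<in> S t" "x = (\<Sum>t\<in>T. f t)" by blast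
    then show "fun_scale c x \<in> ?R" using assms(2)
      by (auto intro!: exI[of _ "\<lambda>t. fun_scale c (f t)"] funs.subspace_scale simp: funs.scale_sum_right)
  qed
  moreover have "(\<Union>t\<in>T. S t) \<subseteq> ?R"
  proof
    fix x assume "x \<in> (\<Union>t\<in>T. S t)"
    then obtain t where t: "t \<in> T" "x \<in> S t" by blast
    have "x = (\<Sum>s\<in>T. if s = t then x else 0)" using assms(1) t by simp
    moreover have "(if s = t then x else 0) \<in> S s" if "s \<in> T" for s
      using t assms(2) that by (auto intro: funs.subspace_0)
    ultimately show "x \<in> ?R"
      by (intro CollectI exI[of _ "\<lambda>s. if s = t then x else 0"] conjI ballI)
  qed
  ultimately have "funs.span (\<Union>t\<in>T. S t) \<subseteq> ?R" by (rule funs.span_minimal[rotated])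
  then have "u \<in> ?R" using assms(3) by (rule subsetD)
  then show ?thesis by (rule CollectD)
qed

text \<open>The usual argument for distinct eigenvalues, on \<open>sg_V M\<close> only:
  \<open>\<tau> r\<close> times the relation plus its graph Laplacian is a relation between the
  multiples \<open>(\<tau> r - \<tau> t) * u t\<close>, without the term r. At boundary vertices
  there is no equation, but all functions vanish.\<close>

lemma deig_independent:
  assumes "finite S" "inj_on \<tau> S" "\<And>t. t \<in> S \<Longrightarrow> deig M (\<tau> t) (u t)"
    "\<And>t x. t \<in> S \<Longrightarrow> x \<in> sg_V 0 \<Longrightarrow> u t x = 0" "\<And>x. x \<in> sg_V M \<Longrightarrow> (\<Sum>t\<in>S. u t x) = 0"
    "t \<in> S" "x \<in> sg_V M"
  shows "u t x = 0"
  using assms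
proof (induction S arbitrary: u t x rule: finite_induct)
  case (insert r S)
  have lap: "(\<Sum>t\<in>insert r S. - \<tau> t * u t y) = 0" if y: "y \<in> sg_V M - sg_V 0" for y
  proof -
    have "(\<Sum>t\<in>insert r S. - \<tau> t * u t y) = (\<Sum>t\<in>insert r S. sg_graph_laplacian M (u t) y)"
      using insert.prems(2) y by (intro sum.cong) (auto simp: deig_def)
    also have "\<dots> = (\<Sum>z | sg_adj M y z. \<Sum>t\<in>insert r S. u t z) - 4 * (\<Sum>t\<in>insert r S. u t y)"
      unfolding sg_graph_laplacian_def sum_subtractf sum_distrib_left by (subst sum.swap) (rule refl)
    also have "(\<Sum>z | sg_adj M y z. \<Sum>t\<in>insert r S. u t z) = 0"
      using insert.prems(4) by (intro sum.neutral) (auto simp: sg_adj_def)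
    also have "(\<Sum>t\<in>insert r S. u t y) = 0" using insert.prems(4) y by blast
    finally show ?thesis by simp
  qed
  define v where "v t = fun_scale (\<tau> r - \<tau> t) (u t)" for t
  have z: "v t y = 0" if "t \<in> S" "y \<in> sg_V M" for t y
  proof (rule insert.IH[of v])
    show "inj_on \<tau> S" using insert.prems(1) by simp
    show "deig M (\<tau> t) (v t)" if "t \<in> S" for t
      using insert.prems(2)[of t] that by (simp add: deig_def v_def sg_graph_laplacian_scale) (simp add: fun_scale_def)
    show "v t x = 0" if "t \<in> S" "x \<in> sg_V 0" for t x
      using insert.prems(3)[of t x] that by (simp add: v_def fun_scale_def)
    show "(\<Sum>t\<in>S. v t x) = 0" if x: "x \<in> sg_V M" for x
    proof (cases "x \<in> sg_V 0")
      case True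
      then show ?thesis using insert.prems(3) by (intro sum.neutral) (simp add: v_def fun_scale_def)
    next
      case False
      have "0 = \<tau> r * (\<Sum>t\<in>insert r S. u t x) + (\<Sum>t\<in>insert r S. - \<tau> t * u t x)"
        using lap[of x] insert.prems(4)[OF x] x False by simp
      also have "\<dots> = (\<Sum>t\<in>insert r S. v t x)"
        by (simp add: sum_distrib_left v_def fun_scale_def flip: sum.distrib) (simp add: algebra_simps)
      also have "\<dots> = (\<Sum>t\<in>S. v t x)" using insert.hyps by (simp add: v_def fun_scale_def)
      finally show ?thesis by simp
    qed
  qed (use that in auto)
  have *: "u t y = 0" if "t \<in> S" "y \<in> sg_V M" for t y
  proof -
    have "\<tau> r \<noteq> \<tau> t" using insert.prems(1) insert.hyps that by (auto simp: inj_on_def)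
    then show ?thesis using z[OF that] by (simp add: v_def fun_scale_def)
  qed
  have "u r y = 0" if "y \<in> sg_V M" for y
    using insert.prems(4)[OF that] insert.hyps * that by simp
  then show ?case using * insert.prems by blast
qed simp

lemma eigenvalue_dec_seq_choice:
  assumes "\<Lambda> \<le> 3/2 * 5 ^ M"
  obtains F where "\<And>t. t \<in> sg_eigenvalues \<Lambda> \<Longrightarrow> dec_seq (2/3 * t / 5 ^ M) (F t)"
proof -
  have "\<exists>ls. dec_seq (2/3 * t / 5 ^ M) ls" if t: "t \<in> sg_eigenvalues \<Lambda>" for t
  proof -
    obtain u where u: "sg_dirichlet_eigenfunction t u" and "t \<le> \<Lambda>"
      using t by (auto simp: sg_eigenvalues_def)
    then have tm: "t \<le> 3/2 * 5 ^ M" using assms by linarith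
    show ?thesis using eigenvalue_dec_seq[OF u tm] by blast
  qed
  then show thesis using that by metis
qed

lemma sg_eig_deig:
  assumes "u \<in> sg_eig t" "dec_seq (2/3 * t / 5 ^ M) ls"
  shows "deig (M + k) (ls k) u"
  using assms by (intro laplacian_deig) (auto simp: sg_eig_def)

text \<open>Restriction to \<open>sg_V M\<close> is injective on \<open>sg_E \<Lambda>\<close>: the
  eigencomponents of u restrict to discrete eigenfunctions with different parameters, so if u
  vanishes there, each component does.\<close>

lemma sg_E_dim_le:
  assumes L: "\<Lambda> \<le> 3/2 * 5 ^ M"
  shows "\<exists>B. finite B \<and> card B \<le> 3 * 3 ^ M \<and> sg_E \<Lambda> \<subseteq> funs.span B"
proof -
  obtain F where F: "\<And>t. t \<in> sg_eigenvalues \<Lambda> \<Longrightarrow> dec_seq (2/3 * t / 5 ^ M) (F t)"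
    using eigenvalue_dec_seq_choice[OF L] by blast
  have zero: "u = 0" if u: "u \<in> sg_E \<Lambda>" "\<And>x. x \<in> sg_V M \<Longrightarrow> u x = 0" for u
  proof -
    have "\<exists>f. (\<forall>t\<in>sg_eigenvalues \<Lambda>. f t \<in> sg_eig t) \<and> u = (\<Sum>t\<in>sg_eigenvalues \<Lambda>. f t)"
      using u(1) unfolding sg_E_eq
      by (intro funs_span_UN sg_eig_subspace card_sg_eigenvalues(1)[OF L])
    then obtain f where f: "\<And>t. t \<in> sg_eigenvalues \<Lambda> \<Longrightarrow> f t \<in> sg_eig t" "u = (\<Sum>t\<in>sg_eigenvalues \<Lambda>. f t)"
      by blast
    have inj: "inj_on (\<lambda>t. F t 0) (sg_eigenvalues \<Lambda>)"
    proof (rule inj_onI)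
      fix s t assume "s \<in> sg_eigenvalues \<Lambda>" "t \<in> sg_eigenvalues \<Lambda>" "F s 0 = F t 0"
      then have "2/3 * s / 5 ^ M = 2/3 * t / 5 ^ M" using F dec_seq_unique by metis
      then show "s = t" by simp
    qed
    have "f t x = 0" if "t \<in> sg_eigenvalues \<Lambda>" "x \<in> sg_V M" for t x
    proof (rule deig_independent[OF card_sg_eigenvalues(1)[OF L] inj, where M = M and u = f])
      show "deig M (F t 0) (f t)" if "t \<in> sg_eigenvalues \<Lambda>" for t
        using sg_eig_deig[OF f(1)[OF that] F[OF that], of 0] by simp
      show "f t x = 0" if "t \<in> sg_eigenvalues \<Lambda>" "x \<in> sg_V 0" for t x
        using f(1)[OF that(1)] that(2) by (simp add: sg_eig_def)
      show "(\<Sum>t\<in>sg_eigenvalues \<Lambda>. f t x) = 0" if "x \<in> sg_V M" for x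
        using u(2)[OF that] f(2) by (simp add: sum_fun_apply)
    qed (use that in auto)
    then have "f t = 0" if "t \<in> sg_eigenvalues \<Lambda>" for t
      using f(1)[OF that] eigenfunction_nonzero_on_V[OF _ F[OF that], of "f t"] that
      unfolding sg_eig_iff by blast
    then show "u = 0" using f(2) by simp
  qed
  let ?L = "(\<lambda>x (u :: real \<times> real \<Rightarrow> real). u x) ` sg_V M"
  have "\<exists>B. finite B \<and> card B \<le> card ?L \<and> B \<subseteq> sg_E \<Lambda> \<and> sg_E \<Lambda> \<subseteq> funs.span ({u \<in> sg_E \<Lambda>. \<forall>l\<in>?L. l u = 0} \<union> B)"
    by (rule funs_span_kernel) (auto simp: funs_lin_def fun_scale_def sg_E_subspace)
  then obtain B where B: "finite B" "card B \<le> card ?L"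
    "sg_E \<Lambda> \<subseteq> funs.span ({u \<in> sg_E \<Lambda>. \<forall>l\<in>?L. l u = 0} \<union> B)" by blast
  have "{u \<in> sg_E \<Lambda>. \<forall>l\<in>?L. l u = 0} \<union> B \<subseteq> insert 0 B" using zero by auto
  then have "sg_E \<Lambda> \<subseteq> funs.span B" using B(3) funs.span_mono funs.span_insert_0 by blast
  moreover have "card B \<le> 3 * 3 ^ M"
    using B(2) card_image_le[OF finite_sg_V, of "\<lambda>x (u :: real \<times> real \<Rightarrow> real). u x" M] card_sg_V[of M]
    by linarith
  ultimately show ?thesis using B(1) by blast
qed

text \<open>One space of functions on \<open>SG\<close> serves every \<open>N\<close>-cell, so that
  all cells carry equally many localized functions; the comparison with the integral in
  \<open>log_det_estimate\<close> rests on this.\<close>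

definition profiles :: "real \<Rightarrow> nat \<Rightarrow> nat \<Rightarrow> (real \<times> real \<Rightarrow> real) set" where
  "profiles \<Lambda> N m = funs.span {v. \<exists>t\<in>sg_eigenvalues \<Lambda>. \<exists>ls. dec_seq (2/3 * t / 5 ^ (N + m)) ls \<and> localizable m ls v}"

lemma profiles_subset_C: "profiles \<Lambda> N m \<subseteq> sg_C"
  unfolding profiles_def by (intro funs.span_minimal sg_C_subspace) (auto simp: localizable_def)

lemma transplant_span:
  assumes "\<And>v. v \<in> S \<Longrightarrow> transplant w v \<in> T" "funs.subspace T" "v \<in> funs.span S"
  shows "transplant w v \<in> T"
proof -
  have "funs.subspace {v. transplant w v \<in> T}"
  proof (rule funs.subspaceI)
    have "transplant w 0 = 0" by (simp add: transplant_def fun_eq_iff)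
    then show "0 \<in> {v. transplant w v \<in> T}" using assms(2) by (simp add: funs.subspace_0)
  qed (use assms(2) in \<open>auto simp: transplant_add transplant_scale intro: funs.subspace_add funs.subspace_scale\<close>)
  then show ?thesis using funs.span_minimal[of S "{v. transplant w v \<in> T}"] assms by blast
qed

lemma transplant_profiles:
  assumes "w \<in> sg_words N" "v \<in> profiles \<Lambda> N m"
  shows "transplant w v \<in> sg_E \<Lambda>"
proof (rule transplant_span[OF _ sg_E_subspace assms(2)[unfolded profiles_def]])
  fix v assume "v \<in> {v. \<exists>t\<in>sg_eigenvalues \<Lambda>. \<exists>ls. dec_seq (2/3 * t / 5 ^ (N + m)) ls \<and> localizable m ls v}"
  then obtain t ls where "t \<in> sg_eigenvalues \<Lambda>" "dec_seq (2/3 * t / 5 ^ (N + m)) ls" "localizable m ls v"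
    by blast
  note t = this
  have "(\<lambda>k. 5 ^ k * ls k) \<longlonglongrightarrow> 2/3 * t / 5 ^ (N + m)" using t(2) unfolding dec_seq_def by blast
  then have "transplant w v \<in> sg_eig t" by (rule transplant_eig[OF t(3) assms(1)])
  then show "transplant w v \<in> sg_E \<Lambda>"
    unfolding sg_E_eq using t(1) by (intro funs.span_base) blast
qed

text \<open>Values and normal derivatives at the three corners of \<open>3 ^ N\<close> cells are
  \<open>6 * 3 ^ N\<close> functionals, and an eigenfunction in their common kernel is a sum of
  transplants. There are at most \<open>3 * 2 ^ (N + m)\<close> eigenspaces, whence the constant
  18.\<close>

lemma sg_E_localize:
  assumes L: "\<Lambda> \<le> 3/2 * 5 ^ (N + m)"
  shows "\<exists>B. finite B \<and> card B \<le> 18 * 2 ^ (N + m) * 3 ^ N \<and> B \<subseteq> sg_E \<Lambda> \<and>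
    sg_E \<Lambda> \<subseteq> funs.span ((\<Union>w\<in>sg_words N. transplant w ` profiles \<Lambda> N m) \<union> B)"
proof -
  let ?W = "\<Union>w\<in>sg_words N. transplant w ` profiles \<Lambda> N m"
  let ?L = "(\<lambda>(w, i) u. u (sg_word_map w (sg_corner i))) ` (sg_words N \<times> sg_alph)
    \<union> (\<lambda>(w, i) u. nd u (w @ replicate m i) i) ` (sg_words N \<times> sg_alph)"
  have lin: "funs_lin l" if "l \<in> ?L" for l
    using that by (auto simp: funs_lin_def fun_scale_def nd_def sum_sg_alph algebra_simps)
  have cL: "card ?L \<le> 6 * 3 ^ N"
  proof -
    have "card ?L \<le> card (sg_words N \<times> sg_alph) + card (sg_words N \<times> sg_alph)"
      by (intro order_trans[OF card_Un_le] add_mono card_image_le) auto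
    then show ?thesis by (simp add: card_cartesian_product card_sg_words)
  qed
  have "\<exists>B. finite B \<and> card B \<le> 6 * 3 ^ N \<and> B \<subseteq> sg_eig t \<and> sg_eig t \<subseteq> funs.span (?W \<union> B)"
    if t: "t \<in> sg_eigenvalues \<Lambda>" for t
  proof -
    obtain F where F: "\<And>t. t \<in> sg_eigenvalues \<Lambda> \<Longrightarrow> dec_seq (2/3 * t / 5 ^ (N + m)) (F t)"
      using eigenvalue_dec_seq_choice[OF L] by blast
    define ls where "ls = F t"
    have ls: "dec_seq (2/3 * t / 5 ^ (N + m)) ls" using F t by (simp add: ls_def)
    have "\<exists>B. finite B \<and> card B \<le> card ?L \<and> B \<subseteq> sg_eig t \<and> sg_eig t \<subseteq> funs.span ({u \<in> sg_eig t. \<forall>l\<in>?L. l u = 0} \<union> B)"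
      by (rule funs_span_kernel[OF _ lin sg_eig_subspace]) auto
    then obtain B where B: "finite B" "card B \<le> card ?L" "B \<subseteq> sg_eig t"
      "sg_eig t \<subseteq> funs.span ({u \<in> sg_eig t. \<forall>l\<in>?L. l u = 0} \<union> B)" by blast
    have "u \<in> funs.span (?W \<union> B)" if u: "u \<in> sg_eig t" "\<forall>l\<in>?L. l u = 0" for u
    proof -
      have u0: "u (sg_word_map w (sg_corner i)) = 0" "nd u (w @ replicate m i) i = 0"
        if "w \<in> sg_words N" "i \<in> sg_alph" for w i
        using u(2) that by (force, force)
      have loc: "localizable m ls (rstr w u)" if w: "w \<in> sg_words N" for w
      proof (rule rstr_localizable[OF sg_eig_C[OF u(1)] sg_eig_deig[OF u(1) ls] w])
        show "ls k = dec (ls (Suc k))" "ls k \<le> 1" for k using ls unfolding dec_seq_def by blast+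
      qed (use u0 w in auto)
      have "u = (\<Sum>w\<in>sg_words N. transplant w (rstr w u))"
        using u0 by (intro sg_C_cell_decomp sg_eig_C[OF u(1)]) (auto simp: sg_V_eq)
      also have "\<dots> \<in> funs.span (?W \<union> B)"
      proof (intro funs.span_sum funs.span_base UnI1)
        fix w assume w: "w \<in> sg_words N"
        have "rstr w u \<in> profiles \<Lambda> N m"
          unfolding profiles_def using t ls loc[OF w] by (intro funs.span_base) blast
        then show "transplant w (rstr w u) \<in> ?W" using w by blast
      qed
      finally show ?thesis .
    qed
    then have "{u \<in> sg_eig t. \<forall>l\<in>?L. l u = 0} \<union> B \<subseteq> funs.span (?W \<union> B)"
      by (auto intro: funs.span_base)
    then have "funs.span ({u \<in> sg_eig t. \<forall>l\<in>?L. l u = 0} \<union> B) \<subseteq> funs.span (?W \<union> B)"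
      by (intro funs.span_minimal) auto
    then show ?thesis using B cL by (intro exI[of _ B]) auto
  qed
  then obtain B where B: "\<And>t. t \<in> sg_eigenvalues \<Lambda> \<Longrightarrow> finite (B t) \<and> card (B t) \<le> 6 * 3 ^ N \<and>
      B t \<subseteq> sg_eig t \<and> sg_eig t \<subseteq> funs.span (?W \<union> B t)" by metis
  let ?B = "\<Union>t\<in>sg_eigenvalues \<Lambda>. B t"
  note fe = card_sg_eigenvalues[OF L]
  have "card ?B \<le> (\<Sum>t\<in>sg_eigenvalues \<Lambda>. card (B t))" using fe by (intro card_UN_le) auto
  also have "\<dots> \<le> (\<Sum>t\<in>sg_eigenvalues \<Lambda>. 6 * 3 ^ N)" using B by (intro sum_mono) auto
  also have "\<dots> = card (sg_eigenvalues \<Lambda>) * (6 * 3 ^ N)" by simp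
  also have "\<dots> \<le> (3 * 2 ^ (N + m)) * (6 * 3 ^ N)" using fe(2) by (rule mult_right_mono) simp
  finally have "card ?B \<le> 18 * 2 ^ (N + m) * 3 ^ N" by simp
  moreover have "finite ?B" using fe B by auto
  moreover have "?B \<subseteq> sg_E \<Lambda>"
  proof -
    have "?B \<subseteq> (\<Union>t\<in>sg_eigenvalues \<Lambda>. sg_eig t)" using B by blast
    then show ?thesis unfolding sg_E_eq using funs.span_superset by blast
  qed
  moreover have "sg_E \<Lambda> \<subseteq> funs.span (?W \<union> ?B)"
    unfolding sg_E_eq
  proof (intro funs.span_minimal funs.subspace_span UN_least)
    fix t assume t: "t \<in> sg_eigenvalues \<Lambda>"
    have "funs.span (?W \<union> B t) \<subseteq> funs.span (?W \<union> ?B)" using t by (intro funs.span_mono) blast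
    then show "sg_eig t \<subseteq> funs.span (?W \<union> ?B)" using B[OF t] by blast
  qed
  ultimately show ?thesis by blast
qed

section \<open>Existence of a localized eigenfunction\<close>

text \<open>Telescoping along z: corner a of the child a is corner a of its parent, so each letter
  costs one oscillation, and the costs form a geometric series.\<close>

lemma word_value_chain:
  fixes V :: "nat list \<Rightarrow> nat \<Rightarrow> real"
  assumes corner: "\<And>w a. set w \<subseteq> sg_alph \<Longrightarrow> a \<in> sg_alph \<Longrightarrow> V (w @ [a]) a = V w a"
    and osc: "\<And>w i j. set w \<subseteq> sg_alph \<Longrightarrow> i \<in> sg_alph \<Longrightarrow> j \<in> sg_alph \<Longrightarrow> \<bar>V w i - V w j\<bar> \<le> C * \<rho> ^ length w"
    and r: "0 < \<rho>" "\<rho> < 1"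
    and w: "set w \<subseteq> sg_alph" and z: "set z \<subseteq> sg_alph" and ij: "i \<in> sg_alph" "j \<in> sg_alph"
  shows "\<bar>V (w @ z) i - V w j\<bar> \<le> C / (1 - \<rho>) * \<rho> ^ length w"
proof -
  have C: "0 \<le> C" using osc[of "[]" i i] ij by simp
  \<comment> \<open>The exact partial sum of the series is kept, since the final bound would not
    survive the induction.\<close>
  have "\<bar>V (w @ z) i - V w j\<bar> \<le> C * (\<rho> ^ length w - \<rho> ^ Suc (length w + length z)) / (1 - \<rho>)"
    using z ij(1)
  proof (induction z arbitrary: i rule: rev_induct)
    case Nil
    have "C * (\<rho> ^ length w - \<rho> ^ Suc (length w)) = C * \<rho> ^ length w * (1 - \<rho>)"
      by (simp add: algebra_simps)
    moreover have "x * (1 - \<rho>) / (1 - \<rho>) = x" for x using r by simp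
    ultimately have "C * (\<rho> ^ length w - \<rho> ^ Suc (length w)) / (1 - \<rho>) = C * \<rho> ^ length w" by (simp only:)
    then show ?case using osc[OF w, of i j] Nil ij by simp
  next
    case (snoc a z)
    have wz: "set (w @ z) \<subseteq> sg_alph" "a \<in> sg_alph" using w snoc.prems by auto
    have "\<bar>V ((w @ z) @ [a]) i - V ((w @ z) @ [a]) a\<bar> \<le> C * \<rho> ^ length ((w @ z) @ [a])"
      using wz snoc.prems by (intro osc) auto
    moreover have "V ((w @ z) @ [a]) a = V (w @ z) a" by (rule corner[OF wz])
    moreover have "\<bar>V (w @ z) a - V w j\<bar> \<le> C * (\<rho> ^ length w - \<rho> ^ Suc (length w + length z)) / (1 - \<rho>)"
      using snoc.IH[of a] snoc.prems wz by simp
    moreover have "C * \<rho> ^ Suc (length w + length z) + C * (\<rho> ^ length w - \<rho> ^ Suc (length w + length z)) / (1 - \<rho>)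
        = C * (\<rho> ^ length w - \<rho> ^ Suc (Suc (length w + length z))) / (1 - \<rho>)"
      using r by (simp add: field_simps)
    ultimately show ?case by simp
  qed
  also have "\<dots> \<le> C * \<rho> ^ length w / (1 - \<rho>)"
    using r C by (intro divide_right_mono mult_left_mono) auto
  finally show ?thesis by simp
qed

text \<open>Both words are padded to the same length without moving their corners; they are then
  equal or the two addresses of one junction, where \<open>sym\<close> applies.\<close>

lemma word_value_well_defined:
  fixes V :: "nat list \<Rightarrow> nat \<Rightarrow> real"
  assumes corner: "\<And>w a. set w \<subseteq> sg_alph \<Longrightarrow> a \<in> sg_alph \<Longrightarrow> V (w @ [a]) a = V w a"
    and sym: "\<And>w a b. set w \<subseteq> sg_alph \<Longrightarrow> a \<in> sg_alph \<Longrightarrow> b \<in> sg_alph \<Longrightarrow> a \<noteq> b \<Longrightarrow> V (w @ [a]) b = V (w @ [b]) a"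
    and w: "set w \<subseteq> sg_alph" "i \<in> sg_alph" and w': "set w' \<subseteq> sg_alph" "i' \<in> sg_alph"
    and eq: "sg_word_map w (sg_corner i) = sg_word_map w' (sg_corner i')"
  shows "V w i = V w' i'"
proof -
  have rep: "V (w @ replicate k i) i = V w i" if "set w \<subseteq> sg_alph" "i \<in> sg_alph" for w i k
  proof (induction k)
    case (Suc k)
    have "set (w @ replicate k i) \<subseteq> sg_alph" using that by auto
    from corner[OF this that(2)] Suc show ?case by (simp add: replicate_append_same)
  qed simp
  define z where "z = w @ replicate (length w') i"
  define z' where "z' = w' @ replicate (length w) i'"
  have z: "z \<in> sg_words (length w + length w')" "z' \<in> sg_words (length w + length w')"
    using w w' by (auto simp: z_def z'_def sg_words_iff)
  have e: "sg_word_map z (sg_corner i) = sg_word_map z' (sg_corner i')"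
    using eq by (simp add: z_def z'_def sg_word_map_append sg_word_map_replicate)
  have "V z i = V z' i'"
  proof (cases "z = z'")
    case True
    then have "i = i'" using e w w' by simp
    then show ?thesis using True by simp
  next
    case False
    obtain s a b k where d: "set s \<subseteq> sg_alph" "a \<in> sg_alph" "b \<in> sg_alph" "a \<noteq> b"
      "z = s @ a # replicate k b" "z' = s @ b # replicate k a" "sg_corner i = sg_corner b" "sg_corner i' = sg_corner a"
      using sg_cells_meet[OF z False sg_corner_tri[OF w(2)] sg_corner_tri[OF w'(2)] e] by blast
    have i: "i = b" "i' = a" using d(2,3,7,8) w(2) w'(2) by simp_all
    have "V z i = V (s @ [a]) b" using rep[of "s @ [a]" b k] d(1-3) unfolding d(5) i by simp
    moreover have "V z' i' = V (s @ [b]) a" using rep[of "s @ [b]" a k] d(1-3) unfolding d(6) i by simp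
    ultimately show ?thesis using sym[OF d(1-4)] by simp
  qed
  then show ?thesis using rep[OF w] rep[OF w'] by (simp add: z_def z'_def)
qed

lemma sg_cells_separated:
  "\<exists>\<delta>>0. \<forall>w\<in>sg_words n. \<forall>w'\<in>sg_words n. \<forall>x\<in>sg_cell w. \<forall>y\<in>sg_cell w'.
     dist x y < \<delta> \<longrightarrow> sg_cell w \<inter> sg_cell w' \<noteq> {}"
proof -
  have "\<exists>\<delta>>0. \<forall>x\<in>sg_cell w. \<forall>y\<in>sg_cell w'. dist x y < \<delta> \<longrightarrow> sg_cell w \<inter> sg_cell w' \<noteq> {}" for w w'
  proof (cases "sg_cell w \<inter> sg_cell w' = {}")
    case True
    obtain d where "d > 0" "\<forall>x\<in>sg_cell w. \<forall>y\<in>sg_cell w'. d \<le> dist x y"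
      using separate_compact_closed[OF sg_cell_compact compact_imp_closed[OF sg_cell_compact] True] by blast
    then show ?thesis by (intro exI[of _ d]) force
  next
    case False then show ?thesis by (intro exI[of _ 1]) simp
  qed
  then obtain d where d: "\<And>w w'. d w w' > 0" "\<And>w w'. \<forall>x\<in>sg_cell w. \<forall>y\<in>sg_cell w'. dist x y < d w w' \<longrightarrow> sg_cell w \<inter> sg_cell w' \<noteq> {}"
    by metis
  let ?D = "(\<lambda>(w, w'). d w w') ` (sg_words n \<times> sg_words n)"
  define e where "e = Min (insert 1 ?D)"
  have "e > 0" unfolding e_def using d(1) by (subst Min_gr_iff) auto
  moreover have "e \<le> d w w'" if "w \<in> sg_words n" "w' \<in> sg_words n" for w w'
    unfolding e_def using that by (intro Min_le) auto
  ultimately show ?thesis using d(2) by (intro exI[of _ e]) (meson less_le_trans)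
qed

text \<open>The prescribed values are uniformly continuous on the set of all vertices: close
  vertices lie in equal or touching cells of level n, on which V varies little. The function is the
  continuous extension to the closure.\<close>

lemma sg_glue:
  fixes V :: "nat list \<Rightarrow> nat \<Rightarrow> real"
  assumes corner: "\<And>w a. set w \<subseteq> sg_alph \<Longrightarrow> a \<in> sg_alph \<Longrightarrow> V (w @ [a]) a = V w a"
    and sym: "\<And>w a b. set w \<subseteq> sg_alph \<Longrightarrow> a \<in> sg_alph \<Longrightarrow> b \<in> sg_alph \<Longrightarrow> a \<noteq> b \<Longrightarrow> V (w @ [a]) b = V (w @ [b]) a"
    and osc: "\<And>w i j. set w \<subseteq> sg_alph \<Longrightarrow> i \<in> sg_alph \<Longrightarrow> j \<in> sg_alph \<Longrightarrow> \<bar>V w i - V w j\<bar> \<le> C * \<rho> ^ length w"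
    and r: "0 < \<rho>" "\<rho> < 1"
  obtains u where "u \<in> sg_C" "\<And>w i. set w \<subseteq> sg_alph \<Longrightarrow> i \<in> sg_alph \<Longrightarrow> u (sg_word_map w (sg_corner i)) = V w i"
proof -
  define U where "U x = (SOME y. \<exists>w i. set w \<subseteq> sg_alph \<and> i \<in> sg_alph \<and> x = sg_word_map w (sg_corner i) \<and> y = V w i)" for x
  have U: "U (sg_word_map w (sg_corner i)) = V w i" if "set w \<subseteq> sg_alph" "i \<in> sg_alph" for w i
    unfolding U_def
  proof (rule some_equality)
    show "\<exists>w' i'. set w' \<subseteq> sg_alph \<and> i' \<in> sg_alph \<and> sg_word_map w (sg_corner i) = sg_word_map w' (sg_corner i') \<and> V w i = V w' i'"
      using that by blast
  next
    fix y assume "\<exists>w' i'. set w' \<subseteq> sg_alph \<and> i' \<in> sg_alph \<and> sg_word_map w (sg_corner i) = sg_word_map w' (sg_corner i') \<and> y = V w' i'"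
    then obtain w' i' where "set w' \<subseteq> sg_alph" "i' \<in> sg_alph"
      "sg_word_map w (sg_corner i) = sg_word_map w' (sg_corner i')" "y = V w' i'" by blast
    then show "y = V w i" using word_value_well_defined[of V, OF corner sym that] by simp
  qed
  let ?X = "\<Union>m. sg_V m"
  have C: "0 \<le> C" using osc[of "[]" 1 1] by simp
  define K where "K = C / (1 - \<rho>)"
  have K: "0 \<le> K" using C r by (simp add: K_def)
  have near: "\<bar>U x - V w j\<bar> \<le> K * \<rho> ^ n"
    if x: "x \<in> ?X" "x \<in> sg_cell w" and w: "w \<in> sg_words n" and j: "j \<in> sg_alph" for x w j n
  proof -
    obtain m where "x \<in> sg_V m" using x(1) by blast
    then have "x \<in> sg_V (n + m)" using sg_V_mono[of m "n + m"] by auto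
    obtain p where p: "p \<in> SG" "x = sg_word_map w p" using x(2) unfolding sg_cell_def by blast
    obtain z q where z: "z \<in> sg_words m" "q \<in> SG" "p = sg_word_map z q" using SG_cellE[OF p(1), of m] by blast
    have wz: "w @ z \<in> sg_words (n + m)" using w z by (auto simp: sg_words_iff)
    have xc: "x \<in> sg_cell (w @ z)"
      unfolding sg_cell_def p(2) z(3) sg_word_map_append[symmetric] using z(2) by blast
    obtain i where i: "i \<in> sg_alph" "x = sg_word_map (w @ z) (sg_corner i)"
      using sg_V_cell[OF \<open>x \<in> sg_V (n + m)\<close> wz xc] by blast
    have "U x = V (w @ z) i" using U[of "w @ z" i] wz i by (simp add: sg_words_iff)
    moreover have "\<bar>V (w @ z) i - V w j\<bar> \<le> C / (1 - \<rho>) * \<rho> ^ length w"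
      by (rule word_value_chain[of V, OF corner osc r]) (use w z i j in \<open>auto simp: sg_words_iff\<close>)
    ultimately show ?thesis using w by (simp add: K_def sg_words_iff)
  qed
  have "uniformly_continuous_on ?X U"
    unfolding uniformly_continuous_on_def
  proof (intro allI impI)
    fix e :: real assume e: "e > 0"
    \<comment> \<open>The passage from x to y through a common corner costs
      \<open>2 * (K * \<rho> ^ n)\<close>; the summand 1 covers the case K = 0.\<close>
    have "e / (4 * K + 1) > 0" using e K by simp
    then obtain n where n: "\<rho> ^ n < e / (4 * K + 1)" using real_arch_pow_inv[of _ \<rho>] r by blast
    have "\<rho> ^ n * (4 * K + 1) < e" using n K by (simp add: pos_less_divide_eq)
    moreover have "\<rho> ^ n * (4 * K + 1) = 4 * (K * \<rho> ^ n) + \<rho> ^ n" by (simp add: algebra_simps)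
    moreover have "0 < \<rho> ^ n" using r by simp
    ultimately have n': "4 * (K * \<rho> ^ n) < e" by linarith
    obtain \<delta> where d: "\<delta> > 0" "\<And>w w' x y. w \<in> sg_words n \<Longrightarrow> w' \<in> sg_words n \<Longrightarrow> x \<in> sg_cell w \<Longrightarrow> y \<in> sg_cell w' \<Longrightarrow>
        dist x y < \<delta> \<Longrightarrow> sg_cell w \<inter> sg_cell w' \<noteq> {}" using sg_cells_separated[of n] by blast
    show "\<exists>d>0. \<forall>x\<in>?X. \<forall>x'\<in>?X. dist x' x < d \<longrightarrow> dist (U x') (U x) < e"
    proof (intro exI[of _ \<delta>] conjI ballI impI d(1))
      fix x y assume x: "x \<in> ?X" and y: "y \<in> ?X" and xy: "dist y x < \<delta>"
      have "x \<in> SG" "y \<in> SG" using x y sg_V_SG by blast+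
      then obtain w w' where w: "w \<in> sg_words n" "x \<in> sg_cell w" and w': "w' \<in> sg_words n" "y \<in> sg_cell w'"
        using SG_cells[of n] by blast
      have xV: "\<bar>U x - V w j\<bar> \<le> K * \<rho> ^ n" if "j \<in> sg_alph" for j using near[OF x w(2,1) that] .
      have yV: "\<bar>U y - V w' j\<bar> \<le> K * \<rho> ^ n" if "j \<in> sg_alph" for j using near[OF y w'(2,1) that] .
      have "\<exists>j\<in>sg_alph. \<exists>j'\<in>sg_alph. V w j = V w' j'"
      proof (cases "w = w'")
        case True then show ?thesis using sg_alph_mem(1) by blast
      next
        case False
        obtain p where p: "p \<in> sg_cell w" "p \<in> sg_cell w'" using d(2)[OF w'(1) w(1) w'(2) w(2) xy] by blast
        have pV: "p \<in> sg_V n" by (rule sg_cell_Int[OF w(1) w'(1) False p])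
        obtain j where j: "j \<in> sg_alph" "p = sg_word_map w (sg_corner j)" using sg_V_cell[OF pV w(1) p(1)] by blast
        obtain j' where j': "j' \<in> sg_alph" "p = sg_word_map w' (sg_corner j')" using sg_V_cell[OF pV w'(1) p(2)] by blast
        have "V w j = U p" "V w' j' = U p"
          using U[OF _ j(1), of w] U[OF _ j'(1), of w'] w w' j j' by (simp_all add: sg_words_iff)
        then have "V w j = V w' j'" by simp
        then show ?thesis using j(1) j'(1) by blast
      qed
      then obtain j j' where "j \<in> sg_alph" "j' \<in> sg_alph" "V w j = V w' j'" by blast
      then have "\<bar>U y - U x\<bar> \<le> 2 * (K * \<rho> ^ n)" using xV[of j] yV[of j'] by linarith
      also have "\<dots> < e" using n' mult_nonneg_nonneg[OF K, of "\<rho> ^ n"] r by (simp add: less_imp_le)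
      finally show "dist (U y) (U x) < e" by (simp add: dist_real_def)
    qed
  qed
  then obtain g where g: "uniformly_continuous_on (closure ?X) g" "\<And>x. x \<in> ?X \<Longrightarrow> U x = g x"
    by (rule uniformly_continuous_on_extension_on_closure) blast
  define u where "u x = (if x \<in> SG then g x else 0)" for x
  have "continuous_on SG g" using uniformly_continuous_imp_continuous[OF g(1)] by (simp only: SG_eq_closure)
  then have "continuous_on SG u" by (rule continuous_on_eq) (simp add: u_def)
  then have "u \<in> sg_C" by (simp add: sg_C_def u_def)
  moreover have "u (sg_word_map w (sg_corner i)) = V w i" if "set w \<subseteq> sg_alph" "i \<in> sg_alph" for w i
  proof -
    have "sg_word_map w (sg_corner i) \<in> sg_V (length w)" using that by (intro sg_V_I) auto
    then have "sg_word_map w (sg_corner i) \<in> ?X" "sg_word_map w (sg_corner i) \<in> SG" using sg_V_SG by blast+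
    then show ?thesis using g(2) U[OF that] by (simp add: u_def)
  qed
  ultimately show thesis by (rule that)
qed

subsection \<open>The decimation sequence starting at 6\<close>

text \<open>The smaller of the two preimages under \<open>dec\<close>.\<close>

definition dec_inv :: "real \<Rightarrow> real" where "dec_inv t = (5 - sqrt (25 - 4 * t)) / 2"

text \<open>The start 6 makes the factor \<open>6 - t\<close> of \<open>hres_step\<close> vanish.
  Its preimages under \<open>dec\<close> are 2 and 3, and 2 is exceptional, so the larger one is
  taken once; afterwards the smaller branch keeps \<open>5 ^ k * six_seq k\<close>
  convergent.\<close>

fun six_seq :: "nat \<Rightarrow> real" where
  "six_seq 0 = 6"
| "six_seq (Suc 0) = 3"
| "six_seq (Suc (Suc k)) = dec_inv (six_seq (Suc k))"

lemma dec_dec_inv: "t \<le> 25/4 \<Longrightarrow> dec (dec_inv t) = t"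
  by (simp add: dec_def dec_inv_def field_simps)

lemma dec_inv_bounds:
  assumes "0 \<le> t" "t \<le> 3"
  shows "0 \<le> dec_inv t" "dec_inv t \<le> 1" "dec_inv t \<le> t / 4"
proof -
  have "sqrt (25 - 4 * t) \<le> 5" using assms by (intro real_le_lsqrt) auto
  moreover have "3 \<le> sqrt (25 - 4 * t)" using assms by (intro real_le_rsqrt) auto
  ultimately show b: "0 \<le> dec_inv t" "dec_inv t \<le> 1" by (simp_all add: dec_inv_def)
  have "dec_inv t * 4 \<le> dec_inv t * (5 - dec_inv t)" using b by (intro mult_left_mono) auto
  then show "dec_inv t \<le> t / 4" using dec_dec_inv[of t] assms by (simp add: dec_def)
qed

lemma six_seq_bounds: "0 \<le> six_seq (Suc k) \<and> six_seq (Suc k) \<le> 3 / 4 ^ k"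
proof (induction k)
  case (Suc k)
  have "(3::real) / 4 ^ k \<le> 3" by (simp add: field_simps)
  then have "0 \<le> six_seq (Suc k)" "six_seq (Suc k) \<le> 3" using Suc by linarith+
  from dec_inv_bounds[OF this] Suc show ?case by simp
qed simp

lemma six_seq_dec: "six_seq k = dec (six_seq (Suc k))"
proof (cases k)
  case (Suc j)
  have "(3::real) / 4 ^ j \<le> 3" by (simp add: field_simps)
  then show ?thesis using six_seq_bounds[of j] Suc by (simp add: dec_dec_inv)
qed (simp add: dec_def)

lemma six_seq_pos: "0 \<le> six_seq k"
  using six_seq_bounds[of "k - 1"] by (cases k) auto

lemma six_seq_le: "six_seq (Suc (Suc k)) \<le> 1"
proof -
  have "(1::real) \<le> 4 ^ k" by simp
  then have "(3::real) \<le> 4 ^ Suc k" unfolding power_Suc by linarith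
  then have "(3::real) / 4 ^ Suc k \<le> 1" by simp
  then show ?thesis using six_seq_bounds[of "Suc k"] by linarith
qed

lemma six_seq_not_forbidden: "(2 - six_seq k) * (5 - six_seq k) \<noteq> 0"
proof -
  consider "k = 0" | "k = 1" | j where "k = Suc (Suc j)" by (metis One_nat_def not0_implies_Suc)
  then show ?thesis
  proof cases
    case (3 j)
    have "six_seq k \<le> 1" unfolding 3 by (rule six_seq_le)
    then have "2 - six_seq k \<noteq> 0" "5 - six_seq k \<noteq> 0" by linarith+
    then show ?thesis by simp
  qed simp_all
qed

text \<open>With \<open>G t = t + t\<^sup>2 / 11\<close>, the sequence \<open>5 ^ k * G (six_seq k)\<close> decreases, which bounds
  the increasing sequence \<open>5 ^ k * six_seq k\<close>.\<close>

lemma six_seq_convergent: "convergent (\<lambda>k. 5 ^ k * six_seq k)"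
proof -
  define G where "G t = t + t\<^sup>2 / 11" for t :: real
  \<comment> \<open>The divisor 11 satisfies 1 + 5/11 = 16/11, so the claim reduces to
    \<open>16 \<le> (5 - t)\<^sup>2\<close>.\<close>
  have step: "5 * G t \<le> G (dec t)" if "0 \<le> t" "t \<le> 1" for t
  proof -
    have "(4::real)\<^sup>2 \<le> (5 - t)\<^sup>2" using that by (intro power_mono) auto
    then have "t\<^sup>2 * 16 \<le> t\<^sup>2 * (5 - t)\<^sup>2" by (intro mult_left_mono) auto
    then show ?thesis by (simp add: G_def dec_def power_mult_distrib algebra_simps power2_eq_square)
  qed
  have bound: "5 ^ k * G (six_seq (Suc k)) \<le> G 3" for k
  proof (induction k)
    case (Suc k)
    have "5 * G (six_seq (Suc (Suc k))) \<le> G (six_seq (Suc k))"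
      using step[of "six_seq (Suc (Suc k))"] six_seq_dec[of "Suc k"] six_seq_pos six_seq_le[of k] by metis
    then have "5 ^ k * (5 * G (six_seq (Suc (Suc k)))) \<le> 5 ^ k * G (six_seq (Suc k))" by simp
    moreover have "5 ^ Suc k * G (six_seq (Suc (Suc k))) = 5 ^ k * (5 * G (six_seq (Suc (Suc k))))"
      by (simp only: power_Suc mult_ac)
    ultimately show ?case using Suc by linarith
  qed simp
  have "5 ^ k * six_seq k \<le> 5 * G 3 + 6" for k
  proof (cases k)
    case 0 then show ?thesis by (simp add: G_def)
  next
    case (Suc j)
    have "6 + 5 ^ j * six_seq (Suc j) \<le> 6 + 5 ^ j * G (six_seq (Suc j))" by (simp add: G_def)
    also have "\<dots> \<le> 6 + G 3" using bound by simp
    finally show ?thesis using Suc bound[of 0] by simp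
  qed
  moreover have "incseq (\<lambda>k. 5 ^ k * six_seq k)"
  proof (rule incseq_SucI)
    fix k
    have "six_seq k \<le> 5 * six_seq (Suc k)"
      by (subst six_seq_dec) (simp add: dec_def algebra_simps)
    then show "5 ^ k * six_seq k \<le> 5 ^ Suc k * six_seq (Suc k)" by simp
  qed
  ultimately obtain L where "(\<lambda>k. 5 ^ k * six_seq k) \<longlonglongrightarrow> L"
    using incseq_convergent[of "\<lambda>k. 5 ^ k * six_seq k" "5 * G 3 + 6"] by blast
  then show ?thesis by (rule convergentI)
qed

text \<open>The midpoint value that \<open>mid_value\<close> forces when all midpoint residuals
  vanish. The third corner enters as the total minus the other two.\<close>

definition mid_val :: "real \<Rightarrow> (nat \<Rightarrow> real) \<Rightarrow> nat \<Rightarrow> nat \<Rightarrow> real" where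
  "mid_val t f a j = ((4 - t) * (f a + f j) + 2 * ((\<Sum>k\<in>sg_alph. f k) - f a - f j)) / ((2 - t) * (5 - t))"

text \<open>Values at the corners of cells; the words are read from right to left.\<close>

fun loc_val :: "nat list \<Rightarrow> nat \<Rightarrow> real" where
  "loc_val [] j = 0"
| "loc_val [a] j = (if a = 1 \<and> j = 2 \<or> a = 2 \<and> j = 1 then 2 else 0)"
| "loc_val (a # b # w) j =
     (if a = j then loc_val (b # w) j else mid_val (six_seq (length w)) (loc_val (b # w)) a j)"

definition loc_word :: "nat list \<Rightarrow> nat \<Rightarrow> real" where
  "loc_word w = loc_val (rev w)"

lemma mid_val_sym: "mid_val t f a b = mid_val t f b a"
  by (simp add: mid_val_def algebra_simps)

lemma loc_word_corner: "loc_word (w @ [a]) a = loc_word w a"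
  by (cases "rev w") (auto simp: loc_word_def)

lemma loc_word_sym: "a \<noteq> b \<Longrightarrow> loc_word (w @ [a]) b = loc_word (w @ [b]) a"
  by (cases "rev w") (auto simp: loc_word_def mid_val_sym)

lemma loc_word_mid:
  assumes "length w = Suc n" "a \<noteq> b"
  shows "loc_word (w @ [a]) b = mid_val (six_seq n) (loc_word w) a b"
proof -
  obtain c z where "rev w = c # z" "length z = n"
    using assms(1) by (metis length_rev length_Suc_conv)
  then show ?thesis using assms by (simp add: loc_word_def)
qed

text \<open>For t = 0 this is harmonic extension, which contracts oscillations by 3/5. For small t
  the factor stays below 7/10, at the price of an error of t times the supremum.\<close>

lemma mid_val_bound:
  assumes t: "0 \<le> t" "t \<le> 1/4" and abc: "sg_alph = {a, b, c}" "a \<noteq> b" "a \<noteq> c" "b \<noteq> c"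
    and S: "\<And>j. j \<in> sg_alph \<Longrightarrow> \<bar>f j\<bar> \<le> S" and Q: "\<And>i j. i \<in> sg_alph \<Longrightarrow> j \<in> sg_alph \<Longrightarrow> \<bar>f i - f j\<bar> \<le> Q"
  shows "\<bar>mid_val t f a b\<bar> \<le> 2 * S" "\<bar>f a - mid_val t f a b\<bar> \<le> 7/10 * Q + t * S"
    "\<bar>mid_val t f a b - mid_val t f a c\<bar> \<le> 7/10 * Q + t * S"
proof -
  define D where "D = (2 - t) * (5 - t)"
  have mem: "a \<in> sg_alph" "b \<in> sg_alph" "c \<in> sg_alph" unfolding abc(1) by simp_all
  have S0: "0 \<le> S" and Q0: "0 \<le> Q" using S[OF mem(1)] Q[OF mem(1) mem(1)] by auto
  have D: "D > 0" unfolding D_def using t by (intro mult_pos_pos) auto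
  then have Dq: "x / D * D = x" for x by simp
  have "t * t \<le> 1/4 * t" using t by (intro mult_right_mono) auto
  then have Dt: "10 - 7 * t \<le> D" unfolding D_def by (simp add: algebra_simps)
  have Da: "f a * D = 10 * f a - 7 * (t * f a) + t * (t * f a)" unfolding D_def by (simp add: algebra_simps)
  have sum: "(\<Sum>k\<in>sg_alph. f k) = f a + f b + f c" by (rule sum_sg_alph'[OF abc])
  have m: "mid_val t f a b * D = (4 - t) * (f a + f b) + 2 * f c"
    "mid_val t f a c * D = (4 - t) * (f a + f c) + 2 * f b"
    unfolding mid_val_def sum D_def[symmetric] Dq by simp_all
  have fabc: "\<bar>f a\<bar> \<le> S" "\<bar>f b\<bar> \<le> S" "\<bar>f c\<bar> \<le> S" using S mem by auto
  have q: "\<bar>f a - f b\<bar> \<le> Q" "\<bar>f a - f c\<bar> \<le> Q" "\<bar>f b - f c\<bar> \<le> Q" using Q mem by auto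
  have div: "\<bar>x\<bar> \<le> y" if "\<bar>x * D\<bar> \<le> y * D" for x y
    using that D by (simp add: abs_mult)
  have "\<bar>(4 - t) * (f a + f b)\<bar> \<le> 4 * (2 * S)"
    unfolding abs_mult using t fabc S0 by (intro mult_mono) auto
  then have "\<bar>mid_val t f a b * D\<bar> \<le> 10 * S" unfolding m(1) using fabc(3) by linarith
  moreover have "2 * S * 5 \<le> 2 * S * D" using Dt t S0 by (intro mult_left_mono) auto
  ultimately have "\<bar>mid_val t f a b * D\<bar> \<le> 2 * S * D" by linarith
  then show "\<bar>mid_val t f a b\<bar> \<le> 2 * S" by (rule div)
  have "(f a - mid_val t f a b) * D = (4 - t) * (f a - f b) + 2 * (f a - f c) - t * (5 - t) * f a"
    unfolding left_diff_distrib m(1) Da by (simp add: algebra_simps)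
  moreover have "\<bar>(4 - t) * (f a - f b)\<bar> \<le> (4 - t) * Q"
    unfolding abs_mult using t q Q0 by (intro mult_mono) auto
  moreover have "\<bar>t * (5 - t) * f a\<bar> \<le> t * D * S"
  proof -
    have "(5 - t) * 1 \<le> (5 - t) * (2 - t)" using t by (intro mult_left_mono) auto
    then have "t * (5 - t) \<le> t * D" unfolding D_def using t by (intro mult_left_mono) (simp_all add: mult.commute)
    moreover have "0 \<le> t * (5 - t)" using t by simp
    ultimately show ?thesis unfolding abs_mult[of _ "f a"] using fabc S0 by (intro mult_mono) auto
  qed
  moreover have "\<bar>x + 2 * y - z\<bar> \<le> p + 2 * r + s" if "\<bar>x\<bar> \<le> p" "\<bar>z\<bar> \<le> s" "\<bar>y\<bar> \<le> r" for x y z p r s :: real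
    using that by linarith
  ultimately have "\<bar>(f a - mid_val t f a b) * D\<bar> \<le> (4 - t) * Q + 2 * Q + t * D * S"
    using q(2) by presburger
  moreover have "(4 - t) * Q + 2 * Q \<le> 7/10 * D * Q"
  proof -
    \<comment> \<open>\<open>6 - t \<le> 7/10 * (10 - 7 * t)\<close> amounts to
      \<open>39 * t \<le> 10\<close>, which explains the bound 1/4 on t.\<close>
    have "6 - t \<le> 7/10 * D" using Dt t by simp
    from mult_right_mono[OF this Q0] show ?thesis by (simp add: left_diff_distrib)
  qed
  moreover have e: "(7/10 * Q + t * S) * D = 7/10 * D * Q + t * D * S"
    by (simp add: algebra_simps)
  ultimately have "\<bar>(f a - mid_val t f a b) * D\<bar> \<le> (7/10 * Q + t * S) * D" unfolding e by linarith
  then show "\<bar>f a - mid_val t f a b\<bar> \<le> 7/10 * Q + t * S" by (rule div)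
  have "(mid_val t f a b - mid_val t f a c) * D = (2 - t) * (f b - f c)"
    unfolding left_diff_distrib m by (simp add: algebra_simps)
  moreover have "\<bar>(2 - t) * (f b - f c)\<bar> \<le> 2 * Q"
    unfolding abs_mult using t q Q0 by (intro mult_mono) auto
  moreover have "2 * Q \<le> 7/10 * D * Q" using Dt t Q0 by (intro mult_right_mono) auto
  moreover have "0 \<le> t * D * S" using t S0 D by simp
  ultimately have "\<bar>(mid_val t f a b - mid_val t f a c) * D\<bar> \<le> (7/10 * Q + t * S) * D"
    unfolding e by linarith
  then show "\<bar>mid_val t f a b - mid_val t f a c\<bar> \<le> 7/10 * Q + t * S" by (rule div)
qed

text \<open>The supremum may double at every level, but the parameter decays like the powers of 1/4,
  so their product decays like those of 1/2. Together with the contraction 7/10 this leaves the rate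
  4/5. The constant 1000 absorbs the first levels and keeps the product term below a tenth of the
  oscillation bound.\<close>

lemma loc_word_decay:
  obtains C where "\<And>w i j. set w \<subseteq> sg_alph \<Longrightarrow> i \<in> sg_alph \<Longrightarrow> j \<in> sg_alph \<Longrightarrow>
    \<bar>loc_word w i - loc_word w j\<bar> \<le> C * (4/5) ^ length w"
proof -
  let ?F = "(\<lambda>(w, j). \<bar>loc_word w j\<bar>) ` ({w. set w \<subseteq> sg_alph \<and> length w \<le> 4} \<times> sg_alph)"
  have fin: "finite ?F" by (intro finite_imageI finite_cartesian_product finite_lists_length_le) auto
  define S where "S = Max (insert 0 ?F)"
  have S0: "0 \<le> S" unfolding S_def using fin by (intro Max_ge) auto
  have S4: "\<bar>loc_word w j\<bar> \<le> S" if "set w \<subseteq> sg_alph" "length w \<le> 4" "j \<in> sg_alph" for w j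
    unfolding S_def using fin that by (intro Max_ge) force+
  have main: "set w \<subseteq> sg_alph \<longrightarrow> (\<forall>i\<in>sg_alph. \<forall>j\<in>sg_alph. \<bar>loc_word w i\<bar> \<le> S * 2 ^ length w \<and>
      \<bar>loc_word w i - loc_word w j\<bar> \<le> 1000 * S * (4/5) ^ length w)" for w
  proof (induction w rule: rev_induct)
    case Nil
    then show ?case using S4[of "[]"] S0 by (auto simp: loc_word_def)
  next
    case (snoc a w)
    show ?case
    proof (intro impI, cases "length w \<le> 3")
      \<comment> \<open>For short words the parameter need not be below 1/4; the finitely many
        values are bounded by S.\<close>
      case True
      assume s: "set (w @ [a]) \<subseteq> sg_alph"
      have b: "\<bar>loc_word (w @ [a]) i\<bar> \<le> S" if "i \<in> sg_alph" for i using S4[OF s _ that] True by simp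
      have "((4::real)/5) ^ 4 \<le> (4/5) ^ length (w @ [a])" using True by (intro power_decreasing) auto
      then have "1000 * S * (4/5) ^ 4 \<le> 1000 * S * (4/5) ^ length (w @ [a])" using S0 by (intro mult_left_mono) auto
      moreover have "2 * S \<le> 1000 * S * (4/5) ^ 4" using S0 by (simp add: power4_eq_xxxx)
      moreover have "S * 1 \<le> S * 2 ^ length (w @ [a])" by (rule mult_left_mono[OF one_le_power S0]) simp
      ultimately show "\<forall>i\<in>sg_alph. \<forall>j\<in>sg_alph. \<bar>loc_word (w @ [a]) i\<bar> \<le> S * 2 ^ length (w @ [a]) \<and>
          \<bar>loc_word (w @ [a]) i - loc_word (w @ [a]) j\<bar> \<le> 1000 * S * (4/5) ^ length (w @ [a])"
        using b by (smt (verit))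
    next
      case False
      assume s: "set (w @ [a]) \<subseteq> sg_alph"
      then have w: "set w \<subseteq> sg_alph" and a: "a \<in> sg_alph" by auto
      define n where "n = length w - 4"
      have n: "length w = Suc (Suc (Suc (Suc n)))" using False by (simp add: n_def)
      define t where "t = six_seq (Suc (Suc (Suc n)))"
      define B where "B = S * 2 ^ length w"
      define Q where "Q = 1000 * S * (4/5) ^ length w"
      have tb: "0 \<le> t" "t \<le> 3 / 4 ^ (Suc (Suc n))" using six_seq_bounds[of "Suc (Suc n)"] by (auto simp: t_def)
      have "(1::real) \<le> 4 ^ n" by simp
      then have "(3::real) / 4 ^ (Suc (Suc n)) \<le> 1/4" unfolding power_Suc by (simp add: field_simps del: one_le_power)
      then have t4: "t \<le> 1/4" using tb by linarith
      have IH: "\<And>j. j \<in> sg_alph \<Longrightarrow> \<bar>loc_word w j\<bar> \<le> B"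
        "\<And>i j. i \<in> sg_alph \<Longrightarrow> j \<in> sg_alph \<Longrightarrow> \<bar>loc_word w i - loc_word w j\<bar> \<le> Q"
        using snoc w by (auto simp: B_def Q_def)
      have B0: "0 \<le> B" and Q0: "0 \<le> Q" using S0 by (auto simp: B_def Q_def)
      have tB: "7/10 * Q + t * B \<le> 1000 * S * (4/5) ^ length (w @ [a])"
      proof -
        have "t * B \<le> 3 / 4 ^ (Suc (Suc n)) * B" using tb B0 by (intro mult_right_mono) auto
        also have "\<dots> = 48 * S * (1/2) ^ length w"
        proof -
          have "(4::real) ^ n = 2 ^ n * 2 ^ n" by (simp flip: power_mult_distrib)
          then show ?thesis by (simp add: B_def n field_simps)
        qed
        also have "\<dots> \<le> 48 * S * (4/5) ^ length w" using S0 by (intro mult_left_mono power_mono) auto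
        also have "\<dots> \<le> 1/10 * Q" using S0 by (simp add: Q_def)
        finally show ?thesis by (simp add: Q_def)
      qed
      have mid: "loc_word (w @ [a]) b = mid_val t (loc_word w) a b" if "b \<noteq> a" for b
        using loc_word_mid[of w "Suc (Suc (Suc n))" a b] n that by (auto simp: t_def)
      have step: "\<bar>loc_word (w @ [a]) b\<bar> \<le> 2 * B" "\<bar>loc_word (w @ [a]) a - loc_word (w @ [a]) b\<bar> \<le> 7/10 * Q + t * B"
        "\<bar>loc_word (w @ [a]) b - loc_word (w @ [a]) c\<bar> \<le> 7/10 * Q + t * B"
        if abc: "sg_alph = {a, b, c}" "a \<noteq> b" "a \<noteq> c" "b \<noteq> c" for b c
        using mid_val_bound[of t a b c "loc_word w" B Q, OF tb(1) t4 abc IH] mid[of b] mid[of c] abc(2-4) loc_word_corner[of w a] by auto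
      show "\<forall>i\<in>sg_alph. \<forall>j\<in>sg_alph. \<bar>loc_word (w @ [a]) i\<bar> \<le> S * 2 ^ length (w @ [a]) \<and>
          \<bar>loc_word (w @ [a]) i - loc_word (w @ [a]) j\<bar> \<le> 1000 * S * (4/5) ^ length (w @ [a])"
      proof (intro ballI conjI)
        fix i j assume i: "i \<in> sg_alph" and j: "j \<in> sg_alph"
        have B2: "2 * B = S * 2 ^ length (w @ [a])" by (simp add: B_def)
        show "\<bar>loc_word (w @ [a]) i\<bar> \<le> S * 2 ^ length (w @ [a])"
        proof (cases "i = a")
          case True then show ?thesis using IH(1)[OF a] loc_word_corner[of w a] B0 B2 by simp
        next
          case False
          obtain c where c: "c \<in> sg_alph" "c \<noteq> a" "c \<noteq> i" "sg_alph = {a, i, c}"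
            using sg_alph_third[OF a i False[symmetric]] .
          show ?thesis
            using step(1)[OF c(4) False[symmetric] c(2)[symmetric] c(3)[symmetric]] B2 by linarith
        qed
        have "\<bar>loc_word (w @ [a]) i - loc_word (w @ [a]) j\<bar> \<le> 7/10 * Q + t * B"
        proof (cases "i = j")
          case True then show ?thesis using Q0 B0 tb by simp
        next
          case ij: False
          show ?thesis
          proof (cases "i = a \<or> j = a")
            case True
            define b where "b = (if i = a then j else i)"
            have b: "b \<in> sg_alph" "a \<noteq> b" using True ij i j by (auto simp: b_def)
            obtain c where c: "c \<in> sg_alph" "c \<noteq> a" "c \<noteq> b" "sg_alph = {a, b, c}" using sg_alph_third[OF a b] .
            have "\<bar>loc_word (w @ [a]) a - loc_word (w @ [a]) b\<bar> \<le> 7/10 * Q + t * B"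
              by (rule step(2)[OF c(4) b(2) c(2)[symmetric] c(3)[symmetric]])
            then show ?thesis using True ij by (auto simp: b_def abs_minus_commute split: if_splits)
          next
            case False
            obtain c where c: "c \<in> sg_alph" "c \<noteq> i" "c \<noteq> j" "sg_alph = {i, j, c}" using sg_alph_third[OF i j ij] .
            have "a \<in> {i, j, c}" using a unfolding c(4) .
            then have "a = c" using False by blast
            then have s3: "sg_alph = {a, i, j}" using c(4) by blast
            show ?thesis by (rule step(3)[OF s3]) (use False ij in auto)
          qed
        qed
        then show "\<bar>loc_word (w @ [a]) i - loc_word (w @ [a]) j\<bar> \<le> 1000 * S * (4/5) ^ length (w @ [a])"
          using tB by linarith
      qed
    qed
  qed
  show thesis by (rule that[of "1000 * S"]) (use main in blast)
qed

text \<open>Converse of \<open>deig_down\<close>: once the midpoint equations hold, those at old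
  vertices follow from the coarser level, or from the vanishing factor if t = 6.\<close>

lemma deig_up:
  assumes mid: "\<And>w i j. w \<in> sg_words n \<Longrightarrow> i \<in> sg_alph \<Longrightarrow> j \<in> sg_alph \<Longrightarrow> i \<noteq> j \<Longrightarrow> midres t u w i j = 0"
    and D: "(2 - t) * (5 - t) \<noteq> 0"
  shows corner_up: "\<And>w i. w \<in> sg_words n \<Longrightarrow> i \<in> sg_alph \<Longrightarrow>
      (2 - t) * (5 - t) * hres t u (w @ [i]) i = (6 - t) * hres (dec t) u w i"
    and "t = 6 \<or> deig n (dec t) u \<Longrightarrow> deig (Suc n) t u"
proof -
  show c: "(2 - t) * (5 - t) * hres t u (w @ [i]) i = (6 - t) * hres (dec t) u w i"
    if w: "w \<in> sg_words n" and i: "i \<in> sg_alph" for w i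
  proof -
    have "\<exists>j\<in>sg_alph. i \<noteq> j" using i by (auto simp: sg_alph_def)
    then obtain j where j: "j \<in> sg_alph" "i \<noteq> j" by blast
    obtain l where l: "l \<in> sg_alph" "l \<noteq> i" "l \<noteq> j" "sg_alph = {i, j, l}"
      using sg_alph_third[OF i j] .
    have "midres t u w i j = 0" "midres t u w i l = 0" "midres t u w j l = 0"
      using mid[OF w] i j l(1-3) by blast+
    then show ?thesis
      using hres_step[OF l(4) j(2) l(2)[symmetric] l(3)[symmetric], of t u w] by simp
  qed
  assume d: "t = 6 \<or> deig n (dec t) u"
  show "deig (Suc n) t u"
  proof (rule deigI)
    fix s a b k assume j: "jn_ok s a b" "Suc n = length s + Suc k"
    have ab: "a \<in> sg_alph" "b \<in> sg_alph" "a \<noteq> b" "set s \<subseteq> sg_alph" using j by (auto simp: jn_ok_def)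
    show "hres t u (s @ a # replicate k b) b + hres t u (s @ b # replicate k a) a = 0"
    proof (cases k)
      case 0
      then show ?thesis using mid[of s a b] ab j by (simp add: midres_def sg_words_iff)
    next
      case (Suc k')
      let ?v = "s @ a # replicate k' b" and ?w = "s @ b # replicate k' a"
      have vw: "?v \<in> sg_words n" "?w \<in> sg_words n" using ab j Suc by (auto simp: sg_words_iff)
      have "(2 - t) * (5 - t) * (hres t u (?v @ [b]) b + hres t u (?w @ [a]) a)
          = (6 - t) * (hres (dec t) u ?v b + hres (dec t) u ?w a)"
        using c[OF vw(1) ab(2)] c[OF vw(2) ab(1)] by (simp only: distrib_left)
      also have "\<dots> = 0"
        using d deigD[of n "dec t" u s a b k'] j Suc by auto
      finally have "hres t u (?v @ [b]) b + hres t u (?w @ [a]) a = 0" using D by simp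
      then show ?thesis using Suc by (simp add: replicate_append_same)
    qed
  qed
qed

text \<open>For t = 6 the right side of the corner identity vanishes. The midpoint rule therefore
  turns a bump at a single level-1 vertex into a level-2 eigenfunction, and the half residuals at
  the corners of \<open>SG\<close> vanish as well. The finer levels continue with
  \<open>six_seq\<close>, keeping both properties.\<close>

lemma localizable_exists:
  obtains v where "localizable 2 six_seq v" "v \<noteq> 0"
proof -
  obtain C where C: "\<And>w i j. set w \<subseteq> sg_alph \<Longrightarrow> i \<in> sg_alph \<Longrightarrow> j \<in> sg_alph \<Longrightarrow>
    \<bar>loc_word w i - loc_word w j\<bar> \<le> C * (4/5) ^ length w" using loc_word_decay by blast
  obtain v where v: "v \<in> sg_C" "\<And>w i. set w \<subseteq> sg_alph \<Longrightarrow> i \<in> sg_alph \<Longrightarrow> v (sg_word_map w (sg_corner i)) = loc_word w i"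
    using sg_glue[of loc_word C "4/5", OF loc_word_corner loc_word_sym C] by auto
  have mid: "midres (six_seq n) v w i j = 0"
    if ijw: "w \<in> sg_words (Suc n)" "i \<in> sg_alph" "j \<in> sg_alph" "i \<noteq> j" for n w i j
  proof -
    obtain l where l: "l \<in> sg_alph" "l \<noteq> i" "l \<noteq> j" "sg_alph = {i, j, l}"
      using sg_alph_third[OF ijw(2-4)] .
    let ?t = "six_seq n" and ?f = "loc_word w"
    let ?D = "(2 - ?t) * (5 - ?t)"
    have D: "?D \<noteq> 0" by (rule six_seq_not_forbidden)
    have w: "set w \<subseteq> sg_alph" "length w = Suc n" using ijw(1) by (auto simp: sg_words_iff)
    have Dq: "?D * (x / ?D) = x" for x by (metis D nonzero_mult_div_cancel_left times_divide_eq_right)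
    have val: "v (sg_word_map w (sg_corner k)) = ?f k" if "k \<in> sg_alph" for k using v(2)[OF w(1) that] .
    have m: "?D * v (sg_word_map (w @ [a]) (sg_corner b)) = (4 - ?t) * (?f a + ?f b) + 2 * (?f i + ?f j + ?f l - ?f a - ?f b)"
      if "a \<in> sg_alph" "b \<in> sg_alph" "a \<noteq> b" for a b
    proof -
      have "v (sg_word_map (w @ [a]) (sg_corner b)) = mid_val ?t ?f a b"
        using v(2)[of "w @ [a]" b] that w loc_word_mid[OF w(2) that(3)] by simp
      then show ?thesis
        unfolding mid_val_def sum_sg_alph'[OF l(4) ijw(4) l(2)[symmetric] l(3)[symmetric], of ?f] by (simp only: Dq)
    qed
    note m' = m[OF ijw(2,3,4)] m[OF ijw(2) l(1) l(2)[symmetric]] m[OF ijw(3) l(1) l(3)[symmetric]]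
    have "?D * midres ?t v w i j = 0"
    proof -
      let ?x = "v (sg_word_map w (sg_map i (sg_corner j)))" and ?y = "v (sg_word_map w (sg_map i (sg_corner l)))"
        and ?z = "v (sg_word_map w (sg_map j (sg_corner l)))"
      have "midres ?t v w i j = ?f i + ?f j + ?y + ?z - (4 - ?t) * ?x"
        unfolding hres_def midres_def nd_def sum_sg_alph'[OF l(4) ijw(4) l(2)[symmetric] l(3)[symmetric]]
          sg_word_map_snoc sg_map_corner sg_map_corner_sym[of j i]
          val[OF ijw(2)] val[OF ijw(3)] by (simp add: field_simps)
      then have "?D * midres ?t v w i j = ?D * (?f i + ?f j) + ?D * ?y + ?D * ?z - (4 - ?t) * (?D * ?x)"
        by (simp only: distrib_left right_diff_distrib mult.left_commute)
      also have "\<dots> = 0"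
        unfolding m'[unfolded sg_word_map_snoc] by (simp add: algebra_simps)
      finally show ?thesis .
    qed
    then show ?thesis using D by simp
  qed
  have dei: "deig (2 + k) (six_seq k) v" for k
  proof (induction k)
    case 0
    have "deig (Suc 1) 6 v" by (rule deig_up(2)) (use mid[of _ 0] in auto)
    then show ?case by (simp add: numeral_2_eq_2)
  next
    case (Suc k)
    have "deig (Suc (2 + k)) (six_seq (Suc k)) v"
    proof (rule deig_up(2)[OF _ six_seq_not_forbidden])
      show "six_seq (Suc k) = 6 \<or> deig (2 + k) (dec (six_seq (Suc k))) v"
        unfolding six_seq_dec[symmetric] using Suc by blast
    qed (use mid[of _ "Suc k"] in auto)
    then show ?case by simp
  qed
  have v0: "v (sg_corner i) = 0" if "i \<in> sg_alph" for i
    using v(2)[of "[]" i] that by (simp add: loc_word_def)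
  have nd0: "hres (six_seq k) v (replicate (2 + k) i) i = 0" if i: "i \<in> sg_alph" for i k
  proof (induction k)
    case 0
    have "[i] \<in> sg_words 1" using i by (simp add: sg_words_iff)
    then have "(2 - 6) * (5 - 6) * hres 6 v ([i] @ [i]) i = (6 - 6) * hres (dec 6) v [i] i"
      using i by (intro deig_up(1)[of 1]) (use mid[of _ 0] in auto)
    then show ?case by (simp add: numeral_2_eq_2)
  next
    case (Suc k)
    let ?t = "six_seq (Suc k)"
    have "replicate (2 + k) i \<in> sg_words (2 + k)" using i by (auto simp: sg_words_iff)
    then have "(2 - ?t) * (5 - ?t) * hres ?t v (replicate (2 + k) i @ [i]) i = (6 - ?t) * hres (dec ?t) v (replicate (2 + k) i) i"
      using i by (intro deig_up(1)[OF _ six_seq_not_forbidden]) (use mid[of _ "Suc k"] in auto)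
    also have "\<dots> = 0" unfolding six_seq_dec[symmetric] Suc by simp
    finally have "hres ?t v (replicate (2 + k) i @ [i]) i = 0" using six_seq_not_forbidden[of "Suc k"] by simp
    then show ?case by (simp add: replicate_append_same)
  qed
  have "nd v (replicate (2 + k) i) i = 0" if i: "i \<in> sg_alph" for i k
    using nd0[OF i, of k] v0[OF i] sg_word_map_replicate[of "2 + k" i] unfolding hres_def by simp
  then have "localizable 2 six_seq v" unfolding localizable_def using v(1) v0 dei by blast
  moreover have "v (sg_word_map [1] (sg_corner 2)) = 2" using v(2)[of "[1]" 2] by (simp add: loc_word_def)
  then have "v \<noteq> 0" by force
  ultimately show thesis by (rule that)
qed

section \<open>The self-similar measure\<close>

definition code_measure :: "(nat \<Rightarrow> nat) measure" where
  "code_measure = PiM UNIV (\<lambda>_. uniform_count_measure sg_alph)"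

text \<open>The point with address \<omega>: unfolding
  \<open>sg_map i x = (1/2) *\<^sub>R (x + sg_corner i)\<close> infinitely often yields this
  series.\<close>

definition code_map :: "(nat \<Rightarrow> nat) \<Rightarrow> real \<times> real" where
  "code_map \<omega> = (\<Sum>n. (1/2) ^ Suc n *\<^sub>R sg_corner (\<omega> n))"

lemma product_prob_space_code: "product_prob_space (\<lambda>_::nat. uniform_count_measure sg_alph)"
proof -
  interpret prob_space "uniform_count_measure sg_alph"
    by (rule prob_space_uniform_count_measure) (auto simp: sg_alph_def)
  show ?thesis by unfold_locales
qed

lemma space_code_measure: "\<omega> \<in> space code_measure \<longleftrightarrow> (\<forall>n. \<omega> n \<in> sg_alph)"
  by (simp add: code_measure_def space_PiM space_uniform_count_measure PiE_iff)

lemma emeasure_code_cylinder: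
  assumes "finite J" "\<And>j. j \<in> J \<Longrightarrow> z j \<in> sg_alph"
  shows "emeasure code_measure {\<omega> \<in> space code_measure. \<forall>j\<in>J. \<omega> j \<in> {z j}} = ennreal ((1/3) ^ card J)"
proof -
  interpret product_prob_space "\<lambda>_::nat. uniform_count_measure sg_alph" UNIV by (rule product_prob_space_code)
  have "emeasure code_measure {\<omega> \<in> space code_measure. \<forall>j\<in>J. \<omega> j \<in> {z j}} =
      (\<Prod>j\<in>J. emeasure (uniform_count_measure sg_alph) {z j})"
    unfolding code_measure_def using assms
    by (intro emeasure_PiM_Collect) (auto simp: sets_uniform_count_measure)
  also have "\<dots> = (\<Prod>j\<in>J. ennreal (1/3))"
    using assms by (intro prod.cong) (simp_all add: emeasure_uniform_count_measure)
  finally show ?thesis by (simp add: ennreal_power)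
qed

lemma norm_sg_corner: "norm (sg_corner i) \<le> 2"
proof -
  have "norm (sg_corner i) \<le> norm (fst (sg_corner i)) + norm (snd (sg_corner i))"
    using norm_Pair_le[of "fst (sg_corner i)" "snd (sg_corner i)"] by simp
  moreover have "sqrt 3 \<le> 2" by (rule real_le_lsqrt) auto
  ultimately show ?thesis by (auto simp: sg_corner_def split: if_splits)
qed

lemma code_map_summable: "summable (\<lambda>n. (1/2) ^ Suc n *\<^sub>R sg_corner (\<omega> n))"
proof (rule summable_norm_cancel, rule summable_comparison_test')
  show "summable (\<lambda>n. 2 * (1/2::real) ^ Suc n)"
    using power_half_series by (intro summable_mult) (rule sums_summable)
  fix n :: nat
  have "(1/2) ^ Suc n * norm (sg_corner (\<omega> n)) \<le> (1/2) ^ Suc n * 2"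
    using norm_sg_corner by (intro mult_left_mono) auto
  then show "norm (norm ((1/2) ^ Suc n *\<^sub>R sg_corner (\<omega> n))) \<le> 2 * (1/2) ^ Suc n" by simp
qed

lemma code_map_step: "code_map \<omega> = sg_map (\<omega> 0) (code_map (\<lambda>n. \<omega> (Suc n)))"
proof -
  have "code_map \<omega> = (\<Sum>n. (1/2) ^ Suc (Suc n) *\<^sub>R sg_corner (\<omega> (Suc n))) + (1/2) *\<^sub>R sg_corner (\<omega> 0)"
    using suminf_split_head[OF code_map_summable[of \<omega>]] by (simp add: code_map_def)
  also have "(\<Sum>n. (1/2) ^ Suc (Suc n) *\<^sub>R sg_corner (\<omega> (Suc n))) =
      (\<Sum>n. (1/2) *\<^sub>R ((1/2) ^ Suc n *\<^sub>R sg_corner (\<omega> (Suc n))))" by simp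
  also have "\<dots> = (1/2) *\<^sub>R code_map (\<lambda>n. \<omega> (Suc n))"
    unfolding code_map_def by (rule suminf_scaleR_right[symmetric]) (rule code_map_summable)
  finally show ?thesis by (simp add: sg_map_eq scaleR_add_right)
qed

lemma map_upt_shift: "map \<omega> [0..<Suc m] = \<omega> 0 # map (\<lambda>n. \<omega> (Suc n)) [0..<m]"
  by (rule nth_equalityI) (auto simp: nth_Cons' simp del: upt_Suc)

lemma code_map_prefix: "code_map \<omega> = sg_word_map (map \<omega> [0..<m]) (code_map (\<lambda>n. \<omega> (m + n)))"
proof (induction m arbitrary: \<omega>)
  case (Suc m)
  show ?case
    unfolding code_map_step[of \<omega>] Suc[of "\<lambda>n. \<omega> (Suc n)"] map_upt_shift by simp
qed simp

lemma code_map_partial: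
  "sg_word_map (map \<omega> [0..<m]) (sg_corner 1) = (\<Sum>n<m. (1/2) ^ Suc n *\<^sub>R sg_corner (\<omega> n))"
proof (induction m arbitrary: \<omega>)
  case 0 then show ?case by (simp add: sg_corner_def zero_prod_def)
next
  case (Suc m)
  have "sg_word_map (map \<omega> [0..<Suc m]) (sg_corner 1) =
      (1/2) *\<^sub>R (\<Sum>n<m. (1/2) ^ Suc n *\<^sub>R sg_corner (\<omega> (Suc n))) + (1/2) *\<^sub>R sg_corner (\<omega> 0)"
    unfolding map_upt_shift sg_word_map.simps o_apply Suc[of "\<lambda>n. \<omega> (Suc n)"] sg_map_eq
    by (simp only: scaleR_add_right)
  also have "\<dots> = (\<Sum>n<Suc m. (1/2) ^ Suc n *\<^sub>R sg_corner (\<omega> n))"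
    by (subst sum.lessThan_Suc_shift) (simp add: scaleR_sum_right)
  finally show ?case .
qed

lemma code_map_SG:
  assumes "\<And>n. \<omega> n \<in> sg_alph"
  shows "code_map \<omega> \<in> SG"
proof -
  have "sg_word_map (map \<omega> [0..<m]) (sg_corner 1) \<in> SG" for m
    using assms by (intro sg_word_map_SG sg_corner_SG) auto
  moreover have "(\<lambda>m. sg_word_map (map \<omega> [0..<m]) (sg_corner 1)) \<longlonglongrightarrow> code_map \<omega>"
    unfolding code_map_partial code_map_def by (rule summable_LIMSEQ[OF code_map_summable])
  ultimately show ?thesis
    by (rule closed_sequentially[OF compact_imp_closed[OF SG_compact]])
qed

lemma code_map_measurable: "code_map \<in> borel_measurable code_measure"
proof (rule borel_measurable_LIMSEQ_metric)
  show "(\<lambda>\<omega>. \<Sum>n<m. (1/2) ^ Suc n *\<^sub>R sg_corner (\<omega> n)) \<in> borel_measurable code_measure" for m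
  proof (intro borel_measurable_sum borel_measurable_scaleR borel_measurable_const)
    fix n
    have "sg_corner \<in> borel_measurable (uniform_count_measure sg_alph)"
      unfolding measurable_def by (auto simp: sets_uniform_count_measure space_uniform_count_measure)
    moreover have "(\<lambda>\<omega>. \<omega> n) \<in> measurable code_measure (uniform_count_measure sg_alph)"
      unfolding code_measure_def by (rule measurable_component_singleton) simp
    ultimately show "(\<lambda>\<omega>. sg_corner (\<omega> n)) \<in> borel_measurable code_measure"
      by (rule measurable_compose[rotated])
  qed
  show "(\<lambda>m. \<Sum>n<m. (1/2) ^ Suc n *\<^sub>R sg_corner (\<omega> n)) \<longlonglongrightarrow> code_map \<omega>" for \<omega>
    unfolding code_map_def by (rule summable_LIMSEQ[OF code_map_summable])
qed

lemma ennreal_le_thirds: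
  assumes "\<And>K. x \<le> ennreal ((1/3) ^ K)"
  shows "x = 0"
proof -
  have "(\<lambda>K. ennreal ((1/3) ^ K)) \<longlonglongrightarrow> ennreal 0"
    by (intro tendsto_ennrealI LIMSEQ_realpow_zero) auto
  then have "x \<le> ennreal 0" by (rule LIMSEQ_le_const) (use assms in auto)
  then show ?thesis by simp
qed

text \<open>Measurability is read off from the positive measure, since sets outside the
  sigma-algebra have measure 0 by convention.\<close>

lemma code_cylinder_sets:
  assumes "finite J" "\<And>j. j \<in> J \<Longrightarrow> z j \<in> sg_alph"
  shows "{\<omega> \<in> space code_measure. \<forall>j\<in>J. \<omega> j \<in> {z j}} \<in> sets code_measure"
proof (rule emeasure_neq_0_sets)
  show "emeasure code_measure {\<omega> \<in> space code_measure. \<forall>j\<in>J. \<omega> j \<in> {z j}} \<noteq> 0"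
  proof -
    have "emeasure code_measure {\<omega> \<in> space code_measure. \<forall>j\<in>J. \<omega> j \<in> {z j}} = ennreal ((1/3) ^ card J)"
      by (rule emeasure_code_cylinder[OF assms])
    moreover have "ennreal ((1/3) ^ card J) > 0" by simp
    ultimately show ?thesis by simp
  qed
qed

lemma code_tail_null:
  assumes a: "a \<in> sg_alph"
  shows "{\<omega> \<in> space code_measure. \<forall>n\<ge>m. \<omega> n = a} \<in> null_sets code_measure"
proof -
  let ?N = "{\<omega> \<in> space code_measure. \<forall>n\<ge>m. \<omega> n = a}"
  let ?C = "\<lambda>K. {\<omega> \<in> space code_measure. \<forall>j\<in>{m..<m+K}. \<omega> j \<in> {a}}"
  have C: "?C K \<in> sets code_measure" for K by (rule code_cylinder_sets) (use a in auto)
  have "?N = (\<Inter>K. ?C K)"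
  proof (intro Set.set_eqI iffI)
    fix \<omega> assume w: "\<omega> \<in> (\<Inter>K. ?C K)"
    have "\<omega> n = a" if "n \<ge> m" for n
    proof -
      have "\<omega> \<in> ?C (Suc n)" using w by blast
      then show ?thesis using that by auto
    qed
    then show "\<omega> \<in> ?N" using w by auto
  qed auto
  moreover have "(\<Inter>K. ?C K) \<in> sets code_measure" using C by (intro sets.countable_INT) auto
  ultimately have N: "?N \<in> sets code_measure" by simp
  have "emeasure code_measure ?N = 0"
  proof (rule ennreal_le_thirds)
    fix K
    have "emeasure code_measure ?N \<le> emeasure code_measure (?C K)"
      using C by (intro emeasure_mono) auto
    also have "\<dots> = ennreal ((1/3) ^ card {m..<m+K})" by (rule emeasure_code_cylinder) (use a in auto)
    finally show "emeasure code_measure ?N \<le> ennreal ((1/3) ^ K)" by simp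
  qed
  then show ?thesis using N by (rule null_setsI)
qed

text \<open>Every finite prefix of the code maps some point of \<open>SG\<close> to the corner, so
  \<open>sg_word_map_eq_corner\<close> applies to each prefix.\<close>

lemma code_map_corner:
  assumes \<omega>: "\<And>n. \<omega> n \<in> sg_alph" and a: "a \<in> sg_alph" and eq: "code_map \<omega> = sg_corner a"
  shows "\<omega> n = a"
proof -
  have sub: "set (map \<omega> [0..<Suc n]) \<subseteq> sg_alph" using \<omega> by auto
  have "code_map (\<lambda>k. \<omega> (Suc n + k)) \<in> SG" by (rule code_map_SG) (rule \<omega>)
  then have "code_map (\<lambda>k. \<omega> (Suc n + k)) \<in> sg_tri" using SG_tri by (rule rev_subsetD)
  then have "map \<omega> [0..<Suc n] = replicate (length (map \<omega> [0..<Suc n])) a"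
  proof -
    have "sg_word_map (map \<omega> [0..<Suc n]) (code_map (\<lambda>k. \<omega> (Suc n + k))) = sg_corner a"
      using eq code_map_prefix[of \<omega> "Suc n"] by (rule trans[OF sym, rotated])
    from sg_word_map_eq_corner[OF sub \<open>code_map _ \<in> sg_tri\<close> a this] show ?thesis by (rule conjunct1)
  qed
  then have "map \<omega> [0..<Suc n] ! n = replicate (Suc n) a ! n" by simp
  then show ?thesis by (simp del: upt_Suc replicate_Suc)
qed

section \<open>Existence of the self-similar measure\<close>

definition self_similar_measure :: "(real \<times> real) measure \<Rightarrow> bool" where
  "self_similar_measure M \<longleftrightarrow> sets M = sets (restrict_space borel SG) \<and>
     (\<forall>m. \<forall>w\<in>sg_words m. emeasure M (sg_cell w) = ennreal ((1/3) ^ m))"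

lemma SG_sets_iff: "A \<in> sets (restrict_space borel SG) \<longleftrightarrow> A \<subseteq> SG \<and> A \<in> sets borel"
  using compact_imp_closed[OF SG_compact] by (intro sets_restrict_space_iff) auto

text \<open>The image of the product measure under the coding map. The preimage of a cell is a
  cylinder, up to codes that start in another cell; these reach a meeting point of two cells, so
  they have constant tails and form a null set.\<close>

lemma self_similar_measure_exists: "\<exists>M. self_similar_measure M"
proof -
  let ?R = "restrict_space borel SG"
  have meas: "code_map \<in> measurable code_measure ?R"
    using code_map_SG code_map_measurable
    by (intro measurable_restrict_space2) (auto simp: space_code_measure)
  have "emeasure (distr code_measure ?R code_map) (sg_cell w) = ennreal ((1/3) ^ m)" if w: "w \<in> sg_words m" for m w
  proof -
    let ?pre = "code_map -` sg_cell w \<inter> space code_measure"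
    let ?A = "{\<omega> \<in> space code_measure. \<forall>j\<in>{..<m}. \<omega> j \<in> {w ! j}}"
    let ?N = "\<Union>a\<in>sg_alph. {\<omega> \<in> space code_measure. \<forall>n\<ge>m. \<omega> n = a}"
    have wj: "w ! j \<in> sg_alph" if "j \<in> {..<m}" for j using w that by (auto simp: sg_words_iff)
    have A: "?A \<in> sets code_measure" by (rule code_cylinder_sets) (use wj in auto)
    have eA: "emeasure code_measure ?A = ennreal ((1/3) ^ m)"
      using emeasure_code_cylinder[of "{..<m}" "\<lambda>j. w ! j"] wj by simp
    have N: "?N \<in> null_sets code_measure" by (intro null_sets_UN' code_tail_null) (auto simp: countable_finite)
    have cell: "sg_cell w \<in> sets ?R"
      using sg_cell_subset[OF w] compact_imp_closed[OF sg_cell_compact] by (simp add: SG_sets_iff)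
    have pre: "?pre \<in> sets code_measure" using measurable_sets[OF meas cell] .
    have prefix: "map \<omega> [0..<m] \<in> sg_words m" if "\<omega> \<in> space code_measure" for \<omega>
      using that by (auto simp: sg_words_iff space_code_measure)
    have tail: "code_map (\<lambda>n. \<omega> (m + n)) \<in> SG" if "\<omega> \<in> space code_measure" for \<omega>
      using that by (intro code_map_SG) (auto simp: space_code_measure)
    have sub1: "?A \<subseteq> ?pre"
    proof
      fix \<omega> assume \<omega>: "\<omega> \<in> ?A"
      then have "map \<omega> [0..<m] = w" using w by (intro nth_equalityI) (auto simp: sg_words_iff)
      then show "\<omega> \<in> ?pre" using \<omega> tail[of \<omega>] code_map_prefix[of \<omega> m] by (auto simp: sg_cell_def)
    qed
    have sub2: "?pre \<subseteq> ?A \<union> ?N"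
    proof
      fix \<omega> assume \<omega>: "\<omega> \<in> ?pre"
      then have \<omega>s: "\<omega> \<in> space code_measure" by simp
      show "\<omega> \<in> ?A \<union> ?N"
      proof (cases "map \<omega> [0..<m] = w")
        case True
        then have "\<omega> j = w ! j" if "j < m" for j using that by (auto simp del: upt_Suc)
        then show ?thesis using \<omega>s by auto
      next
        case False
        let ?p = "code_map (\<lambda>n. \<omega> (m + n))"
        obtain q where q: "q \<in> SG" "code_map \<omega> = sg_word_map w q" using \<omega> unfolding sg_cell_def by blast
        have "?p \<in> sg_tri" "q \<in> sg_tri" using tail[OF \<omega>s] q SG_tri by blast+
        moreover have "sg_word_map (map \<omega> [0..<m]) ?p = sg_word_map w q"
          using code_map_prefix[of \<omega> m] q(2) by simp
        ultimately obtain a where a: "a \<in> sg_alph" "?p = sg_corner a"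
          using sg_cells_meet[OF prefix[OF \<omega>s] w False] by blast
        have "\<omega> n = a" if "n \<ge> m" for n
          using code_map_corner[OF _ a, of "n - m"] \<omega>s that by (simp add: space_code_measure)
        then show ?thesis using \<omega>s a(1) by blast
      qed
    qed
    note lower = emeasure_mono[OF sub1 pre]
    note upper = emeasure_mono[OF sub2 sets.Un[OF A null_setsD2[OF N]], unfolded emeasure_Un_null_set[OF A N]]
    have "emeasure (distr code_measure ?R code_map) (sg_cell w) = emeasure code_measure ?pre"
      by (rule emeasure_distr[OF meas cell])
    also have "\<dots> = emeasure code_measure ?A" by (rule order.antisym[OF upper lower])
    also note eA
    finally show ?thesis .
  qed
  then have "self_similar_measure (distr code_measure ?R code_map)"
    by (simp add: self_similar_measure_def)
  then show ?thesis by blast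
qed

section \<open>Uniqueness of the self-similar measure\<close>

lemma self_similar_space: "self_similar_measure M \<Longrightarrow> space M = SG"
  using sets_eq_imp_space_eq[of M "restrict_space borel SG"]
  by (auto simp: self_similar_measure_def space_restrict_space)

lemma self_similar_singleton:
  assumes M: "self_similar_measure M" and x: "x \<in> SG"
  shows "emeasure M {x} = 0"
proof (rule ennreal_le_thirds)
  fix K
  obtain w where w: "w \<in> sg_words K" "x \<in> sg_cell w" using SG_cells[of K] x by blast
  have "sg_cell w \<in> sets M"
    using M sg_cell_subset[OF w(1)] compact_imp_closed[OF sg_cell_compact]
    by (simp add: self_similar_measure_def SG_sets_iff)
  then have "emeasure M {x} \<le> emeasure M (sg_cell w)" using w by (intro emeasure_mono) auto
  then show "emeasure M {x} \<le> ennreal ((1/3) ^ K)" using M w by (simp add: self_similar_measure_def)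
qed

text \<open>Two cells are nested or meet in at most one point, so adding singletons and the empty
  set to the cells gives a generator closed under intersection.\<close>

definition sg_gen :: "(real \<times> real) set set" where
  "sg_gen = {{}} \<union> (\<lambda>x. {x}) ` SG \<union> {sg_cell w |w. set w \<subseteq> sg_alph}"

text \<open>The longer word is cut to the length of the shorter. Equal words mean nested cells; for
  different words every common point is the corner determined by their first difference.\<close>

lemma sg_cells_Int_gen:
  assumes w: "set w \<subseteq> sg_alph" "set w' \<subseteq> sg_alph" "length w \<le> length w'"
  shows "sg_cell w \<inter> sg_cell w' \<in> sg_gen"
proof -
  define v where "v = take (length w) w'"
  have v: "v \<in> sg_words (length w)" "w \<in> sg_words (length w)"
    using w set_take_subset[of "length w" w'] by (auto simp: v_def sg_words_iff)
  have sub: "sg_cell w' \<subseteq> sg_cell v"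
  proof
    fix x assume "x \<in> sg_cell w'"
    then obtain p where p: "p \<in> SG" "x = sg_word_map (v @ drop (length w) w') p"
      unfolding v_def append_take_drop_id sg_cell_def by blast
    have "sg_word_map (drop (length w) w') p \<in> SG"
      using w set_drop_subset[of "length w" w'] p(1) by (intro sg_word_map_SG) auto
    then show "x \<in> sg_cell v" unfolding p(2) sg_word_map_append sg_cell_def by blast
  qed
  show ?thesis
  proof (cases "w = v")
    case True
    then have "sg_cell w \<inter> sg_cell w' = sg_cell w'" using sub by blast
    then show ?thesis using w by (auto simp: sg_gen_def)
  next
    case False
    have "x = y" if xy: "x \<in> sg_cell w \<inter> sg_cell v" "y \<in> sg_cell w \<inter> sg_cell v" for x y
    proof -
      have *: "\<exists>s a b k k'. a \<noteq> b \<and> b \<in> sg_alph \<and> w = s @ a # replicate k b \<and> v = s @ b # replicate k' a \<and> z = sg_word_map w (sg_corner b)"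
        if z: "z \<in> sg_cell w \<inter> sg_cell v" for z
      proof -
        obtain p q where p: "p \<in> SG" "z = sg_word_map w p" "q \<in> SG" "z = sg_word_map v q"
          using z unfolding sg_cell_def by blast
        have "p \<in> sg_tri" "q \<in> sg_tri" using p SG_tri by blast+
        then show ?thesis using sg_cells_meet[OF v(2,1) False] p by metis
      qed
      obtain s a b k l where 1: "a \<noteq> b" "w = s @ a # replicate k b" "v = s @ b # replicate l a" "x = sg_word_map w (sg_corner b)"
        using *[OF xy(1)] by blast
      obtain s' a' b' k' l' where 2: "a' \<noteq> b'" "w = s' @ a' # replicate k' b'" "v = s' @ b' # replicate l' a'" "y = sg_word_map w (sg_corner b')"
        using *[OF xy(2)] by blast
      have "s @ a # replicate k b = s' @ a' # replicate k' b'" "s @ b # replicate l a = s' @ b' # replicate l' a'"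
        using 1(2,3) 2(2,3) by simp_all
      from word_first_diff_unique[OF this 1(1) 2(1)] show ?thesis using 1(4) 2(4) by simp
    qed
    then have "sg_cell w \<inter> sg_cell w' = {} \<or> (\<exists>x. sg_cell w \<inter> sg_cell w' = {x})" using sub by blast
    moreover have "sg_cell w \<subseteq> SG" using sg_cell_subset[OF v(2)] .
    ultimately show ?thesis by (auto simp: sg_gen_def)
  qed
qed

lemma sg_gen_Int_stable: "Int_stable sg_gen"
proof (rule Int_stableI)
  fix A B assume A: "A \<in> sg_gen" and B: "B \<in> sg_gen"
  show "A \<inter> B \<in> sg_gen"
  proof (cases "\<exists>w w'. set w \<subseteq> sg_alph \<and> set w' \<subseteq> sg_alph \<and> A = sg_cell w \<and> B = sg_cell w'")
    case True
    then obtain w w' where w: "set w \<subseteq> sg_alph" "set w' \<subseteq> sg_alph" "A = sg_cell w" "B = sg_cell w'" by blast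
    then show ?thesis
      using sg_cells_Int_gen[of w w'] sg_cells_Int_gen[of w' w] by (cases "length w \<le> length w'") (auto simp: Int_commute)
  next
    case False
    then have "(A = {} \<or> (\<exists>x\<in>SG. A = {x})) \<or> (B = {} \<or> (\<exists>x\<in>SG. B = {x}))"
      using A B unfolding sg_gen_def by blast
    then have "A \<inter> B = {} \<or> (\<exists>x\<in>SG. A \<inter> B = {x})" by blast
    then show ?thesis unfolding sg_gen_def by blast
  qed
qed

lemma sg_gen_subset: "sg_gen \<subseteq> Pow SG"
proof -
  have "sg_cell w \<subseteq> SG" if "set w \<subseteq> sg_alph" for w
    using that sg_cell_subset[of w "length w"] by (simp add: sg_words_iff)
  then show ?thesis unfolding sg_gen_def by blast
qed

lemma sg_cell_small:
  assumes "open U" "x \<in> U" "x \<in> SG"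
  shows "\<exists>w. set w \<subseteq> sg_alph \<and> x \<in> sg_cell w \<and> sg_cell w \<subseteq> U"
proof -
  obtain e where e: "e > 0" "ball x e \<subseteq> U" using assms openE by blast
  obtain B where B: "\<And>p q. p \<in> SG \<Longrightarrow> q \<in> SG \<Longrightarrow> dist p q \<le> B"
    using compact_imp_bounded[OF SG_compact] bounded_two_points by metis
  have "B \<ge> 0" using B[OF assms(3,3)] by simp
  then have "e / (B + 1) > 0" using e by simp
  then obtain m where m: "(1/2) ^ m < e / (B + 1)" using real_arch_pow_inv[of _ "1/2"] by auto
  then have "(1/2) ^ m * (B + 1) < e" using \<open>B \<ge> 0\<close> by (simp add: pos_less_divide_eq)
  moreover have "(1/2::real) ^ m * B \<le> (1/2) ^ m * (B + 1)" by (intro mult_left_mono) auto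
  moreover have "B / 2 ^ m = (1/2) ^ m * B" by (simp add: power_one_over)
  ultimately have m': "B / 2 ^ m < e" by linarith
  obtain w p where w: "w \<in> sg_words m" "p \<in> SG" "x = sg_word_map w p" using SG_cellE[OF assms(3)] .
  have "sg_cell w \<subseteq> ball x e"
  proof
    fix y assume "y \<in> sg_cell w"
    then obtain q where q: "q \<in> SG" "y = sg_word_map w q" unfolding sg_cell_def by blast
    have "dist x y = dist p q / 2 ^ m" using w q by (simp add: dist_sg_word_map sg_words_iff)
    also have "\<dots> \<le> B / 2 ^ m" using B[OF w(2) q(1)] by (intro divide_right_mono) auto
    finally show "y \<in> ball x e" using m' by simp
  qed
  moreover have "x \<in> sg_cell w" using w(2,3) unfolding sg_cell_def by blast
  ultimately show ?thesis using e(2) w(1) by (intro exI[of _ w]) (auto simp: sg_words_iff)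
qed

text \<open>Within \<open>SG\<close>, an open set is the union of the cells that it contains, and
  there are only countably many words.\<close>

lemma sg_gen_sets: "sets (restrict_space borel SG) = sigma_sets SG sg_gen"
proof
  interpret S: sigma_algebra SG "sigma_sets SG sg_gen" by (rule sigma_algebra_sigma_sets) (rule sg_gen_subset)
  have closed: "closed A" if "A \<in> sg_gen" for A
    using that compact_imp_closed[OF sg_cell_compact] unfolding sg_gen_def by auto
  have cS: "closed SG" by (rule compact_imp_closed[OF SG_compact])
  have "sg_gen \<subseteq> sets (restrict_space borel SG)"
  proof
    fix A assume A: "A \<in> sg_gen"
    then have "A \<subseteq> SG" using sg_gen_subset by blast
    then show "A \<in> sets (restrict_space borel SG)" using borel_closed[OF closed[OF A]] by (simp add: SG_sets_iff)
  qed
  from sets.sigma_sets_subset[OF this] show "sigma_sets SG sg_gen \<subseteq> sets (restrict_space borel SG)"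
    by (simp add: space_restrict_space)
  have open_in: "SG \<inter> U \<in> sigma_sets SG sg_gen" if U: "open U" for U
  proof -
    let ?W = "{w. set w \<subseteq> sg_alph \<and> sg_cell w \<subseteq> U}"
    have sub: "sg_cell w \<subseteq> SG" if "set w \<subseteq> sg_alph" for w
      using that sg_cell_subset[of w "length w"] by (simp add: sg_words_iff)
    have eq: "SG \<inter> U = \<Union> (sg_cell ` ?W)"
    proof (intro Set.set_eqI iffI)
      fix x assume "x \<in> SG \<inter> U"
      then show "x \<in> \<Union> (sg_cell ` ?W)" using sg_cell_small[OF U] by blast
    next
      fix x assume "x \<in> \<Union> (sg_cell ` ?W)"
      then show "x \<in> SG \<inter> U" using sub by blast
    qed
    have "countable (sg_cell ` ?W)" by (intro countable_image) (rule countableI_type)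
    moreover have "b \<in> sigma_sets SG sg_gen" if "b \<in> sg_cell ` ?W" for b
      using that by (intro sigma_sets.Basic) (auto simp: sg_gen_def)
    ultimately show ?thesis unfolding eq by (rule sigma_sets_UNION)
  qed
  have "sets (restrict_space borel SG) = (\<inter>) SG ` sigma_sets UNIV {S. open S}"
    by (simp add: sets_restrict_space borel_def)
  also have "\<dots> = sigma_sets SG ((\<inter>) SG ` {S. open S})"
  proof (rule sigma_sets_Int)
    show "SG \<in> sigma_sets UNIV {S. open S}"
      using cS borel_closed[OF cS] by (simp add: borel_def)
  qed simp
  also have "\<dots> \<subseteq> sigma_sets SG sg_gen"
    by (rule S.sigma_sets_subset) (use open_in in auto)
  finally show "sets (restrict_space borel SG) \<subseteq> sigma_sets SG sg_gen" .
qed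

lemma self_similar_measure_unique:
  assumes M: "self_similar_measure M" and N: "self_similar_measure N"
  shows "M = N"
proof (rule measure_eqI_generator_eq[OF sg_gen_Int_stable sg_gen_subset])
  show "sets M = sigma_sets SG sg_gen" "sets N = sigma_sets SG sg_gen"
    using M N by (simp_all add: self_similar_measure_def sg_gen_sets)
  fix X assume "X \<in> sg_gen"
  then consider "X = {}" | x where "x \<in> SG" "X = {x}" | w where "set w \<subseteq> sg_alph" "X = sg_cell w"
    unfolding sg_gen_def by blast
  then show "emeasure M X = emeasure N X"
  proof cases
    case 3
    then have "w \<in> sg_words (length w)" by (simp add: sg_words_iff)
    then show ?thesis using M N 3 by (simp add: self_similar_measure_def)
  qed (simp_all add: self_similar_singleton M N)
next
  have c: "sg_cell [] = SG" by (simp add: sg_cell_def)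
  show "range (\<lambda>_::nat. SG) \<subseteq> sg_gen" using c unfolding sg_gen_def by force
  have "[] \<in> sg_words 0" by (simp add: sg_words_iff)
  then have "emeasure M SG = ennreal ((1/3) ^ 0)" using M c unfolding self_similar_measure_def by metis
  then show "emeasure M SG \<noteq> \<infinity>" by simp
qed simp

lemma sg_measure_self_similar: "self_similar_measure sg_measure"
proof -
  have "\<exists>!M. self_similar_measure M"
    using self_similar_measure_exists self_similar_measure_unique by blast
  then have "self_similar_measure (THE M. self_similar_measure M)" by (rule theI')
  moreover have "(THE M. self_similar_measure M) = sg_measure"
    unfolding sg_measure_def self_similar_measure_def by (rule refl)
  ultimately show ?thesis by simp
qed

section \<open>Integration over the gasket and its cells\<close>

lemma space_sg_measure: "space sg_measure = SG"
  by (rule self_similar_space[OF sg_measure_self_similar])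

lemma sets_sg_measure: "sets sg_measure = sets (restrict_space borel SG)"
  using sg_measure_self_similar by (simp add: self_similar_measure_def)

lemma sg_cell_sets: "w \<in> sg_words m \<Longrightarrow> sg_cell w \<in> sets sg_measure"
  using sg_cell_subset compact_imp_closed[OF sg_cell_compact] by (simp add: sets_sg_measure SG_sets_iff)

lemma measure_sg_cell: "w \<in> sg_words m \<Longrightarrow> measure sg_measure (sg_cell w) = (1/3) ^ m"
  using sg_measure_self_similar by (simp add: self_similar_measure_def measure_def)

interpretation sg_measure: prob_space sg_measure
proof (rule prob_spaceI)
  have "[] \<in> sg_words 0" "sg_cell [] = SG" by (simp_all add: sg_words_iff sg_cell_def)
  then show "emeasure sg_measure (space sg_measure) = 1"
    using sg_measure_self_similar unfolding space_sg_measure self_similar_measure_def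
    by (metis ennreal_1 power_0)
qed

lemma sg_V_null: "sg_V m \<in> null_sets sg_measure"
proof -
  have "(\<Union>x\<in>sg_V m. {x}) \<in> null_sets sg_measure"
  proof (intro null_sets_UN' null_setsI)
    fix x assume "x \<in> sg_V m"
    then have x: "x \<in> SG" using sg_V_SG by blast
    show "emeasure sg_measure {x} = 0" by (rule self_similar_singleton[OF sg_measure_self_similar x])
    show "{x} \<in> sets sg_measure" using x by (simp add: sets_sg_measure SG_sets_iff)
  qed (simp add: countable_finite)
  then show ?thesis by simp
qed

lemma continuous_integrable:
  assumes "continuous_on SG g"
  shows "integrable sg_measure (g :: real \<times> real \<Rightarrow> real)"
proof -
  have "bounded (g ` SG)" using compact_continuous_image[OF assms SG_compact] compact_imp_bounded by blast
  then obtain B where B: "\<And>x. x \<in> SG \<Longrightarrow> norm (g x) \<le> B" unfolding bounded_iff by blast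
  have "g \<in> borel_measurable (restrict_space borel SG)"
    using assms by (rule borel_measurable_continuous_on_restrict)
  then have "g \<in> borel_measurable sg_measure" using measurable_cong_sets[OF sets_sg_measure refl] by blast
  then show ?thesis using B
    by (intro sg_measure.integrable_const_bound[where B = B]) (auto simp: space_sg_measure)
qed

lemma cell_integrable:
  assumes "continuous_on SG g" "w \<in> sg_words m"
  shows "integrable sg_measure (\<lambda>x. indicator (sg_cell w) x * (g x :: real))"
  using integrable_real_mult_indicator[OF sg_cell_sets[OF assms(2)] continuous_integrable[OF assms(1)]]
  by (simp add: mult.commute)

text \<open>Cells of one level overlap only in vertices, which are finitely many and null, so for
  integrals they act as a partition.\<close>

lemma AE_one_cell:
  "AE x in sg_measure. \<exists>w0\<in>sg_words m. \<forall>w\<in>sg_words m. indicator (sg_cell w) x = (if w = w0 then 1 else (0::real))"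
proof (rule AE_I'[OF sg_V_null[of m]], rule subsetI)
  fix x assume x: "x \<in> {x \<in> space sg_measure. \<not> (\<exists>w0\<in>sg_words m. \<forall>w\<in>sg_words m.
    indicator (sg_cell w) x = (if w = w0 then 1 else (0::real)))}"
  show "x \<in> sg_V m"
  proof (rule ccontr)
    assume n: "x \<notin> sg_V m"
    obtain w0 where w0: "w0 \<in> sg_words m" "x \<in> sg_cell w0" using SG_cells[of m] x space_sg_measure by blast
    have "indicator (sg_cell w) x = (if w = w0 then 1 else (0::real))" if "w \<in> sg_words m" for w
      using sg_cell_Int[OF that w0(1) _ _ w0(2)] n w0(2) by (auto simp: indicator_def)
    then show False using x w0(1) by blast
  qed
qed

section \<open>Effective resistance of cells\<close>

definition cell_energy :: "(real \<times> real \<Rightarrow> real) \<Rightarrow> nat list \<Rightarrow> real" where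
  "cell_energy u w = (u (sg_word_map w (sg_corner 1)) - u (sg_word_map w (sg_corner 2)))\<^sup>2
    + (u (sg_word_map w (sg_corner 1)) - u (sg_word_map w (sg_corner 3)))\<^sup>2
    + (u (sg_word_map w (sg_corner 2)) - u (sg_word_map w (sg_corner 3)))\<^sup>2"

lemma cell_energy_nonneg: "0 \<le> cell_energy u w"
  by (simp add: cell_energy_def)

text \<open>Two cells of one level share at most one vertex, so an ordered pair of neighbours has a
  single address. The six ordered pairs in a cell count its energy twice, which cancels the factor
  1/2 of the definition.\<close>

lemma sg_graph_energy_cells:
  "sg_graph_energy m u = (5/3) ^ m * (\<Sum>w\<in>sg_words m. cell_energy u w)"
proof -
  let ?I = "{(i, j). i \<in> sg_alph \<and> j \<in> sg_alph \<and> i \<noteq> j}"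
  let ?f = "\<lambda>(w, i, j). (sg_word_map w (sg_corner i), sg_word_map w (sg_corner j))"
  have img: "{(x, y). sg_adj m x y} = ?f ` (sg_words m \<times> ?I)"
  proof (intro Set.set_eqI iffI)
    fix p assume "p \<in> {(x, y). sg_adj m x y}"
    then obtain x y where p: "p = (x, y)" "sg_adj m x y" by blast
    then obtain w i j where "w \<in> sg_words m" "i \<in> sg_alph" "j \<in> sg_alph" "i \<noteq> j"
      "x = sg_word_map w (sg_corner i)" "y = sg_word_map w (sg_corner j)" unfolding sg_adj_iff by blast
    then show "p \<in> ?f ` (sg_words m \<times> ?I)" using p by (intro image_eqI[of _ _ "(w, i, j)"]) auto
  next
    fix p assume "p \<in> ?f ` (sg_words m \<times> ?I)"
    then obtain w i j where "w \<in> sg_words m" "i \<in> sg_alph" "j \<in> sg_alph" "i \<noteq> j"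
      "p = (sg_word_map w (sg_corner i), sg_word_map w (sg_corner j))" by auto
    then show "p \<in> {(x, y). sg_adj m x y}" unfolding sg_adj_iff by blast
  qed
  have inj: "inj_on ?f (sg_words m \<times> ?I)"
  proof (rule inj_onI)
    fix p q assume pq: "p \<in> sg_words m \<times> ?I" "q \<in> sg_words m \<times> ?I" "?f p = ?f q"
    obtain w i j where p: "p = (w, i, j)" by (cases p) auto
    obtain w' i' j' where q: "q = (w', i', j')" by (cases q) auto
    have h: "w \<in> sg_words m" "w' \<in> sg_words m" "i \<in> sg_alph" "j \<in> sg_alph" "i \<noteq> j"
      "i' \<in> sg_alph" "j' \<in> sg_alph" "i' \<noteq> j'"
      "sg_word_map w (sg_corner i) = sg_word_map w' (sg_corner i')"
      "sg_word_map w (sg_corner j) = sg_word_map w' (sg_corner j')"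
      using pq unfolding p q by simp_all
    have "w = w'"
    proof (rule ccontr)
      assume ne: "w \<noteq> w'"
      obtain s a b k where 1: "a \<noteq> b" "b \<in> sg_alph" "w = s @ a # replicate k b" "w' = s @ b # replicate k a" "sg_corner i = sg_corner b"
        using sg_cells_meet[OF h(1,2) ne sg_corner_tri[OF h(3)] sg_corner_tri[OF h(6)] h(9)] by metis
      obtain s' a' b' k' where 2: "a' \<noteq> b'" "b' \<in> sg_alph" "w = s' @ a' # replicate k' b'" "w' = s' @ b' # replicate k' a'" "sg_corner j = sg_corner b'"
        using sg_cells_meet[OF h(1,2) ne sg_corner_tri[OF h(4)] sg_corner_tri[OF h(7)] h(10)] by metis
      have "s @ a # replicate k b = s' @ a' # replicate k' b'" "s @ b # replicate k a = s' @ b' # replicate k' a'"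
        using 1(3,4) 2(3,4) by simp_all
      from word_first_diff_unique[OF this 1(1) 2(1)] have "b = b'" by simp
      then show False using 1(2,5) 2(5) h(3-5) by simp
    qed
    then show "p = q" using h unfolding p q by simp
  qed
  have I: "?I = {(1,2), (1,3), (2,1), (2,3), (3,1), (3,2)}" by (auto simp: sg_alph_def)
  have pair: "(\<Sum>(i, j)\<in>?I. (u (sg_word_map w (sg_corner i)) - u (sg_word_map w (sg_corner j)))\<^sup>2) = 2 * cell_energy u w" for w
    unfolding I by (simp add: cell_energy_def power2_commute[of "u (sg_word_map w (sg_corner 2))" "u (sg_word_map w (sg_corner 1))"]
        power2_commute[of "u (sg_word_map w (sg_corner 3))"] del: One_nat_def)
  have fI: "finite ?I" unfolding I by simp
  have "(\<Sum>(x, y)\<in>{(x, y). sg_adj m x y}. (u x - u y)\<^sup>2) =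
      (\<Sum>(w, i, j)\<in>sg_words m \<times> ?I. (u (sg_word_map w (sg_corner i)) - u (sg_word_map w (sg_corner j)))\<^sup>2)"
    unfolding img by (subst sum.reindex[OF inj]) (simp add: case_prod_unfold)
  also have "\<dots> = (\<Sum>w\<in>sg_words m. \<Sum>(i, j)\<in>?I. (u (sg_word_map w (sg_corner i)) - u (sg_word_map w (sg_corner j)))\<^sup>2)"
    by (subst sum.cartesian_product[symmetric]) (simp add: case_prod_unfold)
  also have "\<dots> = 2 * (\<Sum>w\<in>sg_words m. cell_energy u w)"
    unfolding pair by (simp add: sum_distrib_left)
  finally show ?thesis unfolding sg_graph_energy_def by simp
qed

lemma sum_sg_words_Suc: "(\<Sum>w\<in>sg_words (Suc m). g w) = (\<Sum>w\<in>sg_words m. \<Sum>a\<in>sg_alph. (g (w @ [a]) :: real))"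
proof -
  have img: "sg_words (Suc m) = (\<lambda>(w, a). w @ [a]) ` (sg_words m \<times> sg_alph)"
  proof (intro Set.set_eqI iffI)
    fix z assume z: "z \<in> sg_words (Suc m)"
    then obtain w a where "z = w @ [a]" by (cases z rule: rev_cases) (auto simp: sg_words_iff)
    then show "z \<in> (\<lambda>(w, a). w @ [a]) ` (sg_words m \<times> sg_alph)" using z by (auto simp: sg_words_iff)
  qed (auto simp: sg_words_iff)
  have "inj_on (\<lambda>(w, a). w @ [a]) (sg_words m \<times> sg_alph)" by (auto simp: inj_on_def)
  then show ?thesis unfolding img by (subst sum.reindex) (simp_all add: sum.cartesian_product case_prod_unfold)
qed

text \<open>The three squares missing on the right-hand side vanish for the harmonic extension.\<close>

lemma energy_extension_real:
  fixes p q r x y z :: real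
  shows "(p - q)\<^sup>2 + (p - r)\<^sup>2 + (q - r)\<^sup>2 \<le> 5/3 * (((p - x)\<^sup>2 + (p - y)\<^sup>2 + (x - y)\<^sup>2)
    + ((x - q)\<^sup>2 + (x - z)\<^sup>2 + (q - z)\<^sup>2) + ((y - z)\<^sup>2 + (y - r)\<^sup>2 + (z - r)\<^sup>2))"
proof -
  \<comment> \<open>Deviations from the harmonic extension, whose midpoint values weigh the two
    adjacent corners by 2/5 each and the opposite one by 1/5.\<close>
  define a b c where "a = x - (2 * p + 2 * q + r) / 5" and "b = y - (2 * p + q + 2 * r) / 5" and "c = z - (p + 2 * q + 2 * r) / 5"
  have xyz: "x = a + (2 * p + 2 * q + r) / 5" "y = b + (2 * p + q + 2 * r) / 5" "z = c + (p + 2 * q + 2 * r) / 5"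
    by (simp_all add: a_def b_def c_def)
  have "5/3 * (((p - x)\<^sup>2 + (p - y)\<^sup>2 + (x - y)\<^sup>2)
    + ((x - q)\<^sup>2 + (x - z)\<^sup>2 + (q - z)\<^sup>2) + ((y - z)\<^sup>2 + (y - r)\<^sup>2 + (z - r)\<^sup>2))
    = (p - q)\<^sup>2 + (p - r)\<^sup>2 + (q - r)\<^sup>2
      + 5/3 * (2 * a\<^sup>2 + 2 * b\<^sup>2 + 2 * c\<^sup>2 + (a - b)\<^sup>2 + (a - c)\<^sup>2 + (b - c)\<^sup>2)"
    unfolding xyz by (simp add: power2_eq_square field_simps)
  moreover have "0 \<le> 5/3 * (2 * a\<^sup>2 + 2 * b\<^sup>2 + 2 * c\<^sup>2 + (a - b)\<^sup>2 + (a - c)\<^sup>2 + (b - c)\<^sup>2)" by simp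
  ultimately show ?thesis by linarith
qed

lemma cell_energy_step: "cell_energy u w \<le> 5/3 * (\<Sum>a\<in>sg_alph. cell_energy u (w @ [a]))"
  unfolding sum_sg_alph cell_energy_def sg_word_map_snoc sg_map_corner
    sg_map_corner_sym[of 2 1] sg_map_corner_sym[of 3 1] sg_map_corner_sym[of 3 2]
  by (rule energy_extension_real)

lemma sg_graph_energy_incseq: "incseq (\<lambda>m. sg_graph_energy m u)"
proof (rule incseq_SucI)
  fix m
  have "(\<Sum>w\<in>sg_words m. cell_energy u w) \<le> (\<Sum>w\<in>sg_words m. 5/3 * (\<Sum>a\<in>sg_alph. cell_energy u (w @ [a])))"
    by (intro sum_mono cell_energy_step)
  also have "\<dots> = 5/3 * (\<Sum>w\<in>sg_words (Suc m). cell_energy u w)"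
    by (simp add: sum_sg_words_Suc sum_distrib_left)
  finally have "(5/3) ^ m * (\<Sum>w\<in>sg_words m. cell_energy u w) \<le> (5/3) ^ m * (5/3 * (\<Sum>w\<in>sg_words (Suc m). cell_energy u w))"
    by (intro mult_left_mono) auto
  then show "sg_graph_energy m u \<le> sg_graph_energy (Suc m) u"
    by (simp add: sg_graph_energy_cells mult.assoc)
qed

lemma sg_graph_energy_nonneg: "0 \<le> sg_graph_energy m u"
  by (simp add: sg_graph_energy_cells sum_nonneg cell_energy_nonneg)

lemma sg_energy_SUP: "sg_energy u = (SUP m. ennreal (sg_graph_energy m u))"
  unfolding sg_energy_def
proof (rule limI, rule LIMSEQ_SUP)
  show "incseq (\<lambda>m. ennreal (sg_graph_energy m u))"
    using sg_graph_energy_incseq[of u] by (auto simp: incseq_def intro: ennreal_leI)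
qed

lemma sg_energy_le_iff:
  assumes "0 \<le> E"
  shows "sg_energy u \<le> ennreal E \<longleftrightarrow> (\<forall>m. sg_graph_energy m u \<le> E)"
  unfolding sg_energy_SUP SUP_le_iff using assms by (simp add: ennreal_le_iff)

text \<open>The squared difference along an edge of level n is at most \<open>(3/5) ^ n\<close>
  times the energy; the root is the decay of differences per level.\<close>

definition osc_ratio :: real where "osc_ratio = sqrt (3/5)"

lemma osc_ratio: "0 < osc_ratio" "osc_ratio < 1" "osc_ratio\<^sup>2 = 3/5"
  by (auto simp: osc_ratio_def)

text \<open>The edge estimate, summed along addresses by \<open>word_value_chain\<close>, bounds the
  difference at vertices, and continuity carries the bound to the whole cell.\<close>

lemma sg_energy_osc_corner:
  assumes u: "u \<in> sg_C" and E: "\<And>m. sg_graph_energy m u \<le> E"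
    and w: "w \<in> sg_words n" and x: "x \<in> sg_cell w" and j: "j \<in> sg_alph"
  shows "\<bar>u x - u (sg_word_map w (sg_corner j))\<bar> \<le> sqrt E / (1 - osc_ratio) * osc_ratio ^ n"
proof -
  define V where "V z i = u (sg_word_map z (sg_corner i))" for z i
  have corner: "V (z @ [a]) a = V z a" for z a by (simp add: V_def sg_word_map_snoc sg_map_corner)
  have osc: "\<bar>V z i - V z k\<bar> \<le> sqrt E * osc_ratio ^ length z"
    if z: "set z \<subseteq> sg_alph" "i \<in> sg_alph" "k \<in> sg_alph" for z i k
  proof -
    let ?n = "length z"
    have "cell_energy u z \<le> (\<Sum>w\<in>sg_words ?n. cell_energy u w)"
      using z by (intro member_le_sum) (auto simp: sg_words_iff cell_energy_nonneg)
    then have "(5/3) ^ ?n * cell_energy u z \<le> (5/3) ^ ?n * (\<Sum>w\<in>sg_words ?n. cell_energy u w)"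
      by (rule mult_left_mono) simp
    then have "(5/3) ^ ?n * cell_energy u z \<le> E" using E[of ?n] unfolding sg_graph_energy_cells by linarith
    moreover have "(V z i - V z k)\<^sup>2 \<le> cell_energy u z"
      using z(2,3) unfolding sg_alph_def by (auto simp: V_def cell_energy_def power2_commute)
    moreover from this have "(5/3) ^ ?n * (V z i - V z k)\<^sup>2 \<le> (5/3) ^ ?n * cell_energy u z"
      by (rule mult_left_mono) simp
    ultimately have "(5/3) ^ ?n * (V z i - V z k)\<^sup>2 \<le> E" by linarith
    then have "(3/5) ^ ?n * ((5/3) ^ ?n * (V z i - V z k)\<^sup>2) \<le> (3/5) ^ ?n * E" by (intro mult_left_mono) auto
    then have "((3/5) * (5/3)) ^ ?n * (V z i - V z k)\<^sup>2 \<le> (3/5) ^ ?n * E" by (simp only: power_mult_distrib mult.assoc)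
    then have "(V z i - V z k)\<^sup>2 \<le> E * (3/5) ^ ?n" by (simp add: mult.commute)
    then have "sqrt ((V z i - V z k)\<^sup>2) \<le> sqrt (E * (3/5) ^ ?n)" by (rule real_sqrt_le_mono)
    moreover have "sqrt (E * (3/5) ^ ?n) = sqrt E * osc_ratio ^ ?n"
      by (simp add: real_sqrt_mult real_sqrt_power osc_ratio_def)
    ultimately show ?thesis by (simp only: real_sqrt_abs)
  qed
  obtain p where p: "p \<in> SG" "x = sg_word_map w p" using x unfolding sg_cell_def by blast
  have wn: "set w \<subseteq> sg_alph" "length w = n" using w by (auto simp: sg_words_iff)
  let ?g = "\<lambda>p. \<bar>u (sg_word_map w p) - u (sg_word_map w (sg_corner j))\<bar>"
  have "?g p \<le> sqrt E / (1 - osc_ratio) * osc_ratio ^ n"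
  proof (rule continuous_le_on_closure[of "\<Union>m. sg_V m" ?g])
    have "continuous_on SG (\<lambda>p. u (sg_word_map w p))"
    proof (rule continuous_on_compose2[of SG u, OF _ sg_word_map_cont])
      show "continuous_on SG u" using u by (simp add: sg_C_def)
      show "sg_word_map w ` SG \<subseteq> SG" using wn(1) by (auto simp only: sg_word_map_SG)
    qed
    then show "continuous_on (closure (\<Union>m. sg_V m)) ?g"
      unfolding SG_eq_closure[symmetric] by (intro continuous_intros)
    show "p \<in> closure (\<Union>m. sg_V m)" using p(1) unfolding SG_eq_closure .
    fix q assume "q \<in> (\<Union>m. sg_V m)"
    then obtain m z i where z: "z \<in> sg_words m" "i \<in> sg_alph" "q = sg_word_map z (sg_corner i)"
      unfolding sg_V_eq by blast
    have "\<bar>V (w @ z) i - V w j\<bar> \<le> sqrt E / (1 - osc_ratio) * osc_ratio ^ length w"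
      by (rule word_value_chain[of V, OF corner osc osc_ratio(1,2)]) (use z wn j in \<open>auto simp: sg_words_iff\<close>)
    then show "?g q \<le> sqrt E / (1 - osc_ratio) * osc_ratio ^ n"
      using wn(2) z(3) by (simp add: V_def sg_word_map_append)
  qed
  then show ?thesis using p(2) by simp
qed

lemma sg_energy_osc:
  assumes u: "u \<in> sg_C" and E: "\<And>m. sg_graph_energy m u \<le> E"
    and w: "w \<in> sg_words n" and x: "x \<in> sg_cell w" and y: "y \<in> sg_cell w"
  shows "\<bar>u x - u y\<bar> \<le> 2 / (1 - osc_ratio) * osc_ratio ^ n * sqrt E"
proof -
  have "2 / (1 - osc_ratio) * osc_ratio ^ n * sqrt E = 2 * (sqrt E / (1 - osc_ratio) * osc_ratio ^ n)" by simp
  then show ?thesis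
    using sg_energy_osc_corner[OF u E w x sg_alph_mem(1)] sg_energy_osc_corner[OF u E w y sg_alph_mem(1)]
    by linarith
qed

text \<open>Controls the distance of two nearly minimal functions, since their mean is again
  admissible and cannot fall below the infimum.\<close>

lemma sg_graph_energy_parallelogram:
  "sg_graph_energy m (\<lambda>x. u x - v x) + 4 * sg_graph_energy m (\<lambda>x. (u x + v x) / 2)
    = 2 * sg_graph_energy m u + 2 * sg_graph_energy m v"
proof -
  have "cell_energy (\<lambda>x. u x - v x) w + 4 * cell_energy (\<lambda>x. (u x + v x) / 2) w = 2 * cell_energy u w + 2 * cell_energy v w" for w
    unfolding cell_energy_def by (simp add: power2_eq_square field_simps)
  then have "(\<Sum>w\<in>sg_words m. cell_energy (\<lambda>x. u x - v x) w + 4 * cell_energy (\<lambda>x. (u x + v x) / 2) w) =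
      (\<Sum>w\<in>sg_words m. 2 * cell_energy u w + 2 * cell_energy v w)" by simp
  then have "(\<Sum>w\<in>sg_words m. cell_energy (\<lambda>x. u x - v x) w) + 4 * (\<Sum>w\<in>sg_words m. cell_energy (\<lambda>x. (u x + v x) / 2) w) =
      2 * (\<Sum>w\<in>sg_words m. cell_energy u w) + 2 * (\<Sum>w\<in>sg_words m. cell_energy v w)"
    by (simp only: sum.distrib sum_distrib_left)
  from arg_cong[OF this, of "\<lambda>t. (5/3) ^ m * t"] show ?thesis
    unfolding sg_graph_energy_cells by (simp add: distrib_left mult.left_commute)
qed

text \<open>The metric is defined by a least element, which has to exist. A minimizing sequence is
  Cauchy in energy by the parallelogram identity, hence uniformly, because all its members agree at
  x. The energies of each level pass to the limit, as they involve finitely many values.\<close>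

lemma sg_energy_minimizer:
  assumes x: "x \<in> SG" and y: "y \<in> SG" and xy: "x \<noteq> y"
  obtains u where "u \<in> sg_C" "u x = 0" "u y = 1" "\<And>v. v \<in> sg_C \<Longrightarrow> v x = 0 \<Longrightarrow> v y = 1 \<Longrightarrow> sg_energy u \<le> sg_energy v"
proof -
  define S where "S = {E. \<exists>u\<in>sg_C. u x = 0 \<and> u y = 1 \<and> (\<forall>m. sg_graph_energy m u \<le> E)}"
  have in_S: "enn2real (sg_energy v) \<in> S \<and> sg_energy v = ennreal (enn2real (sg_energy v))"
    if "v \<in> sg_C" "v x = 0" "v y = 1" "sg_energy v \<noteq> \<infinity>" for v
  proof -
    have e: "sg_energy v = ennreal (enn2real (sg_energy v))" using that(4) by (simp add: less_top)
    then have "\<forall>m. sg_graph_energy m v \<le> enn2real (sg_energy v)"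
      using sg_energy_le_iff[of "enn2real (sg_energy v)" v] by simp
    then show ?thesis using that e by (auto simp: S_def)
  qed
  show thesis
  proof (cases "S = {}")
    \<comment> \<open>No admissible function has finite energy, so any admissible function is a
      minimizer; this one shows that the class is nonempty.\<close>
    case True
    define u where "u z = (if z \<in> SG then dist z x / dist y x else 0)" for z
    have "continuous_on SG (\<lambda>z. dist z x / dist y x)" using xy by (intro continuous_intros) auto
    then have "continuous_on SG u" by (rule continuous_on_eq) (simp add: u_def)
    then have u: "u \<in> sg_C" "u x = 0" "u y = 1" using xy y by (auto simp: sg_C_def u_def)
    have "sg_energy v = \<infinity>" if "v \<in> sg_C" "v x = 0" "v y = 1" for v
      using in_S[OF that] True by blast
    then show thesis using that[OF u] by simp
  next
    case False
    have S0: "0 \<le> E" if "E \<in> S" for E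
      using that sg_graph_energy_nonneg order_trans unfolding S_def by blast
    then have bdd: "bdd_below S" by (rule bdd_belowI)
    define I where "I = Inf S"
    have I0: "0 \<le> I" unfolding I_def using False S0 by (rule cInf_greatest)
    have I_le: "I \<le> E" if "E \<in> S" for E unfolding I_def using that bdd by (rule cInf_lower)
    have "\<exists>u\<in>sg_C. u x = 0 \<and> u y = 1 \<and> (\<forall>m. sg_graph_energy m u \<le> I + 1 / real (Suc n))" for n
    proof -
      have "I < I + 1 / real (Suc n)" by simp
      then obtain E where E: "E \<in> S" "E < I + 1 / real (Suc n)" using cInf_lessD[OF False] unfolding I_def by blast
      then obtain u where "u \<in> sg_C" "u x = 0" "u y = 1" "\<forall>m. sg_graph_energy m u \<le> E" unfolding S_def by blast
      then show ?thesis using E(2) by (intro bexI[of _ u]) (auto intro: order_trans less_imp_le)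
    qed
    then obtain U where U: "\<And>n. U n \<in> sg_C" "\<And>n. U n x = 0" "\<And>n. U n y = 1"
      "\<And>n m. sg_graph_energy m (U n) \<le> I + 1 / real (Suc n)" by metis
    have diff: "sg_graph_energy m (\<lambda>z. U n z - U k z) \<le> 2 / real (Suc n) + 2 / real (Suc k)" for n k m
    proof (rule ccontr)
      let ?v = "\<lambda>z. U n z - U k z" and ?h = "\<lambda>z. (U n z + U k z) / 2"
      assume neg: "\<not> ?thesis"
      \<comment> \<open>The parallelogram bound for the energy of the mean. Under the negated claim
        it falls below the infimum I; monotonicity in the level extends it from level m to all
        levels.\<close>
      define J where "J = (2 * (I + 1 / real (Suc n)) + 2 * (I + 1 / real (Suc k)) - sg_graph_energy m ?v) / 4"
      have big: "sg_graph_energy m' ?h \<le> J" if "m' \<ge> m" for m'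
        using sg_graph_energy_parallelogram[of m' "U n" "U k"] U(4)[of m' n] U(4)[of m' k]
          incseqD[OF sg_graph_energy_incseq[of ?v] that] unfolding J_def by simp
      have all: "sg_graph_energy m' ?h \<le> J" for m'
        using big[of "max m m'"] incseqD[OF sg_graph_energy_incseq[of ?h], of m' "max m m'"] by simp
      have "?h \<in> sg_C"
        using sg_C_scale[OF sg_C_add[OF U(1)[of n] U(1)[of k]], of "1/2"] by (simp add: fun_scale_def)
      then have "J \<in> S" unfolding S_def using U(2,3) all by (auto intro!: bexI[of _ ?h])
      then have "I \<le> J" by (rule I_le)
      then show False using neg unfolding J_def by simp
    qed
    have unif: "uniformly_Cauchy_on SG U"
    proof (rule uniformly_Cauchy_onI)
      fix e :: real assume e: "e > 0"
      define K where "K = 2 / (1 - osc_ratio)"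
      have K: "K > 0" using osc_ratio by (simp add: K_def)
      have "(e / K)\<^sup>2 / 4 > 0" using e K by simp
      then obtain M where M: "1 / real (Suc M) < (e / K)\<^sup>2 / 4" using nat_approx_posE by blast
      show "\<exists>M. \<forall>z\<in>SG. \<forall>m\<ge>M. \<forall>n\<ge>M. dist (U m z) (U n z) < e"
      proof (intro exI ballI allI impI)
        fix z m n assume z: "z \<in> SG" and mn: "M \<le> m" "M \<le> n"
        have "1 / real (Suc m) \<le> 1 / real (Suc M)" "1 / real (Suc n) \<le> 1 / real (Suc M)"
          using mn by (auto intro!: divide_left_mono)
        then have small: "2 / real (Suc m) + 2 / real (Suc n) < (e / K)\<^sup>2" using M by linarith
        have v: "(\<lambda>z. U m z - U n z) \<in> sg_C"
          using sg_C_add[OF U(1)[of m] sg_C_scale[OF U(1)[of n], of "-1"]] by (simp add: fun_scale_def plus_fun_def)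
        have "[] \<in> sg_words 0" "sg_cell [] = SG" by (simp_all add: sg_words_iff sg_cell_def)
        then have "\<bar>(U m z - U n z) - (U m x - U n x)\<bar> \<le> 2 / (1 - osc_ratio) * osc_ratio ^ 0 * sqrt (2 / real (Suc m) + 2 / real (Suc n))"
          using z x by (intro sg_energy_osc[OF v diff, of "[]"]) simp_all
        then have "\<bar>U m z - U n z\<bar> \<le> K * sqrt (2 / real (Suc m) + 2 / real (Suc n))" by (simp add: U(2) K_def)
        also have "\<dots> < K * sqrt ((e / K)\<^sup>2)" using small K by (intro mult_strict_left_mono real_sqrt_less_mono)
        also have "\<dots> = e" using e K by simp
        finally show "dist (U m z) (U n z) < e" by (simp add: dist_real_def)
      qed
    qed
    then obtain l where l: "uniform_limit SG U l sequentially"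
      using Cauchy_uniformly_convergent[OF unif] unfolding uniformly_convergent_on_def by blast
    define u where "u z = (if z \<in> SG then l z else 0)" for z
    have "continuous_on SG l"
      by (rule uniform_limit_theorem[OF _ l]) (use U(1) in \<open>auto simp: sg_C_def\<close>)
    then have "continuous_on SG u" by (rule continuous_on_eq) (simp add: u_def)
    then have uC: "u \<in> sg_C" by (simp add: sg_C_def u_def)
    have lim: "(\<lambda>n. U n z) \<longlonglongrightarrow> u z" if "z \<in> SG" for z
      using tendsto_uniform_limitI[OF l that] that by (simp add: u_def)
    have ux: "u x = 0" using LIMSEQ_unique[OF lim[OF x]] U(2) by simp
    have uy: "u y = 1" using LIMSEQ_unique[OF lim[OF y]] U(3) by simp
    have "sg_graph_energy m u \<le> I" for m
    proof -
      have pt: "(\<lambda>n. U n (sg_word_map w (sg_corner i))) \<longlonglongrightarrow> u (sg_word_map w (sg_corner i))"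
        if "w \<in> sg_words m" "i \<in> sg_alph" for w i
        by (rule lim, rule sg_word_map_SG[OF _ sg_corner_SG[OF that(2)]]) (use that(1) in \<open>simp add: sg_words_iff\<close>)
      have "(\<lambda>n. sg_graph_energy m (U n)) \<longlonglongrightarrow> sg_graph_energy m u"
        unfolding sg_graph_energy_cells cell_energy_def
        by (intro tendsto_mult tendsto_const tendsto_sum tendsto_add tendsto_power tendsto_diff pt) auto
      moreover have "(\<lambda>n. I + 1 / real (Suc n)) \<longlonglongrightarrow> I + 0"
        by (intro tendsto_add tendsto_const LIMSEQ_Suc[OF lim_1_over_n])
      ultimately have "sg_graph_energy m u \<le> I + 0"
        by (rule LIMSEQ_le) (use U(4) in blast)
      then show ?thesis by simp
    qed
    then have uI: "sg_energy u \<le> ennreal I" using sg_energy_le_iff[OF I0] by blast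
    have "sg_energy u \<le> sg_energy v" if v: "v \<in> sg_C" "v x = 0" "v y = 1" for v
    proof (cases "sg_energy v = \<infinity>")
      case False
      note f = in_S[OF v False]
      have "ennreal I \<le> ennreal (enn2real (sg_energy v))" using I_le f by (intro ennreal_leI) blast
      then show ?thesis using uI f by (metis order_trans)
    qed simp
    then show thesis using that[OF uC ux uy] by blast
  qed
qed

text \<open>A minimizer changes by 1 inside the cell, so \<open>sg_energy_osc\<close> bounds its
  energy below by a multiple of \<open>(5/3) ^ n\<close>.\<close>

lemma sg_resistance_cell_bound:
  obtains c where "c > 0" "\<And>n w x y. w \<in> sg_words n \<Longrightarrow> x \<in> sg_cell w \<Longrightarrow> y \<in> sg_cell w \<Longrightarrow>
    0 \<le> sg_resistance x y \<and> sg_resistance x y \<le> c * (3/5) ^ n"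
proof -
  define c where "c = (2 / (1 - osc_ratio))\<^sup>2"
  have c: "c > 0" using osc_ratio by (simp add: c_def)
  have "0 \<le> sg_resistance x y \<and> sg_resistance x y \<le> c * (3/5) ^ n"
    if w: "w \<in> sg_words n" and xw: "x \<in> sg_cell w" and yw: "y \<in> sg_cell w" for n w x y
  proof (cases "x = y")
    case True then show ?thesis using c by (simp add: sg_resistance_def)
  next
    case False
    have xS: "x \<in> SG" "y \<in> SG" using xw yw sg_cell_subset[OF w] by blast+
    obtain u where u: "u \<in> sg_C" "u x = 0" "u y = 1" "\<And>v. v \<in> sg_C \<Longrightarrow> v x = 0 \<Longrightarrow> v y = 1 \<Longrightarrow> sg_energy u \<le> sg_energy v"
      using sg_energy_minimizer[OF xS False] by blast
    have "(LEAST e. \<exists>u\<in>sg_C. u x = 0 \<and> u y = 1 \<and> e = sg_energy u) = sg_energy u"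
      by (rule Least_equality) (use u in blast)+
    then have r: "sg_resistance x y = inverse (enn2real (sg_energy u))" using False by (simp add: sg_resistance_def)
    show ?thesis
    proof (cases "sg_energy u = \<infinity>")
      \<comment> \<open>Infinite energy would give resistance 0, by the conventions
        \<open>enn2real \<infinity> = 0\<close> and \<open>inverse 0 = 0\<close>.\<close>
      case True then show ?thesis using r c by simp
    next
      case fin: False
      define E where "E = enn2real (sg_energy u)"
      have E0: "0 \<le> E" by (simp add: E_def)
      have "sg_energy u = ennreal E" using fin by (simp add: E_def less_top)
      then have Eb: "\<And>m. sg_graph_energy m u \<le> E" using sg_energy_le_iff[OF E0, of u] by simp
      have "\<bar>u y - u x\<bar> \<le> 2 / (1 - osc_ratio) * osc_ratio ^ n * sqrt E" by (rule sg_energy_osc[OF u(1) Eb w yw xw])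
      then have "1 \<le> 2 / (1 - osc_ratio) * osc_ratio ^ n * sqrt E" using u by simp
      then have "1\<^sup>2 \<le> (2 / (1 - osc_ratio) * osc_ratio ^ n * sqrt E)\<^sup>2" by (intro power_mono) auto
      also have "\<dots> = c * (osc_ratio\<^sup>2) ^ n * E"
        using E0 by (simp add: c_def power_mult_distrib power_divide mult.commute flip: power_mult)
      finally have "1 \<le> c * (3/5) ^ n * E" by (simp add: osc_ratio(3))
      moreover from this have "E > 0" using E0 by (cases "E = 0") auto
      ultimately show ?thesis unfolding r E_def[symmetric] by (simp add: field_simps)
    qed
  qed
  then show thesis using that[OF c] by blast
qed

section \<open>Determinants of Gram matrices\<close>

definition quad :: "nat \<Rightarrow> (nat \<Rightarrow> nat \<Rightarrow> real) \<Rightarrow> (nat \<Rightarrow> real) \<Rightarrow> real" where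
  "quad n a x = (\<Sum>i<n. \<Sum>j<n. x i * x j * a i j)"

abbreviation sqmat :: "nat \<Rightarrow> (nat \<Rightarrow> nat \<Rightarrow> real) \<Rightarrow> real Matrix.mat" where
  "sqmat n a \<equiv> Matrix.mat n n (\<lambda>(i, j). a i j)"

lemma mult_mat_entry:
  assumes "A \<in> carrier_mat n n" "B \<in> carrier_mat n n" "i < n" "j < n"
  shows "(A * B) $$ (i, j) = (\<Sum>k<n. A $$ (i, k) * (B $$ (k, j) :: real))"
  using assms by (simp add: scalar_prod_def atLeast0LessThan)

text \<open>The last column of the matrix is cleared by subtracting the combination of the other columns
  given by Cramer's rule; what remains at the bottom is the Schur complement.\<close>

lemma det_schur_step:
  assumes D: "Determinant.det (sqmat n a) \<noteq> 0"
  shows "\<exists>c. (\<forall>i<n. (\<Sum>j<n. a i j * c j) = a i n) \<and>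
    Determinant.det (sqmat (Suc n) a) = Determinant.det (sqmat n a) * (a n n - (\<Sum>j<n. a n j * c j))"
proof -
  let ?A = "sqmat n a" and ?P = "sqmat (Suc n) a"
  have A: "?A \<in> carrier_mat n n" and P: "?P \<in> carrier_mat (Suc n) (Suc n)" by simp_all
  define B where "B = adj_mat ?A"
  have B: "B \<in> carrier_mat n n" and AB: "?A * B = Determinant.det ?A \<cdot>\<^sub>m 1\<^sub>m n"
    unfolding B_def using adj_mat[OF A] by auto
  define c where "c j = (\<Sum>k<n. B $$ (j, k) * a k n) / Determinant.det ?A" for j
  have c: "(\<Sum>j<n. a i j * c j) = a i n" if i: "i < n" for i
  proof -
    have "(\<Sum>j<n. a i j * c j) = (\<Sum>j<n. \<Sum>k<n. a i j * B $$ (j, k) * a k n) / Determinant.det ?A"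
      by (simp add: c_def sum_distrib_left sum_divide_distrib mult.assoc)
    also have "(\<Sum>j<n. \<Sum>k<n. a i j * B $$ (j, k) * a k n) = (\<Sum>k<n. (\<Sum>j<n. a i j * B $$ (j, k)) * a k n)"
      by (subst sum.swap) (simp add: sum_distrib_right)
    also have "\<dots> = (\<Sum>k<n. (if i = k then Determinant.det ?A else 0) * a k n)"
    proof (rule sum.cong[OF refl])
      fix k assume k: "k \<in> {..<n}"
      have "(\<Sum>j<n. a i j * B $$ (j, k)) = (?A * B) $$ (i, k)"
        using mult_mat_entry[OF A B i, of k] k i by simp
      also have "\<dots> = (if i = k then Determinant.det ?A else 0)" unfolding AB using i k by simp
      finally show "(\<Sum>j<n. a i j * B $$ (j, k)) * a k n = (if i = k then Determinant.det ?A else 0) * a k n" by simp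
    qed
    also have "\<dots> = (\<Sum>k<n. if i = k then Determinant.det ?A * a k n else 0)" by (intro sum.cong) auto
    also have "\<dots> = Determinant.det ?A * a i n" using i by simp
    finally show ?thesis using D by simp
  qed
  define U where "U = sqmat (Suc n) (\<lambda>i j. if i = j then 1 else if j = n then - c i else 0)"
  have U: "U \<in> carrier_mat (Suc n) (Suc n)" by (simp add: U_def)
  have "Determinant.det U = prod_list (diag_mat U)"
    by (rule det_upper_triangular[OF _ U]) (auto simp: U_def upper_triangular_def)
  also have "\<dots> = 1" by (simp add: prod_list_diag_prod U_def)
  finally have detU: "Determinant.det U = 1" .
  define s where "s = a n n - (\<Sum>j<n. a n j * c j)"
  have PU: "?P * U \<in> carrier_mat (Suc n) (Suc n)" by (rule mult_carrier_mat[OF P U])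
  have last: "(?P * U) $$ (i, n) = (if i = n then s else 0)" if i: "i < Suc n" for i
  proof -
    have "(?P * U) $$ (i, n) = (\<Sum>k<Suc n. ?P $$ (i, k) * U $$ (k, n))" by (rule mult_mat_entry[OF P U i]) simp
    also have "\<dots> = (\<Sum>k<n. a i k * - c k) + a i n" using i by (simp add: U_def)
    also have "\<dots> = a i n - (\<Sum>k<n. a i k * c k)" by (simp add: sum_negf)
    finally show ?thesis using c[of i] i by (auto simp: s_def)
  qed
  have rest: "(?P * U) $$ (i, j) = a i j" if i: "i < Suc n" and j: "j < n" for i j
  proof -
    have "(?P * U) $$ (i, j) = (\<Sum>k<Suc n. ?P $$ (i, k) * U $$ (k, j))" by (rule mult_mat_entry[OF P U i]) (use j in simp)
    also have "\<dots> = (\<Sum>k<Suc n. if k = j then a i k else 0)" using i j by (intro sum.cong) (auto simp: U_def)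
    finally show ?thesis using j by simp
  qed
  have "Determinant.det (?P * U) = (\<Sum>i<Suc n. (?P * U) $$ (i, n) * cofactor (?P * U) i n)"
    by (rule laplace_expansion_column[OF PU]) simp
  also have "\<dots> = (\<Sum>i<Suc n. if i = n then s * cofactor (?P * U) i n else 0)"
    by (intro sum.cong) (auto simp: last)
  also have "\<dots> = s * cofactor (?P * U) n n" by simp
  also have "cofactor (?P * U) n n = Determinant.det (mat_delete (?P * U) n n)" by (simp add: cofactor_def)
  also have "mat_delete (?P * U) n n = ?A"
    by (rule eq_matI) (use rest in \<open>auto simp: mat_delete_def U_def\<close>)
  finally have "Determinant.det ?P = Determinant.det ?A * s" using det_mult[OF P U] detU by simp
  then show ?thesis using c unfolding s_def by blast
qed

lemma quad_Suc:
  "quad (Suc n) a x = quad n a x + (\<Sum>i<n. x i * x n * a i n) + (\<Sum>j<n. x n * x j * a n j) + x n * x n * a n n"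
  by (simp add: quad_def sum.distrib)

lemma quad_cong: "(\<And>i. i < n \<Longrightarrow> x i = y i) \<Longrightarrow> quad n a x = quad n a y"
  unfolding quad_def by (intro sum.cong) auto

text \<open>The ratio s of consecutive leading minors is a Schur complement. It is the value of the
  form at a vector with last entry 1, hence at least \<open>l n\<close>; it is also the diagonal
  entry minus a nonnegative value of the form, hence at most \<open>u n\<close>.\<close>

lemma gram_det_bounds:
  assumes sym: "\<And>i j. a i j = a j i"
    and pos: "\<And>i. i < n \<Longrightarrow> 0 < l i"
    and low: "\<And>i x. i < n \<Longrightarrow> x i = 1 \<Longrightarrow> l i \<le> quad n a x"
    and up: "\<And>i. i < n \<Longrightarrow> a i i \<le> u i"
  shows "(\<Prod>i<n. l i) \<le> Determinant.det (sqmat n a) \<and> Determinant.det (sqmat n a) \<le> (\<Prod>i<n. u i)"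
  using pos low up
proof (induction n)
  case 0
  have "Determinant.det (sqmat 0 a) = 1" by (rule det_dim_zero) simp
  then show ?case by simp
next
  case (Suc n)
  \<comment> \<open>Vectors with last entry 0 carry the hypothesis over to the leading
    block.\<close>
  have low': "l i \<le> quad n a x" if "i < n" "x i = 1" for i x
  proof -
    have "l i \<le> quad (Suc n) a (x(n := 0))" using that by (intro Suc.prems(2)) auto
    also have "\<dots> = quad n a (x(n := 0))" by (simp add: quad_Suc)
    also have "\<dots> = quad n a x" by (rule quad_cong) simp
    finally show ?thesis .
  qed
  have IH: "(\<Prod>i<n. l i) \<le> Determinant.det (sqmat n a)" "Determinant.det (sqmat n a) \<le> (\<Prod>i<n. u i)"
    using Suc.IH low' Suc.prems by auto
  have P: "0 < (\<Prod>i<n. l i)" using Suc.prems(1) by (intro prod_pos) auto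
  then have D: "0 < Determinant.det (sqmat n a)" using IH(1) by linarith
  obtain c where c: "\<And>i. i < n \<Longrightarrow> (\<Sum>j<n. a i j * c j) = a i n"
    "Determinant.det (sqmat (Suc n) a) = Determinant.det (sqmat n a) * (a n n - (\<Sum>j<n. a n j * c j))"
    using det_schur_step[of n a] D by auto
  define s where "s = a n n - (\<Sum>j<n. a n j * c j)"
  have qc: "quad n a c = (\<Sum>j<n. a n j * c j)"
  proof -
    have "quad n a c = (\<Sum>i<n. c i * (\<Sum>j<n. a i j * c j))"
      by (simp add: quad_def sum_distrib_left mult_ac)
    also have "\<dots> = (\<Sum>i<n. c i * a i n)" using c(1) by (intro sum.cong) auto
    also have "\<dots> = (\<Sum>i<n. a n i * c i)" using sym by (intro sum.cong) (auto simp: mult.commute)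
    finally show ?thesis .
  qed
  have "l n \<le> quad (Suc n) a (\<lambda>i. if i = n then 1 else - c i)" by (rule Suc.prems(2)) auto
  also have "\<dots> = quad n a c - (\<Sum>i<n. c i * a i n) - (\<Sum>j<n. c j * a n j) + a n n"
  proof -
    have "quad n a (\<lambda>i. if i = n then 1 else - c i) = quad n a c"
      unfolding quad_def by (intro sum.cong) auto
    then show ?thesis by (simp add: quad_Suc sum_negf)
  qed
  also have "(\<Sum>i<n. c i * a i n) = (\<Sum>j<n. a n j * c j)" using sym by (intro sum.cong) (auto simp: mult.commute)
  also have "(\<Sum>j<n. c j * a n j) = (\<Sum>j<n. a n j * c j)" by (simp add: mult.commute)
  finally have sl: "l n \<le> s" unfolding qc s_def by simp
  \<comment> \<open>A nonzero vector can be scaled to have an entry 1, where the form is bounded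
    below by a positive number.\<close>
  have "0 \<le> quad n a c"
  proof (cases "\<exists>i<n. c i \<noteq> 0")
    case True
    then obtain i where i: "i < n" "c i \<noteq> 0" by blast
    have "0 < l i" "l i \<le> quad n a (\<lambda>j. c j / c i)" using Suc.prems(1) low'[of i "\<lambda>j. c j / c i"] i by auto
    moreover have "quad n a c = c i * c i * quad n a (\<lambda>j. c j / c i)"
      using i by (simp add: quad_def sum_distrib_left)
    moreover have "0 \<le> c i * c i" by simp
    ultimately show ?thesis by (metis less_eq_real_def mult_nonneg_nonneg order_trans)
  next
    case False
    then have "quad n a c = quad n a (\<lambda>_. 0)" by (intro quad_cong) auto
    then show ?thesis by (simp add: quad_def)
  qed
  then have su: "s \<le> u n" using Suc.prems(3)[of n] unfolding qc s_def by simp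
  have "(\<Prod>i<n. l i) * l n \<le> Determinant.det (sqmat n a) * s"
    using IH(1) sl Suc.prems(1)[of n] D P by (intro mult_mono) auto
  moreover have "Determinant.det (sqmat n a) * s \<le> (\<Prod>i<n. u i) * u n"
    using IH su sl Suc.prems(1)[of n] D by (intro mult_mono) auto
  ultimately show ?case unfolding c(2) s_def by simp
qed

text \<open>Congruence by a matrix with orthonormal columns: its transpose is a left inverse, so the
  two determinants multiply to 1.\<close>

lemma det_orthogonal_change:
  assumes Q: "\<And>i j. i < d \<Longrightarrow> j < d \<Longrightarrow> (\<Sum>k<d. Q k i * Q k j) = (if i = j then 1 else 0)"
    and a: "\<And>i j. i < d \<Longrightarrow> j < d \<Longrightarrow> a i j = (\<Sum>k<d. \<Sum>l<d. Q k i * Q l j * b k l)"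
  shows "Determinant.det (sqmat d a) = Determinant.det (sqmat d b)"
proof -
  let ?Q = "sqmat d Q" and ?B = "sqmat d b" and ?T = "sqmat d (\<lambda>i j. Q j i)"
  have c: "?Q \<in> carrier_mat d d" "?B \<in> carrier_mat d d" "?T \<in> carrier_mat d d" by simp_all
  have TQ: "?T * ?Q = 1\<^sub>m d"
  proof (rule eq_matI)
    fix i j assume "i < dim_row (1\<^sub>m d)" "j < dim_col (1\<^sub>m d)"
    then have ij: "i < d" "j < d" by simp_all
    show "(?T * ?Q) $$ (i, j) = 1\<^sub>m d $$ (i, j)"
      using mult_mat_entry[OF c(3,1) ij] Q[OF ij] ij by simp
  qed simp_all
  have "sqmat d a = (?T * ?B) * ?Q"
  proof (rule eq_matI)
    fix i j assume "i < dim_row ((?T * ?B) * ?Q)" "j < dim_col ((?T * ?B) * ?Q)"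
    then have ij: "i < d" "j < d" by simp_all
    have TB: "?T * ?B \<in> carrier_mat d d" by (rule mult_carrier_mat[OF c(3,2)])
    have "((?T * ?B) * ?Q) $$ (i, j) = (\<Sum>l<d. (?T * ?B) $$ (i, l) * ?Q $$ (l, j))"
      by (rule mult_mat_entry[OF TB c(1) ij])
    also have "\<dots> = (\<Sum>l<d. (\<Sum>k<d. Q k i * b k l) * Q l j)"
      using mult_mat_entry[OF c(3,2) ij(1)] ij by (intro sum.cong) simp_all
    also have "\<dots> = (\<Sum>k<d. \<Sum>l<d. Q k i * Q l j * b k l)"
      by (subst sum.swap) (simp add: sum_distrib_left mult_ac)
    finally show "sqmat d a $$ (i, j) = ((?T * ?B) * ?Q) $$ (i, j)" using a[OF ij] ij by simp
  qed simp_all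
  then have "Determinant.det (sqmat d a) = Determinant.det ?T * Determinant.det ?B * Determinant.det ?Q"
    by (simp only: det_mult[OF mult_carrier_mat[OF c(3,2)] c(1)] det_mult[OF c(3,2)])
  moreover have "Determinant.det ?T * Determinant.det ?Q = 1" using det_mult[OF c(3,1)] TQ by simp
  moreover have "Determinant.det ?T * Determinant.det ?B * Determinant.det ?Q
      = Determinant.det ?B * (Determinant.det ?T * Determinant.det ?Q)" by (simp only: mult_ac)
  ultimately show ?thesis by simp
qed

section \<open>Orthonormal bases adapted to the cells\<close>

definition wip :: "(real \<times> real \<Rightarrow> real) \<Rightarrow> (real \<times> real \<Rightarrow> real) \<Rightarrow> (real \<times> real \<Rightarrow> real) \<Rightarrow> real" where
  "wip f u v = (\<integral>x. f x * (u x * v x) \<partial>sg_measure)"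

lemma sg_inner_wip: "sg_inner u v = wip (\<lambda>_. 1) u v"
  by (simp add: sg_inner_def wip_def)

lemma wip_commute: "wip f u v = wip f v u"
  by (simp add: wip_def mult.commute)

lemma sg_C_cont: "u \<in> sg_C \<Longrightarrow> continuous_on SG u"
  by (simp add: sg_C_def)

lemma wip_sum_left:
  assumes f: "continuous_on SG f" and A: "finite A" "\<And>a. a \<in> A \<Longrightarrow> h a \<in> sg_C" and v: "v \<in> sg_C"
  shows "wip f (\<Sum>a\<in>A. fun_scale (c a) (h a)) v = (\<Sum>a\<in>A. c a * wip f (h a) v)"
proof -
  have "wip f (\<Sum>a\<in>A. fun_scale (c a) (h a)) v = (\<integral>x. (\<Sum>a\<in>A. c a * (f x * (h a x * v x))) \<partial>sg_measure)"
    unfolding wip_def sum_fun_apply fun_scale_def by (simp add: sum_distrib_left sum_distrib_right mult_ac)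
  also have "\<dots> = (\<Sum>a\<in>A. \<integral>x. c a * (f x * (h a x * v x)) \<partial>sg_measure)"
    by (intro Bochner_Integration.integral_sum integrable_mult_right continuous_integrable continuous_on_mult f sg_C_cont A v)
  finally show ?thesis by (simp add: wip_def)
qed

section \<open>Orthonormal sets of continuous functions\<close>

definition orthonormal :: "(real \<times> real \<Rightarrow> real) set \<Rightarrow> bool" where
  "orthonormal B \<longleftrightarrow> finite B \<and> B \<subseteq> sg_C \<and> (\<forall>x\<in>B. \<forall>y\<in>B. sg_inner x y = (if x = y then 1 else 0))"

lemma orthonormal_coeff:
  assumes B: "orthonormal B" and y: "y \<in> B"
  shows "sg_inner (\<Sum>x\<in>B. fun_scale (c x) x) y = c y"
proof -
  have fin: "finite B" and C: "\<And>x. x \<in> B \<Longrightarrow> x \<in> sg_C" using B by (auto simp: orthonormal_def)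
  have "sg_inner (\<Sum>x\<in>B. fun_scale (c x) x) y = (\<Sum>x\<in>B. c x * sg_inner x y)"
    unfolding sg_inner_wip by (rule wip_sum_left[OF continuous_on_const fin]) (use C y in auto)
  also have "\<dots> = (\<Sum>x\<in>B. if x = y then c x else 0)"
    using B y by (intro sum.cong) (auto simp: orthonormal_def)
  finally show ?thesis using fin y by simp
qed

lemma orthonormal_expand:
  assumes B: "orthonormal B" and u: "u \<in> funs.span B"
  shows "u = (\<Sum>x\<in>B. fun_scale (sg_inner u x) x)"
proof -
  have fin: "finite B" using B by (simp add: orthonormal_def)
  obtain c where c: "u = (\<Sum>x\<in>B. fun_scale (c x) x)" using u unfolding funs.span_finite[OF fin] by blast
  show ?thesis unfolding c using orthonormal_coeff[OF B, of _ c] by (intro sum.cong) simp_all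
qed

lemma orthonormal_independent:
  assumes B: "orthonormal B"
  shows "funs.independent B"
proof (rule funs.independent_if_scalars_zero)
  show "finite B" using B by (simp add: orthonormal_def)
  fix c x assume "(\<Sum>x\<in>B. fun_scale (c x) x) = 0" "x \<in> B"
  then show "c x = 0" using orthonormal_coeff[OF B, of x c] by (simp add: sg_inner_def)
qed

lemma orthonormal_card_span:
  assumes "orthonormal B" "finite D" "B \<subseteq> funs.span D"
  shows "card B \<le> card D"
  using funs.independent_span_bound[OF assms(2) orthonormal_independent[OF assms(1)] assms(3)] by simp

lemma sg_inner_add_scale:
  assumes "u \<in> sg_C" "v \<in> sg_C" "y \<in> sg_C"
  shows "sg_inner (u + fun_scale c v) y = sg_inner u y + c * sg_inner v y"
proof -
  have i: "integrable sg_measure (\<lambda>x. u x * y x)" "integrable sg_measure (\<lambda>x. c * (v x * y x))"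
    by (intro continuous_integrable continuous_on_mult continuous_on_const sg_C_cont assms)+
  have "sg_inner (u + fun_scale c v) y = (\<integral>x. u x * y x + c * (v x * y x) \<partial>sg_measure)"
    unfolding sg_inner_def by (simp add: fun_scale_def algebra_simps)
  then show ?thesis using Bochner_Integration.integral_add[OF i] by (simp add: sg_inner_def)
qed

text \<open>An orthonormal set of maximal size spans S: otherwise a vector minus its projection,
  normalized, could be added. Definiteness is a hypothesis here; on \<open>sg_E \<Lambda>\<close> it
  is supplied by the given eigenbasis.\<close>

lemma orthonormal_extend:
  assumes S: "funs.subspace S" "S \<subseteq> sg_C" and D: "finite D" "S \<subseteq> funs.span D"
    and pd: "\<And>u. u \<in> S \<Longrightarrow> sg_inner u u = 0 \<Longrightarrow> u = 0"
    and B: "orthonormal B" "B \<subseteq> S"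
  shows "\<exists>B'. orthonormal B' \<and> B \<subseteq> B' \<and> B' \<subseteq> S \<and> funs.span B' = S"
proof -
  let ?P = "\<lambda>B'. orthonormal B' \<and> B \<subseteq> B' \<and> B' \<subseteq> S"
  have bound: "\<forall>B'. ?P B' \<longrightarrow> card B' \<le> card D"
    using orthonormal_card_span[OF _ D(1)] D(2) by blast
  obtain B' where B': "?P B'" and max: "\<And>A. ?P A \<Longrightarrow> card A \<le> card B'"
    using Lattices_Big.ex_has_greatest_nat[of ?P B card "Suc (card D)"] B bound by (metis less_Suc_eq_le subset_refl)
  have fin: "finite B'" and on: "orthonormal B'" and B'S: "B' \<subseteq> S" using B' by (auto simp: orthonormal_def)
  have "S \<subseteq> funs.span B'"
  proof (rule ccontr)
    assume "\<not> ?thesis"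
    then obtain v where v: "v \<in> S" "v \<notin> funs.span B'" by blast
    define p where "p = (\<Sum>x\<in>B'. fun_scale (sg_inner v x) x)"
    define q where "q = v + fun_scale (-1) p"
    have pB: "p \<in> funs.span B'" unfolding p_def by (intro funs.span_sum funs.span_scale funs.span_base)
    then have pS: "p \<in> S" using funs.span_minimal[OF B'S S(1)] by blast
    have qS: "q \<in> S" unfolding q_def using v(1) pS S(1) by (intro funs.subspace_add funs.subspace_scale)
    have "q \<noteq> 0"
    proof
      assume "q = 0"
      then have "v = p" by (auto simp: q_def fun_scale_def fun_eq_iff)
      then show False using v(2) pB by simp
    qed
    have qy: "sg_inner q y = 0" if "y \<in> B'" for y
    proof -
      have "sg_inner q y = sg_inner v y + (-1) * sg_inner p y"
        unfolding q_def by (rule sg_inner_add_scale) (use v(1) pS that B'S S(2) in auto)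
      also have "sg_inner p y = sg_inner v y" unfolding p_def by (rule orthonormal_coeff[OF on that])
      finally show ?thesis by simp
    qed
    have qq: "sg_inner q q > 0"
    proof -
      have "sg_inner q q \<noteq> 0" using pd[OF qS] \<open>q \<noteq> 0\<close> by blast
      moreover have "0 \<le> sg_inner q q" unfolding sg_inner_def by (rule integral_nonneg_AE) simp
      ultimately show ?thesis by simp
    qed
    define r where "r = fun_scale (1 / sqrt (sg_inner q q)) q"
    have rS: "r \<in> S" unfolding r_def using qS S(1) by (rule funs.subspace_scale[rotated])
    have ry: "sg_inner r y = 1 / sqrt (sg_inner q q) * sg_inner q y" "sg_inner y r = sg_inner r y" for y
      unfolding r_def sg_inner_def fun_scale_def by (simp_all add: mult.assoc mult.commute)
    have rr: "sg_inner r r = 1"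
      unfolding ry(1) ry(2)[of q] using qq ry(1)[of q] by (simp add: ry(1)[of q] flip: ry(2)[of q])
    have "r \<notin> B'" using qy rr ry(1)[of r] by auto
    have "orthonormal (insert r B')"
      unfolding orthonormal_def
    proof (intro conjI ballI)
      show "finite (insert r B')" using fin by simp
      show "insert r B' \<subseteq> sg_C" using rS B'S S(2) by blast
      fix x y assume "x \<in> insert r B'" "y \<in> insert r B'"
      then show "sg_inner x y = (if x = y then 1 else 0)"
        using on qy ry rr \<open>r \<notin> B'\<close> by (auto simp: orthonormal_def)
    qed
    then have "card (insert r B') \<le> card B'" using B' rS by (intro max) auto
    then show False using fin \<open>r \<notin> B'\<close> by simp
  qed
  moreover have "funs.span B' \<subseteq> S" by (rule funs.span_minimal[OF B'S S(1)])
  ultimately show ?thesis using B' by blast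
qed

lemma transplant_sum:
  assumes "finite A"
  shows "transplant w (\<Sum>a\<in>A. fun_scale (c a) (h a)) = (\<Sum>a\<in>A. fun_scale (c a) (transplant w (h a)))"
  by (rule ext) (simp add: transplant_def sum_fun_apply fun_scale_def)

lemma transplant_eq_0:
  assumes "v \<in> sg_C" "transplant w v = 0"
  shows "v = 0"
proof
  fix x show "v x = 0 x"
  proof (cases "x \<in> SG")
    case True
    then show ?thesis using transplant_inside[OF True, of w v] assms(2) by simp
  qed (use sg_C_off[OF assms(1)] in simp)
qed

lemma transplant_subspace:
  assumes "funs.subspace V"
  shows "funs.subspace (transplant w ` V)"
proof (rule funs.subspaceI)
  have "transplant w 0 = 0" by (simp add: transplant_def fun_eq_iff)
  then show "0 \<in> transplant w ` V" using funs.subspace_0[OF assms] by force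
next
  fix x y assume "x \<in> transplant w ` V" "y \<in> transplant w ` V"
  then obtain u v where "u \<in> V" "v \<in> V" "x = transplant w u" "y = transplant w v" by blast
  then show "x + y \<in> transplant w ` V" using funs.subspace_add[OF assms] by (metis imageI transplant_add)
next
  fix c x assume "x \<in> transplant w ` V"
  then obtain u where "u \<in> V" "x = transplant w u" by blast
  then show "fun_scale c x \<in> transplant w ` V" using funs.subspace_scale[OF assms] by (metis imageI transplant_scale)
qed

text \<open>Transplantation is linear and injective on V, so functions representing an orthonormal
  set in w stay independent when moved to w'. Transporting independence instead of orthonormality
  bypasses the scaling of the measure.\<close>

lemma transplant_card_le:
  assumes V: "funs.subspace V" "V \<subseteq> sg_C"
    and B: "orthonormal B" "B \<subseteq> transplant w ` V" and B': "orthonormal B'" "funs.span B' = transplant w' ` V"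
  shows "card B \<le> card B'"
proof -
  have "\<exists>p\<in>V. x = transplant w p" if "x \<in> B" for x using B(2) that by blast
  then obtain p where p: "\<And>x. x \<in> B \<Longrightarrow> p x \<in> V" "\<And>x. x \<in> B \<Longrightarrow> x = transplant w (p x)" by metis
  have fin: "finite B" "finite B'" using B B' by (auto simp: orthonormal_def)
  let ?h = "\<lambda>x. transplant w' (p x)"
  have zero: "c x = 0" if s: "(\<Sum>x\<in>B. fun_scale (c x) (?h x)) = 0" and x: "x \<in> B" for c x
  proof -
    have "transplant w' (\<Sum>x\<in>B. fun_scale (c x) (p x)) = 0" unfolding transplant_sum[OF fin(1)] by (rule s)
    moreover have "(\<Sum>x\<in>B. fun_scale (c x) (p x)) \<in> sg_C"
      using p(1) V by (intro funs.subspace_sum[OF sg_C_subspace] sg_C_scale) auto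
    ultimately have "(\<Sum>x\<in>B. fun_scale (c x) (p x)) = 0" by (rule transplant_eq_0[rotated])
    then have "(\<Sum>x\<in>B. fun_scale (c x) (transplant w (p x))) = 0"
      unfolding transplant_sum[OF fin(1), symmetric] by (simp add: transplant_def fun_eq_iff)
    moreover have "(\<Sum>x\<in>B. fun_scale (c x) x) = (\<Sum>x\<in>B. fun_scale (c x) (transplant w (p x)))"
      by (rule sum.cong[OF refl]) (simp only: p(2)[symmetric])
    ultimately have "(\<Sum>x\<in>B. fun_scale (c x) x) = 0" by (simp only:)
    then show ?thesis using orthonormal_coeff[OF B(1) x, of c] by (simp add: sg_inner_def)
  qed
  have inj: "inj_on ?h B"
  proof (rule inj_onI, rule ccontr)
    fix x y assume xy: "x \<in> B" "y \<in> B" "?h x = ?h y" "x \<noteq> y"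
    let ?c = "\<lambda>z. if z = x then 1 else if z = y then -1 else (0::real)"
    have "(\<Sum>z\<in>B. fun_scale (?c z) (?h z)) = (\<Sum>z\<in>B. (if z = x then ?h x else 0) + (if z = y then - ?h x else 0))"
    proof (rule sum.cong[OF refl])
      fix z
      consider "z = x" | "z = y" "z \<noteq> x" | "z \<noteq> x" "z \<noteq> y" by blast
      then show "fun_scale (?c z) (?h z) = (if z = x then ?h x else 0) + (if z = y then - ?h x else 0)"
        using xy(3,4) by cases simp_all
    qed
    also have "\<dots> = 0" using fin xy by (simp add: sum.distrib)
    finally have "?c x = 0" using zero[of ?c x] xy(1) by blast
    then show False by simp
  qed
  have "funs.independent (?h ` B)"
  proof (rule funs.independent_if_scalars_zero)
    show "finite (?h ` B)" using fin by simp
    fix c y assume s: "(\<Sum>y\<in>?h ` B. fun_scale (c y) y) = 0" and y: "y \<in> ?h ` B"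
    obtain x where x: "x \<in> B" "y = ?h x" using y by blast
    have "(\<Sum>x\<in>B. fun_scale (c (?h x)) (?h x)) = 0" using s by (simp add: sum.reindex[OF inj])
    then show "c y = 0" using zero[of "\<lambda>x. c (?h x)" x] x by simp
  qed
  moreover have "?h ` B \<subseteq> funs.span B'" unfolding B'(2) using p(1) by blast
  ultimately have "card (?h ` B) \<le> card B'" using funs.independent_span_bound[OF fin(2)] by blast
  then show ?thesis using card_image[OF inj] by simp
qed

section \<open>The given eigenbasis, the projection and the matrix\<close>

lemma fun_diff_scale: "u - v = u + fun_scale (- 1) v"
  by (auto simp: fun_scale_def fun_eq_iff)

lemma sg_inner_commute: "sg_inner u v = sg_inner v u"
  by (simp add: sg_inner_def mult.commute)

lemma eigenbasis_facts:
  assumes onb: "sg_orthonormal_eigenbasis \<Lambda> b"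
  shows "\<And>i. i < sg_d \<Lambda> \<Longrightarrow> b i \<in> sg_E \<Lambda>" "\<And>i. i < sg_d \<Lambda> \<Longrightarrow> b i \<in> sg_C"
    "inj_on b {..<sg_d \<Lambda>}" "orthonormal (b ` {..<sg_d \<Lambda>})" "funs.span (b ` {..<sg_d \<Lambda>}) = sg_E \<Lambda>"
    "card (b ` {..<sg_d \<Lambda>}) = sg_d \<Lambda>"
proof -
  have on: "sg_inner (b i) (b j) = (if i = j then 1 else 0)" if "i < sg_d \<Lambda>" "j < sg_d \<Lambda>" for i j
    using onb that by (simp add: sg_orthonormal_eigenbasis_def)
  show sp: "funs.span (b ` {..<sg_d \<Lambda>}) = sg_E \<Lambda>" using onb by (simp add: sg_orthonormal_eigenbasis_def)
  show E: "b i \<in> sg_E \<Lambda>" if "i < sg_d \<Lambda>" for i unfolding sp[symmetric] using that by (intro funs.span_base) simp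
  show C: "b i \<in> sg_C" if "i < sg_d \<Lambda>" for i using E[OF that] sg_E_subset_C by blast
  show inj: "inj_on b {..<sg_d \<Lambda>}"
  proof (rule inj_onI, rule ccontr)
    fix i j assume "i \<in> {..<sg_d \<Lambda>}" "j \<in> {..<sg_d \<Lambda>}" "b i = b j" "i \<noteq> j"
    then show False using on[of i j] on[of i i] by simp
  qed
  show "orthonormal (b ` {..<sg_d \<Lambda>})"
    unfolding orthonormal_def
  proof (intro conjI ballI)
    fix x y assume "x \<in> b ` {..<sg_d \<Lambda>}" "y \<in> b ` {..<sg_d \<Lambda>}"
    then obtain i j where ij: "i < sg_d \<Lambda>" "j < sg_d \<Lambda>" "x = b i" "y = b j" by blast
    then have "b i = b j \<longleftrightarrow> i = j" using inj by (auto simp: inj_on_def)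
    then show "sg_inner x y = (if x = y then 1 else 0)" using on[OF ij(1,2)] ij(3,4) by simp
  qed (use C in auto)
  show "card (b ` {..<sg_d \<Lambda>}) = sg_d \<Lambda>" using card_image[OF inj] by simp
qed

text \<open>By Parseval, the inner product of u with itself is the sum of its squared
  coefficients.\<close>

lemma orthonormal_span_definite:
  assumes B: "orthonormal B" and u: "u \<in> funs.span B" "sg_inner u u = 0"
  shows "u = 0"
proof -
  have fin: "finite B" and C: "\<And>x. x \<in> B \<Longrightarrow> x \<in> sg_C" using B by (auto simp: orthonormal_def)
  have uC: "u \<in> sg_C" using u(1) funs.span_minimal[OF _ sg_C_subspace] C by blast
  let ?c = "\<lambda>x. sg_inner u x"
  have e: "u = (\<Sum>x\<in>B. fun_scale (?c x) x)" by (rule orthonormal_expand[OF B u(1)])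
  have "sg_inner (\<Sum>x\<in>B. fun_scale (?c x) x) u = (\<Sum>x\<in>B. ?c x * sg_inner x u)"
    unfolding sg_inner_wip[of _ u] by (rule wip_sum_left[OF continuous_on_const fin C uC])
  moreover have "sg_inner u u = sg_inner (\<Sum>x\<in>B. fun_scale (?c x) x) u" by (rule arg_cong[OF e, of "\<lambda>z. sg_inner z u"])
  moreover have "(\<Sum>x\<in>B. ?c x * sg_inner x u) = (\<Sum>x\<in>B. ?c x * ?c x)"
    by (rule sum.cong[OF refl]) (simp only: sg_inner_commute[of _ u])
  ultimately have s: "(\<Sum>x\<in>B. ?c x * ?c x) = 0" using u(2) by linarith
  have "?c x = 0" if "x \<in> B" for x
    using s that sum_nonneg_eq_0_iff[OF fin, of "\<lambda>x. ?c x * ?c x"] by simp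
  then have "(\<Sum>x\<in>B. fun_scale (?c x) x) = 0" by simp
  then show ?thesis by (rule trans[OF e])
qed

text \<open>The expansion in the eigenbasis has the required properties, and definiteness on
  \<open>sg_E \<Lambda>\<close> gives the uniqueness that the definite description demands.\<close>

lemma sg_P_props:
  assumes onb: "sg_orthonormal_eigenbasis \<Lambda> b" and u: "u \<in> sg_C"
  shows "sg_P \<Lambda> u \<in> sg_E \<Lambda>" "\<And>w. w \<in> sg_E \<Lambda> \<Longrightarrow> sg_inner (u - sg_P \<Lambda> u) w = 0"
proof -
  note facts = eigenbasis_facts[OF onb]
  define B where "B = b ` {..<sg_d \<Lambda>}"
  have B: "orthonormal B" "funs.span B = sg_E \<Lambda>" using facts by (auto simp: B_def)
  have fin: "finite B" and C: "\<And>x. x \<in> B \<Longrightarrow> x \<in> sg_C" using B(1) by (auto simp: orthonormal_def)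
  define v where "v = (\<Sum>x\<in>B. fun_scale (sg_inner u x) x)"
  have vE: "v \<in> sg_E \<Lambda>" unfolding v_def B(2)[symmetric] by (intro funs.span_sum funs.span_scale funs.span_base)
  have EC: "w \<in> sg_C" if "w \<in> sg_E \<Lambda>" for w using that sg_E_subset_C by blast
  have uv: "u - v \<in> sg_C" unfolding fun_diff_scale by (intro sg_C_add sg_C_scale u EC vE)
  have orth: "sg_inner (u - v) w = 0" if w: "w \<in> sg_E \<Lambda>" for w
  proof -
    have x0: "sg_inner x (u - v) = 0" if x: "x \<in> B" for x
    proof -
      have "sg_inner (u - v) x = sg_inner u x + (-1) * sg_inner v x"
        unfolding fun_diff_scale by (rule sg_inner_add_scale[OF u EC[OF vE] C[OF x]])
      also have "sg_inner v x = sg_inner u x" unfolding v_def by (rule orthonormal_coeff[OF B(1) x])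
      finally have "sg_inner (u - v) x = sg_inner u x + (-1) * sg_inner u x" .
      then have "sg_inner (u - v) x = 0" by linarith
      then show ?thesis by (subst sg_inner_commute)
    qed
    have "sg_inner (\<Sum>x\<in>B. fun_scale (sg_inner w x) x) (u - v) = (\<Sum>x\<in>B. sg_inner w x * sg_inner x (u - v))"
      unfolding sg_inner_wip[of _ "u - v"] by (rule wip_sum_left[OF continuous_on_const fin C uv])
    also have "\<dots> = 0" using x0 by simp
    finally have s: "sg_inner (\<Sum>x\<in>B. fun_scale (sg_inner w x) x) (u - v) = 0" .
    have "w \<in> funs.span B" using w B(2) by simp
    from arg_cong[OF orthonormal_expand[OF B(1) this], of "\<lambda>z. sg_inner z (u - v)"]
    have "sg_inner w (u - v) = 0" using s by (rule trans)
    then show ?thesis by (subst sg_inner_commute)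
  qed
  have uniq: "v' = v" if v': "v' \<in> sg_E \<Lambda>" "\<forall>w\<in>sg_E \<Lambda>. sg_inner (u - v') w = 0" for v'
  proof -
    define z where "z = v' - v"
    have zE: "z \<in> sg_E \<Lambda>" unfolding z_def using v'(1) vE sg_E_subspace by (rule funs.subspace_diff[rotated])
    have e: "u - v = (u - v') + fun_scale 1 z" by (auto simp: z_def fun_scale_def fun_eq_iff)
    have uv': "u - v' \<in> sg_C" unfolding fun_diff_scale by (intro sg_C_add sg_C_scale u EC v'(1))
    have "sg_inner (u - v) z = sg_inner ((u - v') + fun_scale 1 z) z" by (rule arg_cong[OF e])
    also have "\<dots> = sg_inner (u - v') z + 1 * sg_inner z z"
      by (rule sg_inner_add_scale[OF uv' EC[OF zE] EC[OF zE]])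
    finally have "sg_inner (u - v) z = sg_inner (u - v') z + 1 * sg_inner z z" .
    moreover have "sg_inner (u - v') z = 0" using v'(2) zE by (rule bspec)
    ultimately have "sg_inner z z = 0" using orth[OF zE] by linarith
    then have "z = 0" using orthonormal_span_definite[OF B(1)] zE B(2) by simp
    then show ?thesis by (simp add: z_def)
  qed
  have "sg_P \<Lambda> u = v"
    unfolding sg_P_def by (rule the_equality) (use vE orth uniq in blast)+
  then show "sg_P \<Lambda> u \<in> sg_E \<Lambda>" "\<And>w. w \<in> sg_E \<Lambda> \<Longrightarrow> sg_inner (u - sg_P \<Lambda> u) w = 0" using vE orth by simp_all
qed

text \<open>The projection fixes \<open>b j\<close> and disappears in the inner product with
  \<open>b i\<close>, so the matrix is a weighted Gram matrix.\<close>

lemma sg_M_eq: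
  assumes onb: "sg_orthonormal_eigenbasis \<Lambda> b" and f: "continuous_on SG f"
  shows "sg_M f \<Lambda> b = sqmat (sg_d \<Lambda>) (\<lambda>i j. wip f (b i) (b j))"
proof -
  note facts = eigenbasis_facts[OF onb]
  have Pb: "sg_P \<Lambda> (b j) = b j" if j: "j < sg_d \<Lambda>" for j
  proof -
    let ?z = "b j - sg_P \<Lambda> (b j)"
    have "?z \<in> sg_E \<Lambda>" using facts(1)[OF j] sg_P_props(1)[OF onb facts(2)[OF j]] sg_E_subspace
      by (rule funs.subspace_diff[rotated])
    then have "?z = 0"
      using sg_P_props(2)[OF onb facts(2)[OF j]] orthonormal_span_definite[OF facts(4), of ?z] facts(5) by simp
    then show ?thesis by simp
  qed
  have "sg_inner (sg_P \<Lambda> (mult_op f (b j))) (b i) = wip f (b i) (b j)" if i: "i < sg_d \<Lambda>" and j: "j < sg_d \<Lambda>" for i j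
  proof -
    let ?h = "mult_op f (b j)"
    have "continuous_on SG ?h" unfolding mult_op_def by (intro continuous_on_mult f sg_C_cont facts(2)[OF j])
    then have h: "?h \<in> sg_C" using sg_C_off[OF facts(2)[OF j]] by (simp add: sg_C_def mult_op_def)
    have PC: "sg_P \<Lambda> ?h \<in> sg_C" using sg_P_props(1)[OF onb h] sg_E_subset_C by blast
    have "0 = sg_inner (?h - sg_P \<Lambda> ?h) (b i)" by (rule sg_P_props(2)[OF onb h facts(1)[OF i], symmetric])
    also have "\<dots> = sg_inner ?h (b i) + (-1) * sg_inner (sg_P \<Lambda> ?h) (b i)"
      unfolding fun_diff_scale by (rule sg_inner_add_scale[OF h PC facts(2)[OF i]])
    finally have "sg_inner (sg_P \<Lambda> ?h) (b i) = sg_inner ?h (b i)" by simp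
    also have "\<dots> = wip f (b i) (b j)" by (simp add: sg_inner_def wip_def mult_op_def mult_ac)
    finally show ?thesis .
  qed
  then show ?thesis unfolding sg_M_def using Pb by (intro eq_matI) simp_all
qed

text \<open>Completing the square: the integral of the square of G - y over the cell c is
  nonnegative, and y lives in c, so the square of G has integral at least
  \<open>2 * 1 - 1 = 1\<close> over c. There f is at least \<open>exp t\<close>, and elsewhere the
  weighted integrand is nonnegative.\<close>

lemma wip_cell_lower:
  assumes f: "continuous_on SG f" and pos: "\<And>x. x \<in> SG \<Longrightarrow> f x > 0"
    and G: "G \<in> sg_C" and y: "y \<in> sg_C" "\<And>x. x \<notin> sg_cell c \<Longrightarrow> y x = 0" and c: "c \<in> sg_words k"
    and i: "sg_inner G y = 1" "sg_inner y y = 1" and t: "\<And>x. x \<in> sg_cell c \<Longrightarrow> t \<le> ln (f x)"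
  shows "exp t \<le> wip f G G"
proof -
  let ?I = "indicator (sg_cell c) :: real \<times> real \<Rightarrow> real"
  have iGy: "integrable sg_measure (\<lambda>x. G x * y x)" "integrable sg_measure (\<lambda>x. y x * y x)"
    by (intro continuous_integrable continuous_on_mult sg_C_cont G y(1))+
  have iGG: "integrable sg_measure (\<lambda>x. ?I x * (G x * G x))"
    by (intro cell_integrable[OF _ c] continuous_on_mult sg_C_cont G)
  have "0 \<le> (\<integral>x. ?I x * ((G x - y x) * (G x - y x)) \<partial>sg_measure)" by (rule integral_nonneg_AE) simp
  also have "(\<lambda>x. ?I x * ((G x - y x) * (G x - y x))) = (\<lambda>x. ?I x * (G x * G x) - (2 * (G x * y x) - y x * y x))"
  proof
    fix x show "?I x * ((G x - y x) * (G x - y x)) = ?I x * (G x * G x) - (2 * (G x * y x) - y x * y x)"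
      using y(2)[of x] by (cases "x \<in> sg_cell c") (simp_all add: algebra_simps)
  qed
  also have "(\<integral>x. ?I x * (G x * G x) - (2 * (G x * y x) - y x * y x) \<partial>sg_measure) =
      (\<integral>x. ?I x * (G x * G x) \<partial>sg_measure) - (2 * (\<integral>x. G x * y x \<partial>sg_measure) - (\<integral>x. y x * y x \<partial>sg_measure))"
    using iGy iGG by simp
  finally have one: "1 \<le> (\<integral>x. ?I x * (G x * G x) \<partial>sg_measure)" using i by (simp add: sg_inner_def)
  have "exp t * 1 \<le> exp t * (\<integral>x. ?I x * (G x * G x) \<partial>sg_measure)" using one by (intro mult_left_mono) auto
  also have "\<dots> = (\<integral>x. exp t * (?I x * (G x * G x)) \<partial>sg_measure)" by simp
  also have "\<dots> \<le> (\<integral>x. f x * (G x * G x) \<partial>sg_measure)"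
  proof (rule integral_mono_AE)
    show "integrable sg_measure (\<lambda>x. exp t * (?I x * (G x * G x)))" using iGG by simp
    show "integrable sg_measure (\<lambda>x. f x * (G x * G x))"
      by (intro continuous_integrable continuous_on_mult sg_C_cont G f)
    show "AE x in sg_measure. exp t * (?I x * (G x * G x)) \<le> f x * (G x * G x)"
    proof (rule AE_I2)
      fix x assume "x \<in> space sg_measure"
      then have x: "f x > 0" using pos space_sg_measure by auto
      show "exp t * (?I x * (G x * G x)) \<le> f x * (G x * G x)"
      proof (cases "x \<in> sg_cell c")
        case True
        have "exp t \<le> f x" using t[OF True] x by (metis exp_le_cancel_iff exp_ln)
        then show ?thesis using True by (simp add: mult_right_mono)
      next
        case False then show ?thesis using x by simp
      qed
    qed
  qed
  finally show ?thesis by (simp add: wip_def)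
qed

lemma wip_cell_upper:
  assumes f: "continuous_on SG f" and pos: "\<And>x. x \<in> SG \<Longrightarrow> f x > 0"
    and y: "y \<in> sg_C" "\<And>x. x \<notin> sg_cell c \<Longrightarrow> y x = 0"
    and i: "sg_inner y y = 1" and t: "\<And>x. x \<in> sg_cell c \<Longrightarrow> ln (f x) \<le> t"
  shows "wip f y y \<le> exp t"
proof -
  have "wip f y y \<le> (\<integral>x. exp t * (y x * y x) \<partial>sg_measure)"
    unfolding wip_def
  proof (rule integral_mono_AE)
    show "integrable sg_measure (\<lambda>x. f x * (y x * y x))" "integrable sg_measure (\<lambda>x. exp t * (y x * y x))"
      by (intro continuous_integrable continuous_on_mult sg_C_cont continuous_on_const y f)+
    show "AE x in sg_measure. f x * (y x * y x) \<le> exp t * (y x * y x)"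
    proof (rule AE_I2)
      fix x assume "x \<in> space sg_measure"
      then have x: "f x > 0" using pos space_sg_measure by auto
      show "f x * (y x * y x) \<le> exp t * (y x * y x)"
      proof (cases "x \<in> sg_cell c")
        case True
        have "f x \<le> exp t" using t[OF True] x by (metis exp_le_cancel_iff exp_ln)
        then show ?thesis by (simp add: mult_right_mono)
      qed (use y(2) in simp)
    qed
  qed
  also have "\<dots> = exp t" using i by (simp add: sg_inner_def)
  finally show ?thesis .
qed

lemma inner_disjoint_cells:
  assumes "w \<in> sg_words N" "w' \<in> sg_words N" "w \<noteq> w'"
    and u: "\<And>x. x \<notin> sg_cell w \<Longrightarrow> u x = 0" and v: "\<And>x. x \<notin> sg_cell w' \<Longrightarrow> v x = 0"
  shows "sg_inner u v = 0"
  unfolding sg_inner_def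
proof (rule integral_eq_zero_AE)
  show "AE x in sg_measure. u x * v x = 0"
    using AE_one_cell[of N]
  proof eventually_elim
    case (elim x)
    then obtain w0 where "\<forall>w\<in>sg_words N. indicator (sg_cell w) x = (if w = w0 then 1 else (0::real))" by blast
    then have "x \<notin> sg_cell w \<or> x \<notin> sg_cell w'" using assms(1-3) by (metis indicator_simps(1) zero_neq_one)
    then show ?case using u[of x] v[of x] by (metis mult_eq_0_iff)
  qed
qed

text \<open>Compares h with the step function that takes the value \<open>g w\<close> on the cell w,
  of mass \<open>(1/3) ^ N\<close>.\<close>

lemma integral_cell_approx:
  fixes g :: "nat list \<Rightarrow> real" and h :: "real \<times> real \<Rightarrow> real"
  assumes h: "continuous_on SG h" and g: "\<And>w x. w \<in> sg_words N \<Longrightarrow> x \<in> sg_cell w \<Longrightarrow> \<bar>h x - g w\<bar> \<le> \<delta>"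
  shows "\<bar>(\<integral>x. h x \<partial>sg_measure) - (\<Sum>w\<in>sg_words N. g w) / 3 ^ N\<bar> \<le> \<delta>"
proof -
  let ?s = "\<lambda>x. \<Sum>w\<in>sg_words N. g w * indicator (sg_cell w) x"
  have ind: "integrable sg_measure (\<lambda>x. indicator (sg_cell w) x :: real)" if "w \<in> sg_words N" for w
    using cell_integrable[OF continuous_on_const[of SG 1] that] by simp
  have isum: "integrable sg_measure ?s" using ind by (intro Bochner_Integration.integrable_sum integrable_mult_right) auto
  have "(\<integral>x. ?s x \<partial>sg_measure) = (\<Sum>w\<in>sg_words N. \<integral>x. g w * indicator (sg_cell w) x \<partial>sg_measure)"
    using ind by (intro Bochner_Integration.integral_sum integrable_mult_right) auto
  also have "\<dots> = (\<Sum>w\<in>sg_words N. g w * (1/3) ^ N)"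
  proof (rule sum.cong[OF refl])
    fix w assume w: "w \<in> sg_words N"
    have "sg_cell w \<inter> space sg_measure = sg_cell w" using sg_cell_subset[OF w] space_sg_measure by blast
    then show "(\<integral>x. g w * indicator (sg_cell w) x \<partial>sg_measure) = g w * (1/3) ^ N"
      using measure_sg_cell[OF w] by simp
  qed
  finally have int: "(\<integral>x. ?s x \<partial>sg_measure) = (\<Sum>w\<in>sg_words N. g w) / 3 ^ N"
    by (simp add: sum_divide_distrib power_one_over)
  have AE: "AE x in sg_measure. \<bar>h x - ?s x\<bar> \<le> \<delta>"
    using AE_one_cell[of N]
  proof eventually_elim
    case (elim x)
    then obtain w0 where w0: "w0 \<in> sg_words N" "\<And>w. w \<in> sg_words N \<Longrightarrow> indicator (sg_cell w) x = (if w = w0 then 1 else (0::real))" by blast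
    have "?s x = (\<Sum>w\<in>sg_words N. if w = w0 then g w else 0)" using w0(2) by (intro sum.cong) simp_all
    then have s: "?s x = g w0" using w0(1) by simp
    have "x \<in> sg_cell w0" using w0(2)[OF w0(1)] by (simp add: indicator_def split: if_splits)
    then show ?case using g[OF w0(1)] s by simp
  qed
  have ih: "integrable sg_measure (\<lambda>x. h x - ?s x)" using continuous_integrable[OF h] isum by simp
  have "(\<integral>x. h x - ?s x \<partial>sg_measure) \<le> \<delta>"
    by (rule sg_measure.integral_le_const[OF ih]) (use AE in \<open>eventually_elim; linarith\<close>)
  moreover have "- \<delta> \<le> (\<integral>x. h x - ?s x \<partial>sg_measure)"
    by (rule sg_measure.integral_ge_const[OF ih]) (use AE in \<open>eventually_elim; linarith\<close>)
  ultimately show ?thesis using continuous_integrable[OF h] isum int by (simp add: abs_le_iff)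
qed

text \<open>Orthonormal bases of the localized functions of all cells are joined, since functions
  from different cells are orthogonal, and extended to a basis of \<open>sg_E \<Lambda>\<close>. By
  \<open>sg_E_localize\<close> few functions have to be added.\<close>

lemma adapted_basis:
  assumes L: "\<Lambda> \<le> 3/2 * 5 ^ (N + m)" and onb: "sg_orthonormal_eigenbasis \<Lambda> b"
  obtains Bw B n where "\<And>w. w \<in> sg_words N \<Longrightarrow> card (Bw w) = n \<and> finite (Bw w)"
    "\<And>w x z. w \<in> sg_words N \<Longrightarrow> x \<in> Bw w \<Longrightarrow> z \<notin> sg_cell w \<Longrightarrow> x z = 0"
    "\<And>w w'. w \<in> sg_words N \<Longrightarrow> w' \<in> sg_words N \<Longrightarrow> w \<noteq> w' \<Longrightarrow> Bw w \<inter> Bw w' = {}"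
    "orthonormal B" "funs.span B = sg_E \<Lambda>" "(\<Union>w\<in>sg_words N. Bw w) \<subseteq> B" "card B = sg_d \<Lambda>"
    "card (B - (\<Union>w\<in>sg_words N. Bw w)) \<le> 18 * 2 ^ (N + m) * 3 ^ N"
proof -
  note facts = eigenbasis_facts[OF onb]
  define V where "V = profiles \<Lambda> N m"
  have V: "funs.subspace V" "V \<subseteq> sg_C" unfolding V_def using profiles_subset_C by (auto simp: profiles_def)
  let ?D = "b ` {..<sg_d \<Lambda>}"
  have D: "finite ?D" by simp
  have pd: "u = 0" if "u \<in> sg_E \<Lambda>" "sg_inner u u = 0" for u
    using orthonormal_span_definite[OF facts(4)] that facts(5) by blast
  have WE: "transplant w ` V \<subseteq> sg_E \<Lambda>" if "w \<in> sg_words N" for w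
    using transplant_profiles[OF that] by (auto simp: V_def)
  have e0: "orthonormal {}" by (simp add: orthonormal_def)
  have "\<exists>B'. orthonormal B' \<and> {} \<subseteq> B' \<and> B' \<subseteq> transplant w ` V \<and> funs.span B' = transplant w ` V"
    if w: "w \<in> sg_words N" for w
  proof (rule orthonormal_extend[OF transplant_subspace[OF V(1)] _ D _ _ e0])
    show "transplant w ` V \<subseteq> sg_C" using WE[OF w] sg_E_subset_C by (rule order_trans)
    show "transplant w ` V \<subseteq> funs.span ?D" using WE[OF w] facts(5) by simp
    show "u = 0" if "u \<in> transplant w ` V" "sg_inner u u = 0" for u using pd that WE[OF w] by blast
  qed simp
  then obtain Bw where Bw: "\<And>w. w \<in> sg_words N \<Longrightarrow> orthonormal (Bw w)"
    "\<And>w. w \<in> sg_words N \<Longrightarrow> Bw w \<subseteq> transplant w ` V" "\<And>w. w \<in> sg_words N \<Longrightarrow> funs.span (Bw w) = transplant w ` V" by metis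
  \<comment> \<open>The cell of the constant word 1 is the reference;
    \<open>transplant_card_le\<close> in both directions gives every cell the same number.\<close>
  define n where "n = card (Bw (replicate N 1))"
  have w1: "replicate N 1 \<in> sg_words N" by (auto simp: sg_words_iff)
  have card: "card (Bw w) = n \<and> finite (Bw w)" if w: "w \<in> sg_words N" for w
    using transplant_card_le[OF V Bw(1)[OF w] Bw(2)[OF w] Bw(1)[OF w1] Bw(3)[OF w1]]
      transplant_card_le[OF V Bw(1)[OF w1] Bw(2)[OF w1] Bw(1)[OF w] Bw(3)[OF w]] Bw(1)[OF w]
    by (simp add: n_def orthonormal_def)
  have supp: "x z = 0" if w: "w \<in> sg_words N" "x \<in> Bw w" "z \<notin> sg_cell w" for w x z
  proof -
    obtain p where "x = transplant w p" using Bw(2)[OF w(1)] w(2) by blast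
    then show ?thesis using transplant_outside[OF w(3)] by simp
  qed
  have cross: "sg_inner x y = 0" if "w \<in> sg_words N" "w' \<in> sg_words N" "w \<noteq> w'" "x \<in> Bw w" "y \<in> Bw w'" for w w' x y
    by (rule inner_disjoint_cells[OF that(1-3)]) (use supp that in blast)+
  have unit: "sg_inner x x = 1" if "w \<in> sg_words N" "x \<in> Bw w" for w x
    using Bw(1)[OF that(1)] that(2) by (simp add: orthonormal_def)
  have disj: "Bw w \<inter> Bw w' = {}" if "w \<in> sg_words N" "w' \<in> sg_words N" "w \<noteq> w'" for w w'
  proof (rule ccontr)
    assume "Bw w \<inter> Bw w' \<noteq> {}"
    then obtain x where "x \<in> Bw w" "x \<in> Bw w'" by blast
    then show False using cross[OF that] unit[OF that(1)] by fastforce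
  qed
  let ?B0 = "\<Union>w\<in>sg_words N. Bw w"
  have B0: "orthonormal ?B0"
    unfolding orthonormal_def
  proof (intro conjI ballI)
    show "finite ?B0" using card by auto
    show "?B0 \<subseteq> sg_C" using Bw(1) by (auto simp: orthonormal_def)
    fix x y assume "x \<in> ?B0" "y \<in> ?B0"
    then obtain w w' where ww: "w \<in> sg_words N" "w' \<in> sg_words N" "x \<in> Bw w" "y \<in> Bw w'" by blast
    show "sg_inner x y = (if x = y then 1 else 0)"
    proof (cases "w = w'")
      case True
      then show ?thesis using Bw(1)[OF ww(1)] ww(3,4) by (simp add: orthonormal_def)
    next
      case False
      then have "x \<noteq> y" using disj[OF ww(1,2)] ww(3,4) by blast
      then show ?thesis using cross[OF ww(1,2) False ww(3,4)] by simp
    qed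
  qed
  have B0E: "?B0 \<subseteq> sg_E \<Lambda>" using Bw(2) WE by blast
  have "\<exists>B'. orthonormal B' \<and> ?B0 \<subseteq> B' \<and> B' \<subseteq> sg_E \<Lambda> \<and> funs.span B' = sg_E \<Lambda>"
    by (rule orthonormal_extend[OF sg_E_subspace sg_E_subset_C D _ pd B0 B0E]) (simp_all add: facts(5))
  then obtain B where B: "orthonormal B" "?B0 \<subseteq> B" "B \<subseteq> sg_E \<Lambda>" "funs.span B = sg_E \<Lambda>" by blast
  have finB: "finite B" using B(1) by (simp add: orthonormal_def)
  have "card B \<le> card ?D" by (rule orthonormal_card_span[OF B(1) D]) (use B(3) facts(5) in simp)
  moreover have "card ?D \<le> card B" by (rule orthonormal_card_span[OF facts(4) finB]) (use facts(1) B(4) in auto)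
  ultimately have cB: "card B = sg_d \<Lambda>" using facts(6) by simp
  obtain X where X: "finite X" "card X \<le> 18 * 2 ^ (N + m) * 3 ^ N"
    "sg_E \<Lambda> \<subseteq> funs.span ((\<Union>w\<in>sg_words N. transplant w ` V) \<union> X)"
    using sg_E_localize[OF L] unfolding V_def by blast
  have finB0: "finite ?B0" using B0 by (simp add: orthonormal_def)
  have "transplant w ` V \<subseteq> funs.span (?B0 \<union> X)" if "w \<in> sg_words N" for w
    unfolding Bw(3)[OF that, symmetric] using that by (intro funs.span_mono) blast
  then have "(\<Union>w\<in>sg_words N. transplant w ` V) \<union> X \<subseteq> funs.span (?B0 \<union> X)"
    using funs.span_superset[of "?B0 \<union> X"] by blast
  then have "funs.span ((\<Union>w\<in>sg_words N. transplant w ` V) \<union> X) \<subseteq> funs.span (?B0 \<union> X)"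
    by (rule funs.span_minimal) simp
  then have "B \<subseteq> funs.span (?B0 \<union> X)" using B(3) X(3) by blast
  then have "card B \<le> card (?B0 \<union> X)" using finB0 X(1) by (intro orthonormal_card_span[OF B(1)]) simp
  also have "\<dots> \<le> card ?B0 + card X" by (rule card_Un_le)
  finally have "card (B - ?B0) \<le> card X" using card_Diff_subset[OF finB0 B(2)] by simp
  then have "card (B - ?B0) \<le> 18 * 2 ^ (N + m) * 3 ^ N" using X(2) by simp
  moreover note B(1,4,2) cB
  ultimately show thesis
  proof (intro that[of Bw n B])
    show "\<And>w. w \<in> sg_words N \<Longrightarrow> card (Bw w) = n \<and> finite (Bw w)" by (rule card)
    show "\<And>w x z. w \<in> sg_words N \<Longrightarrow> x \<in> Bw w \<Longrightarrow> z \<notin> sg_cell w \<Longrightarrow> x z = 0" by (rule supp)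
    show "\<And>w w'. w \<in> sg_words N \<Longrightarrow> w' \<in> sg_words N \<Longrightarrow> w \<noteq> w' \<Longrightarrow> Bw w \<inter> Bw w' = {}" by (rule disj)
  qed
qed

text \<open>By \<open>gram_det_bounds\<close> the logarithm of the determinant differs from the sum
  of cell values by at most \<delta> per localized function and K per remaining one. Each cell
  carries n functions, so that sum is n times the sum of g, which approximates the integral up to
  \<delta>.\<close>

lemma log_det_estimate:
  assumes L: "\<Lambda> \<le> 3/2 * 5 ^ (N + m)" and onb: "sg_orthonormal_eigenbasis \<Lambda> b"
    and f: "continuous_on SG f" and pos: "\<And>x. x \<in> SG \<Longrightarrow> f x > 0"
    and g: "\<And>w x. w \<in> sg_words N \<Longrightarrow> x \<in> sg_cell w \<Longrightarrow> \<bar>ln (f x) - g w\<bar> \<le> \<delta>"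
    and K: "\<And>x. x \<in> SG \<Longrightarrow> \<bar>ln (f x)\<bar> \<le> K"
  shows "\<bar>ln (Determinant.det (sg_M f \<Lambda> b)) - real (sg_d \<Lambda>) * (\<integral>x. ln (f x) \<partial>sg_measure)\<bar>
    \<le> 2 * \<delta> * real (sg_d \<Lambda>) + 2 * K * (18 * 2 ^ (N + m) * 3 ^ N)"
proof -
  note facts = eigenbasis_facts[OF onb]
  define d where "d = sg_d \<Lambda>"
  show ?thesis
  proof (rule adapted_basis[OF L onb])
  fix Bw :: "nat list \<Rightarrow> (real \<times> real \<Rightarrow> real) set" and B n
  assume ad: "\<And>w. w \<in> sg_words N \<Longrightarrow> card (Bw w) = n \<and> finite (Bw w)"
    "\<And>w x z. w \<in> sg_words N \<Longrightarrow> x \<in> Bw w \<Longrightarrow> z \<notin> sg_cell w \<Longrightarrow> x z = 0"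
    "\<And>w w'. w \<in> sg_words N \<Longrightarrow> w' \<in> sg_words N \<Longrightarrow> w \<noteq> w' \<Longrightarrow> Bw w \<inter> Bw w' = {}"
    "orthonormal B" "funs.span B = sg_E \<Lambda>" "(\<Union>w\<in>sg_words N. Bw w) \<subseteq> B" "card B = sg_d \<Lambda>"
    "card (B - (\<Union>w\<in>sg_words N. Bw w)) \<le> 18 * 2 ^ (N + m) * 3 ^ N"
  have cBd: "card B = d" using ad(7) by (simp add: d_def)
  let ?B0 = "\<Union>w\<in>sg_words N. Bw w"
  have finB: "finite B" and BC: "\<And>x. x \<in> B \<Longrightarrow> x \<in> sg_C" using ad(4) by (auto simp: orthonormal_def)
  have K0: "0 \<le> K" using K SG_nonempty abs_ge_zero order_trans by blast
  have w1: "replicate N 1 \<in> sg_words N" by (auto simp: sg_words_iff)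
  have "sg_cell (replicate N 1) \<noteq> {}" using SG_nonempty by (simp add: sg_cell_def)
  then have d0: "0 \<le> \<delta>" using g[OF w1] abs_ge_zero order_trans by blast
  obtain v where "bij_betw v {0..<card B} B" using ex_bij_betw_nat_finite[OF finB] by blast
  then have v: "bij_betw v {..<d} B" by (simp add: cBd atLeast0LessThan)
  have vB: "v i \<in> B" if "i < d" for i using v that by (auto simp: bij_betw_def)
  have vC: "v i \<in> sg_C" if "i < d" for i using BC vB[OF that] by blast
  have von: "sg_inner (v i) (v j) = (if i = j then 1 else 0)" if ij: "i < d" "j < d" for i j
  proof -
    have "v i = v j \<longleftrightarrow> i = j" using v ij by (auto simp: bij_betw_def inj_on_def)
    then show ?thesis using ad(4) vB[OF ij(1)] vB[OF ij(2)] by (simp add: orthonormal_def)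
  qed
  define a where "a i j = wip f (v i) (v j)" for i j
  have wl: "wip F (\<Sum>i<d. fun_scale (c i) (v i)) y = (\<Sum>i<d. c i * wip F (v i) y)"
    if "continuous_on SG F" "y \<in> sg_C" for F c y
    by (rule wip_sum_left[OF that(1) finite_lessThan _ that(2)]) (use vC in simp)
  have sumC: "(\<Sum>i<d. fun_scale (c i) (v i)) \<in> sg_C" for c
    using vC by (intro funs.subspace_sum[OF sg_C_subspace] sg_C_scale) simp
  have ww: "wip F (\<Sum>i<d. fun_scale (c i) (v i)) (\<Sum>j<d. fun_scale (c' j) (v j)) = (\<Sum>i<d. \<Sum>j<d. c i * c' j * wip F (v i) (v j))"
    if F: "continuous_on SG F" for F c c'
  proof -
    have "wip F (v i) (\<Sum>j<d. fun_scale (c' j) (v j)) = (\<Sum>j<d. c' j * wip F (v i) (v j))" if "i < d" for i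
      using wl[OF F vC[OF that], of c'] by (simp add: wip_commute)
    then show ?thesis unfolding wl[OF F sumC] by (simp add: sum_distrib_left mult.assoc)
  qed
  have one: "continuous_on SG (\<lambda>_. 1::real)" by (rule continuous_on_const)
  have detM: "Determinant.det (sg_M f \<Lambda> b) = Determinant.det (sqmat d a)"
    unfolding sg_M_eq[OF onb f] d_def[symmetric]
  proof (rule det_orthogonal_change)
    define Q where "Q k i = sg_inner (b i) (v k)" for k i
    have be: "b i = (\<Sum>k<d. fun_scale (Q k i) (v k))" if i: "i < d" for i
    proof -
      have "b i = (\<Sum>x\<in>B. fun_scale (sg_inner (b i) x) x)"
        using facts(1) i ad(5) by (intro orthonormal_expand[OF ad(4)]) (simp add: d_def)
      also have "\<dots> = (\<Sum>k<d. fun_scale (sg_inner (b i) (v k)) (v k))"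
        by (rule sum.reindex_bij_betw[OF v, symmetric])
      finally show ?thesis by (simp add: Q_def)
    qed
    show "(\<Sum>k<d. Q k i * Q k j) = (if i = j then 1 else 0)" if ij: "i < d" "j < d" for i j
    proof -
      have "sg_inner (b i) (b j) = (\<Sum>k<d. Q k i * wip (\<lambda>_. 1) (v k) (b j))"
        unfolding sg_inner_wip using wl[OF one, of "b j" "\<lambda>k. Q k i"] be[OF ij(1)] facts(2) ij by (simp add: d_def)
      also have "\<dots> = (\<Sum>k<d. Q k i * Q k j)" by (simp add: Q_def sg_inner_wip wip_commute)
      finally show ?thesis using onb ij by (simp add: sg_orthonormal_eigenbasis_def d_def)
    qed
    show "wip f (b i) (b j) = (\<Sum>k<d. \<Sum>l<d. Q k i * Q l j * a k l)" if "i < d" "j < d" for i j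
      unfolding a_def using ww[OF f, of "\<lambda>k. Q k i" "\<lambda>k. Q k j"] be[OF that(1)] be[OF that(2)] by simp
  qed
  \<comment> \<open>Centre h and radius e of an interval containing \<open>ln f\<close> on the
    support of a basis function. For functions that are not localized, the support is taken as
    \<open>SG\<close> and the interval as [-K, K].\<close>
  define h where "h x = (\<Sum>w\<in>sg_words N. if x \<in> Bw w then g w else 0)" for x
  define e where "e x = (if x \<in> ?B0 then \<delta> else K)" for x
  have hx: "h x = g w" if "w \<in> sg_words N" "x \<in> Bw w" for w x
  proof -
    have "h x = (\<Sum>w'\<in>sg_words N. if w' = w then g w else 0)"
      unfolding h_def using ad(3) that by (intro sum.cong) auto
    then show ?thesis using that(1) by simp
  qed
  have cell: "\<exists>k. \<exists>c\<in>sg_words k. (\<forall>z. z \<notin> sg_cell c \<longrightarrow> x z = 0) \<and> (\<forall>z\<in>sg_cell c. \<bar>ln (f z) - h x\<bar> \<le> e x)"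
    if x: "x \<in> B" for x
  proof (cases "x \<in> ?B0")
    case True
    then obtain w where w: "w \<in> sg_words N" "x \<in> Bw w" by blast
    then show ?thesis using ad(2)[OF w] g[OF w(1)] hx[OF w] True by (intro exI[of _ N] bexI[of _ w]) (auto simp: e_def)
  next
    case False
    then have "h x = 0" unfolding h_def by (intro sum.neutral) auto
    moreover have "sg_cell [] = SG" "[] \<in> sg_words 0" by (simp_all add: sg_cell_def sg_words_iff)
    ultimately show ?thesis using False K sg_C_off[OF BC[OF x]]
      by (intro exI[of _ 0] bexI[of _ "[]"]) (simp_all add: e_def)
  qed
  have bounds: "(\<Prod>i<d. exp (h (v i) - e (v i))) \<le> Determinant.det (sqmat d a) \<and>
      Determinant.det (sqmat d a) \<le> (\<Prod>i<d. exp (h (v i) + e (v i)))"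
  proof (rule gram_det_bounds)
    show "a i j = a j i" for i j by (simp add: a_def wip_commute)
    fix i assume i: "i < d"
    obtain k c where c: "c \<in> sg_words k" "\<And>z. z \<notin> sg_cell c \<Longrightarrow> v i z = 0"
      "\<And>z. z \<in> sg_cell c \<Longrightarrow> \<bar>ln (f z) - h (v i)\<bar> \<le> e (v i)" using cell[OF vB[OF i]] by blast
    have t: "h (v i) - e (v i) \<le> ln (f z)" "ln (f z) \<le> h (v i) + e (v i)" if "z \<in> sg_cell c" for z
      using c(3)[OF that] by linarith+
    show "a i i \<le> exp (h (v i) + e (v i))"
      unfolding a_def by (rule wip_cell_upper[OF f pos vC[OF i] c(2) _ t(2)]) (use von[OF i i] in simp_all)
    fix x :: "nat \<Rightarrow> real" assume x1: "x i = 1"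
    define G where "G = (\<Sum>j<d. fun_scale (x j) (v j))"
    have "quad d a x = wip f G G" unfolding quad_def a_def G_def using ww[OF f, of x x] by simp
    moreover have "sg_inner G (v i) = 1"
    proof -
      have "sg_inner G (v i) = (\<Sum>j<d. x j * sg_inner (v j) (v i))"
        unfolding sg_inner_wip G_def by (rule wl[OF one vC[OF i]])
      also have "\<dots> = (\<Sum>j<d. if j = i then x j else 0)" using von i by (intro sum.cong) auto
      finally show ?thesis using i x1 by simp
    qed
    then have "exp (h (v i) - e (v i)) \<le> wip f G G"
      using sumC von[OF i i] by (intro wip_cell_lower[OF f pos _ vC[OF i] c(2) c(1) _ _ t(1)]) (simp_all add: G_def)
    ultimately show "exp (h (v i) - e (v i)) \<le> quad d a x" by simp
  qed simp
  have Pexp: "(\<Prod>i<d. exp (F (v i))) = exp (\<Sum>x\<in>B. F x)" for F :: "_ \<Rightarrow> real"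
  proof -
    have "(\<Prod>i<d. exp (F (v i))) = exp (\<Sum>i<d. F (v i))" by (rule exp_sum[symmetric]) simp
    then show ?thesis by (simp only: sum.reindex_bij_betw[OF v, of F])
  qed
  define LD where "LD = ln (Determinant.det (sqmat d a))"
  have "exp (\<Sum>x\<in>B. h x - e x) \<le> Determinant.det (sqmat d a)" "Determinant.det (sqmat d a) \<le> exp (\<Sum>x\<in>B. h x + e x)"
    using bounds Pexp[of "\<lambda>x. h x - e x"] Pexp[of "\<lambda>x. h x + e x"] by simp_all
  moreover from this have "0 < Determinant.det (sqmat d a)" by (metis exp_gt_zero less_le_trans)
  then have "exp LD = Determinant.det (sqmat d a)" by (simp add: LD_def)
  ultimately have "exp (\<Sum>x\<in>B. h x - e x) \<le> exp LD" "exp LD \<le> exp (\<Sum>x\<in>B. h x + e x)" by simp_all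
  then have LDb: "(\<Sum>x\<in>B. h x - e x) \<le> LD" "LD \<le> (\<Sum>x\<in>B. h x + e x)"
    by (simp_all only: exp_le_cancel_iff)
  define r where "r = card (B - ?B0)"
  define GG where "GG = (\<Sum>w\<in>sg_words N. g w)"
  have sumh: "(\<Sum>x\<in>B. h x) = real n * GG"
  proof -
    have "(\<Sum>x\<in>B. h x) = (\<Sum>w\<in>sg_words N. \<Sum>x\<in>B. if x \<in> Bw w then g w else 0)"
      unfolding h_def by (rule sum.swap)
    also have "\<dots> = (\<Sum>w\<in>sg_words N. real n * g w)"
    proof (rule sum.cong[OF refl])
      fix w assume w: "w \<in> sg_words N"
      have "B \<inter> Bw w = Bw w" using ad(6) w by blast
      then show "(\<Sum>x\<in>B. if x \<in> Bw w then g w else 0) = real n * g w"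
        using ad(1)[OF w] sum.inter_restrict[OF finB, of "\<lambda>_. g w" "Bw w"] by simp
    qed
    finally show ?thesis by (simp add: GG_def sum_distrib_left)
  qed
  have cB0: "card ?B0 = n * 3 ^ N"
  proof -
    have "card ?B0 = (\<Sum>w\<in>sg_words N. card (Bw w))" using ad(1,3) by (intro card_UN_disjoint) auto
    also have "\<dots> = (\<Sum>w\<in>sg_words N. n)" using ad(1) by (intro sum.cong) auto
    finally show ?thesis by (simp add: card_sg_words)
  qed
  have finB0: "finite ?B0" using finB ad(6) by (rule finite_subset[rotated])
  have dn: "d = n * 3 ^ N + r"
    using card_Diff_subset[OF finB0 ad(6)] card_mono[OF finB ad(6)] cB0 cBd by (simp add: r_def)
  have sume: "(\<Sum>x\<in>B. e x) = real (n * 3 ^ N) * \<delta> + real r * K"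
  proof -
    have "(\<Sum>x\<in>B. e x) = (\<Sum>x\<in>B - ?B0. e x) + (\<Sum>x\<in>?B0. e x)" by (rule sum.subset_diff[OF ad(6) finB])
    also have "(\<Sum>x\<in>B - ?B0. e x) = (\<Sum>x\<in>B - ?B0. K)" by (intro sum.cong) (auto simp: e_def)
    also have "(\<Sum>x\<in>?B0. e x) = (\<Sum>x\<in>?B0. \<delta>)" by (intro sum.cong) (auto simp: e_def)
    finally show ?thesis using cB0 by (simp add: r_def)
  qed
  define I where "I = (\<integral>x. ln (f x) \<partial>sg_measure)"
  have lnf: "continuous_on SG (\<lambda>x. ln (f x))" using f pos by (intro continuous_on_ln) (auto simp: less_imp_neq[symmetric])
  have I1: "\<bar>I - GG / 3 ^ N\<bar> \<le> \<delta>" unfolding I_def GG_def by (rule integral_cell_approx[OF lnf g])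
  have IK: "\<bar>I\<bar> \<le> K"
  proof -
    have "I \<le> K" unfolding I_def
      by (rule sg_measure.integral_le_const[OF continuous_integrable[OF lnf]]) (use K space_sg_measure in \<open>auto simp: abs_le_iff\<close>)
    moreover have "- K \<le> I" unfolding I_def
      by (rule sg_measure.integral_ge_const[OF continuous_integrable[OF lnf]], rule AE_I2) (use K space_sg_measure in \<open>auto simp: abs_le_iff minus_le_iff\<close>)
    ultimately show ?thesis by simp
  qed
  \<comment> \<open>Three errors: the determinant against the cell values, the cell values against
    the integral, and the share of the integral for the r remaining functions. Each of \<delta> and
    K occurs twice, hence the factors 2.\<close>
  have s1: "\<bar>LD - real n * GG\<bar> \<le> real (n * 3 ^ N) * \<delta> + real r * K"
    using LDb sumh sume by (simp add: sum.distrib sum_subtractf abs_le_iff)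
  have s2: "\<bar>real n * GG - real (n * 3 ^ N) * I\<bar> \<le> real (n * 3 ^ N) * \<delta>"
  proof -
    have "real n * GG - real (n * 3 ^ N) * I = - (real (n * 3 ^ N) * (I - GG / 3 ^ N))" by (simp add: field_simps)
    then have "\<bar>real n * GG - real (n * 3 ^ N) * I\<bar> = real (n * 3 ^ N) * \<bar>I - GG / 3 ^ N\<bar>" by (simp add: abs_mult)
    also have "\<dots> \<le> real (n * 3 ^ N) * \<delta>" using I1 by (rule mult_left_mono) simp
    finally show ?thesis .
  qed
  have s3: "\<bar>real r * I\<bar> \<le> real r * K" unfolding abs_mult using IK by (simp add: mult_left_mono)
  have dI: "real d * I = real (n * 3 ^ N) * I + real r * I" unfolding dn by (simp add: algebra_simps)
  have "n * 3 ^ N \<le> d" by (simp add: dn)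
  then have "real (n * 3 ^ N) \<le> real d" by (rule of_nat_mono)
  then have t1: "real (n * 3 ^ N) * \<delta> \<le> real d * \<delta>" using d0 by (rule mult_right_mono)
  have "real r \<le> 18 * 2 ^ (N + m) * 3 ^ N"  proof -
    have "real r \<le> real (18 * 2 ^ (N + m) * 3 ^ N)" using ad(8) unfolding r_def[symmetric] by (rule of_nat_mono)
    then show ?thesis by simp
  qed
  then have t2: "real r * K \<le> (18 * 2 ^ (N + m) * 3 ^ N) * K" using K0 by (rule mult_right_mono)
  have "\<bar>LD - real d * I\<bar> \<le> 2 * (real d * \<delta>) + 2 * ((18 * 2 ^ (N + m) * 3 ^ N) * K)"
    using s1 s2 s3 t1 t2 unfolding dI by linarith
  then show ?thesis unfolding detM d_def[symmetric] LD_def[symmetric] I_def[symmetric] by (simp add: mult_ac)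
  qed
qed

section \<open>Growth of the dimension\<close>

text \<open>The copies of one localized eigenfunction in the \<open>3 ^ m\<close> cells have the
  common eigenvalue \<open>3/2 * 5 ^ (m + 2) * z\<close> and are independent, since the copies of a
  single point p separate them. The offset consists of j0, with \<open>z < 5 ^ j0\<close>, and the
  two starting levels.\<close>

lemma sg_d_lower:
  obtains j :: nat where "\<And>m \<Lambda> b. 3/2 * 5 ^ (m + j) \<le> \<Lambda> \<Longrightarrow> sg_orthonormal_eigenbasis \<Lambda> b \<Longrightarrow> 3 ^ m \<le> sg_d \<Lambda>"
proof -
  obtain v where v: "localizable 2 six_seq v" "v \<noteq> 0" by (rule localizable_exists)
  obtain z where z: "(\<lambda>k. 5 ^ k * six_seq k) \<longlonglongrightarrow> z" using six_seq_convergent unfolding convergent_def by blast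
  obtain j0 where j0: "z < 5 ^ j0" using real_arch_pow[of 5 z] by auto
  have "3 ^ m \<le> sg_d \<Lambda>" if \<Lambda>: "3/2 * 5 ^ (m + (j0 + 2)) \<le> \<Lambda>" and onb: "sg_orthonormal_eigenbasis \<Lambda> b" for m \<Lambda> b
  proof -
    note facts = eigenbasis_facts[OF onb]
    have vC: "v \<in> sg_C" using v(1) by (simp add: localizable_def)
    define t where "t = 3/2 * 5 ^ (m + 2) * z"
    have t: "t \<le> \<Lambda>"
    proof -
      have "3/2 * 5 ^ (m + 2) * z \<le> 3/2 * 5 ^ (m + 2) * 5 ^ j0" using j0 by (intro mult_left_mono) auto
      also have "\<dots> = 3/2 * 5 ^ (m + (j0 + 2))" by (simp add: power_add)
      finally show ?thesis unfolding t_def using \<Lambda> by (rule order_trans)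
    qed
    have lim: "(\<lambda>k. 5 ^ k * six_seq k) \<longlonglongrightarrow> 2/3 * t / 5 ^ (m + 2)" using z by (simp add: t_def)
    have nz: "transplant w v \<noteq> 0" for w using transplant_eq_0[OF vC] v(2) by blast
    have inE: "transplant w v \<in> sg_E \<Lambda>" if w: "w \<in> sg_words m" for w
    proof -
      have eig: "transplant w v \<in> sg_eig t" by (rule transplant_eig[OF v(1) w lim])
      then have "t \<in> sg_eigenvalues \<Lambda>" using nz t unfolding sg_eig_iff sg_eigenvalues_def by blast
      then show ?thesis unfolding sg_E_eq using eig by (intro funs.span_base) blast
    qed
    let ?h = "\<lambda>w. transplant w v"
    obtain p where p: "p \<in> SG" "v p \<noteq> 0" using v(2) sg_C_off[OF vC] by (metis ext zero_fun_apply)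
    have v0: "\<And>i. i \<in> sg_alph \<Longrightarrow> v (sg_corner i) = 0" using v(1) by (simp add: localizable_def)
    have val: "?h w (sg_word_map w' p) = (if w = w' then v p else 0)" if "w \<in> sg_words m" "w' \<in> sg_words m" for w w'
      using transplant_val[of v w m w' p] v0 that p(1) by (auto simp: sg_words_iff)
    have inj: "inj_on ?h (sg_words m)"
    proof (rule inj_onI, rule ccontr)
      fix w w' assume w: "w \<in> sg_words m" "w' \<in> sg_words m" "?h w = ?h w'" "w \<noteq> w'"
      then show False using val[OF w(1,1)] val[OF w(2,1)] p(2) by simp
    qed
    have "funs.independent (?h ` sg_words m)"
    proof (rule funs.independent_if_scalars_zero)
      fix c y assume s: "(\<Sum>y\<in>?h ` sg_words m. fun_scale (c y) y) = 0" and y: "y \<in> ?h ` sg_words m"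
      obtain w where w: "w \<in> sg_words m" "y = ?h w" using y by blast
      have "(\<Sum>w\<in>sg_words m. fun_scale (c (?h w)) (?h w)) = 0" using s by (simp add: sum.reindex[OF inj])
      then have "(\<Sum>w'\<in>sg_words m. fun_scale (c (?h w')) (?h w')) (sg_word_map w p) = 0" by simp
      then have "(\<Sum>w'\<in>sg_words m. c (?h w') * ?h w' (sg_word_map w p)) = 0" by (simp add: sum_fun_apply fun_scale_def)
      moreover have "(\<Sum>w'\<in>sg_words m. c (?h w') * ?h w' (sg_word_map w p)) = (\<Sum>w'\<in>sg_words m. if w' = w then c (?h w) * v p else 0)"
        using val w(1) by (intro sum.cong) auto
      ultimately show "c y = 0" using w p(2) by simp
    qed simp
    moreover have "?h ` sg_words m \<subseteq> funs.span (b ` {..<sg_d \<Lambda>})" using inE facts(5) by auto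
    ultimately have "card (?h ` sg_words m) \<le> card (b ` {..<sg_d \<Lambda>})"
      using funs.independent_span_bound[of "b ` {..<sg_d \<Lambda>}"] by simp
    then show ?thesis using card_image[OF inj] facts(6) card_sg_words by simp
  qed
  then show thesis by (rule that[of "j0 + 2"])
qed

lemma sg_d_upper:
  assumes "\<Lambda> \<le> 3/2 * 5 ^ M" "sg_orthonormal_eigenbasis \<Lambda> b"
  shows "sg_d \<Lambda> \<le> 3 * 3 ^ M"
proof -
  note facts = eigenbasis_facts[OF assms(2)]
  obtain B where B: "finite B" "card B \<le> 3 * 3 ^ M" "sg_E \<Lambda> \<subseteq> funs.span B" using sg_E_dim_le[OF assms(1)] by blast
  have "card (b ` {..<sg_d \<Lambda>}) \<le> card B"
    by (rule orthonormal_card_span[OF facts(4) B(1)]) (use facts(1) B(3) in auto)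
  then show ?thesis using facts(6) B(2) by simp
qed

text \<open>Below the threshold of this level all decimation parameters lie in [0,1]; for large
  \<Lambda>, minimality makes \<open>5 ^ level \<Lambda>\<close> comparable to \<Lambda>.\<close>

definition level :: "real \<Rightarrow> nat" where
  "level \<Lambda> = (LEAST M. \<Lambda> \<le> 3/2 * 5 ^ M)"

lemma level_upper: "\<Lambda> \<le> 3/2 * 5 ^ level \<Lambda>"
  unfolding level_def
proof (rule LeastI_ex)
  obtain M where "\<Lambda> < 5 ^ M" using real_arch_pow[of 5 \<Lambda>] by auto
  moreover have "(5::real) ^ M \<le> 3/2 * 5 ^ M" by simp
  ultimately show "\<exists>M. \<Lambda> \<le> 3/2 * 5 ^ M" by (intro exI[of _ M]) linarith
qed

lemma level_lower: "M < level \<Lambda> \<Longrightarrow> 3/2 * 5 ^ M < \<Lambda>"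
  unfolding level_def using not_less_Least[of M "\<lambda>M. \<Lambda> \<le> 3/2 * 5 ^ M"] by simp

lemma level_at_top: "filterlim level at_top at_top"
  unfolding filterlim_at_top
proof
  fix Z :: nat
  show "\<forall>\<^sub>F \<Lambda> in at_top. Z \<le> level \<Lambda>"
    using eventually_gt_at_top[of "3/2 * 5 ^ Z :: real"]
  proof eventually_elim
    case (elim \<Lambda>)
    show ?case
    proof (rule ccontr)
      assume "\<not> Z \<le> level \<Lambda>"
      then have "(5::real) ^ level \<Lambda> \<le> 5 ^ Z" by (intro power_increasing) auto
      then show False using level_upper[of \<Lambda>] elim by linarith
    qed
  qed
qed

section \<open>The limit theorem\<close>

text \<open>At level \<open>M\<close>, localization to the cells of level \<open>N\<close> costs a fraction
  \<open>3 ^ N * (2/3) ^ M\<close> of the eigenfunctions.\<close>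

lemma szego_estimate:
  fixes f :: "real \<times> real \<Rightarrow> real"
  assumes f: "continuous_on SG f" and pos: "\<And>x. x \<in> SG \<Longrightarrow> f x > 0"
    and b: "\<And>\<Lambda>. \<Lambda> > 0 \<Longrightarrow> sg_orthonormal_eigenbasis \<Lambda> (b \<Lambda>)"
  obtains C where "C \<ge> 0" "\<forall>\<^sub>F \<Lambda> in at_top. 0 < sg_d \<Lambda> \<and> real (sg_d \<Lambda>) \<le> 3 * 3 ^ level \<Lambda> \<and>
    (\<forall>N \<delta>. N \<le> level \<Lambda> \<longrightarrow> (\<forall>w\<in>sg_words N. \<forall>x\<in>sg_cell w. \<forall>y\<in>sg_cell w. \<bar>ln (f x) - ln (f y)\<bar> \<le> \<delta>) \<longrightarrow>
      \<bar>1 / real (sg_d \<Lambda>) * ln (Determinant.det (sg_M f \<Lambda> (b \<Lambda>))) - (\<integral>x. ln (f x) \<partial>sg_measure)\<bar>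
        \<le> 2 * \<delta> + C * 3 ^ N * (2/3) ^ level \<Lambda>)"
proof -
  obtain j :: nat where j: "\<And>m \<Lambda> b. 3/2 * 5 ^ (m + j) \<le> \<Lambda> \<Longrightarrow> sg_orthonormal_eigenbasis \<Lambda> b \<Longrightarrow> 3 ^ m \<le> sg_d \<Lambda>"
    using sg_d_lower by blast
  have lnf: "continuous_on SG (\<lambda>x. ln (f x))" using f pos by (intro continuous_on_ln) (auto simp: less_imp_neq[symmetric])
  have "bounded ((\<lambda>x. ln (f x)) ` SG)" using compact_continuous_image[OF lnf SG_compact] compact_imp_bounded by blast
  then obtain K where K: "K > 0" "\<And>x. x \<in> SG \<Longrightarrow> \<bar>ln (f x)\<bar> \<le> K" unfolding bounded_pos by auto
  \<comment> \<open>36 is twice the 18 of \<open>sg_E_localize\<close>. The factor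
    \<open>3 ^ (j + 1)\<close> is lost when \<open>3 ^ M\<close> is compared with the dimension: j
    levels by \<open>sg_d_lower\<close>, and one because \<Lambda> exceeds the threshold of level M
    - 1 only.\<close>
  define C where "C = 36 * K * 3 ^ (j + 1)"
  have "C \<ge> 0" using K by (simp add: C_def)
  moreover have "\<forall>\<^sub>F \<Lambda> in at_top. 0 < sg_d \<Lambda> \<and> real (sg_d \<Lambda>) \<le> 3 * 3 ^ level \<Lambda> \<and>
    (\<forall>N \<delta>. N \<le> level \<Lambda> \<longrightarrow> (\<forall>w\<in>sg_words N. \<forall>x\<in>sg_cell w. \<forall>y\<in>sg_cell w. \<bar>ln (f x) - ln (f y)\<bar> \<le> \<delta>) \<longrightarrow>
      \<bar>1 / real (sg_d \<Lambda>) * ln (Determinant.det (sg_M f \<Lambda> (b \<Lambda>))) - (\<integral>x. ln (f x) \<partial>sg_measure)\<bar>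
        \<le> 2 * \<delta> + C * 3 ^ N * (2/3) ^ level \<Lambda>)"
    using eventually_gt_at_top[of "0::real"] level_at_top[unfolded filterlim_at_top, THEN spec, of "j + 1"]
  proof eventually_elim
    case (elim \<Lambda>)
    define M where "M = level \<Lambda>"
    define d where "d = sg_d \<Lambda>"
    have onb: "sg_orthonormal_eigenbasis \<Lambda> (b \<Lambda>)" by (rule b[OF elim(1)])
    have M: "M = (M - (j + 1) + j) + 1" using elim(2) by (simp add: M_def)
    have "3/2 * 5 ^ (M - (j + 1) + j) < \<Lambda>" by (rule level_lower) (use M in \<open>simp add: M_def\<close>)
    then have "3 ^ (M - (j + 1)) \<le> d" unfolding d_def by (intro j[OF _ onb]) simp
    then have "real (3 ^ (M - (j + 1))) \<le> real d" by (rule of_nat_mono)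
    then have dl: "(3::real) ^ (M - (j + 1)) \<le> real d" by simp
    have "(M - (j + 1)) + (j + 1) = M" using elim(2) by (simp add: M_def)
    then have "(3::real) ^ M = 3 ^ (M - (j + 1)) * 3 ^ (j + 1)" by (metis power_add)
    also have "\<dots> \<le> real d * 3 ^ (j + 1)" using dl by (rule mult_right_mono) simp
    finally have dM: "(3::real) ^ M \<le> real d * 3 ^ (j + 1)" .
    have d0: "0 < real d" using dl by (rule less_le_trans[rotated]) simp
    have "sg_d \<Lambda> \<le> 3 * 3 ^ M" unfolding M_def by (rule sg_d_upper[OF level_upper onb])
    then have "real d \<le> real (3 * 3 ^ M)" unfolding d_def by (rule of_nat_mono)
    then have du: "real d \<le> 3 * 3 ^ M" by simp
    have est: "\<bar>1 / real d * ln (Determinant.det (sg_M f \<Lambda> (b \<Lambda>))) - (\<integral>x. ln (f x) \<partial>sg_measure)\<bar>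
        \<le> 2 * \<delta> + C * 3 ^ N * (2/3) ^ M"
      if N: "N \<le> M" and osc: "\<And>w x y. w \<in> sg_words N \<Longrightarrow> x \<in> sg_cell w \<Longrightarrow> y \<in> sg_cell w \<Longrightarrow> \<bar>ln (f x) - ln (f y)\<bar> \<le> \<delta>" for N \<delta>
    proof -
      define LD where "LD = ln (Determinant.det (sg_M f \<Lambda> (b \<Lambda>)))"
      define I where "I = (\<integral>x. ln (f x) \<partial>sg_measure)"
      have NM: "N + (M - N) = M" using N by simp
      have c1: "sg_word_map w (sg_corner 1) \<in> sg_cell w" for w
        unfolding sg_cell_def using sg_corner_SG[OF sg_alph_mem(1)] by blast
      have L: "\<Lambda> \<le> 3/2 * 5 ^ (N + (M - N))" unfolding NM unfolding M_def by (rule level_upper)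
      have "\<bar>LD - real d * I\<bar> \<le> 2 * \<delta> * real d + 2 * K * (18 * 2 ^ (N + (M - N)) * 3 ^ N)"
        unfolding LD_def d_def I_def
        by (rule log_det_estimate[OF L onb f pos, where g = "\<lambda>w. ln (f (sg_word_map w (sg_corner 1)))"])
          (use osc c1 K(2) in auto)
      then have e1: "\<bar>LD - real d * I\<bar> \<le> 2 * \<delta> * real d + 36 * K * 3 ^ N * 2 ^ M" unfolding NM by (simp add: mult_ac)
      have "36 * K * 3 ^ N * 2 ^ M = 36 * K * 3 ^ N * ((2/3) ^ M * 3 ^ M)" by (simp flip: power_mult_distrib)
      also have "\<dots> \<le> 36 * K * 3 ^ N * ((2/3) ^ M * (real d * 3 ^ (j + 1)))"
        using dM K by (intro mult_left_mono) auto
      also have "\<dots> = (C * 3 ^ N * (2/3) ^ M) * real d" by (simp only: C_def mult_ac)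
      finally have "\<bar>LD - real d * I\<bar> \<le> (2 * \<delta> + C * 3 ^ N * (2/3) ^ M) * real d"
        using e1 by (simp only: distrib_right)
      moreover have "1 / real d * LD - I = (LD - real d * I) / real d" using d0 by (simp add: diff_divide_distrib)
      ultimately show ?thesis using d0 unfolding LD_def[symmetric] I_def[symmetric]
        by (simp add: abs_divide pos_divide_le_eq)
    qed
    show ?case
    proof (intro conjI allI impI)
      show "0 < sg_d \<Lambda>" using d0 by (simp add: d_def)
      show "real (sg_d \<Lambda>) \<le> 3 * 3 ^ level \<Lambda>" using du by (simp add: d_def M_def)
    next
      fix N \<delta> assume "N \<le> level \<Lambda>" "\<forall>w\<in>sg_words N. \<forall>x\<in>sg_cell w. \<forall>y\<in>sg_cell w. \<bar>ln (f x) - ln (f y)\<bar> \<le> \<delta>"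
      then show "\<bar>1 / real (sg_d \<Lambda>) * ln (Determinant.det (sg_M f \<Lambda> (b \<Lambda>))) - (\<integral>x. ln (f x) \<partial>sg_measure)\<bar>
          \<le> 2 * \<delta> + C * 3 ^ N * (2/3) ^ level \<Lambda>"
        unfolding d_def[symmetric] M_def[symmetric] by (intro est) blast+
    qed
  qed
  ultimately show thesis by (rule that)
qed

section \<open>Oscillation on cells\<close>

lemma cell_osc_continuous:
  fixes h :: "real \<times> real \<Rightarrow> real"
  assumes h: "continuous_on SG h" and e: "e > 0"
  obtains N where "\<And>w x y. w \<in> sg_words N \<Longrightarrow> x \<in> sg_cell w \<Longrightarrow> y \<in> sg_cell w \<Longrightarrow> \<bar>h x - h y\<bar> \<le> e"
proof -
  obtain \<eta> where \<eta>: "\<eta> > 0" "\<And>x y. x \<in> SG \<Longrightarrow> y \<in> SG \<Longrightarrow> dist y x < \<eta> \<Longrightarrow> dist (h y) (h x) < e"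
    using compact_uniformly_continuous[OF h SG_compact] e unfolding uniformly_continuous_on_def by metis
  obtain B where B: "\<And>p q. p \<in> SG \<Longrightarrow> q \<in> SG \<Longrightarrow> dist p q \<le> B"
    using compact_imp_bounded[OF SG_compact] bounded_two_points by metis
  have "B \<ge> 0" using B[OF sg_corner_SG[OF sg_alph_mem(1)] sg_corner_SG[OF sg_alph_mem(1)]] by simp
  obtain N where N: "B / \<eta> < 2 ^ N" using real_arch_pow[of 2 "B / \<eta>"] by auto
  have "\<bar>h x - h y\<bar> \<le> e" if w: "w \<in> sg_words N" and x: "x \<in> sg_cell w" and y: "y \<in> sg_cell w" for w x y
  proof -
    obtain p q where pq: "p \<in> SG" "q \<in> SG" "x = sg_word_map w p" "y = sg_word_map w q"
      using x y unfolding sg_cell_def by blast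
    have "dist x y = dist p q / 2 ^ N" using pq w by (simp add: dist_sg_word_map sg_words_iff)
    also have "\<dots> \<le> B / 2 ^ N" using B[OF pq(1,2)] by (intro divide_right_mono) auto
    also have "\<dots> < \<eta>" using N \<eta>(1) by (simp add: field_simps)
    finally have "dist x y < \<eta>" .
    moreover have "x \<in> SG" "y \<in> SG" using x y sg_cell_subset[OF w] by blast+
    ultimately have "dist (h x) (h y) < e" using \<eta>(2)[of y x] by blast
    then show ?thesis by (simp add: dist_real_def)
  qed
  then show thesis by (rule that)
qed

text \<open>A cell of level N has resistance diameter of order \<open>(3/5) ^ N\<close>, and on the
  values of f, which are at least their minimum \<open>\<mu>0\<close>, the logarithm is Lipschitz
  with constant \<open>1 / \<mu>0\<close>.\<close>

lemma cell_osc_holder: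
  fixes f :: "real \<times> real \<Rightarrow> real"
  assumes f: "continuous_on SG f" and pos: "\<And>x. x \<in> SG \<Longrightarrow> f x > 0" and a: "\<alpha> > 0" and h: "sg_holder \<alpha> f"
  obtains A where "A \<ge> 0" "\<And>N w x y. w \<in> sg_words N \<Longrightarrow> x \<in> sg_cell w \<Longrightarrow> y \<in> sg_cell w \<Longrightarrow>
    \<bar>ln (f x) - ln (f y)\<bar> \<le> A * ((3/5) ^ N) powr \<alpha>"
proof -
  obtain c where c: "c > 0" "\<And>n w x y. w \<in> sg_words n \<Longrightarrow> x \<in> sg_cell w \<Longrightarrow> y \<in> sg_cell w \<Longrightarrow>
    0 \<le> sg_resistance x y \<and> sg_resistance x y \<le> c * (3/5) ^ n" using sg_resistance_cell_bound by blast
  obtain H where H: "\<And>x y. x \<in> SG \<Longrightarrow> y \<in> SG \<Longrightarrow> \<bar>f x - f y\<bar> \<le> H * sg_resistance x y powr \<alpha>"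
    using h unfolding sg_holder_def by blast
  obtain x0 where x0: "x0 \<in> SG" "\<And>y. y \<in> SG \<Longrightarrow> f x0 \<le> f y"
    using continuous_attains_inf[OF SG_compact SG_nonempty f] by blast
  define \<mu>0 where "\<mu>0 = f x0"
  have m0: "\<mu>0 > 0" using pos[OF x0(1)] by (simp add: \<mu>0_def)
  define A where "A = \<bar>H\<bar> * c powr \<alpha> / \<mu>0"
  have "A \<ge> 0" using m0 by (simp add: A_def)
  moreover have "\<bar>ln (f x) - ln (f y)\<bar> \<le> A * ((3/5) ^ N) powr \<alpha>"
    if w: "w \<in> sg_words N" and x: "x \<in> sg_cell w" and y: "y \<in> sg_cell w" for N w x y
  proof -
    have S: "x \<in> SG" "y \<in> SG" using x y sg_cell_subset[OF w] by blast+
    have fxy: "\<mu>0 \<le> f x" "\<mu>0 \<le> f y" using x0(2) S by (auto simp: \<mu>0_def)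
    have one: "ln p - ln q \<le> \<bar>p - q\<bar> / \<mu>0" if "\<mu>0 \<le> p" "\<mu>0 \<le> q" for p q
    proof -
      have pq: "p > 0" "q > 0" using that m0 by auto
      have "ln p - ln q = ln (p / q)" using pq by (simp add: ln_div)
      also have "\<dots> \<le> p / q - 1" using pq by (intro ln_le_minus_one) simp
      also have "\<dots> = (p - q) / q" using pq by (simp add: field_simps)
      also have "\<dots> \<le> \<bar>p - q\<bar> / q" using pq by (intro divide_right_mono) auto
      also have "\<dots> \<le> \<bar>p - q\<bar> / \<mu>0" using pq m0 that by (intro divide_left_mono) auto
      finally show ?thesis .
    qed
    have "\<bar>ln (f x) - ln (f y)\<bar> \<le> \<bar>f x - f y\<bar> / \<mu>0"
      using one[OF fxy] one[OF fxy(2,1)] by (simp add: abs_le_iff abs_minus_commute)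
    also have "\<dots> \<le> \<bar>H\<bar> * (c * (3/5) ^ N) powr \<alpha> / \<mu>0"
    proof (rule divide_right_mono)
      have r: "0 \<le> sg_resistance x y" "sg_resistance x y \<le> c * (3/5) ^ N" using c(2)[OF w x y] by auto
      have "\<bar>f x - f y\<bar> \<le> H * sg_resistance x y powr \<alpha>" by (rule H[OF S])
      also have "\<dots> \<le> \<bar>H\<bar> * sg_resistance x y powr \<alpha>" by (intro mult_right_mono) auto
      also have "\<dots> \<le> \<bar>H\<bar> * (c * (3/5) ^ N) powr \<alpha>" using r a by (intro mult_left_mono powr_mono2) auto
      finally show "\<bar>f x - f y\<bar> \<le> \<bar>H\<bar> * (c * (3/5) ^ N) powr \<alpha>" .
    qed (use m0 in simp)
    also have "\<dots> = A * ((3/5) ^ N) powr \<alpha>" using c(1) by (simp add: A_def powr_mult)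
    finally show ?thesis .
  qed
  ultimately show thesis by (rule that)
qed

theorem theorem2:
  fixes f :: "real \<times> real \<Rightarrow> real"
    and b :: "real \<Rightarrow> nat \<Rightarrow> real \<times> real \<Rightarrow> real"
  assumes "continuous_on SG f"
    and "\<And>x. x \<in> SG \<Longrightarrow> f x > 0"
    and "\<And>\<Lambda>. \<Lambda> > 0 \<Longrightarrow> sg_orthonormal_eigenbasis \<Lambda> (b \<Lambda>)"
  shows
    "((\<lambda>\<Lambda>. 1 / real (sg_d \<Lambda>) * ln (Determinant.det (sg_M f \<Lambda> (b \<Lambda>))))
        \<longlongrightarrow> (\<integral>x. ln (f x) \<partial>sg_measure)) at_top \<and>
     (\<forall>\<alpha>>0. sg_holder \<alpha> f \<longrightarrow>
        (\<lambda>\<Lambda>. 1 / real (sg_d \<Lambda>) * ln (Determinant.det (sg_M f \<Lambda> (b \<Lambda>)))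
              - (\<integral>x. ln (f x) \<partial>sg_measure))
        \<in> O[at_top](\<lambda>\<Lambda>. real (sg_d \<Lambda>) powr
             - ((\<alpha> * ln (5/3) / (ln 3 + \<alpha> * ln (5/3))) * (1 - ln 2 / ln 3))))"
proof -
  define R where "R \<Lambda> = 1 / real (sg_d \<Lambda>) * ln (Determinant.det (sg_M f \<Lambda> (b \<Lambda>)))" for \<Lambda>
  define I where "I = (\<integral>x. ln (f x) \<partial>sg_measure)"
  obtain C where C: "C \<ge> 0" and ev: "\<forall>\<^sub>F \<Lambda> in at_top. 0 < sg_d \<Lambda> \<and> real (sg_d \<Lambda>) \<le> 3 * 3 ^ level \<Lambda> \<and>
    (\<forall>N \<delta>. N \<le> level \<Lambda> \<longrightarrow> (\<forall>w\<in>sg_words N. \<forall>x\<in>sg_cell w. \<forall>y\<in>sg_cell w. \<bar>ln (f x) - ln (f y)\<bar> \<le> \<delta>) \<longrightarrow>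
      \<bar>R \<Lambda> - I\<bar> \<le> 2 * \<delta> + C * 3 ^ N * (2/3) ^ level \<Lambda>)"
    unfolding R_def I_def using szego_estimate[of f b, OF assms] by blast
  have lnf: "continuous_on SG (\<lambda>x. ln (f x))"
    using assms(1,2) by (intro continuous_on_ln) (auto simp: less_imp_neq[symmetric])
  have "(R \<longlongrightarrow> I) at_top"
  proof (rule tendstoI)
    fix e :: real assume e: "e > 0"
    then have "e / 4 > 0" by simp
    \<comment> \<open>N is fixed by the oscillation alone; afterwards the level grows and the second
      error tends to 0.\<close>
    obtain N where N: "\<And>w x y. w \<in> sg_words N \<Longrightarrow> x \<in> sg_cell w \<Longrightarrow> y \<in> sg_cell w \<Longrightarrow> \<bar>ln (f x) - ln (f y)\<bar> \<le> e / 4"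
      using cell_osc_continuous[OF lnf \<open>e / 4 > 0\<close>] by blast
    have "(\<lambda>M. C * 3 ^ N * (2/3) ^ M) \<longlonglongrightarrow> C * 3 ^ N * 0"
      by (intro tendsto_mult_left LIMSEQ_realpow_zero) auto
    then have "\<forall>\<^sub>F M in sequentially. C * 3 ^ N * (2/3) ^ M < e / 2"
      by (rule order_tendstoD(2)) (use e in simp)
    then have "\<forall>\<^sub>F M in sequentially. N \<le> M \<and> C * 3 ^ N * (2/3) ^ M < e / 2"
      using eventually_ge_at_top[of N] by eventually_elim simp
    then have "\<forall>\<^sub>F \<Lambda> in at_top. N \<le> level \<Lambda> \<and> C * 3 ^ N * (2/3) ^ level \<Lambda> < e / 2"
      by (rule eventually_compose_filterlim[OF _ level_at_top])
    then show "\<forall>\<^sub>F \<Lambda> in at_top. dist (R \<Lambda>) I < e"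
      using ev
    proof eventually_elim
      case (elim \<Lambda>)
      then have "\<bar>R \<Lambda> - I\<bar> \<le> 2 * (e / 4) + C * 3 ^ N * (2/3) ^ level \<Lambda>" using N by blast
      then show ?case using elim(1) by (simp add: dist_real_def)
    qed
  qed
  moreover have "(\<lambda>\<Lambda>. R \<Lambda> - I) \<in> O[at_top](\<lambda>\<Lambda>. real (sg_d \<Lambda>) powr - ((\<alpha> * ln (5/3) / (ln 3 + \<alpha> * ln (5/3))) * (1 - ln 2 / ln 3)))"
    if a: "\<alpha> > 0" and h: "sg_holder \<alpha> f" for \<alpha>
  proof -
    obtain A where A: "A \<ge> 0" "\<And>N w x y. w \<in> sg_words N \<Longrightarrow> x \<in> sg_cell w \<Longrightarrow> y \<in> sg_cell w \<Longrightarrow>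
      \<bar>ln (f x) - ln (f y)\<bar> \<le> A * ((3/5) ^ N) powr \<alpha>"
      using cell_osc_holder[OF assms(1,2) a h] by blast
    define s where "s = ln (5/3 :: real)"
    \<comment> \<open>Balance of the two errors: for \<open>N = \<theta> * M\<close> both
      \<open>((3/5) ^ N) powr \<alpha>\<close> and \<open>3 ^ N * (2/3) ^ M\<close> equal
      \<open>exp (- (\<beta> * ln 3 * M))\<close>, which is the content of the two expressions for
      \<open>\<beta> * ln 3\<close> below.\<close>
    define \<theta> where "\<theta> = (ln 3 - ln 2) / (ln 3 + \<alpha> * s)"
    define \<beta> where "\<beta> = (\<alpha> * s / (ln 3 + \<alpha> * s)) * (1 - ln 2 / ln 3)"
    have s: "s > 0" by (simp add: s_def)
    have l3: "ln (3::real) > ln 2" "ln (2::real) > 0" by simp_all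
    have den: "ln 3 + \<alpha> * s > 0" using a s l3 by (simp add: add_pos_pos)
    have \<theta>: "0 \<le> \<theta>" "\<theta> \<le> 1"
    proof -
      show "0 \<le> \<theta>" using l3 den by (simp add: \<theta>_def)
      have "ln 3 - ln 2 \<le> ln 3 + \<alpha> * s" using a s l3 mult_pos_pos[OF a s] by linarith
      then show "\<theta> \<le> 1" using den by (simp add: \<theta>_def)
    qed
    have "(1 - ln 2 / ln 3) * ln 3 = ln 3 - ln (2::real)" using l3 by (simp add: left_diff_distrib)
    then have "\<beta> * ln 3 = \<alpha> * s / (ln 3 + \<alpha> * s) * (ln 3 - ln 2)" by (simp only: \<beta>_def mult.assoc)
    then have \<beta>1: "\<beta> * ln 3 = \<theta> * (\<alpha> * s)" by (simp add: \<theta>_def mult_ac)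
    have "\<theta> * (ln 3 + \<alpha> * s) = ln 3 - ln 2" using den by (simp add: \<theta>_def)
    then have \<beta>2: "\<beta> * ln 3 = ln 3 - ln 2 - \<theta> * ln 3" unfolding \<beta>1 by (simp add: algebra_simps)
    have \<beta>0: "\<beta> \<ge> 0" unfolding \<beta>_def using a s den l3 by (intro mult_nonneg_nonneg divide_nonneg_nonneg) auto
    \<comment> \<open>The factor \<open>3 powr \<beta>\<close> comes from replacing
      \<open>3 ^ M\<close> by the dimension, which is at most \<open>3 * 3 ^ M\<close>.\<close>
    define D where "D = (2 * A * exp (\<alpha> * s) + C) * 3 powr \<beta>"
    have "\<forall>\<^sub>F \<Lambda> in at_top. norm (R \<Lambda> - I) \<le> D * norm (real (sg_d \<Lambda>) powr - \<beta>)"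
      using ev
    proof eventually_elim
      case (elim \<Lambda>)
      define M where "M = level \<Lambda>"
      \<comment> \<open>Rounding down keeps the bound on \<open>3 ^ N\<close> and costs the
        oscillation term at most the factor \<open>exp (\<alpha> * s)\<close>.\<close>
      define N where "N = nat \<lfloor>\<theta> * real M\<rfloor>"
      have N0: "0 \<le> \<theta> * real M" using \<theta> by simp
      have N1: "real N \<le> \<theta> * real M" "\<theta> * real M - 1 \<le> real N" using N0 unfolding N_def by linarith+
      have "\<theta> * real M \<le> 1 * real M" using \<theta> by (intro mult_right_mono) auto
      then have NM: "N \<le> M" using N1(1) by simp
      define P where "P = exp (- (\<beta> * ln 3 * real M))"
      have "\<bar>R \<Lambda> - I\<bar> \<le> 2 * (A * ((3/5) ^ N) powr \<alpha>) + C * 3 ^ N * (2/3) ^ M"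
        using elim A(2) NM unfolding M_def by blast
      also have "((3/5) ^ N) powr \<alpha> = exp (- (\<alpha> * s * real N))"
      proof -
        have "ln ((3/5::real) ^ N) = - (real N * s)" by (simp add: ln_realpow s_def ln_div algebra_simps)
        then show ?thesis by (simp add: powr_def mult_ac)
      qed
      also have "exp (- (\<alpha> * s * real N)) \<le> exp (\<alpha> * s) * P"
      proof -
        have "\<alpha> * s * (\<theta> * real M - 1) \<le> \<alpha> * s * real N" using N1(2) a s by (intro mult_left_mono) auto
        then have "- (\<alpha> * s * real N) \<le> \<alpha> * s - \<theta> * (\<alpha> * s) * real M" by (simp add: algebra_simps)
        then show ?thesis unfolding P_def \<beta>1 exp_add[symmetric] by simp
      qed
      also have "C * 3 ^ N * (2/3) ^ M \<le> C * P"
      proof -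
        have "3 ^ N * (2/3) ^ M = exp (ln 3 * real N + (ln 2 - ln 3) * real M)"
        proof -
          have "(3::real) ^ N = exp (real N * ln 3)" by (simp add: exp_of_nat_mult)
          moreover have "(2/3::real) ^ M = exp (real M * (ln 2 - ln 3))" by (simp add: exp_of_nat_mult exp_diff)
          ultimately show ?thesis by (simp add: exp_add mult.commute)
        qed
        also have "\<dots> \<le> P"
        proof -
          have "ln 3 * real N \<le> ln 3 * (\<theta> * real M)" using N1(1) by (intro mult_left_mono) auto
          moreover have "- (\<beta> * ln 3 * real M) = ln 3 * (\<theta> * real M) + (ln 2 - ln 3) * real M"
            unfolding \<beta>2 by (simp add: algebra_simps)
          ultimately show ?thesis unfolding P_def by simp
        qed
        finally show ?thesis using C by (simp add: mult.assoc mult_left_mono)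
      qed
      finally have e1: "\<bar>R \<Lambda> - I\<bar> \<le> 2 * (A * (exp (\<alpha> * s) * P)) + C * P"
        using A(1) by (simp add: mult_left_mono)
      have "P \<le> 3 powr \<beta> * real (sg_d \<Lambda>) powr - \<beta>"
      proof -
        have d: "0 < real (sg_d \<Lambda>)" "real (sg_d \<Lambda>) \<le> 3 * 3 ^ M" using elim by (auto simp: M_def)
        have "ln (real (sg_d \<Lambda>)) \<le> ln (3 * 3 ^ M)" using d by simp
        also have "\<dots> = ln 3 + real M * ln 3" by (simp add: ln_mult ln_realpow)
        finally have "\<beta> * ln (real (sg_d \<Lambda>)) \<le> \<beta> * (ln 3 + real M * ln 3)" using \<beta>0 by (rule mult_left_mono)
        then have "- (\<beta> * ln 3 * real M) \<le> \<beta> * ln 3 + - \<beta> * ln (real (sg_d \<Lambda>))" by (simp add: algebra_simps)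
        then show ?thesis unfolding P_def using d(1) by (simp add: powr_def flip: exp_add)
      qed
      then have "(2 * A * exp (\<alpha> * s) + C) * P \<le> (2 * A * exp (\<alpha> * s) + C) * (3 powr \<beta> * real (sg_d \<Lambda>) powr - \<beta>)"
        using A(1) C by (intro mult_left_mono) auto
      then show ?case using e1 by (simp add: D_def algebra_simps)
    qed
    then have "(\<lambda>\<Lambda>. R \<Lambda> - I) \<in> O[at_top](\<lambda>\<Lambda>. real (sg_d \<Lambda>) powr - \<beta>)" by (rule bigoI)
    then show ?thesis by (simp only: \<beta>_def s_def)
  qed
  ultimately show ?thesis unfolding R_def I_def by blast
qed

end
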